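(* Let $A$ and $B$ be graded algebras and let $\sigma$ be a graded automorphism of $A$. Then the twisted tensor product $B\otimes^\sigma A$ is $\mathcal{K}_2$ if and only if $A$ and $B$ are both $\mathcal{K}_2$.
   Context: Conventions. $K$ is a field. A "graded algebra" is a connected $\mathbb{N}$-graded $K$-algebra of the form $A=T(V)/I$, where $V$ is a finite-dimensional $K$-vector space placed in degree 1, $T(V)$ is its tensor algebra, and $I$ is an ideal generated by a (minimal) finite set of homogeneous elements of degree at least 2 (not necessarily all of the same degree). The field $K$ is identified with the trivial $A$-module $A/A_+$. The bigraded Yoneda algebra is $E(A)=\bigoplus_{n,m} E^{n,m}(A)$ with $E^{n,m}(A)=\mathrm{Ext}_A^{n}(K,K)_{-m}$ ($n$ is the cohomological degree, $-m$ the internal degree; Ext is computed in the category of $\mathbb{Z}$-graded locally finite $A$-modules with graded Hom spaces), with the Yoneda (cup) product; $E^n(A)=\bigoplus_m E^{n,m}(A)$. The graded algebra $A$ is called $\mathcal{K}_2$ if $E(A)$ is generated as an algebra by $E^1(A)$ and $E^2(A)$. Twisted tensor product: $B\otimes^\sigma A$ is the graded algebra whose underlying graded vector space is $B\otimes_K A$, with associative multiplication $(b_1\otimes a_1)\cdot(b_2\otimes a_2)=b_1b_2\otimes \sigma^{|b_2|}(a_1)a_2$ for homogeneous $a_1,a_2\in A$, $b_1,b_2\in B$, where $|b_2|$ is the degree of $b_2$. *)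

theory Defs
  imports "HOL-Algebra.QuotRing" "HOL-Algebra.Subrings" "HOL-Algebra.Module"
begin

section \<open>Graded modules and graded algebras\<close>

text \<open>
  The scalars of a graded K-algebra are the elements of the field K and the index type is nat;
  the scalars of a graded A-module are the elements of A and the index type is int.
  For objects that carry no multiplication the fields mult and one, which the library record
  for modules inherits from rings, are left undefined and are never used.
\<close>

record ('i, 'r, 'm) graded_module = "('r, 'm) module" +
  component :: "'i \<Rightarrow> 'm set"

definition decomposes :: "('i, 'r, 'm) graded_module \<Rightarrow> 'm \<Rightarrow> ('i \<Rightarrow> 'm) \<Rightarrow> bool"
  where "decomposes M x c \<longleftrightarrow>
    (\<forall>i. c i \<in> component M i) \<and> finite {i. c i \<noteq> \<zero>\<^bsub>M\<^esub>} \<and>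
    x = (\<Oplus>\<^bsub>M\<^esub>i\<in>{i. c i \<noteq> \<zero>\<^bsub>M\<^esub>}. c i)"

definition is_grading :: "('i, 'r, 'm) graded_module \<Rightarrow> bool"
  where "is_grading M \<longleftrightarrow>
    (\<forall>i. additive_subgroup (component M i) M) \<and> (\<forall>x\<in>carrier M. \<exists>!c. decomposes M x c)"

definition hom_part :: "('i, 'r, 'm) graded_module \<Rightarrow> 'm \<Rightarrow> 'i \<Rightarrow> 'm"
  where "hom_part M x = (THE c. decomposes M x c)"

locale connected_graded_algebra =
  fixes K :: "'k ring" and A :: "(nat, 'k, 'a) graded_module"
  assumes field: "field K"
    and ring: "ring A"
    and module: "module K A"
    and smult_mult_left: "\<And>k x y. k \<in> carrier K \<Longrightarrow> x \<in> carrier A \<Longrightarrow> y \<in> carrier A \<Longrightarrow>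
      k \<odot>\<^bsub>A\<^esub> (x \<otimes>\<^bsub>A\<^esub> y) = (k \<odot>\<^bsub>A\<^esub> x) \<otimes>\<^bsub>A\<^esub> y"
    and smult_mult_right: "\<And>k x y. k \<in> carrier K \<Longrightarrow> x \<in> carrier A \<Longrightarrow> y \<in> carrier A \<Longrightarrow>
      k \<odot>\<^bsub>A\<^esub> (x \<otimes>\<^bsub>A\<^esub> y) = x \<otimes>\<^bsub>A\<^esub> (k \<odot>\<^bsub>A\<^esub> y)"
    and grading: "is_grading A"
    and component_submodule: "\<And>i. submodule (component A i) K A"
    and component_mult: "\<And>i j x y. x \<in> component A i \<Longrightarrow> y \<in> component A j \<Longrightarrow>
      x \<otimes>\<^bsub>A\<^esub> y \<in> component A (i + j)"
    and one_nonzero: "\<one>\<^bsub>A\<^esub> \<noteq> \<zero>\<^bsub>A\<^esub>"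
    and connected: "component A 0 = (\<lambda>k. k \<odot>\<^bsub>A\<^esub> \<one>\<^bsub>A\<^esub>) ` carrier K"

definition graded_alg_iso ::
    "'k ring \<Rightarrow> (nat, 'k, 'a) graded_module \<Rightarrow> (nat, 'k, 'b) graded_module \<Rightarrow> ('a \<Rightarrow> 'b) set"
  where "graded_alg_iso K A B = {h \<in> ring_iso A B.
    (\<forall>k\<in>carrier K. \<forall>x\<in>carrier A. h (k \<odot>\<^bsub>A\<^esub> x) = k \<odot>\<^bsub>B\<^esub> h x) \<and>
    (\<forall>i. h ` component A i = component B i)}"

text \<open>
  The tensor algebra of the space with basis indexed by \<open>{..<n}\<close>: a tensor is given by its
  coefficients with respect to the words in the basis elements.
\<close>

definition tensor_algebra :: "'k ring \<Rightarrow> nat \<Rightarrow> (nat, 'k, nat list \<Rightarrow> 'k) graded_module"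
  where "tensor_algebra K n =
    (let T = {f. (\<forall>w. f w \<in> carrier K) \<and> finite {w. f w \<noteq> \<zero>\<^bsub>K\<^esub>} \<and>
                 (\<forall>w. f w \<noteq> \<zero>\<^bsub>K\<^esub> \<longrightarrow> set w \<subseteq> {..<n})}
     in \<lparr>carrier = T,
         mult = (\<lambda>f g w. \<Oplus>\<^bsub>K\<^esub>i\<in>{..length w}. f (take i w) \<otimes>\<^bsub>K\<^esub> g (drop i w)),
         one = (\<lambda>w. if w = [] then \<one>\<^bsub>K\<^esub> else \<zero>\<^bsub>K\<^esub>),
         zero = (\<lambda>w. \<zero>\<^bsub>K\<^esub>),
         add = (\<lambda>f g w. f w \<oplus>\<^bsub>K\<^esub> g w),
         smult = (\<lambda>k f w. k \<otimes>\<^bsub>K\<^esub> f w),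
         component = (\<lambda>d. {f \<in> T. \<forall>w. f w \<noteq> \<zero>\<^bsub>K\<^esub> \<longrightarrow> length w = d})\<rparr>)"

definition quotient_module ::
    "('r, 'm, 'z) module_scheme \<Rightarrow> 'm set \<Rightarrow> ('r, 'm set) module"
  where "quotient_module M N =
    \<lparr>carrier = a_rcosets\<^bsub>M\<^esub> N, mult = rcoset_mult M N, one = N +>\<^bsub>M\<^esub> \<one>\<^bsub>M\<^esub>,
     zero = N, add = set_add M, smult = (\<lambda>r X. \<Union>x\<in>X. N +>\<^bsub>M\<^esub> (r \<odot>\<^bsub>M\<^esub> x))\<rparr>"

definition quotient_graded ::
    "('i, 'r, 'm) graded_module \<Rightarrow> 'm set \<Rightarrow> ('i, 'r, 'm set) graded_module"
  where "quotient_graded M N = module.extend (quotient_module M N)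
    (graded_module.fields (\<lambda>i. (\<lambda>x. N +>\<^bsub>M\<^esub> x) ` component M i))"

text \<open>
  No minimality is asked of the finite set \<open>R\<close> of relations: a finite homogeneous generating
  set always contains a minimal one.
\<close>

definition graded_algebra :: "'k ring \<Rightarrow> (nat, 'k, 'a) graded_module \<Rightarrow> bool"
  where "graded_algebra K A \<longleftrightarrow> connected_graded_algebra K A \<and>
    (\<exists>n R. finite R \<and> R \<subseteq> (\<Union>d\<in>{2..}. component (tensor_algebra K n) d) \<and>
       graded_alg_iso K
         (quotient_graded (tensor_algebra K n) (genideal (tensor_algebra K n) R)) A \<noteq> {})"


section \<open>Graded free resolutions of the trivial module\<close>

text \<open>
  The graded free left A-module on a set of homogeneous generators. The generators are indexed
  by the domain of \<open>\<beta>\<close>, and \<open>\<beta> i = Some d\<close> says that generator \<open>i\<close> has degree \<open>d\<close>. An element is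
  given by its coefficients. A locally finite graded free module has a countable basis, so that
  index sets of natural numbers suffice.
\<close>

definition free_module ::
    "(nat, 'k, 'a) graded_module \<Rightarrow> (nat \<Rightarrow> int option) \<Rightarrow> (int, 'a, nat \<Rightarrow> 'a) graded_module"
  where "free_module A \<beta> =
    (let F = {f. (\<forall>i. f i \<in> carrier A) \<and> finite {i. f i \<noteq> \<zero>\<^bsub>A\<^esub>} \<and> (\<forall>i. i \<notin> dom \<beta> \<longrightarrow> f i = \<zero>\<^bsub>A\<^esub>)}
     in \<lparr>carrier = F, mult = undefined, one = undefined,
         zero = (\<lambda>i. \<zero>\<^bsub>A\<^esub>),
         add = (\<lambda>f g i. f i \<oplus>\<^bsub>A\<^esub> g i),
         smult = (\<lambda>a f i. a \<otimes>\<^bsub>A\<^esub> f i),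
         component = (\<lambda>m. {f \<in> F. \<forall>i d. \<beta> i = Some d \<longrightarrow>
           f i \<in> (if d \<le> m then component A (nat (m - d)) else {\<zero>\<^bsub>A\<^esub>})})\<rparr>)"

text \<open>The field K is the trivial module: A acts through the projection onto its degree 0 part.\<close>

definition augmentation :: "'k ring \<Rightarrow> (nat, 'k, 'a) graded_module \<Rightarrow> 'a \<Rightarrow> 'k"
  where "augmentation K A a = (THE k. k \<in> carrier K \<and> hom_part A a 0 = k \<odot>\<^bsub>A\<^esub> \<one>\<^bsub>A\<^esub>)"

definition trivial_module ::
    "'k ring \<Rightarrow> (nat, 'k, 'a) graded_module \<Rightarrow> (int, 'a, 'k) graded_module"
  where "trivial_module K A =
    \<lparr>carrier = carrier K, mult = undefined, one = undefined, zero = \<zero>\<^bsub>K\<^esub>, add = add K,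
     smult = (\<lambda>a x. augmentation K A a \<otimes>\<^bsub>K\<^esub> x),
     component = (\<lambda>m. if m = 0 then carrier K else {\<zero>\<^bsub>K\<^esub>})\<rparr>"

text \<open>Homogeneous components are finite-dimensional over K, which acts through \<open>K \<cdot> 1 \<subseteq> A\<close>.\<close>

definition locally_finite ::
    "'k ring \<Rightarrow> (nat, 'k, 'a) graded_module \<Rightarrow> (int, 'a, 'm) graded_module \<Rightarrow> bool"
  where "locally_finite K A M \<longleftrightarrow>
    (\<forall>m. \<exists>S. finite S \<and> S \<subseteq> component M m \<and>
      (\<forall>x\<in>component M m. \<exists>c\<in>S \<rightarrow> carrier K. x = (\<Oplus>\<^bsub>M\<^esub>s\<in>S. (c s \<odot>\<^bsub>A\<^esub> \<one>\<^bsub>A\<^esub>) \<odot>\<^bsub>M\<^esub> s)))"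

text \<open>A-linear maps that raise the internal degree by \<open>d\<close>.\<close>

definition graded_hom ::
    "(nat, 'k, 'a) graded_module \<Rightarrow> (int, 'a, 'm) graded_module \<Rightarrow> (int, 'a, 'n) graded_module \<Rightarrow>
     int \<Rightarrow> ('m \<Rightarrow> 'n) set"
  where "graded_hom A M N d = {f \<in> carrier M \<rightarrow>\<^sub>E carrier N.
    (\<forall>x\<in>carrier M. \<forall>y\<in>carrier M. f (x \<oplus>\<^bsub>M\<^esub> y) = f x \<oplus>\<^bsub>N\<^esub> f y) \<and>
    (\<forall>a\<in>carrier A. \<forall>x\<in>carrier M. f (a \<odot>\<^bsub>M\<^esub> x) = a \<odot>\<^bsub>N\<^esub> f x) \<and>
    (\<forall>j. f ` component M j \<subseteq> component N (j + d))}"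

text \<open>
  The data of a complex \<open>\<dots> \<rightarrow> P 1 \<rightarrow> P 0 \<rightarrow> K\<close> of graded free modules: the degrees of the
  generators of \<open>P n\<close>, the differentials \<open>P (n + 1) \<rightarrow> P n\<close>, and the map \<open>P 0 \<rightarrow> K\<close>.
\<close>

record ('k, 'a) free_complex =
  gens :: "nat \<Rightarrow> nat \<Rightarrow> int option"
  diff :: "nat \<Rightarrow> (nat \<Rightarrow> 'a) \<Rightarrow> (nat \<Rightarrow> 'a)"
  aug :: "(nat \<Rightarrow> 'a) \<Rightarrow> 'k"

abbreviation term_module ::
    "(nat, 'k, 'a) graded_module \<Rightarrow> ('k, 'a) free_complex \<Rightarrow> nat \<Rightarrow> (int, 'a, nat \<Rightarrow> 'a) graded_module"
  where "term_module A P n \<equiv> free_module A (gens P n)"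

definition free_resolution ::
    "'k ring \<Rightarrow> (nat, 'k, 'a) graded_module \<Rightarrow> ('k, 'a) free_complex \<Rightarrow> bool"
  where "free_resolution K A P \<longleftrightarrow>
    (\<forall>n. locally_finite K A (term_module A P n)) \<and>
    (\<forall>n. diff P n \<in> graded_hom A (term_module A P (Suc n)) (term_module A P n) 0) \<and>
    aug P \<in> graded_hom A (term_module A P 0) (trivial_module K A) 0 \<and>
    aug P ` carrier (term_module A P 0) = carrier K \<and>
    {x \<in> carrier (term_module A P 0). aug P x = \<zero>\<^bsub>K\<^esub>}
      = diff P 0 ` carrier (term_module A P 1) \<and>
    (\<forall>n. {x \<in> carrier (term_module A P (Suc n)). diff P n x = \<zero>\<^bsub>term_module A P n\<^esub>}
      = diff P (Suc n) ` carrier (term_module A P (Suc (Suc n))))"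


section \<open>The bigraded Yoneda algebra\<close>

text \<open>
  The maps \<open>P n \<rightarrow> K\<close> of internal degree \<open>-m\<close>, as a module over K.
\<close>

definition cochains ::
    "'k ring \<Rightarrow> (nat, 'k, 'a) graded_module \<Rightarrow> ('k, 'a) free_complex \<Rightarrow> nat \<Rightarrow> int \<Rightarrow>
     ('k, (nat \<Rightarrow> 'a) \<Rightarrow> 'k) module"
  where "cochains K A P n m =
    \<lparr>carrier = graded_hom A (term_module A P n) (trivial_module K A) (- m),
     mult = undefined, one = undefined,
     zero = (\<lambda>x\<in>carrier (term_module A P n). \<zero>\<^bsub>K\<^esub>),
     add = (\<lambda>f g. \<lambda>x\<in>carrier (term_module A P n). f x \<oplus>\<^bsub>K\<^esub> g x),
     smult = (\<lambda>k f. \<lambda>x\<in>carrier (term_module A P n). k \<otimes>\<^bsub>K\<^esub> f x)\<rparr>"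

definition cocycles ::
    "'k ring \<Rightarrow> (nat, 'k, 'a) graded_module \<Rightarrow> ('k, 'a) free_complex \<Rightarrow> nat \<Rightarrow> int \<Rightarrow>
     ((nat \<Rightarrow> 'a) \<Rightarrow> 'k) set"
  where "cocycles K A P n m = {f \<in> carrier (cochains K A P n m).
    \<forall>x\<in>carrier (term_module A P (Suc n)). f (diff P n x) = \<zero>\<^bsub>K\<^esub>}"

definition coboundaries ::
    "'k ring \<Rightarrow> (nat, 'k, 'a) graded_module \<Rightarrow> ('k, 'a) free_complex \<Rightarrow> nat \<Rightarrow> int \<Rightarrow>
     ((nat \<Rightarrow> 'a) \<Rightarrow> 'k) set"
  where "coboundaries K A P n m = (case n of
      0 \<Rightarrow> {\<zero>\<^bsub>cochains K A P 0 m\<^esub>}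
    | Suc l \<Rightarrow> (\<lambda>g. compose (carrier (term_module A P (Suc l))) g (diff P l)) `
        carrier (cochains K A P l m))"

text \<open>\<open>Ext K A P n m\<close> is the space $E^{n,m}(A) = \mathrm{Ext}^n_A(K,K)_{-m}$.\<close>

definition Ext ::
    "'k ring \<Rightarrow> (nat, 'k, 'a) graded_module \<Rightarrow> ('k, 'a) free_complex \<Rightarrow> nat \<Rightarrow> int \<Rightarrow>
     ('k, ((nat \<Rightarrow> 'a) \<Rightarrow> 'k) set) module"
  where "Ext K A P n m =
    quotient_module ((cochains K A P n m)\<lparr>carrier := cocycles K A P n m\<rparr>) (coboundaries K A P n m)"

text \<open>
  \<open>F\<close> is a chain map from the shifted complex \<open>P (\<bullet> + n)\<close> to \<open>P\<close> that lifts the cocycle \<open>f\<close>.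
\<close>

definition is_lift ::
    "'k ring \<Rightarrow> (nat, 'k, 'a) graded_module \<Rightarrow> ('k, 'a) free_complex \<Rightarrow> nat \<Rightarrow> int \<Rightarrow>
     ((nat \<Rightarrow> 'a) \<Rightarrow> 'k) \<Rightarrow> (nat \<Rightarrow> (nat \<Rightarrow> 'a) \<Rightarrow> (nat \<Rightarrow> 'a)) \<Rightarrow> bool"
  where "is_lift K A P n m f F \<longleftrightarrow>
    (\<forall>i. F i \<in> graded_hom A (term_module A P (i + n)) (term_module A P i) (- m)) \<and>
    (\<forall>x\<in>carrier (term_module A P n). aug P (F 0 x) = f x) \<and>
    (\<forall>i. \<forall>x\<in>carrier (term_module A P (Suc i + n)).
      diff P i (F (Suc i) x) = F i (diff P (i + n) x))"

text \<open>
  The Yoneda product $E^{p,q} \times E^{n,m} \to E^{p+n,q+m}$: the class of \<open>g\<close> times the class of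
  \<open>f\<close> is the class of \<open>g \<circ> F p\<close>, for any lift \<open>F\<close> of \<open>f\<close>. The other usual conventions differ from
  this one by the sign $(-1)^{pn}$ or by the order of the factors.
\<close>

definition Yoneda_prod ::
    "'k ring \<Rightarrow> (nat, 'k, 'a) graded_module \<Rightarrow> ('k, 'a) free_complex \<Rightarrow>
     nat \<Rightarrow> int \<Rightarrow> ((nat \<Rightarrow> 'a) \<Rightarrow> 'k) set \<Rightarrow> nat \<Rightarrow> int \<Rightarrow> ((nat \<Rightarrow> 'a) \<Rightarrow> 'k) set \<Rightarrow>
     ((nat \<Rightarrow> 'a) \<Rightarrow> 'k) set"
  where "Yoneda_prod K A P p q X n m Y =
    (THE Z. \<exists>g\<in>X. \<exists>f\<in>Y. \<exists>F. is_lift K A P n m f F \<and>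
      Z = coboundaries K A P (p + n) (q + m) +>\<^bsub>cochains K A P (p + n) (q + m)\<^esub>
            compose (carrier (term_module A P (p + n))) g (F p))"

text \<open>
  The algebra \<open>E(A)\<close> is the direct sum of the spaces $E^{n,m}(A)$; its elements are the finitely
  supported families \<open>x\<close> with \<open>x n m\<close> in $E^{n,m}(A)$. Up to isomorphism it does not depend on
  the resolution \<open>P\<close>.
\<close>

definition Yoneda_algebra ::
    "'k ring \<Rightarrow> (nat, 'k, 'a) graded_module \<Rightarrow> ('k, 'a) free_complex \<Rightarrow>
     ('k, nat \<Rightarrow> int \<Rightarrow> ((nat \<Rightarrow> 'a) \<Rightarrow> 'k) set) module"
  where "Yoneda_algebra K A P =
    (let E = Ext K A P
     in \<lparr>carrier = {x. (\<forall>n m. x n m \<in> carrier (E n m)) \<and> finite {(n, m). x n m \<noteq> \<zero>\<^bsub>E n m\<^esub>}},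
         mult = (\<lambda>x y n m.
           finsum (E n m)
             (\<lambda>(p, q). Yoneda_prod K A P p q (x p q) (n - p) (m - q) (y (n - p) (m - q)))
             {(p, q). p \<le> n \<and> x p q \<noteq> \<zero>\<^bsub>E p q\<^esub>}),
         one = (\<lambda>n m. if n = 0 \<and> m = 0
           then coboundaries K A P 0 0 +>\<^bsub>cochains K A P 0 0\<^esub> aug P else \<zero>\<^bsub>E n m\<^esub>),
         zero = (\<lambda>n m. \<zero>\<^bsub>E n m\<^esub>),
         add = (\<lambda>x y n m. x n m \<oplus>\<^bsub>E n m\<^esub> y n m),
         smult = (\<lambda>k x n m. k \<odot>\<^bsub>E n m\<^esub> x n m)\<rparr>)"

definition Yoneda_degree ::
    "'k ring \<Rightarrow> (nat, 'k, 'a) graded_module \<Rightarrow> ('k, 'a) free_complex \<Rightarrow> nat \<Rightarrow>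
     (nat \<Rightarrow> int \<Rightarrow> ((nat \<Rightarrow> 'a) \<Rightarrow> 'k) set) set"
  where "Yoneda_degree K A P n = {x \<in> carrier (Yoneda_algebra K A P).
    \<forall>i m. i \<noteq> n \<longrightarrow> x i m = \<zero>\<^bsub>Ext K A P i m\<^esub>}"

definition generated_subalgebra :: "'k ring \<Rightarrow> ('k, 'e) module \<Rightarrow> 'e set \<Rightarrow> 'e set"
  where "generated_subalgebra K E S =
    \<Inter>{H. S \<subseteq> H \<and> subring H E \<and> (\<forall>k\<in>carrier K. \<forall>x\<in>H. k \<odot>\<^bsub>E\<^esub> x \<in> H)}"

definition is_K2 :: "'k ring \<Rightarrow> (nat, 'k, 'a) graded_module \<Rightarrow> bool"
  where "is_K2 K A \<longleftrightarrow> (\<exists>P. free_resolution K A P \<and>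
    generated_subalgebra K (Yoneda_algebra K A P) (Yoneda_degree K A P 1 \<union> Yoneda_degree K A P 2)
      = carrier (Yoneda_algebra K A P))"


section \<open>Twisted tensor products\<close>

definition submodule_span :: "'k ring \<Rightarrow> ('k, 'm) module \<Rightarrow> 'm set \<Rightarrow> 'm set"
  where "submodule_span K M S = \<Inter>{N. S \<subseteq> N \<and> submodule N K M}"

text \<open>The vector space with basis \<open>S\<close>.\<close>

definition formal_sums :: "'k ring \<Rightarrow> 's set \<Rightarrow> ('k, 's \<Rightarrow> 'k) module"
  where "formal_sums K S =
    \<lparr>carrier = {f. (\<forall>s. f s \<in> carrier K) \<and> finite {s. f s \<noteq> \<zero>\<^bsub>K\<^esub>} \<and> (\<forall>s. s \<notin> S \<longrightarrow> f s = \<zero>\<^bsub>K\<^esub>)},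
     mult = undefined, one = undefined,
     zero = (\<lambda>s. \<zero>\<^bsub>K\<^esub>), add = (\<lambda>f g s. f s \<oplus>\<^bsub>K\<^esub> g s), smult = (\<lambda>k f s. k \<otimes>\<^bsub>K\<^esub> f s)\<rparr>"

definition basis_vector :: "'k ring \<Rightarrow> 's \<Rightarrow> 's \<Rightarrow> 'k"
  where "basis_vector K s = (\<lambda>t. if t = s then \<one>\<^bsub>K\<^esub> else \<zero>\<^bsub>K\<^esub>)"

definition bilinear_relations ::
    "'k ring \<Rightarrow> ('k, 'b, 'y) module_scheme \<Rightarrow> ('k, 'a, 'x) module_scheme \<Rightarrow> ('b \<times> 'a \<Rightarrow> 'k) set"
  where "bilinear_relations K B A =
    (let F = formal_sums K (carrier B \<times> carrier A); e = (\<lambda>b a. basis_vector K (b, a))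
     in {e (b \<oplus>\<^bsub>B\<^esub> b') a \<ominus>\<^bsub>F\<^esub> (e b a \<oplus>\<^bsub>F\<^esub> e b' a) | b b' a.
           b \<in> carrier B \<and> b' \<in> carrier B \<and> a \<in> carrier A}
      \<union> {e b (a \<oplus>\<^bsub>A\<^esub> a') \<ominus>\<^bsub>F\<^esub> (e b a \<oplus>\<^bsub>F\<^esub> e b a') | b a a'.
           b \<in> carrier B \<and> a \<in> carrier A \<and> a' \<in> carrier A}
      \<union> {e (k \<odot>\<^bsub>B\<^esub> b) a \<ominus>\<^bsub>F\<^esub> (k \<odot>\<^bsub>F\<^esub> e b a) | k b a.
           k \<in> carrier K \<and> b \<in> carrier B \<and> a \<in> carrier A}
      \<union> {e b (k \<odot>\<^bsub>A\<^esub> a) \<ominus>\<^bsub>F\<^esub> (k \<odot>\<^bsub>F\<^esub> e b a) | k b a.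
           k \<in> carrier K \<and> b \<in> carrier B \<and> a \<in> carrier A})"

definition bilinear_span ::
    "'k ring \<Rightarrow> ('k, 'b, 'y) module_scheme \<Rightarrow> ('k, 'a, 'x) module_scheme \<Rightarrow> ('b \<times> 'a \<Rightarrow> 'k) set"
  where "bilinear_span K B A =
    submodule_span K (formal_sums K (carrier B \<times> carrier A)) (bilinear_relations K B A)"

definition tensor_space ::
    "'k ring \<Rightarrow> ('k, 'b, 'y) module_scheme \<Rightarrow> ('k, 'a, 'x) module_scheme \<Rightarrow>
     ('k, ('b \<times> 'a \<Rightarrow> 'k) set) module"
  where "tensor_space K B A =
    quotient_module (formal_sums K (carrier B \<times> carrier A)) (bilinear_span K B A)"

definition pure_tensor ::
    "'k ring \<Rightarrow> ('k, 'b, 'y) module_scheme \<Rightarrow> ('k, 'a, 'x) module_scheme \<Rightarrow> 'b \<Rightarrow> 'a \<Rightarrow>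
     ('b \<times> 'a \<Rightarrow> 'k) set"
  where "pure_tensor K B A b a =
    bilinear_span K B A +>\<^bsub>formal_sums K (carrier B \<times> carrier A)\<^esub> basis_vector K (b, a)"

text \<open>
  The bilinear extension of
  $(b_1 \otimes a_1) (b_2 \otimes a_2) = b_1 b_2 \otimes \sigma^{|b_2|}(a_1) a_2$
  (with $b_2$ homogeneous) to arbitrary elements: \<open>f\<close> and \<open>g\<close> are formal sums of pairs that
  represent the factors, and in each pair of \<open>g\<close> the first entry is split into its homogeneous
  parts. The result does not depend on the choice of \<open>f\<close> and \<open>g\<close>.
\<close>

definition twisted_mult ::
    "'k ring \<Rightarrow> (nat, 'k, 'b) graded_module \<Rightarrow> ('a \<Rightarrow> 'a) \<Rightarrow> (nat, 'k, 'a) graded_module \<Rightarrow>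
     ('b \<times> 'a \<Rightarrow> 'k) set \<Rightarrow> ('b \<times> 'a \<Rightarrow> 'k) set \<Rightarrow> ('b \<times> 'a \<Rightarrow> 'k) set"
  where "twisted_mult K B \<sigma> A X Y =
    (let f = (SOME f. f \<in> X); g = (SOME g. g \<in> Y); T = tensor_space K B A
     in finsum T
          (\<lambda>((b1, a1), (b2, a2), j). (f (b1, a1) \<otimes>\<^bsub>K\<^esub> g (b2, a2)) \<odot>\<^bsub>T\<^esub>
             pure_tensor K B A (b1 \<otimes>\<^bsub>B\<^esub> hom_part B b2 j) ((\<sigma> ^^ j) a1 \<otimes>\<^bsub>A\<^esub> a2))
          {((b1, a1), (b2, a2), j). f (b1, a1) \<noteq> \<zero>\<^bsub>K\<^esub> \<and> g (b2, a2) \<noteq> \<zero>\<^bsub>K\<^esub> \<and>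
             hom_part B b2 j \<noteq> \<zero>\<^bsub>B\<^esub>})"

definition twisted_tensor ::
    "'k ring \<Rightarrow> (nat, 'k, 'b) graded_module \<Rightarrow> ('a \<Rightarrow> 'a) \<Rightarrow> (nat, 'k, 'a) graded_module \<Rightarrow>
     (nat, 'k, ('b \<times> 'a \<Rightarrow> 'k) set) graded_module"
  where "twisted_tensor K B \<sigma> A =
    (let T = tensor_space K B A
     in \<lparr>carrier = carrier T, mult = twisted_mult K B \<sigma> A,
         one = pure_tensor K B A \<one>\<^bsub>B\<^esub> \<one>\<^bsub>A\<^esub>,
         zero = \<zero>\<^bsub>T\<^esub>, add = add T, smult = smult T,
         component = (\<lambda>n. submodule_span K T
           {pure_tensor K B A b a | b a.
              \<exists>i j. i + j = n \<and> b \<in> component B i \<and> a \<in> component A j})\<rparr>)"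

end

theory Submission
 imports Defs "HOL-Library.Nat_Bijection"
begin

text \<open>
Write \<open>C\<close> for the twisted tensor product of \<open>B\<close> and \<open>A\<close>, with underlying space \<open>B \<otimes> A\<close>. For a free resolution \<open>P\<close>
of \<open>K\<close>, a class in \<open>E\<close> is given by a cocycle \<open>P n \<rightarrow> K\<close>, and the product of the classes of \<open>g\<close> and \<open>f\<close> by \<open>g\<close> composed with
a chain map that lifts \<open>f\<close>. So an algebra is K2 iff every cocycle can be built from the augmentation, coboundaries and
cocycles of cohomological degree 1 and 2 by linear combinations and such products; this is the predicate \<open>gen\<close>, and
\<open>is_K2_iff\<close> says moreover that one resolution suffices.

If \<open>C\<close> is K2: both factors are retracts of \<open>C\<close>. The inclusions are \<open>b \<mapsto> b \<otimes> 1\<close> and \<open>a \<mapsto> 1 \<otimes> a\<close>; the projections apply the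
augmentation to the other factor and are multiplicative because \<open>\<sigma>\<close> preserves the augmentation. A cocycle over \<open>A\<close> is
pulled back to \<open>C\<close>, expressed there by low degrees, and pulled back to \<open>A\<close> again, where it is cohomologous to the
cocycle at the start (\<open>gen_retract\<close>).

If \<open>A\<close> and \<open>B\<close> are K2: let \<open>P\<close> and \<open>Q\<close> be minimal resolutions over \<open>A\<close> and \<open>B\<close>. Over \<open>C\<close> there is a free resolution \<open>X\<close>
whose term of degree \<open>n\<close> is the sum of the \<open>Q i \<boxtimes> P (n - i)\<close>, where \<open>C\<close> acts by
\<open>(b \<otimes> a) (q \<boxtimes> p) = b q \<boxtimes> \<sigma>\<^sup>d(a) p\<close> for \<open>q\<close> of degree \<open>d\<close>. It is exact because \<open>K\<close>-linear contractions of \<open>Q\<close> and \<open>P\<close> combine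
to one of \<open>X\<close> (\<open>X_contraction_exists\<close>). By minimality, taking the constant term of the coefficient at a generator is a
cocycle on \<open>P\<close> and on \<open>Q\<close>. A chain map \<open>F\<close> on \<open>P\<close> extends to \<open>q \<boxtimes> p \<mapsto> q \<boxtimes> F p\<close> on \<open>X\<close>; therefore the coordinate functional of \<open>X\<close> at
a pair of generators is the product of the coordinate functionals at its two members, pulled back along the projections
(\<open>X_coordinate_gen\<close>). Pullback preserves \<open>gen\<close>, and the coordinate functionals span all cochains, so \<open>C\<close> is K2.
\<close>

text \<open>
The structure stands in square brackets behind the sign of an operation, with \<open>*:\<close> for the action of scalars; the
sign \<open>\<in>.\<close> means membership in the carrier.
\<close>

abbreviation (input) in_carrier (infix "\<in>." 50) where "x \<in>. M \<equiv> x \<in> carrier M"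
abbreviation (input) ring_zero ("0[_]") where "0[R] \<equiv> \<zero>\<^bsub>R\<^esub>"
abbreviation (input) ring_one ("1[_]") where "1[R] \<equiv> \<one>\<^bsub>R\<^esub>"
abbreviation (input) ring_add ("_ +[_] _" [65, 0, 66] 65) where "x +[R] y \<equiv> x \<oplus>\<^bsub>R\<^esub> y"
abbreviation (input) ring_mult ("_ *[_] _" [70, 0, 71] 70) where "x *[R] y \<equiv> x \<otimes>\<^bsub>R\<^esub> y"
abbreviation (input) module_smult ("_ *:[_] _" [70, 0, 71] 70) where "k *:[M] x \<equiv> k \<odot>\<^bsub>M\<^esub> x"
abbreviation (input) ring_minus ("_ -[_] _" [65, 0, 66] 65) where "x -[R] y \<equiv> x \<ominus>\<^bsub>R\<^esub> y"
abbreviation (input) ring_uminus ("-[_] _" [0, 81] 80) where "-[R] x \<equiv> \<ominus>\<^bsub>R\<^esub> x"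

section \<open>Graded groups and the augmentation of a connected graded algebra\<close>

lemma (in abelian_group) finsum_superset:
 assumes "finite J" "I \<subseteq> J" "\<And>i. i \<in> J - I ==> f i = \<zero>" "\<And>i. i \<in> J ==> f i \<in>. G"
 shows "finsum G f I = finsum G f J"
 by (rule add.finprod_mono_neutral_cong_left) (use assms in auto)

lemma (in abelian_group) finsum_in_closed:
 assumes "finite J" "\<zero> \<in> H" "H \<subseteq> carrier G" "\<And>x y. x \<in> H ==> y \<in> H ==> x \<oplus> y \<in> H"
  "\<And>i. i \<in> J ==> f i \<in> H"
 shows "finsum G f J \<in> H"
 using assms(1,5)
proof (induction J rule: finite_induct)
 case (insert i J)
 hence "f i \<in>. G" "f \<in> J \<rightarrow> carrier G" using assms(3) by auto
 with insert show ?case using assms(4) by simp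
qed (use assms(2) in simp)

lemma additive_finsum:
 assumes "abelian_group M" "abelian_group N" "finite J"
  "\<And>x y. x \<in>. M ==> y \<in>. M ==> h (x +[M] y) = h x +[N] h y"
  "\<And>x. x \<in>. M ==> h x \<in>. N"
  "\<And>i. i \<in> J ==> f i \<in>. M"
 shows "h (finsum M f J) = finsum N (\<lambda>i. h (f i)) J"
proof -
 interpret M: abelian_group M by fact
 interpret N: abelian_group N by fact
 have "h 0[M] +[N] h 0[M] = h 0[M]"
  using assms(4)[of "0[M]" "0[M]"] by simp
 hence z: "h 0[M] = 0[N]"
  using assms(5)[of "0[M]"] N.add.l_cancel_one by auto
 show ?thesis
  using assms(3,6)
 proof (induction J rule: finite_induct)
  case empty
  thus ?case using z by simp
 next
  case (insert i J)
  have "f i \<in>. M" "f \<in> J \<rightarrow> carrier M" using insert.prems by auto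
  moreover from this have "h (f i) \<in>. N" "(\<lambda>i. h (f i)) \<in> J \<rightarrow> carrier N"
   using assms(5) by auto
  ultimately show ?case using insert assms(4) by simp
 qed
qed

locale graded_group = abelian_group M for M :: "('i, 'r, 'm) graded_module" (structure) +
 assumes grading: "is_grading M"
begin

lemma comp_sub: "additive_subgroup (component M i) M"
 using grading by (simp add: is_grading_def)

lemma comp_carrier: "x \<in> component M i ==> x \<in>. M"
 using additive_subgroup.a_subset[OF comp_sub] by blast

lemma comp_zero [simp]: "\<zero> \<in> component M i"
 using additive_subgroup.zero_closed[OF comp_sub] .

lemma comp_add: "x \<in> component M i ==> y \<in> component M i ==> x \<oplus> y \<in> component M i"
 using additive_subgroup.a_closed[OF comp_sub] .

lemma decomposesI:
 assumes "finite J" "\<And>i. c i \<in> component M i" "\<And>i. i \<notin> J ==> c i = \<zero>" "x = finsum M c J"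
 shows "decomposes M x c"
proof -
 have s: "{i. c i ~= \<zero>} \<subseteq> J" using assms(3) by blast
 moreover have "finsum M c {i. c i ~= \<zero>} = finsum M c J"
  by (rule finsum_superset) (use assms s in "auto intro: comp_carrier")
 ultimately show ?thesis
  using assms finite_subset unfolding decomposes_def by auto
qed

lemma decomposes_carrier: "decomposes M x c ==> x \<in>. M"
 unfolding decomposes_def by (auto intro!: finsum_closed intro: comp_carrier)

lemma hom_part_decomposes: "x \<in>. M ==> decomposes M x (hom_part M x)"
 unfolding hom_part_def using grading theI'[of "decomposes M x"] by (simp add: is_grading_def)

lemma hom_part_eqI: "decomposes M x c ==> hom_part M x = c"
 using decomposes_carrier hom_part_decomposes grading unfolding is_grading_def by blast

lemma hom_part_comp: "x \<in>. M ==> hom_part M x i \<in> component M i"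
 using hom_part_decomposes unfolding decomposes_def by blast

lemma hom_part_finite: "x \<in>. M ==> finite {i. hom_part M x i ~= \<zero>}"
 using hom_part_decomposes unfolding decomposes_def by blast

lemma hom_part_sum:
 assumes "x \<in>. M" "finite J" "\<And>i. i \<notin> J ==> hom_part M x i = \<zero>"
 shows "x = finsum M (hom_part M x) J"
proof -
 have "x = finsum M (hom_part M x) {i. hom_part M x i ~= \<zero>}"
  using hom_part_decomposes[OF assms(1)] unfolding decomposes_def by blast
 also have "\<dots> = finsum M (hom_part M x) J"
  by (rule finsum_superset) (use assms in "auto intro: comp_carrier hom_part_comp")
 finally show ?thesis .
qed

lemma hom_part_of_comp:
 assumes "x \<in> component M i"
 shows "hom_part M x j = (if j = i then x else \<zero>)"
proof -
 have "decomposes M x (\<lambda>j. if j = i then x else \<zero>)"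
  by (rule decomposesI[where J = "{i}"])
   (use assms comp_carrier[OF assms] in auto)
 from hom_part_eqI[OF this] show ?thesis by simp
qed

lemma hom_part_add:
 assumes "x \<in>. M" "y \<in>. M"
 shows "hom_part M (x \<oplus> y) j = hom_part M x j \<oplus> hom_part M y j"
proof -
 let ?J = "{i. hom_part M x i ~= \<zero>} \<union> {i. hom_part M y i ~= \<zero>}"
 have fin: "finite ?J" using assms hom_part_finite by blast
 have c: "hom_part M x i \<in>. M" "hom_part M y i \<in>. M" for i
  using assms hom_part_comp comp_carrier by blast+
 have "decomposes M (x \<oplus> y) (\<lambda>j. hom_part M x j \<oplus> hom_part M y j)"
 proof (rule decomposesI[OF fin])
  have "x = finsum M (hom_part M x) ?J" "y = finsum M (hom_part M y) ?J"
   by (rule hom_part_sum; use assms fin in auto)+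
  thus "x \<oplus> y = (\<Oplus>j\<in>?J. hom_part M x j \<oplus> hom_part M y j)"
   using c by (subst finsum_addf) auto
 qed (use assms hom_part_comp comp_add in auto)
 from hom_part_eqI[OF this] show ?thesis by simp
qed

lemma hom_part_zero [simp]: "hom_part M \<zero> j = \<zero>"
 using hom_part_of_comp[of \<zero> j j] by simp

lemma graded_induct [consumes 1, case_names hom add]:
 assumes "x \<in>. M" "\<And>i x. x \<in> component M i ==> Q x"
  "\<And>x y. x \<in>. M ==> y \<in>. M ==> Q x ==> Q y ==> Q (x \<oplus> y)"
 shows "Q x"
proof -
 have "finsum M (hom_part M x) {i. hom_part M x i ~= \<zero>} \<in> {x \<in> carrier M. Q x}"
  by (rule finsum_in_closed)
   (use assms(1) hom_part_finite in "auto intro: comp_carrier hom_part_comp assms(2,3) comp_zero")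
 thus ?thesis using hom_part_sum[OF assms(1) hom_part_finite[OF assms(1)]] by simp
qed

end

context connected_graded_algebra
begin

sublocale A: ring A by (rule ring)
sublocale K: field K by (rule field)
sublocale KA: module K A by (rule module)
sublocale graded_group A by unfold_locales (rule grading)

lemma comp_smult: "k \<in>. K ==> x \<in> component A i ==> k *:[A] x \<in> component A i"
 using submodule.smult_closed[OF component_submodule] by blast

lemma one_comp: "1[A] \<in> component A 0"
 using connected KA.smult_one[of "1[A]"] K.one_closed by (metis A.one_closed imageI)

lemma scalar_inj:
 assumes "k \<in>. K" "l \<in>. K" "k *:[A] 1[A] = l *:[A] 1[A]"
 shows "k = l"
proof (rule ccontr)
 assume "k ~= l"
 let ?d = "k -[K] l"
 have d: "?d \<in>. K" "?d ~= 0[K]" using assms \<open>k ~= l\<close> by auto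
 have "?d *:[A] 1[A] = 0[A]"
  using assms by (simp add: K.minus_eq KA.smult_l_distr KA.smult_l_minus A.r_neg)
 hence "inv\<^bsub>K\<^esub> ?d *:[A] (?d *:[A] 1[A]) = 0[A]"
  using d by (simp add: K.field_Units)
 moreover have "inv\<^bsub>K\<^esub> ?d *:[A] (?d *:[A] 1[A]) = 1[A]"
  using d by (simp add: K.field_Units flip: KA.smult_assoc1)
 ultimately show False using one_nonzero by simp
qed

definition eps where "eps = augmentation K A"

lemma eps_spec:
 assumes "x \<in>. A"
 shows "eps x \<in>. K" "hom_part A x 0 = eps x *:[A] 1[A]"
proof -
 have "hom_part A x 0 \<in> component A 0" using assms hom_part_comp by blast
 hence "\<exists>!k. k \<in>. K \<and> hom_part A x 0 = k *:[A] 1[A]"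
  using connected scalar_inj by auto
 from theI'[OF this] show "eps x \<in>. K" "hom_part A x 0 = eps x *:[A] 1[A]"
  unfolding eps_def augmentation_def by blast+
qed

lemma eps_eqI:
 assumes "x \<in>. A" "k \<in>. K" "hom_part A x 0 = k *:[A] 1[A]"
 shows "eps x = k"
 using assms eps_spec scalar_inj by metis

lemma eps_closed [simp]: "x \<in>. A ==> eps x \<in>. K"
 using eps_spec by blast

lemma eps_add: "x \<in>. A ==> y \<in>. A ==> eps (x +[A] y) = eps x +[K] eps y"
 by (rule eps_eqI, simp, simp add: eps_spec(1),
   simp add: hom_part_add eps_spec(2)[of x] eps_spec(2)[of y] KA.smult_l_distr eps_spec(1))

lemma eps_scalar [simp]: "k \<in>. K ==> eps (k *:[A] 1[A]) = k"
 by (rule eps_eqI) (simp_all add: hom_part_of_comp[OF comp_smult[OF _ one_comp]])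

lemma eps_one [simp]: "eps 1[A] = 1[K]"
 using eps_scalar[of "1[K]"] by simp

lemma eps_pos: "x \<in> component A i ==> i ~= 0 ==> eps x = 0[K]"
 by (rule eps_eqI) (use comp_carrier in "auto simp: hom_part_of_comp")

lemma comp0E:
 assumes "x \<in> component A 0"
 shows "x = eps x *:[A] 1[A]"
 using eps_spec(2)[OF comp_carrier[OF assms]] hom_part_of_comp[OF assms] by simp

text \<open>Products with a factor of positive degree have no part of degree 0, and \<open>component A 0\<close> is a copy of \<open>K\<close>.\<close>
lemma eps_mult:
 assumes "x \<in>. A" "y \<in>. A"
 shows "eps (x *[A] y) = eps x *[K] eps y"
 using assms(1)
proof (induction rule: graded_induct)
 case (hom i x)
 hence x: "x \<in>. A" using comp_carrier by blast
 show ?case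
  using assms(2)
 proof (induction rule: graded_induct)
  case (hom j y)
  have y: "y \<in>. A" using comp_carrier hom by blast
  have xy: "x *[A] y \<in> component A (i + j)"
   using component_mult \<open>x \<in> component A i\<close> hom by blast
  show ?case
  proof (cases "i = 0 \<and> j = 0")
   case True
   hence "x = eps x *:[A] 1[A]" "y = eps y *:[A] 1[A]"
    using comp0E \<open>x \<in> component A i\<close> hom by auto
   hence "x *[A] y = (eps x *:[A] 1[A]) *[A] (eps y *:[A] 1[A])" by simp
   also have "\<dots> = (eps x *[K] eps y) *:[A] 1[A]"
    using x y by (simp add: KA.smult_assoc1 flip: smult_mult_left)
   finally show ?thesis using x y by simp
  next
   case False
   thus ?thesis
    using eps_pos[OF xy] eps_pos[OF \<open>x \<in> component A i\<close>] eps_pos[OF hom] x y by auto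
  qed
 next
  case (add y z)
  thus ?case using x by (simp add: A.r_distr eps_add K.r_distr)
 qed
next
 case (add x z)
 thus ?case using assms(2) by (simp add: A.l_distr eps_add K.l_distr)
qed

lemma eps_smult: "k \<in>. K ==> x \<in>. A ==> eps (k *:[A] x) = k *[K] eps x"
 using eps_mult[of "k *:[A] 1[A]" x] by (simp flip: smult_mult_left)

lemma eps_zero [simp]: "eps 0[A] = 0[K]"
 by (rule eps_eqI) auto

lemma scalar_mult: "k \<in>. K ==> x \<in>. A ==> (k *:[A] 1[A]) *[A] x = k *:[A] x"
 by (simp flip: smult_mult_left)

end

definition galg_hom ::
  "'k ring => (nat, 'k, 'a) graded_module => (nat, 'k, 'b) graded_module => ('a => 'b) => bool"
 where "galg_hom K A B h \<longleftrightarrow> h \<in> ring_hom A B \<and>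
  (\<forall>k\<in>carrier K. \<forall>x\<in>carrier A. h (k *:[A] x) = k *:[B] h x) \<and>
  (\<forall>i. h ` component A i \<subseteq> component B i)"

lemma galg_homD:
 assumes "galg_hom K A B h"
 shows "x \<in>. A ==> h x \<in>. B"
  and "x \<in>. A ==> y \<in>. A ==> h (x *[A] y) = h x *[B] h y"
  and "x \<in>. A ==> y \<in>. A ==> h (x +[A] y) = h x +[B] h y"
  and "h 1[A] = 1[B]"
  and "k \<in>. K ==> x \<in>. A ==> h (k *:[A] x) = k *:[B] h x"
  and "x \<in> component A i ==> h x \<in> component B i"
 using assms unfolding galg_hom_def ring_hom_def by (simp_all add: Pi_iff image_subset_iff)

lemma galg_hom_id: "galg_hom K A A id"
 by (simp add: galg_hom_def)

lemma galg_hom_comp: "galg_hom K A B f ==> galg_hom K B C g ==> galg_hom K A C (g \<circ> f)"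
 unfolding galg_hom_def using ring_hom_trans ring_hom_closed by (fastforce simp: image_subset_iff)

lemma galg_hom_aug:
 assumes "connected_graded_algebra K A" "connected_graded_algebra K B" "galg_hom K A B h" "x \<in>. A"
 shows "augmentation K B (h x) = augmentation K A x"
proof -
 interpret A: connected_graded_algebra K A by fact
 interpret B: connected_graded_algebra K B by fact
 have "B.eps (h x) = A.eps x"
  using assms(4)
 proof (induction rule: A.graded_induct)
  case (hom i x)
  show ?case
  proof (cases "i = 0")
   case True
   hence "x = A.eps x *:[A] 1[A]" using A.comp0E hom by blast
   moreover have "A.eps x \<in>. K" using hom A.comp_carrier by auto
   ultimately show ?thesis
    using galg_homD[OF assms(3)] by (metis A.A.one_closed B.eps_scalar)
  next
   case False
   thus ?thesis using hom A.eps_pos B.eps_pos galg_homD(6)[OF assms(3)] by metis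
  qed
 next
  case (add x y)
  thus ?case using galg_homD[OF assms(3)] by (simp add: A.eps_add B.eps_add)
 qed
 thus ?thesis by (simp add: A.eps_def B.eps_def)
qed

section \<open>Graded modules and semilinear maps\<close>

locale graded_mod = A: connected_graded_algebra K A + N: abelian_group N
  for K :: "'k ring" and A :: "(nat, 'k, 'a) graded_module" and N :: "(int, 'a, 'm) graded_module" +
 assumes smult_closed [simp]: "a \<in>. A ==> x \<in>. N ==> a *:[N] x \<in>. N"
  and smult_l_distr: "a \<in>. A ==> b \<in>. A ==> x \<in>. N ==>
   (a +[A] b) *:[N] x = a *:[N] x +[N] b *:[N] x"
  and smult_r_distr: "a \<in>. A ==> x \<in>. N ==> y \<in>. N ==>
   a *:[N] (x +[N] y) = a *:[N] x +[N] a *:[N] y"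
  and smult_assoc: "a \<in>. A ==> b \<in>. A ==> x \<in>. N ==>
   (a *[A] b) *:[N] x = a *:[N] (b *:[N] x)"
  and smult_one [simp]: "x \<in>. N ==> 1[A] *:[N] x = x"
  and ncomp_sub: "additive_subgroup (component N j) N"
  and ncomp_smult: "a \<in> component A i ==> x \<in> component N j ==>
   a *:[N] x \<in> component N (int i + j)"
begin

lemma ncomp_carrier: "x \<in> component N i ==> x \<in>. N"
 using additive_subgroup.a_subset[OF ncomp_sub] by blast

lemma ncomp_zero [simp]: "0[N] \<in> component N i"
 using additive_subgroup.zero_closed[OF ncomp_sub] .

lemma ncomp_add: "x \<in> component N i ==> y \<in> component N i ==> x +[N] y \<in> component N i"
 using additive_subgroup.a_closed[OF ncomp_sub] .

lemma ncomp_neg: "x \<in> component N i ==> -[N] x \<in> component N i"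
 using additive_subgroup.a_inv_closed[OF ncomp_sub] .

lemma smult_zero_l [simp]: "x \<in>. N ==> 0[A] *:[N] x = 0[N]"
 using smult_l_distr[of "0[A]" "0[A]" x] N.add.l_cancel_one'[of "0[A] *:[N] x" "0[A] *:[N] x"] by simp

lemma smult_zero_r [simp]: "a \<in>. A ==> a *:[N] 0[N] = 0[N]"
 using smult_r_distr[of a "0[N]" "0[N]"] N.add.l_cancel_one'[of "a *:[N] 0[N]" "a *:[N] 0[N]"] by simp

lemma smult_neg:
 assumes "a \<in>. A" "x \<in>. N"
 shows "a *:[N] (-[N] x) = -[N] (a *:[N] x)"
 using assms smult_r_distr[of a "-[N] x" x]
 by (metis N.add.inv_closed N.l_neg N.minus_equality smult_closed smult_zero_r)

end

text \<open>The map \<open>\<phi>\<close> allows modules over two algebras to be compared; with \<open>\<phi> = id\<close> the elements are linear maps that may take any values outside the carrier.\<close>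
definition semihom ::
  "('a => 'b) => (nat, 'k, 'a) graded_module => (int, 'a, 'm) graded_module => (int, 'b, 'n) graded_module =>
   int => ('m => 'n) set"
 where "semihom \<phi> A M N d = {f.
  (\<forall>x\<in>carrier M. f x \<in>. N) \<and>
  (\<forall>x\<in>carrier M. \<forall>y\<in>carrier M. f (x +[M] y) = f x +[N] f y) \<and>
  (\<forall>a\<in>carrier A. \<forall>x\<in>carrier M. f (a *:[M] x) = \<phi> a *:[N] f x) \<and>
  (\<forall>j. \<forall>x\<in>component M j. f x \<in> component N (j + d))}"

lemma semihomI:
 assumes "\<And>x. x \<in>. M ==> f x \<in>. N"
  "\<And>x y. x \<in>. M ==> y \<in>. M ==> f (x +[M] y) = f x +[N] f y"
  "\<And>a x. a \<in>. A ==> x \<in>. M ==> f (a *:[M] x) = \<phi> a *:[N] f x"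
  "\<And>j x. x \<in> component M j ==> f x \<in> component N (j + d)"
 shows "f \<in> semihom \<phi> A M N d"
 using assms unfolding semihom_def by blast

lemma semihomD:
 assumes "f \<in> semihom \<phi> A M N d"
 shows "x \<in>. M ==> f x \<in>. N"
  and "x \<in>. M ==> y \<in>. M ==> f (x +[M] y) = f x +[N] f y"
  and "a \<in>. A ==> x \<in>. M ==> f (a *:[M] x) = \<phi> a *:[N] f x"
  and "x \<in> component M j ==> f x \<in> component N (j + d)"
 using assms unfolding semihom_def by blast+

lemma additive_zero:
 assumes "abelian_group M" "abelian_group N"
  "\<And>x y. x \<in>. M ==> y \<in>. M ==> f (x +[M] y) = f x +[N] f y"
  "\<And>x. x \<in>. M ==> f x \<in>. N"
 shows "f 0[M] = 0[N]"
 using additive_finsum[of M N "{}" f] assms by (simp add: abelian_group_def abelian_monoid.finsum_empty)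

lemma additive_neg:
 assumes "abelian_group M" "abelian_group N"
  "\<And>x y. x \<in>. M ==> y \<in>. M ==> f (x +[M] y) = f x +[N] f y"
  "\<And>x. x \<in>. M ==> f x \<in>. N" "x \<in>. M"
 shows "f (-[M] x) = -[N] f x"
proof -
 interpret M: abelian_group M by fact
 interpret N: abelian_group N by fact
 have "f (-[M] x) +[N] f x = 0[N]"
  using assms(3)[of "-[M] x" x] assms(5) additive_zero[OF assms(1-4)] by (simp add: M.l_neg)
 thus ?thesis using N.minus_equality assms(4,5) by simp
qed

lemma semihom_zero:
 "abelian_group M ==> abelian_group N ==> f \<in> semihom \<phi> A M N d ==> f 0[M] = 0[N]"
 by (rule additive_zero) (auto dest: semihomD)

lemma semihom_neg:
 "abelian_group M ==> abelian_group N ==> f \<in> semihom \<phi> A M N d ==> x \<in>. M ==>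
  f (-[M] x) = -[N] f x"
 by (rule additive_neg) (auto dest: semihomD)

lemma semihom_comp:
 assumes f: "f \<in> semihom \<phi> A M N d" and g: "g \<in> semihom \<chi> B N L e"
  and \<phi>: "\<And>a. a \<in>. A ==> \<phi> a \<in>. B" and eq: "\<And>a. a \<in>. A ==> \<chi> (\<phi> a) = \<psi> a"
  and s: "s = d + e"
 shows "(\<lambda>x. g (f x)) \<in> semihom \<psi> A M L s"
proof (rule semihomI)
 fix j x assume "x \<in> component M j"
 thus "g (f x) \<in> component L (j + s)"
  using semihomD(4)[OF g semihomD(4)[OF f], of x j] s by (simp add: add.assoc)
qed (use \<phi> eq semihomD[OF f] semihomD[OF g] in auto)

lemma (in graded_mod) semihom_add:
 assumes "f \<in> semihom \<phi> A' M N d" "g \<in> semihom \<phi> A' M N d"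
  "\<And>a. a \<in>. A' ==> \<phi> a \<in>. A"
 shows "(\<lambda>x. f x +[N] g x) \<in> semihom \<phi> A' M N d"
 by (rule semihomI)
  (use assms(3) semihomD[OF assms(1)] semihomD[OF assms(2)] in
   \<open>auto simp: N.a_ac smult_r_distr ncomp_add\<close>)

lemma (in graded_mod) semihom_uminus:
 assumes "f \<in> semihom \<phi> A' M N d" "\<And>a. a \<in>. A' ==> \<phi> a \<in>. A"
 shows "(\<lambda>x. -[N] f x) \<in> semihom \<phi> A' M N d"
 by (rule semihomI)
  (use assms(2) semihomD[OF assms(1)] in "auto simp: N.minus_add N.a_comm smult_neg ncomp_neg")

lemma (in graded_mod) semihom_const_zero:
 assumes "\<And>a. a \<in>. A' ==> \<phi> a \<in>. A"
 shows "(\<lambda>x. 0[N]) \<in> semihom \<phi> A' M N d"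
 by (rule semihomI) (use assms in auto)

lemma semihom_cong:
 assumes "f \<in> semihom \<phi> A M N d" "\<And>x. x \<in>. M ==> f x = g x"
  "abelian_group M" "\<And>j x. x \<in> component M j ==> x \<in>. M"
  "\<And>a x. a \<in>. A ==> x \<in>. M ==> a *:[M] x \<in>. M"
 shows "g \<in> semihom \<phi> A M N d"
proof (rule semihomI)
 interpret M: abelian_group M by fact
 show "g (x +[M] y) = g x +[N] g y" if "x \<in>. M" "y \<in>. M" for x y
  using that assms(2) semihomD(2)[OF assms(1)] M.a_closed by metis
qed (use assms semihomD[OF assms(1)] in "simp_all flip: assms(2)")

lemma graded_hom_iff:
 "f \<in> graded_hom A M N d \<longleftrightarrow> f \<in> semihom id A M N d \<and> f \<in> extensional (carrier M)"
 unfolding graded_hom_def semihom_def PiE_def by (auto simp: Pi_iff image_subset_iff)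

lemma (in graded_mod) semihom_restrict:
 assumes "f \<in> semihom id A N L d"
 shows "restrict f (carrier N) \<in> graded_hom A N L d"
 unfolding graded_hom_iff
 by (auto intro!: semihom_cong[OF assms] simp: N.abelian_group_axioms ncomp_carrier)

section \<open>Free modules and the trivial module\<close>

lemma free_module_simps [simp]:
 "0[free_module A \<beta>] = (\<lambda>i. 0[A])"
 "x +[free_module A \<beta>] y = (\<lambda>i. x i +[A] y i)"
 "a *:[free_module A \<beta>] x = (\<lambda>i. a *[A] x i)"
 by (simp_all add: free_module_def)

lemma free_module_carrier:
 "x \<in>. free_module A \<beta> \<longleftrightarrow>
  (\<forall>i. x i \<in>. A) \<and> finite {i. x i ~= 0[A]} \<and> (\<forall>i. \<beta> i = None --> x i = 0[A])"
 by (auto simp: free_module_def domIff)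

lemma free_module_comp:
 "x \<in> component (free_module A \<beta>) m \<longleftrightarrow> x \<in>. free_module A \<beta> \<and>
  (\<forall>i d. \<beta> i = Some d --> x i \<in> (if d \<le> m then component A (nat (m - d)) else {0[A]}))"
 by (simp add: free_module_def)

lemma fm_compD:
 assumes "x \<in> component (free_module A \<beta>) m"
 shows "x \<in>. free_module A \<beta>"
  and "\<beta> i = Some d ==> d \<le> m ==> x i \<in> component A (nat (m - d))"
  and "\<beta> i = Some d ==> \<not> d \<le> m ==> x i = 0[A]"
proof -
 have *: "x i \<in> (if d \<le> m then component A (nat (m - d)) else {0[A]})" if "\<beta> i = Some d" for i d
  using assms that unfolding free_module_comp by blast
 show "\<beta> i = Some d ==> d \<le> m ==> x i \<in> component A (nat (m - d))"
  "\<beta> i = Some d ==> \<not> d \<le> m ==> x i = 0[A]"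
  using *[of i d] by simp_all
qed (use assms in "simp add: free_module_comp")

lemma fm_compI:
 assumes "x \<in>. free_module A \<beta>"
  "\<And>i d. \<beta> i = Some d ==> d \<le> m ==> x i \<in> component A (nat (m - d))"
  "\<And>i d. \<beta> i = Some d ==> \<not> d \<le> m ==> x i = 0[A]"
 shows "x \<in> component (free_module A \<beta>) m"
 using assms by (simp add: free_module_comp)

definition single :: "(nat, 'k, 'a) graded_module => 'a => nat => nat => 'a"
 where "single A a i = (\<lambda>j. if j = i then a else 0[A])"

lemma trivial_module_simps [simp]:
 "carrier (trivial_module K A) = carrier K"
 "0[trivial_module K A] = 0[K]"
 "x +[trivial_module K A] y = x +[K] y"
 "a *:[trivial_module K A] x = augmentation K A a *[K] x"
 "component (trivial_module K A) m = (if m = 0 then carrier K else {0[K]})"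
 by (simp_all add: trivial_module_def)

context connected_graded_algebra
begin

abbreviation "F \<beta> \<equiv> free_module A \<beta>"

lemma fm_coeff: "x \<in>. F \<beta> ==> x i \<in>. A"
 by (simp add: free_module_carrier)

lemma fm_add_closed:
 assumes "x \<in>. F \<beta>" "y \<in>. F \<beta>"
 shows "(\<lambda>i. x i +[A] y i) \<in>. F \<beta>"
proof -
 have "{i. x i +[A] y i ~= 0[A]} \<subseteq> {i. x i ~= 0[A]} \<union> {i. y i ~= 0[A]}"
  by auto
 thus ?thesis using assms finite_subset by (fastforce simp: free_module_carrier)
qed

lemma fm_smult_closed:
 assumes "a \<in>. A" "x \<in>. F \<beta>"
 shows "(\<lambda>i. a *[A] x i) \<in>. F \<beta>"
proof -
 have "{i. a *[A] x i ~= 0[A]} \<subseteq> {i. x i ~= 0[A]}"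
  using assms(1) by auto
 thus ?thesis using assms finite_subset by (fastforce simp: free_module_carrier)
qed

lemma fm_neg_closed:
 assumes "x \<in>. F \<beta>"
 shows "(\<lambda>i. -[A] x i) \<in>. F \<beta>"
proof -
 have "{i. -[A] x i ~= 0[A]} \<subseteq> {i. x i ~= 0[A]}"
  by auto
 thus ?thesis using assms finite_subset by (fastforce simp: free_module_carrier)
qed

lemma fm_group: "abelian_group (F \<beta>)"
proof (rule abelian_groupI)
 fix x y assume "x \<in>. F \<beta>" "y \<in>. F \<beta>"
 thus "x +[F \<beta>] y \<in>. F \<beta>" using fm_add_closed by simp
 show "x +[F \<beta>] y = y +[F \<beta>] x"
  using \<open>x \<in> _\<close> \<open>y \<in> _\<close> by (auto simp: free_module_carrier A.a_comm)
next
 fix x assume x: "x \<in>. F \<beta>"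
 thus "\<exists>y\<in>carrier (F \<beta>). y +[F \<beta>] x = 0[F \<beta>]"
  by (intro bexI[OF _ fm_neg_closed[OF x]]) (auto simp: free_module_carrier A.l_neg)
qed (auto simp: free_module_carrier A.a_assoc)

lemma fm_uminus: "x \<in>. F \<beta> ==> -[F \<beta>] x = (\<lambda>i. -[A] x i)"
 by (rule abelian_group.minus_equality[OF fm_group])
  (auto simp: fm_neg_closed free_module_carrier A.l_neg)

lemma fm_graded_mod: "graded_mod K A (F \<beta>)"
proof -
 interpret N: abelian_group "F \<beta>" by (rule fm_group)
 show ?thesis
 proof (intro graded_mod.intro graded_mod_axioms.intro connected_graded_algebra_axioms fm_group)
  fix j
  show "additive_subgroup (component (F \<beta>) j) (F \<beta>)"
  proof (rule additive_subgroupI, rule N.add.subgroupI)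
   show "component (F \<beta>) j \<subseteq> carrier (F \<beta>)" by (auto simp: free_module_comp)
   have "0[F \<beta>] \<in> component (F \<beta>) j"
    using N.zero_closed by (auto simp: free_module_comp)
   thus "component (F \<beta>) j ~= {}" by blast
   show "-[F \<beta>] x \<in> component (F \<beta>) j" if x: "x \<in> component (F \<beta>) j" for x
   proof (rule fm_compI)
    show "-[F \<beta>] x \<in>. F \<beta>" using fm_compD(1)[OF x] by simp
    fix i d assume i: "\<beta> i = Some d"
    have e: "(-[F \<beta>] x) i = -[A] x i" using fm_uminus[OF fm_compD(1)[OF x]] by simp
    show "(-[F \<beta>] x) i \<in> component A (nat (j - d))" if "d \<le> j"
     using e additive_subgroup.a_inv_closed[OF comp_sub fm_compD(2)[OF x i that]] by simp
    show "(-[F \<beta>] x) i = 0[A]" if "\<not> d \<le> j"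
     using e fm_compD(3)[OF x i that] by simp
   qed
   show "x +[F \<beta>] y \<in> component (F \<beta>) j" if "x \<in> component (F \<beta>) j" "y \<in> component (F \<beta>) j" for x y
    using fm_add_closed[OF fm_compD(1)[OF that(1)] fm_compD(1)[OF that(2)]]
     comp_add[OF fm_compD(2)[OF that(1)] fm_compD(2)[OF that(2)]]
     fm_compD(3)[OF that(1)] fm_compD(3)[OF that(2)]
    by (intro fm_compI) simp_all
  qed
  fix a x i assume a: "a \<in> component A i" and x: "x \<in> component (F \<beta>) j"
  have "a *[A] x l \<in> component A (nat (int i + j - d))" if "\<beta> l = Some d" "d \<le> j" for l d
  proof -
   have "x l \<in> component A (nat (j - d))" using fm_compD(2)[OF x that] .
   hence "a *[A] x l \<in> component A (i + nat (j - d))" using a component_mult by blast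
   moreover have "i + nat (j - d) = nat (int i + j - d)" using that by simp
   ultimately show ?thesis by simp
  qed
  moreover have "a *[A] x l = 0[A]" if "\<beta> l = Some d" "\<not> d \<le> j" for l d
   using fm_compD(3)[OF x that] comp_carrier[OF a] by simp
  ultimately have *: "a *[A] x l \<in> component A (nat (int i + j - d))" if "\<beta> l = Some d" for l d
   using that by (cases "d \<le> j") auto
  show "a *:[F \<beta>] x \<in> component (F \<beta>) (int i + j)"
  proof (rule fm_compI)
   show "a *:[F \<beta>] x \<in>. F \<beta>"
    using fm_smult_closed[OF comp_carrier[OF a] fm_compD(1)[OF x]] by simp
   fix l d assume l: "\<beta> l = Some d"
   show "(a *:[F \<beta>] x) l \<in> component A (nat (int i + j - d))" using *[OF l] by simp
   show "(a *:[F \<beta>] x) l = 0[A]" if "\<not> d \<le> int i + j"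
    using fm_compD(3)[OF x l] that comp_carrier[OF a] by simp
  qed
 next
  fix a b x assume *: "a \<in>. A" "b \<in>. A" "x \<in>. F \<beta>"
  note x = fm_coeff[OF *(3)]
  show "(a +[A] b) *:[F \<beta>] x = a *:[F \<beta>] x +[F \<beta>] b *:[F \<beta>] x"
   "(a *[A] b) *:[F \<beta>] x = a *:[F \<beta>] (b *:[F \<beta>] x)"
   using * x by (simp_all add: A.l_distr A.m_assoc)
 next
  fix a x y assume *: "a \<in>. A" "x \<in>. F \<beta>" "y \<in>. F \<beta>"
  show "a *:[F \<beta>] (x +[F \<beta>] y) = a *:[F \<beta>] x +[F \<beta>] a *:[F \<beta>] y"
   using * fm_coeff[OF *(2)] fm_coeff[OF *(3)] by (simp add: A.r_distr)
 next
  fix a x assume *: "a \<in>. A" "x \<in>. F \<beta>"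
  show "a *:[F \<beta>] x \<in>. F \<beta>" using fm_smult_closed[OF *] by simp
 next
  fix x assume "x \<in>. F \<beta>"
  thus "1[A] *:[F \<beta>] x = x" using fm_coeff[of x] by simp
 qed
qed

lemma single_carrier [simp]: "a \<in>. A ==> \<beta> i = Some d ==> single A a i \<in>. F \<beta>"
 by (auto simp: free_module_carrier single_def)

lemma single_comp:
 assumes "a \<in> component A k" "\<beta> i = Some d"
 shows "single A a i \<in> component (F \<beta>) (int k + d)"
 using assms single_carrier[where a = a and i = i and \<beta> = \<beta>] comp_carrier[OF assms(1)]
 by (auto simp: free_module_comp) (auto simp: single_def)

lemma single_eq: "a \<in>. A ==> single A a i = a *:[F \<beta>] single A 1[A] i"
 by (auto simp: single_def)

text \<open>An element is the sum of the finitely many terms supported on a single generator.\<close>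
lemma fm_support_induct:
 assumes "x \<in>. F \<beta>" "Q (\<lambda>i. 0[A])"
  "\<And>i d. \<beta> i = Some d ==> Q (single A (x i) i)"
  "\<And>y z. y \<in>. F \<beta> ==> z \<in>. F \<beta> ==> Q y ==> Q z ==> Q (\<lambda>i. y i +[A] z i)"
 shows "Q x"
proof -
 have "Q (\<lambda>i. if i \<in> S then x i else 0[A])" if "finite S" for S
  using that
 proof (induction S rule: finite_induct)
  case (insert s S)
  let ?y = "\<lambda>i. if i \<in> S then x i else 0[A]"
  have x: "x i \<in>. A" for i using assms(1) by (auto simp: free_module_carrier)
  show ?case
  proof (cases "\<beta> s")
   case None
   hence "x s = 0[A]" using assms(1) by (auto simp: free_module_carrier)
   hence "(\<lambda>i. if i \<in> insert s S then x i else 0[A]) = ?y" by auto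
   thus ?thesis using insert by simp
  next
   case (Some d)
   have "?y \<in>. F \<beta>"
    unfolding free_module_carrier
    by (intro conjI allI rev_finite_subset[OF insert.hyps(1)])
     (use assms(1) in "auto simp: free_module_carrier")
   moreover have "(\<lambda>i. if i \<in> insert s S then x i else 0[A]) = (\<lambda>i. ?y i +[A] single A (x s) s i)"
    using insert.hyps x by (auto simp: single_def)
   ultimately show ?thesis
    using assms(4)[of ?y "single A (x s) s"] assms(3)[OF Some] insert.IH x[of s] Some
     single_carrier[of "x s" \<beta> s d] by simp
  qed
 qed (use assms(2) in simp)
 from this[of "{i. x i ~= 0[A]}"] have "Q (\<lambda>i. if i \<in> {i. x i ~= 0[A]} then x i else 0[A])"
  using assms(1) by (simp add: free_module_carrier)
 moreover have "(\<lambda>i. if i \<in> {i. x i ~= 0[A]} then x i else 0[A]) = x" by auto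
 ultimately show ?thesis by simp
qed

lemma fm_comp_induct [consumes 1, case_names zero single add]:
 assumes "x \<in> component (F \<beta>) m" "Q (\<lambda>i. 0[A])"
  "\<And>i d k a. \<beta> i = Some d ==> d + int k = m ==> a \<in> component A k ==> Q (single A a i)"
  "\<And>y z. y \<in>. F \<beta> ==> z \<in>. F \<beta> ==> Q y ==> Q z ==> Q (\<lambda>i. y i +[A] z i)"
 shows "Q x"
proof (rule fm_support_induct[of x \<beta>])
 show "x \<in>. F \<beta>" using assms(1) by (simp add: free_module_comp)
 fix i d assume i: "\<beta> i = Some d"
 show "Q (single A (x i) i)"
 proof (cases "d \<le> m")
  case True
  have "x i \<in> component A (nat (m - d))"
   using fm_compD(2)[OF assms(1) i True] .
  thus ?thesis using assms(3)[OF i, of "nat (m - d)"] True by simp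
 next
  case False
  hence "single A (x i) i = (\<lambda>i. 0[A])"
   using fm_compD(3)[OF assms(1) i] by (auto simp: single_def)
  thus ?thesis using assms(2) by simp
 qed
qed (use assms in auto)

lemma fm_induct [consumes 1, case_names zero single add]:
 assumes "x \<in>. F \<beta>" "Q (\<lambda>i. 0[A])"
  "\<And>i d k a. \<beta> i = Some d ==> a \<in> component A k ==> Q (single A a i)"
  "\<And>y z. y \<in>. F \<beta> ==> z \<in>. F \<beta> ==> Q y ==> Q z ==> Q (\<lambda>i. y i +[A] z i)"
 shows "Q x"
proof (rule fm_support_induct[of x \<beta>])
 fix i d assume i: "\<beta> i = Some d"
 have "x i \<in>. A" using assms(1) by (auto simp: free_module_carrier)
 thus "Q (single A (x i) i)"
 proof (induction rule: graded_induct)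
  case (add a b)
  have "single A (a +[A] b) i = (\<lambda>j. single A a i j +[A] single A b i j)"
   by (auto simp: single_def)
  thus ?case
   using add i assms(4)[of "single A a i" "single A b i"] single_carrier[of _ \<beta> i d] by simp
 qed (use assms i in blast)
qed (use assms in auto)

lemma fm_hom_induct [consumes 1, case_names hom add]:
 assumes "x \<in>. F \<beta>" "\<And>m x. x \<in> component (F \<beta>) m ==> Q x"
  "\<And>y z. y \<in>. F \<beta> ==> z \<in>. F \<beta> ==> Q y ==> Q z ==> Q (\<lambda>i. y i +[A] z i)"
 shows "Q x"
 using assms(1)
proof (induction rule: fm_induct)
 case zero
 show ?case using assms(2)[of _ 0] graded_mod.ncomp_zero[OF fm_graded_mod] by (simp add: free_module_def)
next
 case (single i d k a)
 thus ?case using assms(2) single_comp by blast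
qed (use assms(3) in blast)

lemma fm_hom_unique:
 assumes "f \<in> semihom \<phi> A (F \<beta>) N d" "g \<in> semihom \<phi> A (F \<beta>) N d" "abelian_group N"
  "\<And>i e. \<beta> i = Some e ==> f (single A 1[A] i) = g (single A 1[A] i)" "x \<in>. F \<beta>"
 shows "f x = g x"
 using assms(5)
proof (induction rule: fm_induct)
 case zero
 show ?case using semihom_zero[OF fm_group assms(3) assms(1)] semihom_zero[OF fm_group assms(3) assms(2)] by simp
next
 case (single i d k a)
 thus ?case
  using single_eq[of a i \<beta>] comp_carrier[of a k] semihomD(3)[OF assms(1), of a "single A 1[A] i"]
   semihomD(3)[OF assms(2), of a "single A 1[A] i"] single_carrier[of "1[A]" \<beta> i d] assms(4) by simp
next
 case (add y z)
 thus ?case using semihomD(2)[OF assms(1)] semihomD(2)[OF assms(2)] by simp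
qed

text \<open>The element \<open>x\<close> is sent to the sum of the \<open>\<phi> (x i) *:[N] y i\<close>, which is finite.\<close>
lemma fm_ext:
 assumes N: "graded_mod K B N" and \<phi>: "galg_hom K A B \<phi>"
  and y: "\<And>i d. \<beta> i = Some d ==> y i \<in> component N (d + s)"
 shows "\<exists>T \<in> semihom \<phi> A (F \<beta>) N s. \<forall>i d. \<beta> i = Some d --> T (single A 1[A] i) = y i"
proof -
 interpret N: graded_mod K B N by fact
 define T where "T x = (\<Oplus>\<^bsub>N\<^esub>i\<in>{i. x i ~= 0[A]}. \<phi> (x i) *:[N] y i)" for x
 have yN: "y i \<in>. N" if "\<beta> i = Some d" for i d using y that N.ncomp_carrier by blast
 have \<phi>0: "\<phi> 0[A] = 0[B]"
  using additive_zero[of A B \<phi>] galg_homD[OF \<phi>] A.abelian_group_axioms N.A.A.abelian_group_axioms by blast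
 have c: "\<phi> (x i) *:[N] y i \<in>. N" if "x \<in>. F \<beta>" "x i ~= 0[A]" for x i
  using that yN[of i] galg_homD(1)[OF \<phi>] by (cases "\<beta> i") (auto simp: free_module_carrier)
 have T: "T x = (\<Oplus>\<^bsub>N\<^esub>i\<in>J. \<phi> (x i) *:[N] y i)"
  if "x \<in>. F \<beta>" "finite J" "J \<subseteq> dom \<beta>" "{i. x i ~= 0[A]} \<subseteq> J" for x J
  unfolding T_def
 proof (rule N.N.finsum_superset)
  show "\<phi> (x i) *:[N] y i \<in>. N" if "i \<in> J" for i
   using that \<open>J \<subseteq> dom \<beta>\<close> \<open>x \<in> _\<close> yN[of i] galg_homD(1)[OF \<phi>] by (auto simp: free_module_carrier)
  show "\<phi> (x i) *:[N] y i = 0[N]" if "i \<in> J - {i. x i ~= 0[A]}" for i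
   using that \<open>J \<subseteq> dom \<beta>\<close> yN[of i] \<phi>0 by auto
 qed (use that in auto)
 have dom: "{i. x i ~= 0[A]} \<subseteq> dom \<beta>" "finite {i. x i ~= 0[A]}" if "x \<in>. F \<beta>" for x
  using that by (auto simp: free_module_carrier)
 have "T \<in> semihom \<phi> A (F \<beta>) N s"
 proof (rule semihomI)
  fix x assume x: "x \<in>. F \<beta>"
  show "T x \<in>. N" unfolding T_def using c[OF x] by (intro N.N.finsum_closed) auto
  fix z assume z: "z \<in>. F \<beta>"
  let ?J = "{i. x i ~= 0[A]} \<union> {i. z i ~= 0[A]}"
  have xz: "x i \<in>. A" "z i \<in>. A" for i using x z by (auto simp: free_module_carrier)
  have J: "finite ?J" "?J \<subseteq> dom \<beta>" using dom x z by auto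
  have yJ: "y i \<in>. N" if "i \<in> ?J" for i using that J(2) yN by blast
  have "T (x +[F \<beta>] z) = (\<Oplus>\<^bsub>N\<^esub>i\<in>?J. \<phi> (x i +[A] z i) *:[N] y i)"
  proof -
   have "{i. (x +[F \<beta>] z) i ~= 0[A]} \<subseteq> ?J" using A.l_zero by auto
   from T[OF _ J this] show ?thesis using fm_add_closed[OF x z] by simp
  qed
  also have "\<dots> = (\<Oplus>\<^bsub>N\<^esub>i\<in>?J. \<phi> (x i) *:[N] y i +[N] \<phi> (z i) *:[N] y i)"
   by (rule N.N.finsum_cong') (use xz yJ in \<open>auto simp: galg_homD[OF \<phi>] N.smult_l_distr\<close>)
  also have "\<dots> = T x +[N] T z"
   unfolding T[OF x J Un_upper1] T[OF z J Un_upper2]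
   by (rule N.N.finsum_addf) (use xz yJ in \<open>auto simp: galg_homD[OF \<phi>]\<close>)
  finally show "T (x +[F \<beta>] z) = T x +[N] T z" .
 next
  fix a x assume a: "a \<in>. A" and x: "x \<in>. F \<beta>"
  let ?J = "{i. x i ~= 0[A]}"
  have xA: "x i \<in>. A" for i using x by (auto simp: free_module_carrier)
  have yJ: "y i \<in>. N" if "i \<in> ?J" for i using that dom(1)[OF x] yN by blast
  have "T (a *:[F \<beta>] x) = (\<Oplus>\<^bsub>N\<^esub>i\<in>?J. \<phi> (a *[A] x i) *:[N] y i)"
  proof -
   have "{i. (a *:[F \<beta>] x) i ~= 0[A]} \<subseteq> ?J" using a by auto
   from T[OF _ dom(2)[OF x] dom(1)[OF x] this] show ?thesis using fm_smult_closed[OF a x] by simp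
  qed
  also have "\<dots> = (\<Oplus>\<^bsub>N\<^esub>i\<in>?J. \<phi> a *:[N] (\<phi> (x i) *:[N] y i))"
   by (rule N.N.finsum_cong') (use a xA yJ in \<open>auto simp: galg_homD[OF \<phi>] N.smult_assoc\<close>)
  also have "\<dots> = \<phi> a *:[N] T x"
   unfolding T_def
   by (rule additive_finsum[OF N.N.abelian_group_axioms N.N.abelian_group_axioms, symmetric])
    (use a xA yJ dom[OF x] in \<open>auto simp: galg_homD[OF \<phi>] N.smult_r_distr\<close>)
  finally show "T (a *:[F \<beta>] x) = \<phi> a *:[N] T x" .
 next
  fix j x assume x: "x \<in> component (F \<beta>) j"
  hence xc: "x \<in>. F \<beta>" by (simp add: free_module_comp)
  show "T x \<in> component N (j + s)"
   unfolding T_def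
  proof (rule N.N.finsum_in_closed)
   fix i assume "i \<in> {i. x i ~= 0[A]}"
   then obtain d where d: "\<beta> i = Some d" "x i ~= 0[A]" using dom[OF xc] by auto
   hence "d \<le> j" "x i \<in> component A (nat (j - d))" using fm_compD(2,3)[OF x d(1)] by blast+
   thus "\<phi> (x i) *:[N] y i \<in> component N (j + s)"
    using N.ncomp_smult[OF galg_homD(6)[OF \<phi>] y[OF d(1)], of "x i" "nat (j - d)"] by (simp add: algebra_simps)
  qed (use dom[OF xc] N.ncomp_carrier N.ncomp_add in auto)
 qed
 moreover have "T (single A 1[A] i) = y i" if "\<beta> i = Some d" for i d
 proof -
  have "T (single A 1[A] i) = (\<Oplus>\<^bsub>N\<^esub>l\<in>{i}. \<phi> (single A 1[A] i l) *:[N] y l)"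
   by (rule T) (use that in "auto simp: single_def free_module_carrier")
  thus ?thesis using yN[OF that] galg_homD(4)[OF \<phi>] by (simp add: single_def)
 qed
 ultimately show ?thesis by blast
qed

text \<open>The homogeneous part of degree \<open>m\<close>: a generator of degree \<open>d\<close> contributes the part of degree \<open>m - d\<close> of its coefficient.\<close>
definition pr :: "(nat => int option) => int => (nat => 'a) => nat => 'a"
 where "pr \<beta> m x = (\<lambda>i. case \<beta> i of None => 0[A] | Some d =>
  if d \<le> m then hom_part A (x i) (nat (m - d)) else 0[A])"

lemma pr_comp:
 assumes "x \<in>. F \<beta>"
 shows "pr \<beta> m x \<in> component (F \<beta>) m"
proof -
 have xA: "x i \<in>. A" for i using assms by (simp add: free_module_carrier)
 have "pr \<beta> m x i = 0[A]" if "x i = 0[A]" for i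
  using that by (cases "\<beta> i") (simp_all add: pr_def)
 hence "{i. pr \<beta> m x i ~= 0[A]} \<subseteq> {i. x i ~= 0[A]}" by blast
 moreover have "finite {i. x i ~= 0[A]}" using assms by (simp add: free_module_carrier)
 ultimately have fin: "finite {i. pr \<beta> m x i ~= 0[A]}" by (rule finite_subset)
 show ?thesis
 proof (rule fm_compI)
  show "pr \<beta> m x \<in>. F \<beta>"
  proof -
   have "pr \<beta> m x i \<in>. A" for i
    using comp_carrier[OF hom_part_comp[OF xA]] by (cases "\<beta> i") (simp_all add: pr_def)
   thus ?thesis using fin by (simp add: free_module_carrier pr_def)
  qed
 qed (use hom_part_comp[OF xA] in "simp_all add: pr_def")
qed

lemma pr_add:
 assumes "x \<in>. F \<beta>" "y \<in>. F \<beta>"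
 shows "pr \<beta> m (\<lambda>i. x i +[A] y i) = (\<lambda>i. pr \<beta> m x i +[A] pr \<beta> m y i)"
 using hom_part_add[OF fm_coeff[OF assms(1)] fm_coeff[OF assms(2)]]
 by (intro ext) (simp add: pr_def split: option.split)

lemma pr_of_comp:
 assumes "x \<in> component (F \<beta>) m"
 shows "pr \<beta> k x = (if k = m then x else (\<lambda>i. 0[A]))"
proof
 fix i
 show "pr \<beta> k x i = (if k = m then x else (\<lambda>i. 0[A])) i"
 proof (cases "\<beta> i")
  case None
  hence "x i = 0[A]" using fm_compD(1)[OF assms] by (simp add: free_module_carrier)
  thus ?thesis using None by (simp add: pr_def)
 next
  case (Some d)
  show ?thesis
  proof (cases "d \<le> m")
   case True
   show ?thesis
    using Some True hom_part_of_comp[OF fm_compD(2)[OF assms Some True]] by (auto simp: pr_def)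
  next
   case False
   thus ?thesis using Some fm_compD(3)[OF assms Some] by (auto simp: pr_def)
  qed
 qed
qed

lemma pr_hom:
 assumes "f \<in> semihom \<phi> A' (free_module A' \<beta>) (F \<gamma>) s" "x \<in>. free_module A' \<beta>"
  "connected_graded_algebra K A'"
 shows "pr \<gamma> (m + s) (f x) = f (connected_graded_algebra.pr A' \<beta> m x)"
proof -
 interpret A': connected_graded_algebra K A' by fact
 have fz: "f (\<lambda>i. 0[A']) = (\<lambda>i. 0[A])"
  using semihom_zero[OF A'.fm_group fm_group assms(1)] by simp
 show ?thesis
  using assms(2)
 proof (induction rule: A'.fm_hom_induct)
  case (hom k x)
  thus ?case
   using pr_of_comp[OF semihomD(4)[OF assms(1) hom], of "m + s"] A'.pr_of_comp[OF hom, of m] fz by simp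
 next
  case (add y z)
  have "f y \<in>. F \<gamma>" "f z \<in>. F \<gamma>"
   using add semihomD(1)[OF assms(1)] by blast+
  thus ?case
   using add semihomD(2)[OF assms(1) add(1,2)] A'.pr_add[OF add(1,2)] pr_add
    semihomD(2)[OF assms(1), of "A'.pr \<beta> m y" "A'.pr \<beta> m z"] A'.pr_comp[of _ \<beta> m]
   by (simp add: free_module_comp)
 qed
qed

text \<open>An element is the sum of its homogeneous parts, of which finitely many are nonzero.\<close>
lemma fm_of_parts:
 assumes x: "x \<in>. F \<beta>" and parts: "\<And>m. pr \<beta> m x \<in> H" and zero: "(\<lambda>i. 0[A]) \<in> H"
  and sub: "H \<subseteq> carrier (F \<beta>)"
  and add: "\<And>y z. y \<in> H ==> z \<in> H ==> (\<lambda>i. y i +[A] z i) \<in> H"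
 shows "x \<in> H"
proof -
 interpret N: abelian_group "F \<beta>" by (rule fm_group)
 have "\<exists>J. finite J \<and> x = finsum (F \<beta>) (\<lambda>m. pr \<beta> m x) J \<and> (\<forall>m. m \<notin> J --> pr \<beta> m x = (\<lambda>i. 0[A]))"
  using x
 proof (induction rule: fm_hom_induct)
  case (hom m x)
  hence "x \<in>. F \<beta>" by (simp add: free_module_comp)
  thus ?case
   using pr_of_comp[OF hom] fm_coeff[OF \<open>x \<in>. F \<beta>\<close>] by (intro exI[of _ "{m}"]) auto
 next
  case (add y z)
  then obtain J J' where J: "finite J" "y = finsum (F \<beta>) (\<lambda>m. pr \<beta> m y) J" "\<And>m. m \<notin> J ==> pr \<beta> m y = (\<lambda>i. 0[A])"
   "finite J'" "z = finsum (F \<beta>) (\<lambda>m. pr \<beta> m z) J'" "\<And>m. m \<notin> J' ==> pr \<beta> m z = (\<lambda>i. 0[A])"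
   by blast
  have c: "pr \<beta> m y \<in>. F \<beta>" "pr \<beta> m z \<in>. F \<beta>" for m
   using pr_comp add by (auto simp: free_module_comp)
  have yz: "pr \<beta> m (\<lambda>i. y i +[A] z i) = pr \<beta> m y +[F \<beta>] pr \<beta> m z" for m
   using pr_add[OF add(1,2)] by simp
  have "y = finsum (F \<beta>) (\<lambda>m. pr \<beta> m y) (J \<union> J')" "z = finsum (F \<beta>) (\<lambda>m. pr \<beta> m z) (J \<union> J')"
   using J c N.finsum_superset[of "J \<union> J'" J "\<lambda>m. pr \<beta> m y"]
    N.finsum_superset[of "J \<union> J'" J' "\<lambda>m. pr \<beta> m z"] by auto
  hence "(\<lambda>i. y i +[A] z i) = finsum (F \<beta>) (\<lambda>m. pr \<beta> m y) (J \<union> J') +[F \<beta>] finsum (F \<beta>) (\<lambda>m. pr \<beta> m z) (J \<union> J')"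
   by simp
  also have "\<dots> = finsum (F \<beta>) (\<lambda>m. pr \<beta> m y +[F \<beta>] pr \<beta> m z) (J \<union> J')"
   by (rule N.finsum_addf[symmetric]) (use c in auto)
  finally have "(\<lambda>i. y i +[A] z i) = finsum (F \<beta>) (\<lambda>m. pr \<beta> m (\<lambda>i. y i +[A] z i)) (J \<union> J')"
   unfolding yz .
  moreover have "\<forall>m. m \<notin> J \<union> J' --> pr \<beta> m (\<lambda>i. y i +[A] z i) = (\<lambda>i. 0[A])"
   unfolding yz using J by auto
  ultimately show ?case using J(1,4) by blast
 qed
 then obtain J where "finite J" "x = finsum (F \<beta>) (\<lambda>m. pr \<beta> m x) J" by blast
 moreover from this have "finsum (F \<beta>) (\<lambda>m. pr \<beta> m x) J \<in> H"
  by (intro N.finsum_in_closed) (use zero sub add parts in auto)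
 ultimately show ?thesis by simp
qed

lemma tm_graded_mod: "graded_mod K A (trivial_module K A)"
proof -
 interpret N: abelian_group "trivial_module K A"
  by (rule abelian_groupI) (auto simp: K.a_ac intro: bexI[of _ "-[K] _"] K.l_neg)
 have eps: "augmentation K A = eps" by (simp add: eps_def)
 show ?thesis
 proof (intro graded_mod.intro graded_mod_axioms.intro connected_graded_algebra_axioms N.abelian_group_axioms)
  fix j
  show "additive_subgroup (component (trivial_module K A) j) (trivial_module K A)"
  proof (rule additive_subgroupI, rule N.add.subgroupI)
   fix x assume "x \<in> component (trivial_module K A) j"
   moreover have "-[trivial_module K A] 0[K] = 0[K]"
    using N.minus_equality[of "0[K]" "0[K]"] by simp
   moreover have "-[trivial_module K A] x \<in>. K" if "x \<in>. K"
    using N.a_inv_closed that by simp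
   ultimately show "-[trivial_module K A] x \<in> component (trivial_module K A) j"
    by (auto split: if_splits)
  qed (auto split: if_splits)
 qed (auto simp: eps eps_add eps_mult K.l_distr K.r_distr K.m_assoc eps_pos split: if_splits dest: comp_carrier)
qed

lemma tm_uminus: "x \<in>. K ==> -[trivial_module K A] x = -[K] x"
 by (rule abelian_group.minus_equality) (use tm_graded_mod in "auto simp: graded_mod_def K.l_neg")

end

section \<open>Chain maps between resolutions\<close>

lemma semihom_trivial_iff:
 assumes "connected_graded_algebra K A" "connected_graded_algebra K B" "galg_hom K A B \<phi>"
 shows "semihom \<phi> A M (trivial_module K B) s = semihom id A M (trivial_module K A) s"
 unfolding semihom_def using galg_hom_aug[OF assms] by simp

text \<open>On a free module it is enough to choose homogeneous preimages of the values at the generators.\<close>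
lemma (in connected_graded_algebra) lift_step:
 assumes N': "graded_mod K B N'" and N: "graded_mod K B N" and \<phi>: "galg_hom K A B \<phi>"
  and d: "d \<in> semihom id B N' N 0" and f: "f \<in> semihom \<phi> A (F \<beta>) N s"
  and ex: "\<And>j x. x \<in> component (F \<beta>) j ==> \<exists>y\<in>component N' (j + s). d y = f x"
 shows "\<exists>g\<in>semihom \<phi> A (F \<beta>) N' s. \<forall>x\<in>carrier (F \<beta>). d (g x) = f x"
proof -
 interpret N': graded_mod K B N' by fact
 interpret N: graded_mod K B N by fact
 have "\<exists>y. \<forall>e. \<beta> i = Some e --> y \<in> component N' (e + s) \<and> d y = f (single A 1[A] i)" for i
 proof (cases "\<beta> i")
  case (Some e)
  have "single A 1[A] i \<in> component (F \<beta>) e" using single_comp[where \<beta> = \<beta> and i = i, OF one_comp Some] by simp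
  thus ?thesis using ex Some by fastforce
 qed simp
 then obtain y where y: "\<And>i e. \<beta> i = Some e ==> y i \<in> component N' (e + s)"
  "\<And>i e. \<beta> i = Some e ==> d (y i) = f (single A 1[A] i)" by metis
 obtain T where T: "T \<in> semihom \<phi> A (F \<beta>) N' s"
  "\<And>i e. \<beta> i = Some e ==> T (single A 1[A] i) = y i"
  using fm_ext[OF N' \<phi>, of \<beta> y s] y(1) by blast
 have dT: "(\<lambda>x. d (T x)) \<in> semihom \<phi> A (F \<beta>) N s"
  by (rule semihom_comp[OF T(1) d]) (use galg_homD(1)[OF \<phi>] in auto)
 have "d (T x) = f x" if "x \<in>. F \<beta>" for x
  by (rule fm_hom_unique[OF dT f N.N.abelian_group_axioms _ that]) (use T y in simp)
 thus ?thesis using T(1) by blast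
qed

locale resolution = connected_graded_algebra K A for K :: "'k ring" and A :: "(nat, 'k, 'a) graded_module" +
 fixes P :: "('k, 'a) free_complex"
 assumes res: "free_resolution K A P"
begin

abbreviation "T n \<equiv> free_module A (gens P n)"

sublocale T: graded_mod K A "T n" for n by (rule fm_graded_mod)
sublocale triv: graded_mod K A "trivial_module K A" by (rule tm_graded_mod)

lemma d_hom: "diff P n \<in> semihom id A (T (Suc n)) (T n) 0"
 and aug_hom: "aug P \<in> semihom id A (T 0) (trivial_module K A) 0"
 using res unfolding free_resolution_def graded_hom_iff by blast+

lemma d_closed: "x \<in>. T (Suc n) ==> diff P n x \<in>. T n"
 using semihomD(1)[OF d_hom] .

lemma aug_d: "x \<in>. T (Suc 0) ==> aug P (diff P 0 x) = 0[K]"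
 using res unfolding free_resolution_def by (auto simp: set_eq_iff)

lemma ker_d: "{x \<in> carrier (T (Suc n)). diff P n x = 0[T n]} = diff P (Suc n) ` carrier (T (Suc (Suc n)))"
 using res unfolding free_resolution_def by blast

lemma d_d:
 assumes "x \<in>. T (Suc (Suc n))"
 shows "diff P n (diff P (Suc n) x) = 0[T n]"
proof -
 have "diff P (Suc n) x \<in> diff P (Suc n) ` carrier (T (Suc (Suc n)))" using assms by blast
 thus ?thesis using ker_d by blast
qed

lemma d_zero: "diff P n 0[T (Suc n)] = 0[T n]"
 by (rule semihom_zero[OF fm_group fm_group d_hom])

text \<open>The homogeneous part of degree \<open>j\<close> of any preimage is again a preimage, because the differential has degree 0.\<close>
lemma exact:
 assumes "x \<in> component (T (Suc n)) j" "diff P n x = 0[T n]"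
 shows "\<exists>y\<in>component (T (Suc (Suc n))) j. diff P (Suc n) y = x"
proof -
 have "x \<in> {x \<in> carrier (T (Suc n)). diff P n x = 0[T n]}"
  using fm_compD(1)[OF assms(1)] assms(2) by simp
 hence "x \<in> diff P (Suc n) ` carrier (T (Suc (Suc n)))" unfolding ker_d .
 then obtain y where y: "y \<in>. T (Suc (Suc n))" "diff P (Suc n) y = x" by blast
 have "pr (gens P (Suc n)) (j + 0) (diff P (Suc n) y) = diff P (Suc n) (pr (gens P (Suc (Suc n))) j y)"
  by (rule pr_hom[OF d_hom y(1)]) unfold_locales
 hence "diff P (Suc n) (pr (gens P (Suc (Suc n))) j y) = x" using y(2) pr_of_comp[OF assms(1), of j] by simp
 thus ?thesis using pr_comp[OF y(1), of j] by blast
qed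

lemma exact0:
 assumes "x \<in> component (T 0) j" "aug P x = 0[K]"
 shows "\<exists>y\<in>component (T (Suc 0)) j. diff P 0 y = x"
proof -
 have "x \<in> {x \<in> carrier (T 0). aug P x = 0[K]}" using fm_compD(1)[OF assms(1)] assms(2) by simp
 hence "x \<in> diff P 0 ` carrier (T (Suc 0))"
  using res unfolding free_resolution_def by simp
 then obtain y where y: "y \<in>. T (Suc 0)" "diff P 0 y = x" by blast
 have "pr (gens P 0) (j + 0) (diff P 0 y) = diff P 0 (pr (gens P (Suc 0)) j y)"
  by (rule pr_hom[OF d_hom y(1)]) unfold_locales
 hence "diff P 0 (pr (gens P (Suc 0)) j y) = x" using y(2) pr_of_comp[OF assms(1), of j] by simp
 thus ?thesis using pr_comp[OF y(1), of j] by blast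
qed

lemma aug_onto:
 assumes "k \<in> component (trivial_module K A) j"
 shows "\<exists>y\<in>component (T 0) j. aug P y = k"
proof (cases "j = 0")
 case False
 hence "k = aug P 0[T 0]"
  using assms semihom_zero[OF fm_group triv.N.abelian_group_axioms aug_hom] by simp
 thus ?thesis using T.ncomp_zero by blast
next
 case True
 hence "k \<in> aug P ` carrier (T 0)" using assms res unfolding free_resolution_def by simp
 then obtain y where y: "y \<in>. T 0" "aug P y = k" by blast
 define H where "H = {x \<in> carrier (T 0). aug P x = aug P (pr (gens P 0) 0 x)}"
 have pc: "pr (gens P 0) 0 x \<in>. T 0" if "x \<in>. T 0" for x
  using fm_compD(1)[OF pr_comp[OF that]] .
 have "aug P y = aug P (pr (gens P 0) 0 y)"
  using y(1)
 proof (induction rule: fm_hom_induct)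
  case (hom m x)
  have z: "aug P (\<lambda>i. 0[A]) = 0[K]"
   using semihom_zero[OF fm_group triv.N.abelian_group_axioms aug_hom] by simp
  show ?case
   using semihomD(4)[OF aug_hom hom] pr_of_comp[OF hom, of 0] z by (auto split: if_splits)
 next
  case (add x z)
  thus ?case
   using semihomD(2)[OF aug_hom add(1,2)] semihomD(2)[OF aug_hom pc[OF add(1)] pc[OF add(2)]]
    pr_add[OF add(1,2)] by simp
 qed
 thus ?thesis using y True pr_comp[OF y(1), of 0] by auto
qed

end

definition chain_map ::
  "('a => 'b) => (nat, 'k, 'a) graded_module => ('k, 'a) free_complex => nat => int =>
   (nat, 'k, 'b) graded_module => ('k, 'b) free_complex => (nat => (nat => 'a) => nat => 'b) => bool"
 where "chain_map \<phi> A P n s B Q F \<longleftrightarrow>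
  (\<forall>i. F i \<in> semihom \<phi> A (term_module A P (i + n)) (term_module B Q i) s) \<and>
  (\<forall>i. \<forall>x\<in>carrier (term_module A P (Suc i + n)). diff Q i (F (Suc i) x) = F i (diff P (i + n) x))"

lemma chain_mapD:
 assumes "chain_map \<phi> A P n s B Q F"
 shows "F i \<in> semihom \<phi> A (term_module A P (i + n)) (term_module B Q i) s"
  and "x \<in>. term_module A P (Suc (i + n)) ==> diff Q i (F (Suc i) x) = F i (diff P (i + n) x)"
 using assms unfolding chain_map_def by auto

definition is_coc where
 "is_coc K A P n m f \<longleftrightarrow> f \<in> semihom id A (term_module A P n) (trivial_module K A) (- m) \<and>
  (\<forall>x\<in>carrier (term_module A P (Suc n)). f (diff P n x) = 0[K])"

text \<open>No module precedes \<open>P 0\<close>, so that in cohomological degree 0 only the zero map is a coboundary.\<close>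
definition is_cob where
 "is_cob K A P n m f \<longleftrightarrow> (case n of 0 => \<forall>x\<in>carrier (term_module A P 0). f x = 0[K]
  | Suc l => \<exists>u\<in>semihom id A (term_module A P l) (trivial_module K A) (- m).
    \<forall>x\<in>carrier (term_module A P n). f x = u (diff P l x))"

locale res_pair = P: resolution K A P + Q: resolution K B Q
 for K :: "'k ring" and A :: "(nat, 'k, 'a) graded_module" and P
  and B :: "(nat, 'k, 'b) graded_module" and Q +
 fixes \<phi> :: "'a => 'b"
 assumes phi: "galg_hom K A B \<phi>"
begin

lemma phi_closed: "a \<in>. A ==> \<phi> a \<in>. B"
 using galg_homD(1)[OF phi] .

lemma triv_eq:
 fixes M :: "(int, 'a, 'm) graded_module"
 shows "semihom \<phi> A M (trivial_module K B) s = semihom id A M (trivial_module K A) s"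
 by (rule semihom_trivial_iff[OF _ _ phi]) unfold_locales

text \<open>The components are chosen one after the other: the map to be lifted takes cycles as values, and these are boundaries since \<open>Q\<close> is exact.\<close>
lemma lift_exists:
 assumes f: "f \<in> semihom id A (P.T n) (trivial_module K A) s"
  and cyc: "\<And>x. x \<in>. P.T (Suc n) ==> f (diff P n x) = 0[K]"
 shows "\<exists>F. chain_map \<phi> A P n s B Q F \<and> (\<forall>x\<in>carrier (P.T n). aug Q (F 0 x) = f x)"
proof -
 define R where "R i G \<longleftrightarrow> G \<in> semihom \<phi> A (P.T (i + n)) (Q.T i) s \<and>
  (\<forall>x\<in>carrier (P.T (Suc (i + n))). (case i of 0 => aug Q (G (diff P (i + n) x)) = 0[K]
   | Suc l => diff Q l (G (diff P (i + n) x)) = 0[Q.T l])) \<and>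
  (i = 0 --> (\<forall>x\<in>carrier (P.T n). aug Q (G x) = f x))" for i G
 have f': "f \<in> semihom \<phi> A (P.T n) (trivial_module K B) s" using f unfolding triv_eq .
 have "\<exists>g\<in>semihom \<phi> A (P.T n) (Q.T 0) s. \<forall>x\<in>carrier (P.T n). aug Q (g x) = f x"
  by (rule P.lift_step[OF Q.fm_graded_mod Q.tm_graded_mod phi Q.aug_hom f'])
   (use Q.aug_onto semihomD(4)[OF f'] in blast)
 then obtain g where g: "g \<in> semihom \<phi> A (P.T n) (Q.T 0) s" "\<And>x. x \<in>. P.T n ==> aug Q (g x) = f x"
  by blast
 have R0: "R 0 g" unfolding R_def using g cyc P.d_closed by auto
 have step: "\<exists>G'. R (Suc i) G' \<and> (\<forall>x\<in>carrier (P.T (Suc (i + n))). diff Q i (G' x) = G (diff P (i + n) x))"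
  if G: "R i G" for i G
 proof -
  have Gh: "G \<in> semihom \<phi> A (P.T (i + n)) (Q.T i) s" using G unfolding R_def by blast
  have Gd: "(\<lambda>x. G (diff P (i + n) x)) \<in> semihom \<phi> A (P.T (Suc (i + n))) (Q.T i) s"
   by (rule semihom_comp[OF P.d_hom Gh]) auto
  have "\<exists>g\<in>semihom \<phi> A (P.T (Suc (i + n))) (Q.T (Suc i)) s.
    \<forall>x\<in>carrier (P.T (Suc (i + n))). diff Q i (g x) = G (diff P (i + n) x)"
  proof (rule P.lift_step[OF Q.fm_graded_mod Q.fm_graded_mod phi Q.d_hom Gd])
   fix j x assume x: "x \<in> component (P.T (Suc (i + n))) j"
   have c: "G (diff P (i + n) x) \<in> component (Q.T i) (j + s)" using semihomD(4)[OF Gd x] .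
   show "\<exists>y\<in>component (Q.T (Suc i)) (j + s). diff Q i y = G (diff P (i + n) x)"
    using Q.exact0 Q.exact c G fm_compD(1)[OF x] unfolding R_def by (cases i) auto
  qed
  then obtain g where g: "g \<in> semihom \<phi> A (P.T (Suc (i + n))) (Q.T (Suc i)) s"
   "\<And>x. x \<in>. P.T (Suc (i + n)) ==> diff Q i (g x) = G (diff P (i + n) x)" by blast
  have "diff Q i (g (diff P (Suc (i + n)) x)) = 0[Q.T i]" if "x \<in>. P.T (Suc (Suc (i + n)))" for x
   using g(2)[OF P.d_closed[OF that]] P.d_d[OF that] semihom_zero[OF P.fm_group Q.fm_group Gh] by simp
  hence "R (Suc i) g" using g(1) unfolding R_def by simp
  thus ?thesis using g(2) by blast
 qed
 obtain F where F: "\<And>i. R i (F i)"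
  "\<And>i x. x \<in>. P.T (Suc (i + n)) ==> diff Q i (F (Suc i) x) = F i (diff P (i + n) x)"
  using dependent_nat_choice[of R "\<lambda>i G G'. \<forall>x\<in>carrier (P.T (Suc (i + n))). diff Q i (G' x) = G (diff P (i + n) x)"]
   R0 step by blast
 have "chain_map \<phi> A P n s B Q F"
  unfolding chain_map_def using F unfolding R_def by auto
 moreover have "\<forall>x\<in>carrier (P.T n). aug Q (F 0 x) = f x" using F(1)[of 0] unfolding R_def by simp
 ultimately show ?thesis by blast
qed

text \<open>Again stage by stage: what remains of \<open>D\<close> after subtracting the homotopy so far takes cycles as values.\<close>
lemma null_homotopy:
 assumes D: "chain_map \<phi> A P n s B Q D" and D0: "\<And>x. x \<in>. P.T n ==> aug Q (D 0 x) = 0[K]"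
 shows "\<exists>h. (\<forall>i. h i \<in> semihom \<phi> A (P.T (i + n)) (Q.T (Suc i)) s) \<and>
  (\<forall>x\<in>carrier (P.T n). D 0 x = diff Q 0 (h 0 x)) \<and>
  (\<forall>i. \<forall>x\<in>carrier (P.T (Suc (i + n))).
   D (Suc i) x = diff Q (Suc i) (h (Suc i) x) +[Q.T (Suc i)] h i (diff P (i + n) x))"
proof -
 note Dh = chain_mapD(1)[OF D] and Dd = chain_mapD(2)[OF D]
 define R where "R i G \<longleftrightarrow> G \<in> semihom \<phi> A (P.T (i + n)) (Q.T (Suc i)) s \<and>
  (\<forall>x\<in>carrier (P.T (Suc (i + n))). diff Q i (D (Suc i) x) = diff Q i (G (diff P (i + n) x))) \<and>
  (i = 0 --> (\<forall>x\<in>carrier (P.T n). diff Q 0 (G x) = D 0 x))" for i G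
 have D0h: "D 0 \<in> semihom \<phi> A (P.T n) (Q.T 0) s" using Dh[of 0] by simp
 have "\<exists>g\<in>semihom \<phi> A (P.T n) (Q.T (Suc 0)) s. \<forall>x\<in>carrier (P.T n). diff Q 0 (g x) = D 0 x"
  by (rule P.lift_step[OF Q.fm_graded_mod Q.fm_graded_mod phi Q.d_hom D0h])
   (use Q.exact0 semihomD(4)[OF D0h] D0 fm_compD(1) in metis)
 then obtain g where g: "g \<in> semihom \<phi> A (P.T n) (Q.T (Suc 0)) s" "\<And>x. x \<in>. P.T n ==> diff Q 0 (g x) = D 0 x"
  by blast
 have R0: "R 0 g" unfolding R_def using g Dd[of _ 0] P.d_closed by auto
 have step: "\<exists>G'. R (Suc i) G' \<and> (\<forall>x\<in>carrier (P.T (Suc (i + n))).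
   D (Suc i) x = diff Q (Suc i) (G' x) +[Q.T (Suc i)] G (diff P (i + n) x))"
  if G: "R i G" for i G
 proof -
  have Gh: "G \<in> semihom \<phi> A (P.T (i + n)) (Q.T (Suc i)) s" using G unfolding R_def by blast
  have Gd: "(\<lambda>x. G (diff P (i + n) x)) \<in> semihom \<phi> A (P.T (Suc (i + n))) (Q.T (Suc i)) s"
   by (rule semihom_comp[OF P.d_hom Gh]) auto
  have DSh: "D (Suc i) \<in> semihom \<phi> A (P.T (Suc (i + n))) (Q.T (Suc i)) s" using Dh[of "Suc i"] by simp
  let ?E = "\<lambda>x. D (Suc i) x +[Q.T (Suc i)] -[Q.T (Suc i)] G (diff P (i + n) x)"
  have E: "?E \<in> semihom \<phi> A (P.T (Suc (i + n))) (Q.T (Suc i)) s"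
   by (rule Q.T.semihom_add[OF DSh Q.T.semihom_uminus[OF Gd]]) (use phi_closed in auto)
  have dE: "diff Q i (?E x) = 0[Q.T i]" if x: "x \<in>. P.T (Suc (i + n))" for x
  proof -
   have c: "D (Suc i) x \<in>. Q.T (Suc i)" "G (diff P (i + n) x) \<in>. Q.T (Suc i)"
    using semihomD(1)[OF DSh x] semihomD(1)[OF Gd x] by auto
   have "diff Q i (?E x) = diff Q i (D (Suc i) x) +[Q.T i] -[Q.T i] diff Q i (G (diff P (i + n) x))"
    using c semihomD(2)[OF Q.d_hom c(1) Q.T.N.a_inv_closed[OF c(2)]]
     semihom_neg[OF Q.fm_group Q.fm_group Q.d_hom c(2)] by metis
   also have "diff Q i (D (Suc i) x) = diff Q i (G (diff P (i + n) x))"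
    using G x unfolding R_def by blast
   finally show ?thesis using Q.T.N.r_neg[OF semihomD(1)[OF Q.d_hom c(2)]] by metis
  qed
  have "\<exists>g\<in>semihom \<phi> A (P.T (Suc (i + n))) (Q.T (Suc (Suc i))) s.
    \<forall>x\<in>carrier (P.T (Suc (i + n))). diff Q (Suc i) (g x) = ?E x"
   by (rule P.lift_step[OF Q.fm_graded_mod Q.fm_graded_mod phi Q.d_hom E])
    (use Q.exact[OF semihomD(4)[OF E]] dE fm_compD(1) in blast)
  then obtain g where g: "g \<in> semihom \<phi> A (P.T (Suc (i + n))) (Q.T (Suc (Suc i))) s"
   "\<And>x. x \<in>. P.T (Suc (i + n)) ==> diff Q (Suc i) (g x) = ?E x" by blast
  have e: "D (Suc i) x = diff Q (Suc i) (g x) +[Q.T (Suc i)] G (diff P (i + n) x)"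
   if x: "x \<in>. P.T (Suc (i + n))" for x
  proof -
   have c: "D (Suc i) x \<in>. Q.T (Suc i)" "G (diff P (i + n) x) \<in>. Q.T (Suc i)"
    using semihomD(1)[OF DSh x] semihomD(1)[OF Gd x] by auto
   show ?thesis unfolding g(2)[OF x] using c
    by (metis Q.T.N.a_assoc Q.T.N.a_inv_closed Q.T.N.l_neg Q.T.N.r_zero)
  qed
  have "diff Q (Suc i) (D (Suc (Suc i)) x) = diff Q (Suc i) (g (diff P (Suc (i + n)) x))"
   if x: "x \<in>. P.T (Suc (Suc (i + n)))" for x
  proof -
   let ?y = "diff P (Suc (i + n)) x"
   have "diff Q (Suc i) (D (Suc (Suc i)) x) = D (Suc i) ?y" using Dd[of x "Suc i"] x by simp
   also have "\<dots> = diff Q (Suc i) (g ?y) +[Q.T (Suc i)] G (diff P (i + n) ?y)"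
    by (rule e[OF P.d_closed[OF x]])
   also have "G (diff P (i + n) ?y) = 0[Q.T (Suc i)]"
    unfolding P.d_d[OF x] by (rule semihom_zero[OF P.fm_group Q.fm_group Gh])
   finally show ?thesis
    using Q.T.N.r_zero[OF Q.d_closed[OF semihomD(1)[OF g(1) P.d_closed[OF x]]]] by metis
  qed
  hence "R (Suc i) g" using g(1) unfolding R_def by simp
  thus ?thesis using e by blast
 qed
 obtain h where h: "\<And>i. R i (h i)" "\<And>i x. x \<in>. P.T (Suc (i + n)) ==>
   D (Suc i) x = diff Q (Suc i) (h (Suc i) x) +[Q.T (Suc i)] h i (diff P (i + n) x)"
  using dependent_nat_choice[of R "\<lambda>i G G'. \<forall>x\<in>carrier (P.T (Suc (i + n))).
   D (Suc i) x = diff Q (Suc i) (G' x) +[Q.T (Suc i)] G (diff P (i + n) x)"]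
   R0 step by blast
 have "\<forall>x\<in>carrier (P.T n). D 0 x = diff Q 0 (h 0 x)" using h(1)[of 0] unfolding R_def by simp
 thus ?thesis using h unfolding R_def by blast
qed

text \<open>A cocycle kills the part of \<open>D\<close> that is a boundary; the other part of the homotopy formula is a coboundary.\<close>
lemma null_cob0:
 assumes D: "chain_map \<phi> A P n (- m) B Q D" and D0: "\<And>x. x \<in>. P.T n ==> aug Q (D 0 x) = 0[K]"
  and g: "is_coc K B Q p q g"
 shows "is_cob K A P (p + n) (q + m) (\<lambda>x. g (D p x))"
proof -
 obtain h where h: "\<And>i. h i \<in> semihom \<phi> A (P.T (i + n)) (Q.T (Suc i)) (- m)"
  "\<And>x. x \<in>. P.T n ==> D 0 x = diff Q 0 (h 0 x)"
  "\<And>i x. x \<in>. P.T (Suc (i + n)) ==>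
   D (Suc i) x = diff Q (Suc i) (h (Suc i) x) +[Q.T (Suc i)] h i (diff P (i + n) x)"
  using null_homotopy[OF D D0] by blast
 have gh: "g \<in> semihom id B (Q.T p) (trivial_module K B) (- q)"
  and gd: "\<And>x. x \<in>. Q.T (Suc p) ==> g (diff Q p x) = 0[K]"
  using g unfolding is_coc_def by auto
 show ?thesis
 proof (cases p)
  case 0
  have z: "g (D p x) = 0[K]" if "x \<in>. P.T n" for x
   using 0 h(2)[OF that] gd[of "h 0 x"] semihomD(1)[OF h(1)[of 0], of x] that by simp
  show ?thesis
  proof (cases n)
   case 0
   thus ?thesis using z \<open>p = 0\<close> by (simp add: is_cob_def)
  next
   case (Suc l)
   thus ?thesis using z \<open>p = 0\<close>
    by (auto simp: is_cob_def intro!: bexI[of _ "\<lambda>x. 0[K]"]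
      P.triv.semihom_const_zero[where d = "- (q + m)" and \<phi> = id and A' = A, simplified])
  qed
 next
  case (Suc l)
  have u: "(\<lambda>x. g (h l x)) \<in> semihom id A (P.T (l + n)) (trivial_module K A) (- (q + m))"
  proof -
   have "(\<lambda>x. g (h l x)) \<in> semihom \<phi> A (P.T (l + n)) (trivial_module K B) (- (q + m))"
    by (rule semihom_comp[OF h(1) gh[unfolded Suc]]) (use phi_closed in auto)
   thus ?thesis unfolding triv_eq .
  qed
  have "g (D p x) = g (h l (diff P (l + n) x))" if x: "x \<in>. P.T (Suc (l + n))" for x
  proof -
   have c: "h (Suc l) x \<in>. Q.T (Suc (Suc l))" "h l (diff P (l + n) x) \<in>. Q.T (Suc l)"
    using semihomD(1)[OF h(1)[of "Suc l"]] semihomD(1)[OF h(1)[of l]] x P.d_closed[OF x] by auto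
   have "g (D p x) = g (diff Q (Suc l) (h (Suc l) x)) +[K] g (h l (diff P (l + n) x))"
    using h(3)[OF x] semihomD(2)[OF gh, of "diff Q (Suc l) (h (Suc l) x)" "h l (diff P (l + n) x)"]
     Q.d_closed[OF c(1)] c Suc by simp
   thus ?thesis using gd[of "h (Suc l) x"] c Suc semihomD(1)[OF gh, of "h l (diff P (l + n) x)"] by simp
  qed
  thus ?thesis unfolding is_cob_def using u Suc by auto
 qed
qed

end

section \<open>Cocycles generated in cohomological degrees one and two\<close>

text \<open>The cocycles whose classes lie in the subalgebra generated by cohomological degrees 1 and 2. The rule \<open>cob\<close> makes the predicate depend only on the class, and \<open>prod\<close> allows every lift \<open>L\<close> of \<open>f\<close>.\<close>
inductive gen :: "'k ring => (nat, 'k, 'a) graded_module => ('k, 'a) free_complex => nat => int =>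
  ((nat => 'a) => 'k) => bool"
 for K A P where
  unit: "gen K A P 0 0 (aug P)"
 | cob: "is_coc K A P n m f ==> is_cob K A P n m f ==> gen K A P n m f"
 | low: "is_coc K A P n m f ==> n = 1 \<or> n = 2 ==> gen K A P n m f"
 | add: "gen K A P n m f ==> gen K A P n m g ==> gen K A P n m (\<lambda>x. f x +[K] g x)"
 | scal: "k \<in>. K ==> gen K A P n m f ==> gen K A P n m (\<lambda>x. k *[K] f x)"
 | prod: "gen K A P p q g ==> gen K A P n m f ==> chain_map id A P n (- m) A P L ==>
   (\<forall>x\<in>carrier (term_module A P n). aug P (L 0 x) = f x) ==>
   gen K A P (p + n) (q + m) (\<lambda>x. g (L p x))"
 | eq: "gen K A P n m f ==> (\<forall>x\<in>carrier (term_module A P n). f x = f' x) ==> gen K A P n m f'"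

lemma is_cocD:
 assumes "is_coc K A P n m f"
 shows "f \<in> semihom id A (term_module A P n) (trivial_module K A) (- m)"
  and "x \<in>. term_module A P (Suc n) ==> f (diff P n x) = 0[K]"
 using assms unfolding is_coc_def by auto

context resolution
begin

lemma coc_cong:
 assumes "is_coc K A P n m f" "\<forall>x\<in>carrier (T n). f x = f' x"
 shows "is_coc K A P n m f'"
 unfolding is_coc_def
proof
 show "f' \<in> semihom id A (T n) (trivial_module K A) (- m)"
  by (rule semihom_cong[OF is_cocD(1)[OF assms(1)] _ fm_group])
   (use assms(2) T.ncomp_carrier T.smult_closed in blast)+
 show "\<forall>x\<in>carrier (T (Suc n)). f' (diff P n x) = 0[K]"
  using assms(2) d_closed is_cocD(2)[OF assms(1)] by metis
qed

lemma coc_add: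
 assumes "is_coc K A P n m f" "is_coc K A P n m g"
 shows "is_coc K A P n m (\<lambda>x. f x +[K] g x)"
 unfolding is_coc_def
 using triv.semihom_add[OF is_cocD(1)[OF assms(1)] is_cocD(1)[OF assms(2)]]
  is_cocD(2)[OF assms(1)] is_cocD(2)[OF assms(2)] by simp

lemma semihom_scal:
 assumes "f \<in> semihom id A (T n) (trivial_module K A) d" "k \<in>. K"
 shows "(\<lambda>x. k *[K] f x) \<in> semihom id A (T n) (trivial_module K A) d"
proof (rule semihomI)
 fix a x assume *: "a \<in>. A" "x \<in>. T n"
 have "f x \<in>. K" "eps a \<in>. K" using semihomD(1)[OF assms(1) *(2)] * by auto
 thus "k *[K] f (a *:[T n] x) = id a *:[trivial_module K A] (k *[K] f x)"
  using semihomD(3)[OF assms(1) *] assms(2) by (simp add: K.m_lcomm flip: eps_def)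
next
 fix x y assume *: "x \<in>. T n" "y \<in>. T n"
 thus "k *[K] f (x +[T n] y) = (k *[K] f x) +[trivial_module K A] (k *[K] f y)"
  using semihomD(1)[OF assms(1) *(1)] semihomD(1)[OF assms(1) *(2)] semihomD(2)[OF assms(1) *] assms(2)
  by (simp add: K.r_distr)
next
 fix x assume "x \<in>. T n"
 thus "k *[K] f x \<in>. trivial_module K A"
  using semihomD(1)[OF assms(1)] assms(2) by simp
next
 fix j x assume "x \<in> component (T n) j"
 thus "k *[K] f x \<in> component (trivial_module K A) (j + d)"
  using semihomD(4)[OF assms(1)] assms(2) by (fastforce split: if_splits)
qed

lemma coc_scal:
 assumes "is_coc K A P n m f" "k \<in>. K"
 shows "is_coc K A P n m (\<lambda>x. k *[K] f x)"
 unfolding is_coc_def using semihom_scal[OF is_cocD(1)[OF assms(1)] assms(2)] is_cocD(2)[OF assms(1)] assms(2)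
 by simp

lemma coc_aug: "is_coc K A P 0 0 (aug P)"
 unfolding is_coc_def using aug_hom aug_d by simp

lemma coc_minus:
 assumes "is_coc K A P n m f" "is_coc K A P n m g"
 shows "is_coc K A P n m (\<lambda>x. f x -[K] g x)"
proof (rule coc_cong[OF coc_add[OF assms(1) coc_scal[OF assms(2), of "-[K] 1[K]"]]])
 show "\<forall>x\<in>carrier (T n). f x +[K] -[K] 1[K] *[K] g x = f x -[K] g x"
  using semihomD(1)[OF is_cocD(1)[OF assms(2)]] by (simp add: K.minus_eq K.l_minus)
qed simp

end

lemma (in res_pair) coc_pullback:
 assumes g: "is_coc K B Q p q g" and F: "chain_map \<phi> A P n (- m) B Q L"
 shows "is_coc K A P (p + n) (q + m) (\<lambda>x. g (L p x))"
proof -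
 have "(\<lambda>x. g (L p x)) \<in> semihom \<phi> A (P.T (p + n)) (trivial_module K B) (- (q + m))"
  by (rule semihom_comp[OF chain_mapD(1)[OF F] is_cocD(1)[OF g]]) (use phi_closed in auto)
 moreover have "g (L p (diff P (p + n) x)) = 0[K]" if "x \<in>. P.T (Suc (p + n))" for x
  using chain_mapD(2)[OF F that] is_cocD(2)[OF g] semihomD(1)[OF chain_mapD(1)[OF F, of "Suc p"]] that
  by (metis add_Suc)
 ultimately show ?thesis unfolding is_coc_def triv_eq by blast
qed

lemma res_pair_id:
 assumes "resolution K A P"
 shows "res_pair K A P A P id"
 using assms by (simp add: res_pair_def res_pair_axioms_def galg_hom_id)

lemma (in resolution) gen_coc: "gen K A P n m f ==> is_coc K A P n m f"
proof (induction rule: gen.induct)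
 case (prod p q g n m f L)
 interpret res_pair K A P A P id by (rule res_pair_id) unfold_locales
 show ?case using coc_pullback[OF prod.IH(1) prod.hyps(3)] .
qed (use coc_aug coc_add coc_scal coc_cong in blast)+

lemma chain_map_comp:
 assumes F: "chain_map \<phi> A P n s B Q L" and G: "chain_map \<psi> B Q m t C R M"
  and \<phi>: "\<And>a. a \<in>. A ==> \<phi> a \<in>. B" and eq: "\<And>a. a \<in>. A ==> \<psi> (\<phi> a) = \<chi> a"
  and u: "u = s + t" and l: "l = m + n"
 shows "chain_map \<chi> A P l u C R (\<lambda>i x. M i (L (i + m) x))"
 unfolding chain_map_def
proof (intro conjI allI ballI)
 fix i
 show "(\<lambda>x. M i (L (i + m) x)) \<in> semihom \<chi> A (term_module A P (i + l)) (term_module C R i) u"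
  using semihom_comp[OF chain_mapD(1)[OF F, of "i + m"] chain_mapD(1)[OF G, of i] \<phi> eq u]
  by (simp add: l add.assoc)
 fix x assume "x \<in>. term_module A P (Suc i + l)"
 hence x: "x \<in>. term_module A P (Suc ((i + m) + n))" by (simp add: l add.assoc)
 have "L (Suc (i + m)) x \<in>. term_module B Q (Suc (i + m))"
  using semihomD(1)[OF chain_mapD(1)[OF F, of "Suc (i + m)"]] x by simp
 hence "diff R i (M (Suc i) (L (Suc (i + m)) x)) = M i (diff Q (i + m) (L (Suc (i + m)) x))"
  by (rule chain_mapD(2)[OF G])
 thus "diff R i (M (Suc i) (L (Suc i + m) x)) = M i (L (i + m) (diff P (i + l) x))"
  using chain_mapD(2)[OF F x] by (simp add: l add.assoc)
qed

lemma (in res_pair) chain_map_diff: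
 assumes F: "chain_map \<phi> A P n s B Q L" and G: "chain_map \<phi> A P n s B Q M"
 shows "chain_map \<phi> A P n s B Q (\<lambda>i x. L i x +[Q.T i] -[Q.T i] M i x)"
 unfolding chain_map_def
proof (intro conjI allI ballI)
 fix i
 show "(\<lambda>x. L i x +[Q.T i] -[Q.T i] M i x) \<in> semihom \<phi> A (P.T (i + n)) (Q.T i) s"
  by (rule Q.T.semihom_add[OF chain_mapD(1)[OF F] Q.T.semihom_uminus[OF chain_mapD(1)[OF G]]])
   (use phi_closed in auto)
 fix x assume "x \<in>. P.T (Suc i + n)"
 hence x: "x \<in>. P.T (Suc (i + n))" by simp
 have c: "L (Suc i) x \<in>. Q.T (Suc i)" "M (Suc i) x \<in>. Q.T (Suc i)"
  using semihomD(1)[OF chain_mapD(1)[OF F, of "Suc i"]] semihomD(1)[OF chain_mapD(1)[OF G, of "Suc i"]] x by simp_all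
 show "diff Q i (L (Suc i) x +[Q.T (Suc i)] -[Q.T (Suc i)] M (Suc i) x) =
   L i (diff P (i + n) x) +[Q.T i] -[Q.T i] M i (diff P (i + n) x)"
  unfolding semihomD(2)[OF Q.d_hom c(1) Q.T.N.a_inv_closed[OF c(2)]]
   semihom_neg[OF Q.fm_group Q.fm_group Q.d_hom c(2)]
   chain_mapD(2)[OF F x] chain_mapD(2)[OF G x] ..
qed

text \<open>The difference of the two lifts is null-homotopic.\<close>
lemma (in res_pair) lift_unique:
 assumes F: "chain_map \<phi> A P n (- m) B Q L" and G: "chain_map \<phi> A P n (- m) B Q M"
  and eq: "\<And>x. x \<in>. P.T n ==> aug Q (L 0 x) = aug Q (M 0 x)"
  and g: "is_coc K B Q p q g"
 shows "is_cob K A P (p + n) (q + m) (\<lambda>x. g (L p x) -[K] g (M p x))"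
proof -
 have LM: "L i x \<in>. Q.T i" "M i x \<in>. Q.T i" if "x \<in>. P.T (i + n)" for i x
  using semihomD(1)[OF chain_mapD(1)[OF F, of i] that] semihomD(1)[OF chain_mapD(1)[OF G, of i] that] by auto
 have diff: "h (L i x +[Q.T i] -[Q.T i] M i x) = h (L i x) -[K] h (M i x)"
  if h: "h \<in> semihom id B (Q.T i) (trivial_module K B) d" and x: "x \<in>. P.T (i + n)" for h i x d
  using semihomD(2)[OF h LM(1)[OF x] Q.T.N.a_inv_closed[OF LM(2)[OF x]]]
   semihom_neg[OF Q.fm_group Q.triv.N.abelian_group_axioms h LM(2)[OF x]]
   Q.tm_uminus semihomD(1)[OF h LM(2)[OF x]] by (simp add: P.K.minus_eq)
 have "is_cob K A P (p + n) (q + m) (\<lambda>x. g (L p x +[Q.T p] -[Q.T p] M p x))"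
 proof (rule null_cob0[OF chain_map_diff[OF F G] _ g])
  fix x assume x: "x \<in>. P.T n"
  have "aug Q (M 0 x) \<in>. K" using semihomD(1)[OF Q.aug_hom LM(2)[of x 0]] x by simp
  thus "aug Q (L 0 x +[Q.T 0] -[Q.T 0] M 0 x) = 0[K]"
   using diff[OF Q.aug_hom, of x] x eq by (simp add: P.K.minus_eq P.K.r_neg)
 qed
 moreover have "g (L p x +[Q.T p] -[Q.T p] M p x) = g (L p x) -[K] g (M p x)" if "x \<in>. P.T (p + n)" for x
  by (rule diff[OF is_cocD(1)[OF g] that])
 ultimately show ?thesis unfolding is_cob_def by (auto split: nat.splits)
qed

lemma (in resolution) gen_cob_shift:
 assumes g: "gen K A P n m g" and f: "is_coc K A P n m f"
  and c: "is_cob K A P n m (\<lambda>x. f x -[K] g x)"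
 shows "gen K A P n m f"
proof -
 have "gen K A P n m (\<lambda>x. f x -[K] g x)"
  by (rule gen.cob[OF coc_minus[OF f gen_coc[OF g]] c])
 from gen.add[OF this g] show ?thesis
 proof (rule gen.eq, intro ballI)
  fix x assume "x \<in>. T n"
  hence "f x \<in>. K" "g x \<in>. K"
   using semihomD(1)[OF is_cocD(1)[OF f]] semihomD(1)[OF is_cocD(1)[OF gen_coc[OF g]]] by auto
  thus "f x -[K] g x +[K] g x = f x"
   by (simp add: K.minus_eq K.a_assoc K.l_neg)
 qed
qed

text \<open>Pulling back is multiplicative on classes: for a lift \<open>L\<close> of \<open>f\<close> over \<open>B\<close> and a lift of the pulled back cocycle over \<open>A\<close>, following the first by and preceding the second with \<open>\<theta>\<close> gives two lifts of one cocycle.\<close>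
lemma (in res_pair) gen_pullback:
 assumes \<theta>: "chain_map \<phi> A P 0 0 B Q \<theta>" "\<And>x. x \<in>. P.T 0 ==> aug Q (\<theta> 0 x) = aug P x"
  and f: "gen K B Q n m f"
 shows "gen K A P n m (\<lambda>x. f (\<theta> n x))"
 using f
proof (induction rule: gen.induct)
 case unit
 show ?case by (rule gen.eq[OF gen.unit]) (use \<theta>(2) in simp)
next
 case (cob n m f)
 have c: "is_coc K A P n m (\<lambda>x. f (\<theta> n x))"
  using coc_pullback[OF cob(1), of 0 0 \<theta>] \<theta>(1) by simp
 have "is_cob K A P n m (\<lambda>x. f (\<theta> n x))"
 proof (cases n)
  case 0
  thus ?thesis
   using cob(2) semihomD(1)[OF chain_mapD(1)[OF \<theta>(1), of 0]] unfolding is_cob_def by simp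
 next
  case (Suc l)
  then obtain u where u: "u \<in> semihom id B (Q.T l) (trivial_module K B) (- m)"
   "\<And>x. x \<in>. Q.T n ==> f x = u (diff Q l x)"
   using cob(2) unfolding is_cob_def by auto
  have "(\<lambda>x. u (\<theta> l x)) \<in> semihom \<phi> A (P.T l) (trivial_module K B) (- m)"
   using semihom_comp[OF chain_mapD(1)[OF \<theta>(1), of l] u(1), where \<psi> = \<phi> and s = "- m"] phi_closed by simp
  moreover have "f (\<theta> n x) = u (\<theta> l (diff P l x))" if "x \<in>. P.T n" for x
   using u(2)[of "\<theta> n x"] semihomD(1)[OF chain_mapD(1)[OF \<theta>(1), of n], of x]
    chain_mapD(2)[OF \<theta>(1), of x l] that Suc by simp
  ultimately show ?thesis using Suc unfolding is_cob_def triv_eq by auto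
 qed
 with c show ?case by (rule gen.cob)
next
 case (low n m f)
 have "is_coc K A P n m (\<lambda>x. f (\<theta> n x))"
  using coc_pullback[OF low(1), of 0 0 \<theta>] \<theta>(1) by simp
 thus ?case using low(2) by (rule gen.low)
next
 case (add n m f g)
 show ?case by (rule gen.add[OF add.IH])
next
 case (scal k n m f)
 show ?case by (rule gen.scal[OF scal.hyps(1) scal.IH])
next
 case (eq n m f f')
 show ?case
  by (rule gen.eq[OF eq.IH]) (use eq.hyps(2) semihomD(1)[OF chain_mapD(1)[OF \<theta>(1), of n]] in simp)
next
 case (prod p q g n m f L)
 interpret Pid: res_pair K A P A P id by (rule res_pair_id) unfold_locales
 have fc: "is_coc K B Q n m f" "is_coc K B Q p q g" using prod Q.gen_coc by blast+
 have f\<theta>: "is_coc K A P n m (\<lambda>x. f (\<theta> n x))" using P.gen_coc[OF prod.IH(2)] .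
 obtain L' where L': "chain_map id A P n (- m) A P L'" "\<And>x. x \<in>. P.T n ==> aug P (L' 0 x) = f (\<theta> n x)"
  using Pid.lift_exists[OF is_cocD(1)[OF f\<theta>] is_cocD(2)[OF f\<theta>]] by blast
 have g': "gen K A P (p + n) (q + m) (\<lambda>x. g (\<theta> p (L' p x)))"
  by (rule gen.prod[OF prod.IH L'(1)]) (use L'(2) in simp)
 have c1: "chain_map \<phi> A P n (- m) B Q (\<lambda>i x. L i (\<theta> (i + n) x))"
  by (rule chain_map_comp[OF \<theta>(1) prod.hyps(3)]) (use phi_closed in auto)
 have c2: "chain_map \<phi> A P n (- m) B Q (\<lambda>i x. \<theta> i (L' i x))"
  using chain_map_comp[OF L'(1) \<theta>(1), where \<chi> = \<phi> and u = "- m" and l = n] by simp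
 have "is_cob K A P (p + n) (q + m) (\<lambda>x. g (L p (\<theta> (p + n) x)) -[K] g (\<theta> p (L' p x)))"
 proof (rule lift_unique[OF c1 c2 _ fc(2)])
  fix x assume x: "x \<in>. P.T n"
  have "\<theta> n x \<in>. Q.T n" using semihomD(1)[OF chain_mapD(1)[OF \<theta>(1), of n], of x] x by simp
  moreover have "L' 0 x \<in>. P.T 0" using semihomD(1)[OF chain_mapD(1)[OF L'(1), of 0], of x] x by simp
  ultimately show "aug Q (L 0 (\<theta> (0 + n) x)) = aug Q (\<theta> 0 (L' 0 x))"
   using prod.hyps(4) \<theta>(2) L'(2)[OF x] by simp
 qed
 moreover have "is_coc K A P (p + n) (q + m) (\<lambda>x. g (L p (\<theta> (p + n) x)))"
  using coc_pullback[OF fc(2) c1] .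
 ultimately show ?case using P.gen_cob_shift[OF g'] by blast
qed

text \<open>A retract \<open>A \<rightarrow> C \<rightarrow> A\<close> makes \<open>E(A)\<close> a quotient of \<open>E(C)\<close>. With \<open>C = A\<close> the lemma says that the choice of the resolution does not matter.\<close>
lemma gen_retract:
 assumes P: "resolution K A P" and R: "resolution K C R"
  and \<iota>: "galg_hom K A C \<iota>" and \<pi>: "galg_hom K C A \<pi>" and eq: "\<And>a. a \<in>. A ==> \<pi> (\<iota> a) = a"
  and all: "\<And>n m f. is_coc K C R n m f ==> gen K C R n m f"
  and f: "is_coc K A P n m f"
 shows "gen K A P n m f"
proof -
 interpret I: res_pair K A P C R \<iota> using P R \<iota> by (simp add: res_pair_def res_pair_axioms_def)
 interpret J: res_pair K C R A P \<pi> using P R \<pi> by (simp add: res_pair_def res_pair_axioms_def)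
 interpret D: res_pair K A P A P id by (rule res_pair_id[OF P])
 obtain \<theta> where \<theta>: "chain_map \<iota> A P 0 0 C R \<theta>" "\<And>x. x \<in>. I.P.T 0 ==> aug R (\<theta> 0 x) = aug P x"
  using I.lift_exists[OF I.P.aug_hom] I.P.aug_d by auto
 obtain \<psi> where \<psi>: "chain_map \<pi> C R 0 0 A P \<psi>" "\<And>x. x \<in>. I.Q.T 0 ==> aug P (\<psi> 0 x) = aug R x"
  using J.lift_exists[OF I.Q.aug_hom] I.Q.aug_d by auto
 have "is_coc K C R n m (\<lambda>x. f (\<psi> n x))"
  using J.coc_pullback[OF f, of 0 0 \<psi>] \<psi>(1) by simp
 hence g: "gen K A P n m (\<lambda>x. f (\<psi> n (\<theta> n x)))"
  by (intro I.gen_pullback[OF \<theta>] all)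
 have idc: "chain_map id A P 0 0 A P (\<lambda>i x. x)"
  unfolding chain_map_def by (auto intro!: semihomI)
 have c: "chain_map id A P 0 0 A P (\<lambda>i x. \<psi> i (\<theta> i x))"
  using chain_map_comp[OF \<theta>(1) \<psi>(1), where \<chi> = id and u = 0 and l = 0] eq I.phi_closed by simp
 have "is_cob K A P (n + 0) (m + 0) (\<lambda>x. f x -[K] f (\<psi> n (\<theta> n x)))"
 proof (rule D.lift_unique[OF _ _ _ f])
  show "chain_map id A P 0 (- 0) A P (\<lambda>i x. x)" "chain_map id A P 0 (- 0) A P (\<lambda>i x. \<psi> i (\<theta> i x))"
   using idc c by simp_all
  fix x assume x: "x \<in>. I.P.T 0"
  hence "\<theta> 0 x \<in>. I.Q.T 0" using semihomD(1)[OF chain_mapD(1)[OF \<theta>(1), of 0], of x] by simp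
  thus "aug P x = aug P (\<psi> 0 (\<theta> 0 x))" using \<theta>(2)[OF x] \<psi>(2) by simp
 qed
 thus ?thesis using I.P.gen_cob_shift[OF g f] by simp
qed

section \<open>The condition K2 in terms of cocycles\<close>

lemma (in abelian_group) minus_of_sum:
 "h \<in>. G ==> g \<in>. G ==> h \<oplus> g = f ==> f \<ominus> g = h"
 by (auto simp: minus_eq a_assoc r_neg)

lemma quotient_module_simps [simp]:
 "0[quotient_module M N] = N"
 "x +[quotient_module M N] y = x <+>\<^bsub>M\<^esub> y"
 "k *:[quotient_module M N] X = (\<Union>x\<in>X. N +>\<^bsub>M\<^esub> (k *:[M] x))"
 by (simp_all add: quotient_module_def)

locale quotient = module K M + S: submodule S K M
 for K :: "'k ring" and M :: "('k, 'm, 'z) module_scheme" and S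
begin

abbreviation cls where "cls x \<equiv> S +>\<^bsub>M\<^esub> x"
abbreviation "Q \<equiv> quotient_module M S"

sublocale AS: abelian_subgroup S M
 by (rule abelian_subgroupI3) (simp_all add: additive_subgroup_def S.subgroup_axioms abelian_group_axioms)

lemma carrier_Q: "carrier Q = cls ` carrier M"
 by (auto simp: quotient_module_def A_RCOSETS_def' image_def)

lemma cls_add: "x \<in>. M ==> y \<in>. M ==> cls x +[Q] cls y = cls (x +[M] y)"
 using AS.a_rcos_sum by simp

lemma cls_zero: "cls 0[M] = 0[Q]"
 using AS.a_subset by simp

lemma cls_eq_iff:
 assumes "x \<in>. M" "y \<in>. M"
 shows "cls x = cls y \<longleftrightarrow> x -[M] y \<in> S"
proof -
 have "x \<in> cls y \<longleftrightarrow> x -[M] y \<in> S"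
  using AS.a_rcos_module[OF assms(2,1)] by (simp add: M.minus_eq)
 moreover have "cls x = cls y \<longleftrightarrow> x \<in> cls y"
  using AS.a_repr_independence'[OF _ assms(2), of x] AS.a_rcos_self[OF assms(1)] by auto
 ultimately show ?thesis by simp
qed

lemma cls_self: "x \<in>. M ==> x \<in> cls x"
 by (rule AS.a_rcos_self)

lemma cls_mem: "x \<in>. M ==> y \<in> cls x ==> y \<in>. M \<and> cls y = cls x"
 using AS.a_repr_independence' AS.a_elemrcos_carrier by metis

lemma cls_smult:
 assumes "k \<in>. K" "x \<in>. M"
 shows "k *:[Q] cls x = cls (k *:[M] x)"
proof -
 have "cls (k *:[M] y) = cls (k *:[M] x)" if "y \<in> cls x" for y
 proof -
  have y: "y \<in>. M" "y -[M] x \<in> S" using cls_mem[OF assms(2) that] cls_eq_iff assms by auto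
  hence "k *:[M] (y -[M] x) \<in> S" using assms(1) by simp
  moreover have "k *:[M] (y -[M] x) = k *:[M] y -[M] k *:[M] x"
   using y(1) assms by (simp add: M.minus_eq smult_r_distr smult_r_minus)
  ultimately show ?thesis using cls_eq_iff assms y(1) by simp
 qed
 hence "(\<Union>y\<in>cls x. cls (k *:[M] y)) = (\<Union>y\<in>cls x. cls (k *:[M] x))"
  by (rule SUP_cong[OF refl])
 also have "\<dots> = cls (k *:[M] x)" using cls_self[OF assms(2)] by blast
 finally show ?thesis by simp
qed

lemma quotient_is_module: "module K Q"
proof (rule moduleI)
 show "cring K" by unfold_locales
 show "abelian_group Q"
 proof (rule abelian_groupI)
  show "X +[Q] Y \<in>. Q" if "X \<in>. Q" "Y \<in>. Q" for X Y
   using that unfolding carrier_Q using cls_add by (auto simp del: quotient_module_simps)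
  show "0[Q] \<in>. Q" using cls_zero carrier_Q by (metis M.zero_closed imageI)
  show "X +[Q] Y +[Q] Z = X +[Q] (Y +[Q] Z)"
   if "X \<in>. Q" "Y \<in>. Q" "Z \<in>. Q" for X Y Z
   using that unfolding carrier_Q by (auto simp: cls_add M.a_assoc simp del: quotient_module_simps)
  show "X +[Q] Y = Y +[Q] X" if "X \<in>. Q" "Y \<in>. Q" for X Y
   using that unfolding carrier_Q by (auto simp: cls_add M.a_comm simp del: quotient_module_simps)
  show "0[Q] +[Q] X = X" if "X \<in>. Q" for X
   using that unfolding carrier_Q cls_zero[symmetric] by (auto simp: cls_add simp del: quotient_module_simps)
  show "\<exists>Y\<in>carrier Q. Y +[Q] X = 0[Q]" if "X \<in>. Q" for X
  proof -
   from that obtain x where x: "x \<in>. M" "X = cls x" unfolding carrier_Q by blast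
   hence "cls (-[M] x) +[Q] X = 0[Q]"
    unfolding cls_zero[symmetric] by (simp add: cls_add M.l_neg del: quotient_module_simps)
   thus ?thesis using x unfolding carrier_Q by blast
  qed
 qed
qed (use carrier_Q in "auto simp: cls_smult cls_add smult_l_distr smult_r_distr smult_assoc1 simp del: quotient_module_simps")

end

context resolution
begin

text \<open>Cocycles and coboundaries in the extensional form in which \<open>Ext\<close> is defined.\<close>
definition Z where "Z n m = {f. is_coc K A P n m f \<and> f \<in> extensional (carrier (T n))}"
definition Bd where "Bd n m = {f \<in> Z n m. is_cob K A P n m f}"

lemma cob_cong: "is_cob K A P n m f ==> \<forall>x\<in>carrier (T n). f x = f' x ==> is_cob K A P n m f'"
 unfolding is_cob_def by (cases n) auto

lemma cob_add:
 assumes "is_cob K A P n m f" "is_cob K A P n m g"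
 shows "is_cob K A P n m (\<lambda>x. f x +[K] g x)"
proof (cases n)
 case 0
 thus ?thesis using assms by (simp add: is_cob_def)
next
 case (Suc l)
 then obtain u v where "u \<in> semihom id A (T l) (trivial_module K A) (- m)" "\<forall>x\<in>carrier (T n). f x = u (diff P l x)"
  "v \<in> semihom id A (T l) (trivial_module K A) (- m)" "\<forall>x\<in>carrier (T n). g x = v (diff P l x)"
  using assms unfolding is_cob_def by auto
 thus ?thesis
  using triv.semihom_add[of u id A "T l" "- m" v] Suc unfolding is_cob_def by auto
qed

lemma cob_scal:
 assumes "is_cob K A P n m f" "k \<in>. K"
 shows "is_cob K A P n m (\<lambda>x. k *[K] f x)"
proof (cases n)
 case 0
 thus ?thesis using assms by (simp add: is_cob_def)
next
 case (Suc l)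
 then obtain u where "u \<in> semihom id A (T l) (trivial_module K A) (- m)" "\<forall>x\<in>carrier (T n). f x = u (diff P l x)"
  using assms unfolding is_cob_def by auto
 thus ?thesis using semihom_scal[of u l "- m" k] assms(2) Suc unfolding is_cob_def by auto
qed

lemma coc_zero: "is_coc K A P n m (\<lambda>x. 0[K])"
 unfolding is_coc_def using triv.semihom_const_zero[of A id "T n" "- m"] by simp

lemma cob_zero: "is_cob K A P n m (\<lambda>x. 0[K])"
 using coc_zero[of _ m] unfolding is_cob_def is_coc_def by (cases n) auto

lemma coc_val: "is_coc K A P n m f ==> x \<in>. T n ==> f x \<in>. K"
 using semihomD(1)[OF is_cocD(1)] by fastforce

lemma restrict_Z: "is_coc K A P n m f ==> restrict f (carrier (T n)) \<in> Z n m"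
 unfolding Z_def using coc_cong[of n m f] by simp

lemma Z_coc: "f \<in> Z n m ==> is_coc K A P n m f" by (simp add: Z_def)

lemma Z_restrict: "f \<in> Z n m ==> restrict f (carrier (T n)) = f"
 by (simp add: Z_def extensional_restrict)

lemma cocycles_eq: "cocycles K A P n m = Z n m"
 by (auto simp: cocycles_def cochains_def Z_def is_coc_def graded_hom_iff)

lemma coboundaries_eq: "coboundaries K A P n m = Bd n m"
proof (cases n)
 case 0
 have "f = (\<lambda>x\<in>carrier (T 0). 0[K])" if "f \<in> Bd 0 m" for f
  using that by (intro extensionalityI[of _ "carrier (T 0)"]) (auto simp: Bd_def Z_def is_cob_def)
 moreover have "(\<lambda>x\<in>carrier (T 0). 0[K]) \<in> Bd 0 m"
  using restrict_Z[OF coc_zero] cob_cong[OF cob_zero] by (simp add: Bd_def)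
 ultimately have "Bd 0 m = {\<lambda>x\<in>carrier (T 0). 0[K]}" by blast
 thus ?thesis using 0 by (simp add: coboundaries_def cochains_def)
next
 case (Suc l)
 have "compose (carrier (T n)) g (diff P l) \<in> Bd n m" if "g \<in> graded_hom A (T l) (trivial_module K A) (- m)" for g
 proof -
  have g: "g \<in> semihom id A (T l) (trivial_module K A) (- m)" using that by (simp add: graded_hom_iff)
  have gd: "(\<lambda>x. g (diff P l x)) \<in> semihom id A (T n) (trivial_module K A) (- m)"
   using semihom_comp[OF d_hom g, of id "- m"] Suc by simp
  have "g (diff P l (diff P n x)) = 0[K]" if "x \<in>. T (Suc n)" for x
   using d_d[of x l] that semihom_zero[OF fm_group triv.N.abelian_group_axioms g] Suc by simp
  hence "is_coc K A P n m (\<lambda>x. g (diff P l x))" using gd unfolding is_coc_def by simp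
  hence "restrict (\<lambda>x. g (diff P l x)) (carrier (T n)) \<in> Z n m" by (rule restrict_Z)
  moreover have "is_cob K A P n m (restrict (\<lambda>x. g (diff P l x)) (carrier (T n)))"
   using g Suc unfolding is_cob_def by auto
  ultimately show ?thesis by (simp add: Bd_def compose_def)
 qed
 moreover have "f \<in> (\<lambda>g. compose (carrier (T n)) g (diff P l)) ` graded_hom A (T l) (trivial_module K A) (- m)"
  if "f \<in> Bd n m" for f
 proof -
  have "\<exists>u\<in>semihom id A (T l) (trivial_module K A) (- m). \<forall>x\<in>carrier (T n). f x = u (diff P l x)"
  proof -
   have "is_cob K A P (Suc l) m f" using that Suc by (simp add: Bd_def)
   thus ?thesis using Suc unfolding is_cob_def nat.case by blast
  qed
  then obtain u where u: "u \<in> semihom id A (T l) (trivial_module K A) (- m)" "\<forall>x\<in>carrier (T n). f x = u (diff P l x)"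
   by blast
  have "f = compose (carrier (T n)) (restrict u (carrier (T l))) (diff P l)"
   using u(2) that d_closed[of _ l] Suc
   by (intro extensionalityI[of _ "carrier (T n)"]) (auto simp: Bd_def Z_def compose_def)
  thus ?thesis using T.semihom_restrict[OF u(1)] by blast
 qed
 ultimately have "Bd n m = (\<lambda>g. compose (carrier (T n)) g (diff P l)) ` graded_hom A (T l) (trivial_module K A) (- m)"
  by blast
 thus ?thesis using Suc by (simp add: coboundaries_def cochains_def)
qed

abbreviation "CZ n m \<equiv> (cochains K A P n m)\<lparr>carrier := cocycles K A P n m\<rparr>"

lemma CZ_simps:
 "carrier (CZ n m) = Z n m" "0[CZ n m] = (\<lambda>x\<in>carrier (T n). 0[K])"
 "f +[CZ n m] g = (\<lambda>x\<in>carrier (T n). f x +[K] g x)"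
 "k *:[CZ n m] f = (\<lambda>x\<in>carrier (T n). k *[K] f x)"
 by (simp_all add: cocycles_eq) (simp_all add: cochains_def)

lemma CZ_module: "module K (CZ n m)"
proof (rule moduleI)
 have v: "f x \<in>. K" if "f \<in> Z n m" "x \<in>. T n" for f x
  using coc_val Z_coc that by blast
 show "cring K" by unfold_locales
 show "abelian_group (CZ n m)"
 proof (rule abelian_groupI)
  fix f g assume f: "f \<in>. CZ n m" and g: "g \<in>. CZ n m"
  thus "f +[CZ n m] g \<in>. CZ n m"
   unfolding CZ_simps using restrict_Z coc_add Z_coc by blast
  show "f +[CZ n m] g = g +[CZ n m] f"
   using f g v unfolding CZ_simps by (intro restrict_ext) (simp add: K.a_comm)
  fix h assume "h \<in>. CZ n m"
  thus "f +[CZ n m] g +[CZ n m] h = f +[CZ n m] (g +[CZ n m] h)"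
   using f g v unfolding CZ_simps by (intro restrict_ext) (simp add: K.a_assoc)
 next
  show "0[CZ n m] \<in>. CZ n m" unfolding CZ_simps by (rule restrict_Z[OF coc_zero])
  fix f assume f: "f \<in>. CZ n m"
  hence f': "f \<in> Z n m" by (simp only: CZ_simps)
  show "0[CZ n m] +[CZ n m] f = f"
   unfolding CZ_simps using f' v
   by (intro extensionalityI[of _ "carrier (T n)"]) (auto simp: Z_def)
  have "restrict (\<lambda>x. -[K] 1[K] *[K] f x) (carrier (T n)) \<in>. CZ n m"
   unfolding CZ_simps using restrict_Z coc_scal[OF Z_coc[OF f']] by simp
  moreover have "restrict (\<lambda>x. -[K] 1[K] *[K] f x) (carrier (T n)) +[CZ n m] f = 0[CZ n m]"
   unfolding CZ_simps using f' v by (intro restrict_ext) (simp add: K.l_minus K.l_neg)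
  ultimately show "\<exists>g\<in>carrier (CZ n m). g +[CZ n m] f = 0[CZ n m]" by blast
 qed
 fix a f assume a: "a \<in>. K" and "f \<in>. CZ n m"
 hence f: "f \<in> Z n m" by (simp only: CZ_simps)
 show "a *:[CZ n m] f \<in>. CZ n m"
  unfolding CZ_simps using restrict_Z coc_scal[OF Z_coc[OF f] a] by blast
 fix b assume b: "b \<in>. K"
 show "(a +[K] b) *:[CZ n m] f = a *:[CZ n m] f +[CZ n m] b *:[CZ n m] f"
  "(a *[K] b) *:[CZ n m] f = a *:[CZ n m] (b *:[CZ n m] f)"
  unfolding CZ_simps using a b v[OF f] by (auto intro!: restrict_ext simp: K.l_distr K.m_assoc)
next
 fix a f g assume "a \<in>. K" "f \<in>. CZ n m" "g \<in>. CZ n m"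
 hence "a \<in>. K" "f \<in> Z n m" "g \<in> Z n m" by (simp_all only: CZ_simps)
 thus "a *:[CZ n m] (f +[CZ n m] g) = a *:[CZ n m] f +[CZ n m] a *:[CZ n m] g"
  unfolding CZ_simps using coc_val[OF Z_coc] by (auto intro!: restrict_ext simp: K.r_distr)
next
 fix f assume "f \<in>. CZ n m"
 hence f: "f \<in> Z n m" by (simp only: CZ_simps)
 show "1[K] *:[CZ n m] f = f"
  unfolding CZ_simps using f coc_val[OF Z_coc[OF f]]
  by (intro extensionalityI[of _ "carrier (T n)"]) (auto simp: Z_def)
qed

lemma Bd_submodule: "submodule (Bd n m) K (CZ n m)"
proof (rule module.submoduleI[OF CZ_module], unfold CZ_simps)
 show "Bd n m \<subseteq> Z n m" by (auto simp: Bd_def)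
 show "(\<lambda>x\<in>carrier (T n). 0[K]) \<in> Bd n m"
  using restrict_Z[OF coc_zero] cob_cong[OF cob_zero] by (simp add: Bd_def)
 fix f assume f: "f \<in> Bd n m"
 hence f': "is_coc K A P n m f" "is_cob K A P n m f" by (auto simp: Bd_def Z_def)
 show *: "(\<lambda>x\<in>carrier (T n). k *[K] f x) \<in> Bd n m" if "k \<in>. K" for k
  unfolding Bd_def using restrict_Z[OF coc_scal[OF f'(1) that]] cob_cong[OF cob_scal[OF f'(2) that]] by simp
 show "-[CZ n m] f \<in> Bd n m"
 proof -
  interpret C: module K "CZ n m" by (rule CZ_module)
  have fc: "f \<in>. CZ n m" unfolding CZ_simps using f by (simp add: Bd_def)
  have "-[CZ n m] f = (-[K] 1[K]) *:[CZ n m] f"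
   using C.smult_l_minus[OF K.one_closed fc] C.smult_one[OF fc] by metis
  also have "\<dots> \<in> Bd n m" unfolding CZ_simps by (rule *) simp
  finally show ?thesis .
 qed
 show "(\<lambda>x\<in>carrier (T n). f x +[K] g x) \<in> Bd n m" if "g \<in> Bd n m" for g
 proof -
  have g': "is_coc K A P n m g" "is_cob K A P n m g" using that by (auto simp: Bd_def Z_def)
  show ?thesis
   unfolding Bd_def using restrict_Z[OF coc_add[OF f'(1) g'(1)]] cob_cong[OF cob_add[OF f'(2) g'(2)]] by simp
 qed
qed

sublocale quo: quotient K "CZ n m" "Bd n m" for n m
 unfolding quotient_def using CZ_module Bd_submodule by blast

abbreviation "Et n m \<equiv> Ext K A P n m"

lemma Ext_eq: "Et n m = quotient_module (CZ n m) (Bd n m)"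
 by (simp add: Ext_def coboundaries_eq)

sublocale Et: module K "Et n m" for n m
 unfolding Ext_eq by (rule quo.quotient_is_module)

definition cl where "cl n m f = coboundaries K A P n m +>\<^bsub>cochains K A P n m\<^esub> restrict f (carrier (T n))"

lemma cl_eq: "cl n m f = Bd n m +>\<^bsub>CZ n m\<^esub> restrict f (carrier (T n))"
 by (simp add: cl_def coboundaries_eq a_r_coset_def r_coset_def)

lemma CZ_minus:
 assumes "f \<in> Z n m" "g \<in> Z n m"
 shows "f -[CZ n m] g = (\<lambda>x\<in>carrier (T n). f x -[K] g x)"
proof -
 have v: "f x \<in>. K" "g x \<in>. K" if "x \<in>. T n" for x
  using coc_val Z_coc that assms by blast+
 have c: "f \<in>. CZ n m" "g \<in>. CZ n m" "(\<lambda>x\<in>carrier (T n). f x -[K] g x) \<in>. CZ n m"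
  unfolding CZ_simps using assms restrict_Z[OF coc_minus[OF Z_coc[OF assms(1)] Z_coc[OF assms(2)]]] by auto
 have "(\<lambda>x\<in>carrier (T n). f x -[K] g x) +[CZ n m] g = f"
  unfolding CZ_simps using v assms
  by (intro extensionalityI[of _ "carrier (T n)"]) (auto simp: Z_def K.minus_eq K.a_assoc K.l_neg)
 from quo.M.minus_of_sum[OF c(3) c(2) this] show ?thesis .
qed

lemma cl_eq_iff:
 assumes "is_coc K A P n m f" "is_coc K A P n m g"
 shows "cl n m f = cl n m g \<longleftrightarrow> is_cob K A P n m (\<lambda>x. f x -[K] g x)"
proof -
 have "cl n m f = cl n m g \<longleftrightarrow> restrict f (carrier (T n)) -[CZ n m] restrict g (carrier (T n)) \<in> Bd n m"
  unfolding cl_eq by (rule quo.cls_eq_iff) (simp_all only: CZ_simps restrict_Z[OF assms(1)] restrict_Z[OF assms(2)])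
 also have "\<dots> \<longleftrightarrow> is_cob K A P n m (\<lambda>x. f x -[K] g x)"
  unfolding CZ_minus[OF restrict_Z[OF assms(1)] restrict_Z[OF assms(2)]] Bd_def
  using coc_cong[OF coc_minus[OF assms]] by (auto simp: Z_def elim: cob_cong)
 finally show ?thesis .
qed

lemma carrier_Et: "carrier (Et n m) = cl n m ` {f. is_coc K A P n m f}"
proof
 show "carrier (Et n m) \<subseteq> cl n m ` {f. is_coc K A P n m f}"
  unfolding Ext_eq quo.carrier_Q CZ_simps
  using Z_restrict Z_coc cl_eq by (metis (no_types, lifting) image_eqI image_subsetI mem_Collect_eq)
 show "cl n m ` {f. is_coc K A P n m f} \<subseteq> carrier (Et n m)"
  unfolding Ext_eq quo.carrier_Q CZ_simps cl_eq using restrict_Z by blast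
qed

lemma cl_mem:
 assumes "is_coc K A P n m f" "g \<in> cl n m f"
 shows "g \<in> Z n m" "is_cob K A P n m (\<lambda>x. g x -[K] f x)" "cl n m g = cl n m f"
proof -
 have *: "g \<in>. CZ n m \<and> Bd n m +>\<^bsub>CZ n m\<^esub> g = Bd n m +>\<^bsub>CZ n m\<^esub> restrict f (carrier (T n))"
  by (rule quo.cls_mem) (use assms in "simp_all only: CZ_simps restrict_Z cl_eq")
 thus g: "g \<in> Z n m" by (simp only: CZ_simps)
 show "cl n m g = cl n m f" using * unfolding cl_eq Z_restrict[OF g] by simp
 thus "is_cob K A P n m (\<lambda>x. g x -[K] f x)" using cl_eq_iff[OF Z_coc[OF g] assms(1)] by simp
qed

lemma cl_self: "is_coc K A P n m f ==> restrict f (carrier (T n)) \<in> cl n m f"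
 unfolding cl_eq by (rule quo.cls_self) (simp only: CZ_simps restrict_Z)

lemma cl_cong: "\<forall>x\<in>carrier (T n). f x = g x ==> cl n m f = cl n m g"
 unfolding cl_def by (metis restrict_ext)

lemma cl_add:
 assumes "is_coc K A P n m f" "is_coc K A P n m g"
 shows "cl n m f +[Et n m] cl n m g = cl n m (\<lambda>x. f x +[K] g x)"
proof -
 have "cl n m f +[Et n m] cl n m g =
   Bd n m +>\<^bsub>CZ n m\<^esub> (restrict f (carrier (T n)) +[CZ n m] restrict g (carrier (T n)))"
  unfolding Ext_eq cl_eq
  by (rule quo.cls_add) (simp_all only: CZ_simps restrict_Z[OF assms(1)] restrict_Z[OF assms(2)])
 also have "restrict f (carrier (T n)) +[CZ n m] restrict g (carrier (T n)) = restrict (\<lambda>x. f x +[K] g x) (carrier (T n))"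
  unfolding CZ_simps by (rule restrict_ext) simp
 finally show ?thesis unfolding cl_eq .
qed

lemma cl_scal:
 assumes "is_coc K A P n m f" "k \<in>. K"
 shows "k *:[Et n m] cl n m f = cl n m (\<lambda>x. k *[K] f x)"
proof -
 have "k *:[Et n m] cl n m f = Bd n m +>\<^bsub>CZ n m\<^esub> (k *:[CZ n m] restrict f (carrier (T n)))"
  unfolding Ext_eq cl_eq
  by (rule quo.cls_smult[OF assms(2)]) (simp only: CZ_simps restrict_Z[OF assms(1)])
 also have "k *:[CZ n m] restrict f (carrier (T n)) = restrict (\<lambda>x. k *[K] f x) (carrier (T n))"
  unfolding CZ_simps by (rule restrict_ext) simp
 finally show ?thesis unfolding cl_eq .
qed

lemma cl_zero: "is_coc K A P n m f ==> is_cob K A P n m f ==> cl n m f = 0[Et n m]"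
proof -
 assume f: "is_coc K A P n m f" "is_cob K A P n m f"
 have "cl n m f = cl n m (\<lambda>x. 0[K])"
  using cl_eq_iff[OF f(1) coc_zero] cob_cong[OF f(2)] coc_val[OF f(1)] by (simp add: K.minus_eq)
 also have "\<dots> = Bd n m +>\<^bsub>CZ n m\<^esub> 0[CZ n m]" unfolding cl_eq CZ_simps ..
 finally show ?thesis unfolding quo.cls_zero Ext_eq .
qed

text \<open>Independence of the representatives. Changing \<open>g\<close> by \<open>u \<circ> d\<close> changes the product by the coboundary of \<open>u \<circ> L\<close>. If \<open>f\<close> changes by \<open>u \<circ> d\<close> and \<open>U\<close> lifts \<open>u\<close> to \<open>P 0\<close>, then adding \<open>U \<circ> d\<close> to the component of \<open>L\<close> in degree 0 gives a lift of the new cocycle, and lifts are unique up to homotopy.\<close>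
lemma cup_cob:
 assumes g: "is_coc K A P p q g" "is_coc K A P p q g'" "is_cob K A P p q (\<lambda>x. g' x -[K] g x)"
  and f: "is_coc K A P n m f" "is_coc K A P n m f'" "is_cob K A P n m (\<lambda>x. f' x -[K] f x)"
  and L: "chain_map id A P n (- m) A P L" "\<forall>x\<in>carrier (T n). aug P (L 0 x) = f x"
  and L': "chain_map id A P n (- m) A P L'" "\<forall>x\<in>carrier (T n). aug P (L' 0 x) = f' x"
 shows "is_cob K A P (p + n) (q + m) (\<lambda>x. g' (L' p x) -[K] g (L p x))"
proof -
 interpret res_pair K A P A P id by (rule res_pair_id) unfold_locales
 have Lc: "L p x \<in>. T p" "L' p x \<in>. T p" if "x \<in>. T (p + n)" for p x
  using semihomD(1)[OF chain_mapD(1)[OF L(1)] that] semihomD(1)[OF chain_mapD(1)[OF L'(1)] that] by auto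
 have 1: "is_cob K A P (p + n) (q + m) (\<lambda>x. g' (L' p x) -[K] g (L' p x))"
 proof (cases p)
  case 0
  have z: "\<forall>x\<in>carrier (T (p + n)). 0[K] = g' (L' p x) -[K] g (L' p x)"
   using g(3) Lc(2)[of _ p] 0 unfolding is_cob_def by simp
  show ?thesis by (rule cob_cong[OF cob_zero z])
 next
  case (Suc l)
  then obtain u where u: "u \<in> semihom id A (T l) (trivial_module K A) (- q)"
   "\<forall>x\<in>carrier (T p). g' x -[K] g x = u (diff P l x)"
   using g(3) unfolding is_cob_def by auto
  have "(\<lambda>x. u (L' l x)) \<in> semihom id A (T (l + n)) (trivial_module K A) (- (q + m))"
   by (rule semihom_comp[OF chain_mapD(1)[OF L'(1)] u(1)]) auto
  moreover have "g' (L' p x) -[K] g (L' p x) = u (L' l (diff P (l + n) x))" if "x \<in>. T (p + n)" for x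
   using u(2) Lc(2)[OF that] chain_mapD(2)[OF L'(1), of x l] that Suc by simp
  ultimately show ?thesis using Suc unfolding is_cob_def by auto
 qed
 have 2: "is_cob K A P (p + n) (q + m) (\<lambda>x. g (L' p x) -[K] g (L p x))"
 proof (cases n)
  case 0
  have "f' x = f x" if "x \<in>. T n" for x
  proof -
   have "f' x -[K] f x = 0[K]" using f(3) that 0 unfolding is_cob_def by simp
   thus ?thesis using coc_val[OF f(1) that] coc_val[OF f(2) that] K.r_right_minus_eq by blast
  qed
  thus ?thesis
   by (intro lift_unique[OF L'(1) L(1) _ g(1)]) (use L(2) L'(2) in simp)
 next
  case (Suc l)
  then obtain u where u: "u \<in> semihom id A (T l) (trivial_module K A) (- m)"
   "\<forall>x\<in>carrier (T n). f' x -[K] f x = u (diff P l x)"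
   using f(3) unfolding is_cob_def by auto
  have "\<exists>U\<in>semihom id A (T l) (T 0) (- m). \<forall>x\<in>carrier (T l). aug P (U x) = u x"
   by (rule lift_step[OF fm_graded_mod tm_graded_mod galg_hom_id aug_hom u(1)])
    (use aug_onto semihomD(4)[OF u(1)] in blast)
  then obtain U where U: "U \<in> semihom id A (T l) (T 0) (- m)" "\<And>x. x \<in>. T l ==> aug P (U x) = u x"
   by blast
  have Ud: "(\<lambda>x. U (diff P l x)) \<in> semihom id A (T n) (T 0) (- m)"
   using semihom_comp[OF d_hom U(1), of id "- m"] Suc by simp
  \<comment> \<open>A lift of \<open>f'\<close> that differs from \<open>L\<close> only in degree 0.\<close>
  define M where "M i = (if i = 0 then (\<lambda>x. L 0 x +[T 0] U (diff P l x)) else L i)" for i :: nat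
  have M: "chain_map id A P n (- m) A P M"
   unfolding chain_map_def
  proof (intro conjI allI ballI)
   fix i
   have "(\<lambda>x. L 0 x +[T 0] U (diff P l x)) \<in> semihom id A (T (0 + n)) (T 0) (- m)"
    by (rule T.semihom_add[OF chain_mapD(1)[OF L(1)]]) (use Ud in auto)
   thus "M i \<in> semihom id A (T (i + n)) (T i) (- m)"
    using chain_mapD(1)[OF L(1), of i] by (simp add: M_def)
   fix x assume x: "x \<in>. T (Suc i + n)"
   show "diff P i (M (Suc i) x) = M i (diff P (i + n) x)"
   proof (cases "i = 0")
    case True
    have "U (diff P l (diff P n x)) = 0[T 0]"
     using d_d[of x l] x Suc True semihom_zero[OF fm_group fm_group U(1)] by simp
    moreover have "L 0 (diff P n x) \<in>. T 0"
     using Lc(1)[of "diff P n x" 0] d_closed[of x n] x True by simp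
    ultimately have "M 0 (diff P n x) = L 0 (diff P n x)"
     using T.N.r_zero unfolding M_def by simp
    thus ?thesis using chain_mapD(2)[OF L(1), of x 0] x True by (simp add: M_def)
   next
    case False
    thus ?thesis using chain_mapD(2)[OF L(1), of x i] x by (simp add: M_def)
   qed
  qed
  have augM: "aug P (M 0 x) = f' x" if x: "x \<in>. T n" for x
  proof -
   have dx: "diff P l x \<in>. T l" using d_closed[of x l] x Suc by simp
   have "aug P (M 0 x) = aug P (L 0 x) +[K] aug P (U (diff P l x))"
    using semihomD(2)[OF aug_hom Lc(1)[of x 0] semihomD(1)[OF U(1) dx]] x by (simp add: M_def)
   also have "\<dots> = f x +[K] (f' x -[K] f x)" using L(2) U(2)[OF dx] u(2) x by simp
   also have "\<dots> = f' x"
    using coc_val[OF f(1) x] coc_val[OF f(2) x] by algebra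
   finally show ?thesis .
  qed
  have a: "is_cob K A P (p + n) (q + m) (\<lambda>x. g (L' p x) -[K] g (M p x))"
   by (rule lift_unique[OF L'(1) M _ g(1)]) (use L'(2) augM in simp)
  have b: "is_cob K A P (p + n) (q + m) (\<lambda>x. g (M p x) -[K] g (L p x))"
  proof (cases p)
   case 0
   have "(\<lambda>x. g (U x)) \<in> semihom id A (T l) (trivial_module K A) (- (q + m))"
    using semihom_comp[OF U(1) is_cocD(1)[OF g(1)[unfolded 0]], of id "- (q + m)"] by simp
   moreover have "g (M p x) -[K] g (L p x) = g (U (diff P l x))" if x: "x \<in>. T (p + n)" for x
   proof -
    have dx: "diff P l x \<in>. T l" using d_closed[of x l] x Suc 0 by simp
    have gs: "g \<in> semihom id A (T 0) (trivial_module K A) (- q)" using is_cocD(1)[OF g(1)[unfolded 0]] .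
    have c: "L 0 x \<in>. T 0" "U (diff P l x) \<in>. T 0"
     using Lc(1)[of x 0] x 0 semihomD(1)[OF U(1) dx] by auto
    have "g (M p x) = g (L 0 x) +[K] g (U (diff P l x))"
     using semihomD(2)[OF gs c] 0 by (simp add: M_def)
    moreover have "g (L 0 x) \<in>. K" "g (U (diff P l x)) \<in>. K"
     using semihomD(1)[OF gs c(1)] semihomD(1)[OF gs c(2)] by auto
    ultimately show ?thesis using 0 by (simp add: K.minus_eq K.a_ac K.r_neg1 K.r_neg2)
   qed
   ultimately show ?thesis using Suc 0 unfolding is_cob_def by auto
  next
   case (Suc k)
   have z: "\<forall>x\<in>carrier (T (p + n)). 0[K] = g (M p x) -[K] g (L p x)"
    using Suc coc_val[OF g(1) Lc(1)] by (simp add: M_def K.minus_eq K.r_neg)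
   show ?thesis by (rule cob_cong[OF cob_zero z])
  qed
  show ?thesis
  proof (rule cob_cong[OF cob_add[OF a b]], intro ballI)
   fix x assume x: "x \<in>. T (p + n)"
   have "M p x \<in>. T p" using semihomD(1)[OF chain_mapD(1)[OF M] x] .
   hence "g (L' p x) \<in>. K" "g (M p x) \<in>. K" "g (L p x) \<in>. K"
    using coc_val[OF g(1)] Lc[OF x] by auto
   thus "g (L' p x) -[K] g (M p x) +[K] (g (M p x) -[K] g (L p x)) = g (L' p x) -[K] g (L p x)"
    by algebra
  qed
 qed
 show ?thesis
 proof (rule cob_cong[OF cob_add[OF 1 2]], intro ballI)
  fix x assume x: "x \<in>. T (p + n)"
  have "g' (L' p x) \<in>. K" "g (L' p x) \<in>. K" "g (L p x) \<in>. K"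
   using coc_val[OF g(1)] coc_val[OF g(2)] Lc[OF x] by auto
  thus "g' (L' p x) -[K] g (L' p x) +[K] (g (L' p x) -[K] g (L p x)) = g' (L' p x) -[K] g (L p x)"
   by algebra
 qed
qed

lemma is_lift_iff:
 "is_lift K A P n m f L \<longleftrightarrow> chain_map id A P n (- m) A P L \<and>
  (\<forall>x\<in>carrier (T n). aug P (L 0 x) = f x) \<and> (\<forall>i. L i \<in> extensional (carrier (T (i + n))))"
 unfolding is_lift_def chain_map_def graded_hom_iff by auto

text \<open>By \<open>cup_cob\<close> all choices in the definition of the product give one class; the lift only has to be restricted to the carriers.\<close>
lemma Yoneda_prod_eq:
 assumes g: "is_coc K A P p q g" and f: "is_coc K A P n m f"
  and L: "chain_map id A P n (- m) A P L" "\<forall>x\<in>carrier (T n). aug P (L 0 x) = f x"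
 shows "Yoneda_prod K A P p q (cl p q g) n m (cl n m f) = cl (p + n) (q + m) (\<lambda>x. g (L p x))"
proof -
 interpret res_pair K A P A P id by (rule res_pair_id) unfold_locales
 define g0 where "g0 = restrict g (carrier (T p))"
 define f0 where "f0 = restrict f (carrier (T n))"
 define L0 where "L0 i = restrict (L i) (carrier (T (i + n)))" for i
 have L0c: "chain_map id A P n (- m) A P L0"
  unfolding chain_map_def
 proof (intro conjI allI ballI)
  fix i
  show "L0 i \<in> semihom id A (T (i + n)) (T i) (- m)"
   using T.semihom_restrict[OF chain_mapD(1)[OF L(1), of i]] unfolding L0_def graded_hom_iff by blast
  fix x assume "x \<in>. T (Suc i + n)"
  thus "diff P i (L0 (Suc i) x) = L0 i (diff P (i + n) x)"
   using chain_mapD(2)[OF L(1), of x i] d_closed[of x "i + n"] by (simp add: L0_def)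
 qed
 have L0: "is_lift K A P n m f0 L0"
  unfolding is_lift_iff using L0c L(2) by (auto simp: L0_def f0_def)
 have comp_eq: "coboundaries K A P (p + n) (q + m) +>\<^bsub>cochains K A P (p + n) (q + m)\<^esub>
   compose (carrier (T (p + n))) g' (L' p) = cl (p + n) (q + m) (\<lambda>x. g' (L' p x))" for g' L'
  unfolding cl_def compose_def ..
 have wd: "cl (p + n) (q + m) (\<lambda>x. g' (L' p x)) = cl (p + n) (q + m) (\<lambda>x. g (L p x))"
  if "g' \<in> cl p q g" "f' \<in> cl n m f" "is_lift K A P n m f' L'" for g' f' L'
 proof -
  note g' = cl_mem[OF g that(1)] and f' = cl_mem[OF f that(2)]
  have L': "chain_map id A P n (- m) A P L'" "\<forall>x\<in>carrier (T n). aug P (L' 0 x) = f' x"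
   using that(3) unfolding is_lift_iff by auto
  show ?thesis
   using cl_eq_iff[OF coc_pullback[OF Z_coc[OF g'(1)] L'(1)] coc_pullback[OF g L(1)]]
    cup_cob[OF g Z_coc[OF g'(1)] g'(2) f Z_coc[OF f'(1)] f'(2) L L'] by blast
 qed
 show ?thesis
  unfolding Yoneda_prod_def
 proof (rule the_equality)
  have "cl (p + n) (q + m) (\<lambda>x. g0 (L0 p x)) = cl (p + n) (q + m) (\<lambda>x. g (L p x))"
   by (rule wd[OF _ _ L0]) (use cl_self[OF g] cl_self[OF f] in "simp_all only: g0_def f0_def")
  thus "\<exists>g'\<in>cl p q g. \<exists>f'\<in>cl n m f. \<exists>F. is_lift K A P n m f' F \<and> cl (p + n) (q + m) (\<lambda>x. g (L p x)) =
    coboundaries K A P (p + n) (q + m) +>\<^bsub>cochains K A P (p + n) (q + m)\<^esub> compose (carrier (T (p + n))) g' (F p)"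
   using cl_self[OF g] cl_self[OF f] L0 unfolding comp_eq g0_def[symmetric] f0_def[symmetric] by metis
 next
  fix X assume "\<exists>g'\<in>cl p q g. \<exists>f'\<in>cl n m f. \<exists>F. is_lift K A P n m f' F \<and> X =
    coboundaries K A P (p + n) (q + m) +>\<^bsub>cochains K A P (p + n) (q + m)\<^esub> compose (carrier (T (p + n))) g' (F p)"
  then obtain g' f' F where "g' \<in> cl p q g" "f' \<in> cl n m f" "is_lift K A P n m f' F"
   "X = cl (p + n) (q + m) (\<lambda>x. g' (F p x))" unfolding comp_eq by blast
  thus "X = cl (p + n) (q + m) (\<lambda>x. g (L p x))" using wd by simp
 qed
qed

end

section \<open>The subalgebra generated by the low degrees\<close>

context resolution
begin

abbreviation "YA \<equiv> Yoneda_algebra K A P"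
abbreviation "YP \<equiv> Yoneda_prod K A P"

lemma YA_simps:
 "carrier YA = {x. (\<forall>n m. x n m \<in>. Et n m) \<and> finite {(n, m). x n m ~= 0[Et n m]}}"
 "x *[YA] y = (\<lambda>n m. finsum (Et n m) (\<lambda>(p, q). YP p q (x p q) (n - p) (m - q) (y (n - p) (m - q)))
   {(p, q). p \<le> n \<and> x p q ~= 0[Et p q]})"
 "1[YA] = (\<lambda>n m. if n = 0 \<and> m = 0
   then coboundaries K A P 0 0 +>\<^bsub>cochains K A P 0 0\<^esub> aug P else 0[Et n m])"
 "0[YA] = (\<lambda>n m. 0[Et n m])"
 "x +[YA] y = (\<lambda>n m. x n m +[Et n m] y n m)"
 "k *:[YA] x = (\<lambda>n m. k *:[Et n m] x n m)"
 by (simp_all add: Yoneda_algebra_def Let_def)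

lemma Et_cases:
 assumes "X \<in>. Et n m"
 obtains f where "is_coc K A P n m f" "X = cl n m f"
 using assms unfolding carrier_Et by blast

lemma cl_carrier: "is_coc K A P n m f ==> cl n m f \<in>. Et n m"
 unfolding carrier_Et by blast

lemma zero_cl: "0[Et n m] = cl n m (\<lambda>x. 0[K])"
 using cl_zero[OF coc_zero cob_zero] by simp

lemma coc_lift:
 assumes "is_coc K A P n m f"
 obtains L where "chain_map id A P n (- m) A P L" "\<forall>x\<in>carrier (T n). aug P (L 0 x) = f x"
proof -
 interpret res_pair K A P A P id by (rule res_pair_id) unfold_locales
 show ?thesis using lift_exists[OF is_cocD(1)[OF assms] is_cocD(2)[OF assms]] that by blast
qed

lemma YP_closed:
 assumes "X \<in>. Et p q" "Y \<in>. Et n m"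
 shows "YP p q X n m Y \<in>. Et (p + n) (q + m)"
proof -
 interpret res_pair K A P A P id by (rule res_pair_id) unfold_locales
 from assms obtain g f where g: "is_coc K A P p q g" "X = cl p q g" and f: "is_coc K A P n m f" "Y = cl n m f"
  by (metis Et_cases)
 obtain L where L: "chain_map id A P n (- m) A P L" "\<forall>x\<in>carrier (T n). aug P (L 0 x) = f x"
  by (rule coc_lift[OF f(1)])
 show ?thesis unfolding g(2) f(2) Yoneda_prod_eq[OF g(1) f(1) L]
  by (rule cl_carrier[OF coc_pullback[OF g(1) L(1)]])
qed

lemma YP_zero_left:
 assumes "Y \<in>. Et n m"
 shows "YP p q 0[Et p q] n m Y = 0[Et (p + n) (q + m)]"
proof -
 from assms obtain f where f: "is_coc K A P n m f" "Y = cl n m f" by (rule Et_cases)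
 obtain L where L: "chain_map id A P n (- m) A P L" "\<forall>x\<in>carrier (T n). aug P (L 0 x) = f x"
  by (rule coc_lift[OF f(1)])
 show ?thesis unfolding f(2) zero_cl using Yoneda_prod_eq[OF coc_zero f(1) L] by simp
qed

lemma YP_zero_right:
 assumes "X \<in>. Et p q"
 shows "YP p q X n m 0[Et n m] = 0[Et (p + n) (q + m)]"
proof -
 from assms obtain g where g: "is_coc K A P p q g" "X = cl p q g" by (rule Et_cases)
 have z: "chain_map id A P n (- m) A P (\<lambda>i x. 0[T i])"
  unfolding chain_map_def using d_zero T.semihom_const_zero[of A id] by auto
 have e: "aug P 0[T 0] = 0[K]" "g 0[T p] = 0[K]"
  using semihom_zero[OF fm_group triv.N.abelian_group_axioms aug_hom]
   semihom_zero[OF fm_group triv.N.abelian_group_axioms is_cocD(1)[OF g(1)]] by auto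
 show ?thesis unfolding g(2) zero_cl using Yoneda_prod_eq[OF g(1) coc_zero z] e by simp
qed

definition sg where "sg n m X = (\<lambda>n' m'. if n' = n \<and> m' = m then X else 0[Et n' m'])"

lemma sg_carrier: "X \<in>. Et n m ==> sg n m X \<in>. YA"
 unfolding YA_simps
proof (intro CollectI conjI)
 have "{(n', m'). sg n m X n' m' ~= 0[Et n' m']} \<subseteq> {(n, m)}" by (auto simp: sg_def)
 thus "finite {(n', m'). sg n m X n' m' ~= 0[Et n' m']}" by (rule finite_subset) simp
 show "X \<in>. Et n m ==> \<forall>n' m'. sg n m X n' m' \<in>. Et n' m'"
  unfolding sg_def using Et.M.zero_closed by simp
qed

lemma sg_zero: "sg n m 0[Et n m] = 0[YA]"
 unfolding YA_simps sg_def by (intro ext) simp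

lemma sg_add: "X \<in>. Et n m ==> Y \<in>. Et n m ==>
  sg n m X +[YA] sg n m Y = sg n m (X +[Et n m] Y)"
 unfolding YA_simps using Et.M.l_zero[OF Et.M.zero_closed] by (intro ext) (simp add: sg_def)

lemma sg_smult: "k \<in>. K ==> k *:[YA] sg n m X = sg n m (k *:[Et n m] X)"
 unfolding YA_simps using Et.smult_r_null by (intro ext) (simp add: sg_def)

lemma sg_one: "1[YA] = sg 0 0 (cl 0 0 (aug P))"
proof -
 have "restrict (aug P) (carrier (T 0)) = aug P"
  using res unfolding free_resolution_def graded_hom_iff by (simp add: extensional_restrict)
 thus ?thesis unfolding YA_simps cl_def sg_def by (intro ext) simp
qed

lemma sg_mult:
 assumes X: "X \<in>. Et p q" and Y: "Y \<in>. Et n m"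
 shows "sg p q X *[YA] sg n m Y = sg (p + n) (q + m) (YP p q X n m Y)"
proof (intro ext)
 fix N M
 let ?f = "\<lambda>(p', q'). YP p' q' (sg p q X p' q') (N - p') (M - q') (sg n m Y (N - p') (M - q'))"
 have e: "(sg p q X *[YA] sg n m Y) N M = finsum (Et N M) ?f {(p', q'). p' \<le> N \<and> sg p q X p' q' ~= 0[Et p' q']}"
  unfolding YA_simps ..
 show "(sg p q X *[YA] sg n m Y) N M = sg (p + n) (q + m) (YP p q X n m Y) N M"
 proof (cases "X = 0[Et p q] \<or> N < p")
  case True
  hence "{(p', q'). p' \<le> N \<and> sg p q X p' q' ~= 0[Et p' q']} = {}"
   by (auto simp: sg_def)
  hence "(sg p q X *[YA] sg n m Y) N M = 0[Et N M]" unfolding e by (simp only: Et.M.finsum_empty)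
  also have "\<dots> = sg (p + n) (q + m) (YP p q X n m Y) N M"
   using True YP_zero_left[OF Y, of p q] by (auto simp: sg_def)
  finally show ?thesis .
 next
  case False
  hence "{(p', q'). p' \<le> N \<and> sg p q X p' q' ~= 0[Et p' q']} = {(p, q)}"
   by (auto simp: sg_def split: if_splits)
  moreover have "YP p q X (N - p) (M - q) (sg n m Y (N - p) (M - q)) = sg (p + n) (q + m) (YP p q X n m Y) N M \<and>
    sg (p + n) (q + m) (YP p q X n m Y) N M \<in>. Et N M"
  proof (cases "N = p + n \<and> M = q + m")
   case True
   thus ?thesis using YP_closed[OF X Y] by (simp add: sg_def)
  next
   case no: False
   hence "sg n m Y (N - p) (M - q) = 0[Et (N - p) (M - q)]" using False by (auto simp: sg_def)
   thus ?thesis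
    using YP_zero_right[OF X, of "N - p" "M - q"] no False Et.M.zero_closed by (auto simp: sg_def)
  qed
  moreover have "sg p q X p q = X" by (simp add: sg_def)
  ultimately show ?thesis
   unfolding e using Et.M.finsum_insert[of "{}" "(p, q)" ?f N M] Et.M.r_zero by simp
 qed
qed

lemma YA_group: "abelian_group YA"
proof (rule abelian_groupI)
 fix x y assume x: "x \<in>. YA" and y: "y \<in>. YA"
 have "{(n, m). x n m +[Et n m] y n m ~= 0[Et n m]}
   \<subseteq> {(n, m). x n m ~= 0[Et n m]} \<union> {(n, m). y n m ~= 0[Et n m]}"
  using Et.M.l_zero[OF Et.M.zero_closed] by auto
 moreover have "finite ({(n, m). x n m ~= 0[Et n m]} \<union> {(n, m). y n m ~= 0[Et n m]})"
  using x y unfolding YA_simps by simp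
 ultimately have "finite {(n, m). x n m +[Et n m] y n m ~= 0[Et n m]}" by (rule finite_subset)
 thus "x +[YA] y \<in>. YA" using x y Et.M.a_closed unfolding YA_simps by simp
 show "x +[YA] y = y +[YA] x" using x y Et.M.a_comm unfolding YA_simps by simp
 fix z assume "z \<in>. YA"
 thus "x +[YA] y +[YA] z = x +[YA] (y +[YA] z)"
  using x y Et.M.a_assoc unfolding YA_simps by simp
next
 show "0[YA] \<in>. YA" using Et.M.zero_closed unfolding YA_simps by simp
 fix x assume x: "x \<in>. YA"
 show "0[YA] +[YA] x = x" using x Et.M.l_zero unfolding YA_simps by simp
 have e: "-[Et n m] x n m = 0[Et n m] \<longleftrightarrow> x n m = 0[Et n m]" for n m
  using x Et.M.add.inv_eq_1_iff unfolding YA_simps by blast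
 have "(\<lambda>n m. -[Et n m] x n m) \<in>. YA"
  using x Et.M.a_inv_closed unfolding YA_simps e by simp
 moreover have "(\<lambda>n m. -[Et n m] x n m) +[YA] x = 0[YA]"
  using x Et.M.l_neg unfolding YA_simps by simp
 ultimately show "\<exists>y\<in>carrier YA. y +[YA] x = 0[YA]" by blast
qed

sublocale YA: abelian_group YA by (rule YA_group)

definition Gcl where "Gcl n m = {cl n m f | f. gen K A P n m f}"

lemma Gcl_carrier: "X \<in> Gcl n m ==> X \<in>. Et n m"
 unfolding Gcl_def using cl_carrier gen_coc by blast

lemma Gcl_gen:
 assumes "cl n m f \<in> Gcl n m" "is_coc K A P n m f"
 shows "gen K A P n m f"
proof -
 obtain g where g: "gen K A P n m g" "cl n m f = cl n m g" using assms(1) unfolding Gcl_def by blast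
 hence "is_cob K A P n m (\<lambda>x. f x -[K] g x)" using cl_eq_iff[OF assms(2) gen_coc] by blast
 thus ?thesis using gen_cob_shift[OF g(1) assms(2)] by blast
qed

lemma Gcl_zero: "0[Et n m] \<in> Gcl n m"
 unfolding Gcl_def zero_cl using gen.cob[OF coc_zero cob_zero] by blast

lemma Gcl_add: "X \<in> Gcl n m ==> Y \<in> Gcl n m ==> X +[Et n m] Y \<in> Gcl n m"
 unfolding Gcl_def using cl_add gen_coc gen.add by fastforce

lemma Gcl_smult: "k \<in>. K ==> X \<in> Gcl n m ==> k *:[Et n m] X \<in> Gcl n m"
 unfolding Gcl_def using cl_scal gen_coc gen.scal by fastforce

lemma Gcl_prod:
 assumes "X \<in> Gcl p q" "Y \<in> Gcl n m"
 shows "YP p q X n m Y \<in> Gcl (p + n) (q + m)"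
proof -
 obtain g f where g: "gen K A P p q g" "X = cl p q g" and f: "gen K A P n m f" "Y = cl n m f"
  using assms unfolding Gcl_def by blast
 obtain L where L: "chain_map id A P n (- m) A P L" "\<forall>x\<in>carrier (T n). aug P (L 0 x) = f x"
  by (rule coc_lift[OF gen_coc[OF f(1)]])
 show ?thesis
  unfolding g(2) f(2) Yoneda_prod_eq[OF gen_coc[OF g(1)] gen_coc[OF f(1)] L] Gcl_def
  using gen.prod[OF g(1) f(1) L] by blast
qed

text \<open>The family has all its components generated by low degrees; these families turn out to be the generated subalgebra.\<close>
definition H0 where "H0 = {x \<in> carrier YA. \<forall>n m. x n m \<in> Gcl n m}"

lemma H0_smult:
 assumes "k \<in>. K" "x \<in> H0"
 shows "k *:[YA] x \<in> H0"
proof -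
 have x: "x \<in>. YA" "\<And>n m. x n m \<in> Gcl n m" using assms(2) by (auto simp: H0_def)
 have "k *:[Et n m] x n m = 0[Et n m]" if "x n m = 0[Et n m]" for n m
  unfolding that by (rule Et.smult_r_null[OF assms(1)])
 hence "{(n, m). k *:[Et n m] x n m ~= 0[Et n m]} \<subseteq> {(n, m). x n m ~= 0[Et n m]}"
  by blast
 moreover have "finite {(n, m). x n m ~= 0[Et n m]}" using x(1) unfolding YA_simps by simp
 ultimately have "finite {(n, m). k *:[Et n m] x n m ~= 0[Et n m]}" by (rule finite_subset)
 thus ?thesis
  using x assms(1) Et.smult_closed Gcl_smult unfolding H0_def YA_simps by simp
qed

lemma H0_mult:
 assumes x: "x \<in> H0" and y: "y \<in> H0"
 shows "x *[YA] y \<in> H0"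
proof -
 have xG: "x n m \<in> Gcl n m" and yG: "y n m \<in> Gcl n m" for n m using x y by (auto simp: H0_def)
 have fin: "finite {(n, m). x n m ~= 0[Et n m]}" "finite {(n, m). y n m ~= 0[Et n m]}"
  using x y unfolding H0_def YA_simps by auto
 let ?I = "\<lambda>n. {(p, q). p \<le> n \<and> x p q ~= 0[Et p q]}"
 let ?f = "\<lambda>n m (p, q). YP p q (x p q) (n - p) (m - q) (y (n - p) (m - q))"
 have f: "?f n m i \<in> Gcl n m" if "i \<in> ?I n" for n m i
 proof -
  obtain p q where i: "i = (p, q)" by (cases i)
  have pn: "p \<le> n" using that i by simp
  have "YP p q (x p q) (n - p) (m - q) (y (n - p) (m - q)) \<in> Gcl (p + (n - p)) (q + (m - q))"
   by (rule Gcl_prod[OF xG yG])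
  thus ?thesis using i pn by simp
 qed
 have m: "(x *[YA] y) n m \<in> Gcl n m" for n m
  unfolding YA_simps
 proof (rule Et.M.finsum_in_closed)
  show "finite (?I n)" by (rule finite_subset[OF _ fin(1)]) auto
  show "0[Et n m] \<in> Gcl n m" by (rule Gcl_zero)
  show "Gcl n m \<subseteq> carrier (Et n m)" using Gcl_carrier by blast
 qed (use Gcl_add f in blast)+
 have "(n, m) \<in> (\<lambda>((p, q), (p', q')). (p + p', q + q')) `
   ({(n, m). x n m ~= 0[Et n m]} \<times> {(n, m). y n m ~= 0[Et n m]})"
  if nz: "(x *[YA] y) n m ~= 0[Et n m]" for n m
 proof -
  have "\<exists>i\<in>?I n. ?f n m i ~= 0[Et n m]"
  proof (rule ccontr)
   assume "\<not> (\<exists>i\<in>?I n. ?f n m i ~= 0[Et n m])"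
   hence "finsum (Et n m) (?f n m) (?I n) = 0[Et n m]"
    by (intro Et.M.add.finprod_one_eqI) blast
   thus False using nz unfolding YA_simps by simp
  qed
  then obtain p q where pq: "p \<le> n" "x p q ~= 0[Et p q]" "?f n m (p, q) ~= 0[Et n m]" by auto
  have "y (n - p) (m - q) ~= 0[Et (n - p) (m - q)]"
   using pq YP_zero_right[OF Gcl_carrier[OF xG], of p q "n - p" "m - q"] by auto
  thus ?thesis
   using pq by (intro image_eqI[of _ _ "((p, q), (n - p, m - q))"]) auto
 qed
 hence "{(n, m). (x *[YA] y) n m ~= 0[Et n m]} \<subseteq> (\<lambda>((p, q), (p', q')). (p + p', q + q')) `
   ({(n, m). x n m ~= 0[Et n m]} \<times> {(n, m). y n m ~= 0[Et n m]})" by auto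
 hence "finite {(n, m). (x *[YA] y) n m ~= 0[Et n m]}"
  by (rule finite_subset) (use fin in simp)
 moreover have "(x *[YA] y) n m \<in>. Et n m" for n m using m Gcl_carrier by blast
 ultimately have "x *[YA] y \<in>. YA" unfolding YA_simps(1) by blast
 thus ?thesis using m by (simp add: H0_def)
qed

lemma H0_sg: "X \<in> Gcl n m ==> sg n m X \<in> H0"
 unfolding H0_def using sg_carrier[OF Gcl_carrier] Gcl_zero by (auto simp: sg_def)

lemma H0_subring: "subring H0 YA"
proof -
 have "subgroup H0 (add_monoid YA)"
 proof (rule YA.add.subgroupI)
  show "H0 \<subseteq> carrier YA" by (auto simp: H0_def)
  have "0[YA] \<in> H0" using H0_sg[OF Gcl_zero] sg_zero by metis
  thus "H0 ~= {}" by blast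
  fix x assume x: "x \<in> H0"
  hence xc: "\<And>n m. x n m \<in>. Et n m" "x \<in>. YA" using Gcl_carrier by (auto simp: H0_def)
  have "(-[K] 1[K]) *:[YA] x +[YA] x = 0[YA]"
   unfolding YA_simps using xc(1) Et.smult_l_minus[OF K.one_closed] Et.smult_one Et.M.l_neg by simp
  moreover have m: "(-[K] 1[K]) *:[YA] x \<in> H0" by (rule H0_smult[OF _ x]) simp
  ultimately have "-[YA] x = (-[K] 1[K]) *:[YA] x"
   using YA.minus_equality xc(2) by (simp add: H0_def)
  thus "-[YA] x \<in> H0" using m by simp
  fix y assume "y \<in> H0"
  thus "x +[YA] y \<in> H0"
   using x YA.a_closed Gcl_add unfolding H0_def by (simp add: YA_simps(5))
 qed
 moreover have "submonoid H0 YA"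
 proof
  show "H0 \<subseteq> carrier YA" by (auto simp: H0_def)
  show "1[YA] \<in> H0"
   unfolding sg_one by (rule H0_sg) (use gen.unit in "auto simp: Gcl_def")
 qed (rule H0_mult)
 ultimately show ?thesis by (simp add: subring_def)
qed

text \<open>\<open>H0\<close> is a subalgebra that contains the classes of degree 1 and 2.\<close>
lemma all_gen_if_generated:
 assumes "generated_subalgebra K YA (Yoneda_degree K A P 1 \<union> Yoneda_degree K A P 2) = carrier YA"
  and f: "is_coc K A P n m f"
 shows "gen K A P n m f"
proof -
 have low: "x \<in> H0" if "x \<in> Yoneda_degree K A P d" "d = 1 \<or> d = 2" for x d
 proof -
  have x: "x \<in>. YA" "\<And>i m. i ~= d ==> x i m = 0[Et i m]"
   using that(1) by (auto simp: Yoneda_degree_def)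
  have "x i m \<in> Gcl i m" for i m
  proof (cases "i = d")
   case True
   have "x i m \<in>. Et i m" using x(1) unfolding YA_simps by blast
   then obtain f where "is_coc K A P i m f" "x i m = cl i m f" by (rule Et_cases)
   thus ?thesis using gen.low that(2) True unfolding Gcl_def by blast
  qed (use x(2) Gcl_zero in simp)
  thus ?thesis using x(1) by (simp add: H0_def)
 qed
 have "generated_subalgebra K YA (Yoneda_degree K A P 1 \<union> Yoneda_degree K A P 2) \<subseteq> H0"
  unfolding generated_subalgebra_def by (rule Inter_lower) (use low H0_subring H0_smult in blast)
 hence "sg n m (cl n m f) \<in> H0" using assms(1) sg_carrier[OF cl_carrier[OF f]] by blast
 hence "sg n m (cl n m f) n m \<in> Gcl n m" by (simp add: H0_def)
 thus ?thesis using Gcl_gen[OF _ f] by (simp add: sg_def)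
qed

text \<open>By induction over \<open>gen\<close>, a subalgebra that contains degrees 1 and 2 contains the class of every generated cocycle; every element is a finite sum of such classes.\<close>
lemma generated_if_all_gen:
 assumes all: "\<And>n m f. is_coc K A P n m f ==> gen K A P n m f"
 shows "generated_subalgebra K YA (Yoneda_degree K A P 1 \<union> Yoneda_degree K A P 2) = carrier YA"
proof
 let ?S = "Yoneda_degree K A P 1 \<union> Yoneda_degree K A P 2"
 have "x n m \<in> Gcl n m" if "x \<in>. YA" for x n m
 proof -
  have "x n m \<in>. Et n m" using that unfolding YA_simps by blast
  then obtain f where "is_coc K A P n m f" "x n m = cl n m f" by (rule Et_cases)
  thus ?thesis using all unfolding Gcl_def by blast
 qed
 hence "H0 = carrier YA" by (auto simp: H0_def)
 moreover have "?S \<subseteq> carrier YA" by (auto simp: Yoneda_degree_def)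
 ultimately show "generated_subalgebra K YA ?S \<subseteq> carrier YA"
  unfolding generated_subalgebra_def by (intro Inter_lower) (use H0_subring H0_smult in auto)
 show "carrier YA \<subseteq> generated_subalgebra K YA ?S"
  unfolding generated_subalgebra_def
 proof (intro Inter_greatest subsetI, elim CollectE conjE)
  fix H x assume S: "?S \<subseteq> H" and H: "subring H YA" and sm: "\<forall>k\<in>carrier K. \<forall>x\<in>H. k *:[YA] x \<in> H"
   and x: "x \<in>. YA"
  interpret H: subring H YA by fact
  have Ha: "y +[YA] z \<in> H" if "y \<in> H" "z \<in> H" for y z
   using subgroup.m_closed[OF subring.axioms(1)[OF H] that] by simp
  have Hz: "0[YA] \<in> H" using subgroup.one_closed[OF subring.axioms(1)[OF H]] by simp
  have Hm: "y *[YA] z \<in> H" if "y \<in> H" "z \<in> H" for y z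
   using submonoid.m_closed[OF subring.axioms(2)[OF H] that] .
  have sgH: "sg n m (cl n m f) \<in> H" if "gen K A P n m f" for n m f
   using that
  proof (induction rule: gen.induct)
   case unit
   show ?case using submonoid.one_closed[OF subring.axioms(2)[OF H]] sg_one by simp
  next
   case (cob n m f)
   thus ?case using cl_zero[of n m f] Hz by (simp add: sg_zero)
  next
   case (low n m f)
   have "sg n m (cl n m f) \<in> Yoneda_degree K A P n"
    unfolding Yoneda_degree_def using sg_carrier[OF cl_carrier[OF low(1)]] by (auto simp: sg_def)
   thus ?case using S low(2) by blast
  next
   case (add n m f g)
   note gf = gen_coc[OF add.hyps(1)] gen_coc[OF add.hyps(2)]
   show ?case
    using Ha[OF add.IH] sg_add[OF cl_carrier[OF gf(1)] cl_carrier[OF gf(2)]] cl_add[OF gf] by simp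
  next
   case (scal k n m f)
   have "k *:[YA] sg n m (cl n m f) \<in> H" using sm scal.hyps(1) scal.IH by blast
   thus ?case
    using sg_smult[OF scal.hyps(1), of n m "cl n m f"] cl_scal[OF gen_coc[OF scal.hyps(2)] scal.hyps(1)] by simp
  next
   case (prod p q g n m f L)
   note gf = gen_coc[OF prod.hyps(1)] gen_coc[OF prod.hyps(2)]
   show ?case
    using Hm[OF prod.IH] sg_mult[OF cl_carrier[OF gf(1)] cl_carrier[OF gf(2)]]
     Yoneda_prod_eq[OF gf prod.hyps(3,4)] by simp
  next
   case (eq n m f f')
   thus ?case using cl_cong[OF eq.hyps(2)] by simp
  qed
  have part: "sg n m (x n m) \<in> H" for n m
  proof -
   have "x n m \<in>. Et n m" using x unfolding YA_simps by blast
   then obtain f where "is_coc K A P n m f" "x n m = cl n m f" by (rule Et_cases)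
   thus ?thesis using all sgH by simp
  qed
  have xE: "x n m \<in>. Et n m" for n m using x unfolding YA_simps by blast
  have "(\<lambda>n m. if (n, m) \<in> J then x n m else 0[Et n m]) \<in> H" if "finite J" for J
   using that
  proof (induction J rule: finite_induct)
   case empty
   show ?case using Hz unfolding YA_simps by simp
  next
   case (insert j J)
   obtain p q where j: "j = (p, q)" by (cases j)
   have "(\<lambda>n m. if (n, m) \<in> insert j J then x n m else 0[Et n m]) =
     sg p q (x p q) +[YA] (\<lambda>n m. if (n, m) \<in> J then x n m else 0[Et n m])"
    unfolding YA_simps using insert.hyps(2) j xE Et.M.l_zero Et.M.r_zero Et.M.zero_closed
    by (intro ext) (auto simp: sg_def)
   thus ?case using Ha[OF part insert.IH] by simp
  qed
  from this[of "{(n, m). x n m ~= 0[Et n m]}"]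
  have "(\<lambda>n m. if (n, m) \<in> {(n, m). x n m ~= 0[Et n m]} then x n m else 0[Et n m]) \<in> H"
   using x unfolding YA_simps by blast
  moreover have "(\<lambda>n m. if (n, m) \<in> {(n, m). x n m ~= 0[Et n m]} then x n m else 0[Et n m]) = x"
   by (intro ext) simp
  ultimately show "x \<in> H" by simp
 qed
qed

end

text \<open>One direction restricts a generated subalgebra to single classes, the other adds up classes.\<close>
lemma is_K2_iff:
 assumes "connected_graded_algebra K A"
 shows "is_K2 K A \<longleftrightarrow> (\<exists>P. resolution K A P \<and> (\<forall>n m f. is_coc K A P n m f --> gen K A P n m f))"
proof
 assume "is_K2 K A"
 then obtain P where P: "free_resolution K A P" "generated_subalgebra K (Yoneda_algebra K A P)
   (Yoneda_degree K A P 1 \<union> Yoneda_degree K A P 2) = carrier (Yoneda_algebra K A P)"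
  unfolding is_K2_def by blast
 have r: "resolution K A P" using assms P(1) by (simp add: resolution_def resolution_axioms_def)
 thus "\<exists>P. resolution K A P \<and> (\<forall>n m f. is_coc K A P n m f --> gen K A P n m f)"
  using resolution.all_gen_if_generated[OF r P(2)] by blast
next
 assume "\<exists>P. resolution K A P \<and> (\<forall>n m f. is_coc K A P n m f --> gen K A P n m f)"
 then obtain P where r: "resolution K A P" and g: "\<And>n m f. is_coc K A P n m f ==> gen K A P n m f" by blast
 show "is_K2 K A"
  unfolding is_K2_def
  using resolution.generated_if_all_gen[OF r g] resolution.res[OF r] by blast
qed

section \<open>Spans and finite dimension\<close>

text \<open>The submonoid generated by \<open>G\<close>. For sets closed under scalars it is the linear span.\<close>
inductive_set asum :: "('m, 'z) ring_scheme => 'm set => 'm set" for N G where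
 zero: "0[N] \<in> asum N G"
| step: "g \<in> G ==> x \<in> asum N G ==> g +[N] x \<in> asum N G"

lemma asum_subset:
 assumes "G \<subseteq> H" "0[N] \<in> H" "\<And>x y. x \<in> H ==> y \<in> H ==> x +[N] y \<in> H"
 shows "asum N G \<subseteq> H"
proof
 fix x assume "x \<in> asum N G"
 thus "x \<in> H" by induction (use assms in auto)
qed

context abelian_group
begin

lemma asum_carrier: "S \<subseteq> carrier G ==> asum G S \<subseteq> carrier G"
 by (rule asum_subset) auto

lemma asum_incl: "s \<in> S ==> S \<subseteq> carrier G ==> s \<in> asum G S"
 using asum.step[of s S \<zero> G] asum.zero[of G S] by auto

lemma asum_add:
 assumes "S \<subseteq> carrier G" "x \<in> asum G S" "y \<in> asum G S"
 shows "x \<oplus> y \<in> asum G S"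
 using assms(2)
proof induction
 case zero
 thus ?case using assms(3) asum_carrier[OF assms(1)] by auto
next
 case (step g x)
 hence "g \<in>. G" "x \<in>. G" "y \<in>. G" using assms asum_carrier[OF assms(1)] by auto
 thus ?case using asum.step[OF step.hyps(1) step.IH] by (simp add: a_assoc)
qed

lemma asum_mono: "S \<subseteq> asum G S' ==> S' \<subseteq> carrier G ==> asum G S \<subseteq> asum G S'"
 using asum_subset[of S "asum G S'"] asum.zero asum_add by blast

lemma asum_image:
 assumes "abelian_group N" "S \<subseteq> carrier G" "S' \<subseteq> carrier N" "\<And>x y. x \<in>. G ==> y \<in>. G ==> h (x \<oplus> y) = h x +[N] h y"
  "h \<zero> = 0[N]" "\<And>s. s \<in> S ==> h s \<in> asum N S'" "x \<in> asum G S"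
 shows "h x \<in> asum N S'"
 using assms(7)
proof induction
 case zero
 thus ?case using assms(5) asum.zero[of N S'] by simp
next
 case (step g x)
 hence "g \<in>. G" "x \<in>. G" using assms(2) asum_carrier[OF assms(2)] by auto
 thus ?case using assms(4) abelian_group.asum_add[OF assms(1,3) assms(6)[OF step.hyps(1)] step.IH] by simp
qed

end

context graded_mod
begin

text \<open>Scalars act on a module over \<open>A\<close> through the constants of \<open>A\<close>.\<close>
definition sc :: "'k => 'm => 'm" where "sc k x = (k *:[A] 1[A]) *:[N] x"

lemma sc_closed [simp]: "k \<in>. K ==> x \<in>. N ==> sc k x \<in>. N"
 by (simp add: sc_def)

lemma sc_add_l: "k \<in>. K ==> l \<in>. K ==> x \<in>. N ==> sc (k +[K] l) x = sc k x +[N] sc l x"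
 by (simp add: sc_def A.KA.smult_l_distr smult_l_distr)

lemma sc_add_r: "k \<in>. K ==> x \<in>. N ==> y \<in>. N ==> sc k (x +[N] y) = sc k x +[N] sc k y"
 by (simp add: sc_def smult_r_distr)

lemma sc_smult:
 "k \<in>. K ==> a \<in>. A ==> x \<in>. N ==> sc k (a *:[N] x) = (k *:[A] a) *:[N] x"
 by (simp add: sc_def A.scalar_mult flip: smult_assoc)

lemma sc_assoc: "k \<in>. K ==> l \<in>. K ==> x \<in>. N ==> sc k (sc l x) = sc (k *[K] l) x"
 using sc_smult[of k "l *:[A] 1[A]" x] by (simp add: sc_def A.KA.smult_assoc1)

lemma sc_one: "x \<in>. N ==> sc 1[K] x = x"
 by (simp add: sc_def)

lemma sc_zero_l: "x \<in>. N ==> sc 0[K] x = 0[N]"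
 by (simp add: sc_def)

lemma sc_zero_r: "k \<in>. K ==> sc k 0[N] = 0[N]"
 by (simp add: sc_def)

lemma sc_comp: "k \<in>. K ==> x \<in> component N j ==> sc k x \<in> component N j"
 using ncomp_smult[OF A.comp_smult[OF _ A.one_comp], of k x j] by (simp add: sc_def)

lemma sc_minus: "x \<in>. N ==> sc (-[K] 1[K]) x = -[N] x"
proof -
 assume x: "x \<in>. N"
 have "sc (-[K] 1[K]) x +[N] x = sc (-[K] 1[K] +[K] 1[K]) x"
  using sc_add_l[of "-[K] 1[K]" "1[K]" x] x sc_one[OF x] by simp
 also have "\<dots> = 0[N]" using x by (simp add: A.K.l_neg sc_zero_l)
 finally show ?thesis using N.minus_equality[of "sc (-[K] 1[K]) x" x] x by simp
qed

definition scs :: "'m set => 'm set" where "scs S = {sc k s | k s. k \<in>. K \<and> s \<in> S}"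
abbreviation "lspan S \<equiv> asum N (scs S)"
definition fdim :: "'m set => bool" where "fdim V \<longleftrightarrow> (\<exists>S. finite S \<and> S \<subseteq> V \<and> V \<subseteq> lspan S)"

lemma scs_carrier: "S \<subseteq> carrier N ==> scs S \<subseteq> carrier N"
 by (auto simp: scs_def)

lemma lspan_sc:
 assumes "S \<subseteq> carrier N" "k \<in>. K" "x \<in> lspan S"
 shows "sc k x \<in> lspan S"
proof (rule N.asum_image[OF N.abelian_group_axioms scs_carrier[OF assms(1)] scs_carrier[OF assms(1)] _ _ _ assms(3)])
 fix s assume "s \<in> scs S"
 then obtain l t where s: "s = sc l t" "l \<in>. K" "t \<in> S" by (auto simp: scs_def)
 hence "sc k s = sc (k *[K] l) t" using assms(1,2) sc_assoc by auto
 hence "sc k s \<in> scs S" using s assms(2) by (auto simp: scs_def)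
 thus "sc k s \<in> lspan S" using N.asum_incl scs_carrier[OF assms(1)] by blast
qed (use assms(2) sc_add_r sc_zero_r in auto)

lemma lspan_insert:
 assumes "S \<subseteq> carrier N" "s \<in>. N" "x \<in> lspan (insert s S)"
 shows "\<exists>k\<in>carrier K. \<exists>y\<in>lspan S. x = sc k s +[N] y"
 using assms(3)
proof induction
 case zero
 have "0[N] = sc 0[K] s +[N] 0[N]" using assms(2) by (simp add: sc_zero_l)
 thus ?case using asum.zero[of N "scs S"] A.K.zero_closed by blast
next
 case (step g x)
 then obtain k y where ky: "k \<in>. K" "y \<in> lspan S" "x = sc k s +[N] y" by blast
 have y: "y \<in>. N" using ky(2) N.asum_carrier[OF scs_carrier[OF assms(1)]] by blast
 obtain l t where g: "g = sc l t" "l \<in>. K" "t \<in> insert s S"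
  using step.hyps(1) unfolding scs_def by blast
 have gc: "g \<in>. N" using g assms(1,2) by auto
 show ?case
 proof (cases "t = s")
  case True
  hence "g +[N] x = sc (l +[K] k) s +[N] y"
   using ky g assms(2) y by (simp add: sc_add_l N.a_assoc)
  thus ?thesis using ky(1,2) g(2) A.K.a_closed by blast
 next
  case False
  hence "g \<in> scs S" using g by (auto simp: scs_def)
  from asum.step[OF this ky(2)] have "g +[N] y \<in> lspan S" .
  moreover have "g +[N] x = sc k s +[N] (g +[N] y)"
   using ky gc y assms(2) by (simp add: N.a_lcomm)
  ultimately show ?thesis using ky(1) by blast
 qed
qed

text \<open>Induction on the spanning set: an element of \<open>V\<close> with a nonzero coefficient at the new vector, if there is one, clears that coefficient from all others.\<close>
lemma fdim_subspace:
 assumes "finite S" "S \<subseteq> carrier N" "V \<subseteq> lspan S" "0[N] \<in> V"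
  "\<And>x y. x \<in> V ==> y \<in> V ==> x +[N] y \<in> V" "\<And>k x. k \<in>. K ==> x \<in> V ==> sc k x \<in> V"
 shows "fdim V"
 using assms
proof (induction S arbitrary: V rule: finite_induct)
 case empty
 have "lspan {} \<subseteq> {0[N]}" by (rule asum_subset) (auto simp: scs_def)
 thus ?case unfolding fdim_def using empty asum.zero[of N "scs {}"] by blast
next
 case (insert s S)
 have S: "S \<subseteq> carrier N" "s \<in>. N" using insert.prems(1) by auto
 have spc: "lspan S \<subseteq> carrier N" by (rule N.asum_carrier[OF scs_carrier[OF S(1)]])
 have "fdim (V \<inter> lspan S)"
 proof (rule insert.IH)
  show "x +[N] y \<in> V \<inter> lspan S" if "x \<in> V \<inter> lspan S" "y \<in> V \<inter> lspan S" for x y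
   using that insert.prems(4) N.asum_add[OF scs_carrier[OF S(1)]] by blast
  show "sc k x \<in> V \<inter> lspan S" if "k \<in>. K" "x \<in> V \<inter> lspan S" for k x
   using that insert.prems(5) lspan_sc[OF S(1)] by blast
 qed (use S insert.prems asum.zero[of N "scs S"] in blast)+
 then obtain T where T: "finite T" "T \<subseteq> V \<inter> lspan S" "V \<inter> lspan S \<subseteq> lspan T" unfolding fdim_def by blast
 show ?case
 proof (cases "V \<subseteq> lspan S")
  case True
  thus ?thesis unfolding fdim_def using T by blast
 next
  case False
  then obtain x0 where x0: "x0 \<in> V" "x0 \<notin> lspan S" by blast
  obtain k y where ky: "k \<in>. K" "y \<in> lspan S" "x0 = sc k s +[N] y"
   using lspan_insert[OF S] x0(1) insert.prems(2) by blast
  have yc: "y \<in>. N" and x0c: "x0 \<in>. N" using ky spc S by auto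
  have k0: "k ~= 0[K]"
  proof
   assume "k = 0[K]"
   hence "x0 = y" using ky(3) yc S by (simp add: sc_zero_l)
   thus False using ky(2) x0(2) by simp
  qed
  let ?i = "inv\<^bsub>K\<^esub> k"
  have ic: "?i \<in>. K" "?i *[K] k = 1[K]" using ky(1) k0 A.K.field_Units by auto
  have TV: "insert x0 T \<subseteq> V" "insert x0 T \<subseteq> carrier N" using T(2) x0(1) x0c spc by auto
  have "x \<in> lspan (insert x0 T)" if x: "x \<in> V" for x
  proof -
   obtain k' y' where ky': "k' \<in>. K" "y' \<in> lspan S" "x = sc k' s +[N] y'"
    using lspan_insert[OF S] x insert.prems(2) by blast
   have yc': "y' \<in>. N" using ky'(2) spc by blast
   let ?c = "k' *[K] ?i"
   let ?m = "-[K] 1[K] *[K] ?c"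
   have c: "?c \<in>. K" "?m \<in>. K" "?c +[K] ?m = 0[K]" "?c *[K] k = k'"
    using ky'(1) ic ky(1) by (simp_all add: A.K.l_minus A.K.r_neg A.K.m_assoc)
   have mk: "?m *[K] k = -[K] k'" using c ky(1) ky'(1) by (simp add: A.K.m_assoc A.K.l_minus)
   let ?z = "x +[N] sc ?m x0"
   have "sc ?m x0 = sc (-[K] k') s +[N] sc ?m y"
    using ky c(2) S yc mk by (simp add: sc_add_r sc_assoc)
   hence "?z = (sc k' s +[N] sc (-[K] k') s) +[N] (y' +[N] sc ?m y)"
    using ky'(3) yc yc' S c(2) ky'(1) by (simp add: N.a_ac)
   also have "sc k' s +[N] sc (-[K] k') s = 0[N]"
    using ky'(1) S sc_zero_l[of s] by (simp add: A.K.r_neg flip: sc_add_l)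
   finally have "?z = y' +[N] sc ?m y" using yc yc' c(2) by simp
   moreover have "sc ?m y \<in> lspan S" by (rule lspan_sc[OF S(1) c(2) ky(2)])
   ultimately have "?z \<in> lspan S" using N.asum_add[OF scs_carrier[OF S(1)] ky'(2)] by metis
   moreover have "?z \<in> V" using x x0(1) c(2) insert.prems(4,5) by blast
   ultimately have "?z \<in> lspan T" using T(3) by blast
   moreover have "scs T \<subseteq> lspan (insert x0 T)"
   proof
    fix t assume "t \<in> scs T"
    hence "t \<in> scs (insert x0 T)" by (auto simp: scs_def)
    thus "t \<in> lspan (insert x0 T)" using N.asum_incl scs_carrier[OF TV(2)] by blast
   qed
   ultimately have 1: "?z \<in> lspan (insert x0 T)"
    using N.asum_mono[of "scs T" "scs (insert x0 T)"] scs_carrier[OF TV(2)] by blast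
   have "sc ?c x0 \<in> scs (insert x0 T)" using c(1) by (auto simp: scs_def)
   from asum.step[OF this 1] have "sc ?c x0 +[N] ?z \<in> lspan (insert x0 T)" .
   moreover have "sc ?c x0 +[N] ?z = x +[N] (sc ?c x0 +[N] sc ?m x0)"
    using c x0c ky'(3) yc' ky'(1) S by (simp add: N.a_lcomm)
   moreover have "sc ?c x0 +[N] sc ?m x0 = 0[N]"
    using sc_add_l[OF c(1,2) x0c] c(3) sc_zero_l[OF x0c] by simp
   ultimately show ?thesis using ky' yc' S by simp
  qed
  thus ?thesis unfolding fdim_def using TV(1) T(1) finite.insertI by blast
 qed
qed

lemma lspan_combination:
 assumes "finite S" "S \<subseteq> carrier N" "x \<in> lspan S"
 shows "\<exists>c\<in>S \<rightarrow> carrier K. x = (\<Oplus>\<^bsub>N\<^esub>s\<in>S. sc (c s) s)"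
 using assms(3)
proof induction
 case zero
 have "(\<Oplus>\<^bsub>N\<^esub>s\<in>S. sc 0[K] s) = 0[N]"
  by (rule N.add.finprod_one_eqI) (use assms(2) sc_zero_l in blast)
 thus ?case by (intro bexI[of _ "\<lambda>s. 0[K]"]) auto
next
 case (step g x)
 then obtain c where c: "c \<in> S \<rightarrow> carrier K" "x = (\<Oplus>\<^bsub>N\<^esub>s\<in>S. sc (c s) s)" by blast
 obtain l t where g: "g = sc l t" "l \<in>. K" "t \<in> S" using step.hyps(1) unfolding scs_def by blast
 define e where "e s = (if s = t then l else 0[K])" for s
 have ec: "e s \<in>. K" for s using g by (simp add: e_def)
 have "(\<Oplus>\<^bsub>N\<^esub>s\<in>{t}. sc (e s) s) = (\<Oplus>\<^bsub>N\<^esub>s\<in>S. sc (e s) s)"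
  by (rule N.finsum_superset) (use assms g ec in "auto simp: e_def sc_zero_l")
 moreover have "(\<Oplus>\<^bsub>N\<^esub>s\<in>{t}. sc (e s) s) = g" using g assms(2) by (auto simp: e_def)
 ultimately have "g +[N] x = (\<Oplus>\<^bsub>N\<^esub>s\<in>S. sc (e s) s) +[N] (\<Oplus>\<^bsub>N\<^esub>s\<in>S. sc (c s) s)" using c(2) by simp
 also have "\<dots> = (\<Oplus>\<^bsub>N\<^esub>s\<in>S. sc (e s) s +[N] sc (c s) s)"
  by (rule N.finsum_addf[symmetric]) (use c(1) ec assms(2) in "auto simp: Pi_iff subset_iff")
 also have "\<dots> = (\<Oplus>\<^bsub>N\<^esub>s\<in>S. sc (e s +[K] c s) s)"
  by (rule N.finsum_cong') (use c(1) ec assms(2) in "auto simp: sc_add_l subset_iff Pi_iff")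
 finally show ?case using c(1) ec by (intro bexI[of _ "\<lambda>s. e s +[K] c s"]) auto
qed

lemma locally_finite_iff: "locally_finite K A N \<longleftrightarrow> (\<forall>m. fdim (component N m))"
proof
 assume lf: "locally_finite K A N"
 show "\<forall>m. fdim (component N m)"
 proof
  fix m
  obtain S where S: "finite S" "S \<subseteq> component N m"
   "\<And>x. x \<in> component N m ==> \<exists>c\<in>S \<rightarrow> carrier K. x = (\<Oplus>\<^bsub>N\<^esub>s\<in>S. (c s *:[A] 1[A]) *:[N] s)"
   using lf unfolding locally_finite_def by meson
  have Sc: "S \<subseteq> carrier N" using S(2) ncomp_carrier by blast
  have "x \<in> lspan S" if x: "x \<in> component N m" for x
  proof -
   obtain c where c: "c \<in> S \<rightarrow> carrier K" "x = (\<Oplus>\<^bsub>N\<^esub>s\<in>S. (c s *:[A] 1[A]) *:[N] s)"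
    using S(3)[OF x] by blast
   show ?thesis
    unfolding c(2)
   proof (rule N.finsum_in_closed[OF S(1) asum.zero N.asum_carrier[OF scs_carrier[OF Sc]] N.asum_add[OF scs_carrier[OF Sc]]])
    fix s assume s: "s \<in> S"
    hence "sc (c s) s \<in> scs S" using c(1) by (auto simp: scs_def)
    thus "(c s *:[A] 1[A]) *:[N] s \<in> lspan S"
     using N.asum_incl[OF _ scs_carrier[OF Sc]] by (simp add: sc_def)
   qed
  qed
  thus "fdim (component N m)" unfolding fdim_def using S(1,2) by blast
 qed
next
 assume f: "\<forall>m. fdim (component N m)"
 show "locally_finite K A N"
  unfolding locally_finite_def
 proof
  fix m
  obtain S where S: "finite S" "S \<subseteq> component N m" "component N m \<subseteq> lspan S"
   using f unfolding fdim_def by blast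
  have "S \<subseteq> carrier N" using S(2) ncomp_carrier by blast
  from lspan_combination[OF S(1) this] S show "\<exists>S. finite S \<and> S \<subseteq> component N m \<and>
   (\<forall>x\<in>component N m. \<exists>c\<in>S \<rightarrow> carrier K. x = (\<Oplus>\<^bsub>N\<^esub>s\<in>S. (c s *:[A] 1[A]) *:[N] s))"
   unfolding sc_def by blast
 qed
qed

end

section \<open>Minimal resolutions\<close>

text \<open>Bounded below and finite in each degree; together with finite-dimensional components of the algebra this makes a free module locally finite.\<close>
definition good_gens :: "(nat => int option) => bool" where
 "good_gens \<beta> \<longleftrightarrow> (\<forall>i d. \<beta> i = Some d --> 0 \<le> d) \<and> (\<forall>d. finite {i. \<beta> i = Some d})"

text \<open>Minimal generators of the graded submodule \<open>M\<close>, chosen degree by degree: \<open>S j\<close> is a smallest finite set that spans \<open>M j\<close> modulo what comes from lower degrees. If an element of the kernel had a coefficient with nonzero constant term, the corresponding generator could be expressed by the others and removed, against the choice of \<open>S j\<close>.\<close>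
lemma (in connected_graded_algebra) min_cover:
 fixes B :: "(nat, 'k, 'b) graded_module" and M :: "int => (nat => 'b) set" and \<gamma> :: "nat => int option"
 defines "N \<equiv> free_module B \<gamma>"
 assumes B: "connected_graded_algebra K B" and \<phi>: "galg_hom K A B \<phi>"
  and sub: "\<And>j. M j \<subseteq> component N j" and zero: "\<And>j. 0[N] \<in> M j"
  and add: "\<And>j x y. x \<in> M j ==> y \<in> M j ==> x +[N] y \<in> M j"
  and smult: "\<And>i j a x. a \<in> component A i ==> x \<in> M j ==> \<phi> a *:[N] x \<in> M (int i + j)"
  and neg: "\<And>j. j < 0 ==> M j \<subseteq> {0[N]}"
  and fd: "\<And>j. graded_mod.fdim K B N (M j)"
 shows "\<exists>\<beta> \<Psi>. good_gens \<beta> \<and> \<Psi> \<in> semihom \<phi> A (F \<beta>) N 0 \<and>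
  (\<forall>j. \<Psi> ` component (F \<beta>) j = M j) \<and>
  (\<forall>z\<in>carrier (F \<beta>). \<Psi> z = 0[N] --> (\<forall>i. eps (z i) = 0[K]))"
proof -
 interpret B: connected_graded_algebra K B by fact
 interpret N: graded_mod K B N unfolding N_def by (rule B.fm_graded_mod)
 have Mc: "x \<in>. N" if "x \<in> M j" for x j using that sub N.ncomp_carrier by blast
 have \<phi>c: "\<phi> a \<in>. B" if "a \<in>. A" for a using galg_homD(1)[OF \<phi> that] .
 have \<phi>c': "\<phi> a \<in>. B" if "a \<in> component A i" for a i using \<phi>c comp_carrier[OF that] by blast
 have \<phi>k: "\<phi> (k *:[A] 1[A]) = k *:[B] 1[B]" if "k \<in>. K" for k
  using galg_homD(4,5)[OF \<phi>] that by simp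
 have scM: "N.sc k x \<in> M j" if "k \<in>. K" "x \<in> M j" for k x j
  using smult[OF comp_smult[OF that(1) one_comp] that(2)] \<phi>k[OF that(1)] by (simp add: N.sc_def)
 \<comment> \<open>\<open>G j S\<close> generates the submodule \<open>K S + A\<^sub>+ M\<close> in degree \<open>j\<close>.\<close>
 define G where "G j S = N.scs S \<union> {\<phi> a *:[N] x | a x i l. i > 0 \<and> a \<in> component A i \<and> x \<in> M l \<and> int i + l = j}" for j S
 have GM: "G j S \<subseteq> M j" if "S \<subseteq> M j" for j S
  using that scM smult unfolding G_def N.scs_def by blast
 have Gc: "G j S \<subseteq> carrier N" if "S \<subseteq> M j" for j S using GM[OF that] Mc by blast
 have Rsc: "N.sc k x \<in> asum N (G j S)" if "S \<subseteq> M j" "k \<in>. K" "x \<in> asum N (G j S)" for k x j S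
 proof (rule N.N.asum_image[OF N.N.abelian_group_axioms Gc[OF that(1)] Gc[OF that(1)] _ _ _ that(3)])
  fix g assume "g \<in> G j S"
  hence "N.sc k g \<in> G j S"
  proof (unfold G_def, elim UnE)
   assume "g \<in> N.scs S"
   then obtain l s where "g = N.sc l s" "l \<in>. K" "s \<in> S" by (auto simp: N.scs_def)
   moreover from this have "N.sc k g = N.sc (k *[K] l) s" using that Mc N.sc_assoc by blast
   ultimately show "N.sc k g \<in> N.scs S \<union> {\<phi> a *:[N] x | a x i l. i > 0 \<and> a \<in> component A i \<and> x \<in> M l \<and> int i + l = j}"
    using that(2) K.m_closed unfolding N.scs_def by blast
  next
   assume "g \<in> {\<phi> a *:[N] x | a x i l. i > 0 \<and> a \<in> component A i \<and> x \<in> M l \<and> int i + l = j}"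
   then obtain a x i l where g: "g = \<phi> a *:[N] x" "i > 0" "a \<in> component A i" "x \<in> M l" "int i + l = j" by blast
   have "N.sc k g = \<phi> (k *:[A] a) *:[N] x"
    using g that(2) N.sc_smult[OF that(2) \<phi>c'[OF g(3)] Mc[OF g(4)]] galg_homD(5)[OF \<phi> that(2) comp_carrier[OF g(3)]] by simp
   thus "N.sc k g \<in> N.scs S \<union> {\<phi> a *:[N] x | a x i l. i > 0 \<and> a \<in> component A i \<and> x \<in> M l \<and> int i + l = j}"
    using g comp_smult[OF that(2) g(3)] by blast
  qed
  thus "N.sc k g \<in> asum N (G j S)" using N.N.asum_incl Gc[OF that(1)] by blast
 qed (use that(2) N.sc_add_r N.sc_zero_r in auto)
 have "\<exists>S. (finite S \<and> S \<subseteq> M j \<and> M j \<subseteq> asum N (G j S)) \<and>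
   (\<forall>S'. finite S' \<and> S' \<subseteq> M j \<and> M j \<subseteq> asum N (G j S') --> card S \<le> card S')" for j
 proof -
  obtain S where S: "finite S" "S \<subseteq> M j" "M j \<subseteq> N.lspan S" using fd[of j] unfolding N.fdim_def by blast
  have "N.scs S \<subseteq> asum N (G j S)" using N.N.asum_incl[OF _ Gc[OF S(2)]] unfolding G_def by blast
  hence "N.lspan S \<subseteq> asum N (G j S)" using N.N.asum_mono Gc[OF S(2)] by blast
  hence "finite S \<and> S \<subseteq> M j \<and> M j \<subseteq> asum N (G j S)" using S by blast
  from ex_has_least_nat[where P = "\<lambda>S. finite S \<and> S \<subseteq> M j \<and> M j \<subseteq> asum N (G j S)" and m = card, OF this]
  show ?thesis by blast
 qed
 then obtain S where S: "\<And>j. finite (S j)" "\<And>j. S j \<subseteq> M j" "\<And>j. M j \<subseteq> asum N (G j (S j))"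
  "\<And>j S'. finite S' ==> S' \<subseteq> M j ==> M j \<subseteq> asum N (G j S') ==> card (S j) \<le> card S'" by metis
 have "\<exists>h. bij_betw h {0..<card (S j)} (S j)" for j by (rule ex_bij_betw_nat_finite[OF S(1)])
 then obtain e where e: "\<And>j. bij_betw (e j) {0..<card (S j)} (S j)" by metis
 define \<beta> where "\<beta> i = (if snd (prod_decode i) < card (S (int (fst (prod_decode i))))
  then Some (int (fst (prod_decode i))) else None)" for i
 define y where "y i = e (int (fst (prod_decode i))) (snd (prod_decode i))" for i
 have \<beta>D: "0 \<le> d" "i = prod_encode (nat d, snd (prod_decode i))" "snd (prod_decode i) < card (S d)"
   "y i = e d (snd (prod_decode i))" if "\<beta> i = Some d" for i d
 proof -
  have d: "d = int (fst (prod_decode i))" "snd (prod_decode i) < card (S (int (fst (prod_decode i))))"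
   using that unfolding \<beta>_def by (auto split: if_splits)
  show "0 \<le> d" "snd (prod_decode i) < card (S d)" "y i = e d (snd (prod_decode i))" using d by (auto simp: y_def)
  have "prod_encode (fst (prod_decode i), snd (prod_decode i)) = i" by simp
  thus "i = prod_encode (nat d, snd (prod_decode i))" using d(1) by simp
 qed
 have good: "good_gens \<beta>"
  unfolding good_gens_def
 proof (intro conjI allI impI)
  fix d
  have "{i. \<beta> i = Some d} \<subseteq> prod_encode ` ({nat d} \<times> {..<card (S d)})"
  proof
   fix i assume "i \<in> {i. \<beta> i = Some d}"
   hence i: "\<beta> i = Some d" by simp
   show "i \<in> prod_encode ` ({nat d} \<times> {..<card (S d)})"
    by (rule image_eqI[where f = prod_encode and x = "(nat d, snd (prod_decode i))", OF \<beta>D(2)[OF i]]) (use \<beta>D(3)[OF i] in simp)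
  qed
  thus "finite {i. \<beta> i = Some d}" by (rule finite_subset) simp
 qed (use \<beta>D(1) in blast)
 have yS: "y i \<in> S d" if "\<beta> i = Some d" for i d
  using bij_betwE[OF e[of d]] \<beta>D(3,4)[OF that] by auto
 have yM: "y i \<in> M d" if "\<beta> i = Some d" for i d using yS[OF that] S(2) by blast
 have yinj: "i = i'" if "\<beta> i = Some d" "\<beta> i' = Some d" "y i = y i'" for i i' d
 proof -
  have "snd (prod_decode i) = snd (prod_decode i')"
   using inj_onD[OF bij_betw_imp_inj_on[OF e[of d]]] \<beta>D(3,4)[OF that(1)] \<beta>D(3,4)[OF that(2)] that(3) by simp
  thus ?thesis using \<beta>D(2)[OF that(1)] \<beta>D(2)[OF that(2)] by simp
 qed
 have ysurj: "\<exists>i. \<beta> i = Some d \<and> y i = s" if sS: "s \<in> S d" and d0: "0 \<le> d" for s d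
 proof -
  have "s \<in> e d ` {0..<card (S d)}" using sS bij_betw_imp_surj_on[OF e[of d]] by simp
  then obtain k where "k < card (S d)" "e d k = s" by auto
  thus ?thesis using d0 by (intro exI[of _ "prod_encode (nat d, k)"]) (simp add: \<beta>_def y_def)
 qed
 have "\<exists>T \<in> semihom \<phi> A (F \<beta>) N 0. \<forall>i d. \<beta> i = Some d --> T (single A 1[A] i) = y i"
  by (rule fm_ext[OF N.graded_mod_axioms \<phi>]) (use yM sub in fastforce)
 then obtain \<Psi> where \<Psi>: "\<Psi> \<in> semihom \<phi> A (F \<beta>) N 0" "\<And>i d. \<beta> i = Some d ==> \<Psi> (single A 1[A] i) = y i" by blast
 have \<Psi>s: "\<Psi> (single A a i) = \<phi> a *:[N] y i" if "\<beta> i = Some d" "a \<in>. A" for a i d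
  using single_eq[OF that(2), of i \<beta>] semihomD(3)[OF \<Psi>(1) that(2), of "single A 1[A] i"] \<Psi>(2)[OF that(1)]
   single_carrier[of "1[A]" \<beta> i d] that(1) by simp
 have \<Psi>0: "\<Psi> (\<lambda>i. 0[A]) = 0[N]" using semihom_zero[OF fm_group N.N.abelian_group_axioms \<Psi>(1)] by simp
 have \<Psi>M: "\<Psi> z \<in> M j" if "z \<in> component (F \<beta>) j" for z j
  using that
 proof (induction rule: fm_comp_induct)
  case zero
  thus ?case using \<Psi>0 \<open>\<And>j. 0[N] \<in> M j\<close> by simp
 next
  case (single i d k a)
  thus ?case
   using \<Psi>s[OF single(1) comp_carrier[OF single(3)]] smult[OF single(3) yM[OF single(1)]] by (simp add: add.commute)
 next
  case (add z z')
  thus ?case using semihomD(2)[OF \<Psi>(1) add(1,2)] \<open>\<And>j x y. x \<in> M j ==> y \<in> M j ==> x +[N] y \<in> M j\<close> by simp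
 qed
 have img_zero: "0[N] \<in> \<Psi> ` component (F \<beta>) j" for j
  using \<Psi>0 graded_mod.ncomp_zero[OF fm_graded_mod, of \<beta> j] by force
 have img_add: "x +[N] x' \<in> \<Psi> ` component (F \<beta>) j"
  if "x \<in> \<Psi> ` component (F \<beta>) j" "x' \<in> \<Psi> ` component (F \<beta>) j" for x x' j
 proof -
  obtain z z' where z: "z \<in> component (F \<beta>) j" "x = \<Psi> z" "z' \<in> component (F \<beta>) j" "x' = \<Psi> z'"
   using \<open>x \<in> _\<close> \<open>x' \<in> _\<close> by blast
  hence "x +[N] x' = \<Psi> (z +[F \<beta>] z')"
   using semihomD(2)[OF \<Psi>(1)] fm_compD(1) by metis
  thus ?thesis using graded_mod.ncomp_add[OF fm_graded_mod z(1,3)] by blast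
 qed
 have below: "\<forall>j. j < int n --> M j \<subseteq> \<Psi> ` component (F \<beta>) j" for n
 proof (induction n)
  case 0
  thus ?case using neg img_zero by fastforce
 next
  case (Suc n)
  show ?case
  proof (intro allI impI)
   fix j assume j: "j < int (Suc n)"
   show "M j \<subseteq> \<Psi> ` component (F \<beta>) j"
   proof (cases "j < int n")
    case False
    hence j: "j = int n" using j by simp
    have "asum N (G j (S j)) \<subseteq> \<Psi> ` component (F \<beta>) j"
    proof (rule asum_subset[OF _ img_zero img_add])
     show "G j (S j) \<subseteq> \<Psi> ` component (F \<beta>) j"
     proof
      fix g assume "g \<in> G j (S j)"
      then consider (a) k s where "g = N.sc k s" "k \<in>. K" "s \<in> S j"
       | (b) a x i l where "g = \<phi> a *:[N] x" "i > 0" "a \<in> component A i" "x \<in> M l" "int i + l = j"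
       unfolding G_def N.scs_def by blast
      thus "g \<in> \<Psi> ` component (F \<beta>) j"
      proof cases
       case a
       have "0 \<le> j" using j by simp
       from ysurj[OF a(3) this] obtain i where i: "\<beta> i = Some j" "y i = s" by blast
       have "g = \<Psi> (single A (k *:[A] 1[A]) i)"
        using \<Psi>s[OF i(1), of "k *:[A] 1[A]"] a i(2) \<phi>k[OF a(2)] by (simp add: N.sc_def)
       moreover have "single A (k *:[A] 1[A]) i \<in> component (F \<beta>) j"
        using single_comp[where \<beta> = \<beta> and i = i, OF comp_smult[OF a(2) one_comp] i(1)] by simp
       ultimately show ?thesis by blast
      next
       case b
       hence "l < int n" using j by simp
       then obtain z where z: "z \<in> component (F \<beta>) l" "x = \<Psi> z" using Suc.IH b(4) by blast
       have "g = \<Psi> (a *:[F \<beta>] z)"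
        using semihomD(3)[OF \<Psi>(1) comp_carrier[OF b(3)] fm_compD(1)[OF z(1)]] b(1) z(2) by simp
       thus ?thesis using graded_mod.ncomp_smult[OF fm_graded_mod b(3) z(1)] b(5) by blast
      qed
     qed
    qed
    thus ?thesis using S(3) by blast
   qed (use Suc.IH in blast)
  qed
 qed
 have "M j \<subseteq> \<Psi> ` component (F \<beta>) j" for j
  using below[of "Suc (nat j)"] by simp
 hence img: "\<Psi> ` component (F \<beta>) j = M j" for j using \<Psi>M by blast
 have min: "eps (z i0) = 0[K]" if z: "z \<in>. F \<beta>" "\<Psi> z = 0[N]" for z i0
 proof (cases "\<beta> i0")
  case None
  thus ?thesis using z(1) by (simp add: free_module_carrier)
 next
  case (Some d)
  define zd where "zd = pr \<beta> d z"
  have zd: "zd \<in> component (F \<beta>) d" unfolding zd_def by (rule pr_comp[OF z(1)])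
  have "B.pr \<gamma> (d + 0) (\<Psi> z) = \<Psi> zd"
   unfolding zd_def by (rule B.pr_hom[OF \<Psi>(1)[unfolded N_def] z(1)]) unfold_locales
  moreover have "B.pr \<gamma> (d + 0) 0[N] = 0[N]"
   using B.pr_of_comp[OF N.ncomp_zero[unfolded N_def], of d "d + 0"] by (simp add: N_def)
  ultimately have \<Psi>zd: "\<Psi> zd = 0[N]" using z(2) by simp
  have zi: "z i0 \<in>. A" using fm_coeff[OF z(1)] .
  have ez: "eps (zd i0) = eps (z i0)" using Some eps_spec[OF zi] by (simp add: zd_def pr_def)
  let ?R = "asum N (G d (S d - {y i0}))"
  have SM: "S d - {y i0} \<subseteq> M d" using S(2) by blast
  have y0: "y i0 \<in>. N" using yM[OF Some] Mc by blast
  have "\<exists>r\<in>?R. \<Psi> x = N.sc (eps (x i0)) (y i0) +[N] r" if "x \<in> component (F \<beta>) d" for x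
   using that
  proof (induction rule: fm_comp_induct)
   case zero
   show ?case using \<Psi>0 asum.zero[of N] y0 by (intro bexI[of _ "0[N]"]) (simp_all add: N.sc_zero_l)
  next
   case (single i d' k a)
   have ac: "a \<in>. A" using comp_carrier[OF single(3)] .
   have yc: "y i \<in>. N" using yM[OF single(1)] Mc by blast
   show ?case
   proof (cases "i = i0")
    case True
    hence "k = 0" using single Some by simp
    hence "a = eps a *:[A] 1[A]" using comp0E single(3) by simp
    hence "\<phi> a = eps a *:[B] 1[B]" using \<phi>k[OF eps_closed[OF ac]] by simp
    hence "\<Psi> (single A a i) = N.sc (eps a) (y i0)"
     using \<Psi>s[OF single(1) ac] True by (simp add: N.sc_def)
    thus ?thesis
     using True asum.zero[of N] N.sc_closed[OF eps_closed[OF ac] y0] by (intro bexI[of _ "0[N]"]) (simp_all add: single_def)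
   next
    case False
    have "\<phi> a *:[N] y i \<in> G d (S d - {y i0})"
    proof (cases "k = 0")
     case True
     hence d': "d' = d" using single(2) by simp
     hence "y i \<in> S d - {y i0}" using yS single(1) yinj[OF _ Some] False by auto
     moreover have "\<phi> a *:[N] y i = N.sc (eps a) (y i)"
      using comp0E[of a] single(3) True \<phi>k[OF eps_closed[OF ac]] unfolding N.sc_def by simp
     ultimately show ?thesis using eps_closed[OF ac] unfolding G_def N.scs_def by blast
    next
     case k: False
     have "int k + d' = d" using single(2) by simp
     thus ?thesis using k single(3) yM[OF single(1)] unfolding G_def by blast
    qed
    hence "\<phi> a *:[N] y i \<in> ?R" using N.N.asum_incl Gc[OF SM] by blast
    moreover have "\<Psi> (single A a i) = N.sc (eps (single A a i i0)) (y i0) +[N] (\<phi> a *:[N] y i)"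
     using False \<Psi>s[OF single(1) ac] y0 yc \<phi>c[OF ac] by (simp add: single_def N.sc_zero_l)
    ultimately show ?thesis by blast
   qed
  next
   case (add x x')
   then obtain r r' where r: "r \<in> ?R" "r' \<in> ?R" "\<Psi> x = N.sc (eps (x i0)) (y i0) +[N] r"
    "\<Psi> x' = N.sc (eps (x' i0)) (y i0) +[N] r'" by blast
   have rc: "r \<in>. N" "r' \<in>. N" using r N.N.asum_carrier[OF Gc[OF SM]] by auto
   have xc: "x i0 \<in>. A" "x' i0 \<in>. A" using add fm_coeff by blast+
   have "\<Psi> (\<lambda>i. x i +[A] x' i) = \<Psi> x +[N] \<Psi> x'" using semihomD(2)[OF \<Psi>(1) add(1,2)] by simp
   also have "\<dots> = N.sc (eps (x i0 +[A] x' i0)) (y i0) +[N] (r +[N] r')"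
    unfolding r(3,4) eps_add[OF xc] using rc y0 xc by (simp add: N.sc_add_l N.N.a_ac)
   finally show ?case using N.N.asum_add[OF Gc[OF SM] r(1,2)] by blast
  qed
  from this[OF zd] obtain r where r: "r \<in> ?R" "0[N] = N.sc (eps (z i0)) (y i0) +[N] r"
   unfolding \<Psi>zd ez by blast
  show ?thesis
  proof (rule ccontr)
   let ?k = "eps (z i0)"
   assume "?k ~= 0[K]"
   hence k: "?k \<in>. K" "inv\<^bsub>K\<^esub> ?k \<in>. K" "inv\<^bsub>K\<^esub> ?k *[K] ?k = 1[K]"
    using eps_closed[OF zi] K.field_Units by auto
   have rc: "r \<in>. N" using r(1) N.N.asum_carrier[OF Gc[OF SM]] by blast
   let ?m = "-[K] 1[K] *[K] inv\<^bsub>K\<^esub> ?k"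
   have m: "?m \<in>. K" using k by simp
   have "N.sc ?k (y i0) = -[N] r"
    using r(2) N.N.minus_equality[of "N.sc ?k (y i0)" r] k(1) y0 rc by simp
   also have "\<dots> = N.sc (-[K] 1[K]) r" using N.sc_minus[OF rc] by simp
   finally have "N.sc (inv\<^bsub>K\<^esub> ?k) (N.sc ?k (y i0)) = N.sc (inv\<^bsub>K\<^esub> ?k) (N.sc (-[K] 1[K]) r)" by simp
   hence "y i0 = N.sc (inv\<^bsub>K\<^esub> ?k *[K] -[K] 1[K]) r"
    using k y0 rc by (simp add: N.sc_assoc N.sc_one)
   hence yR: "y i0 \<in> ?R" using Rsc[OF SM _ r(1), of "inv\<^bsub>K\<^esub> ?k *[K] -[K] 1[K]"] k by simp
   have "G d (S d) \<subseteq> ?R"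
   proof
    fix g assume g: "g \<in> G d (S d)"
    show "g \<in> ?R"
    proof (cases "g \<in> G d (S d - {y i0})")
     case True
     thus ?thesis using N.N.asum_incl Gc[OF SM] by blast
    next
     case False
     then obtain l where "l \<in>. K" "g = N.sc l (y i0)" using g unfolding G_def N.scs_def by blast
     thus ?thesis using Rsc[OF SM _ yR] by simp
    qed
   qed
   hence "asum N (G d (S d)) \<subseteq> ?R" using N.N.asum_mono Gc[OF SM] by blast
   hence "card (S d) \<le> card (S d - {y i0})" using S(4)[OF _ SM] S(1,3) by blast
   moreover have "card (S d - {y i0}) < card (S d)" by (rule card_Diff1_less[OF S(1) yS[OF Some]])
   ultimately show False by simp
  qed
 qed
 show ?thesis using good \<Psi>(1) img min by blast
qed

context connected_graded_algebra
begin

definition fin_comps :: bool where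
 "fin_comps \<longleftrightarrow> (\<forall>d. \<exists>S. finite S \<and> S \<subseteq> component A d \<and>
  component A d \<subseteq> asum A {k *:[A] s | k s. k \<in>. K \<and> s \<in> S})"

text \<open>Only the finitely many generators of degree at most \<open>j\<close> contribute in degree \<open>j\<close>.\<close>
lemma fm_fdim:
 assumes fin_comps "good_gens \<beta>"
 shows "graded_mod.fdim K A (F \<beta>) (component (F \<beta>) j)"
proof -
 interpret N: graded_mod K A "F \<beta>" by (rule fm_graded_mod)
 from choice[OF assms(1)[unfolded fin_comps_def]] obtain S where
  S': "\<forall>d. finite (S d) \<and> S d \<subseteq> component A d \<and>
   component A d \<subseteq> asum A {k *:[A] s | k s. k \<in>. K \<and> s \<in> S d}" ..
 have S: "finite (S d)" "S d \<subseteq> component A d"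
  "component A d \<subseteq> asum A {k *:[A] s | k s. k \<in>. K \<and> s \<in> S d}" for d
  using S'[THEN spec[of _ d]] by simp_all
 define W where "W = (\<Union>d\<in>{0..j}. \<Union>i\<in>{i. \<beta> i = Some d}. (\<lambda>s. single A s i) ` S (nat (j - d)))"
 have "finite W" unfolding W_def using assms(2) S(1) by (auto simp: good_gens_def)
 moreover have Wj: "W \<subseteq> component (F \<beta>) j"
 proof
  fix x assume "x \<in> W"
  then obtain d i s where x: "x = single A s i" "\<beta> i = Some d" "d \<le> j" "s \<in> S (nat (j - d))"
   unfolding W_def by auto
  thus "x \<in> component (F \<beta>) j"
   using single_comp[where \<beta> = \<beta> and i = i and a = s and d = d and k = "nat (j - d)"] S(2) by auto
 qed
 moreover have "x \<in> N.lspan W" if "x \<in> component (F \<beta>) j" for x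
  using that
 proof (induction rule: fm_comp_induct)
  case zero
  show ?case using asum.zero[of "F \<beta>" "N.scs W"] by simp
 next
  case (single i d k a)
  have Wc: "N.scs W \<subseteq> carrier (F \<beta>)" using N.scs_carrier Wj N.ncomp_carrier by blast
  have sub: "{l *:[A] s | l s. l \<in>. K \<and> s \<in> S k} \<subseteq> carrier A"
   using S(2) comp_carrier by fastforce
  have "a \<in> asum A {l *:[A] s | l s. l \<in>. K \<and> s \<in> S k}" using single(3) S(3) by blast
  thus ?case
  proof induction
   case zero
   have "single A 0[A] i = (\<lambda>i. 0[A])" by (auto simp: single_def)
   thus ?case using asum.zero[of "F \<beta>" "N.scs W"] by simp
  next
   case (step g x)
   obtain l s where g: "g = l *:[A] s" "l \<in>. K" "s \<in> S k" using step.hyps(1) by blast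
   have sA: "s \<in>. A" using g(3) S(2) comp_carrier by blast
   have "0 \<le> d" "d \<le> j" "nat (j - d) = k" using single(1,2) assms(2) by (auto simp: good_gens_def)
   hence "single A s i \<in> W"
    unfolding W_def using single(1) g(3) by (intro UN_I[of d] UN_I[of i] image_eqI[of _ _ s]) auto
   moreover have "single A g i = N.sc l (single A s i)"
    using g sA scalar_mult[of l s] by (auto simp: N.sc_def single_def)
   ultimately have "single A g i \<in> N.scs W" unfolding N.scs_def using g(2) by blast
   from asum.step[OF this step.IH] have "single A g i +[F \<beta>] single A x i \<in> N.lspan W" .
   moreover have "single A g i +[F \<beta>] single A x i = single A (g +[A] x) i"
    by (auto simp: single_def)
   ultimately show ?case by simp
  qed
 next
  case (add y z)
  have Wc: "N.scs W \<subseteq> carrier (F \<beta>)" using N.scs_carrier Wj N.ncomp_carrier by blast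
  show ?case using N.N.asum_add[OF Wc add(3,4)] by simp
 qed
 ultimately show ?thesis unfolding N.fdim_def by blast
qed

lemma fin_comps_retract:
 assumes C: "connected_graded_algebra K C" "connected_graded_algebra.fin_comps K C"
  and \<iota>: "galg_hom K A C \<iota>" and \<pi>: "galg_hom K C A \<pi>" and eq: "\<And>a. a \<in>. A ==> \<pi> (\<iota> a) = a"
 shows fin_comps
 unfolding fin_comps_def
proof
 interpret C: connected_graded_algebra K C by fact
 fix d
 from C(2)[unfolded C.fin_comps_def, THEN spec[of _ d]]
 obtain S where S: "finite S" "S \<subseteq> component C d"
  "component C d \<subseteq> asum C {k *:[C] s | k s. k \<in>. K \<and> s \<in> S}"
  by (elim exE conjE)
 have Sc: "s \<in>. C" if "s \<in> S" for s using that S(2) C.comp_carrier by blast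
 let ?G = "{k *:[A] s | k s. k \<in>. K \<and> s \<in> \<pi> ` S}"
 have gen: "x \<in>. C \<and> \<pi> x \<in> asum A ?G" if "x \<in> asum C {k *:[C] s | k s. k \<in>. K \<and> s \<in> S}" for x
  using that
 proof induction
  case zero
  have "\<pi> 0[C] = 0[A]"
   by (rule additive_zero) (use galg_homD[OF \<pi>] C.A.abelian_group_axioms A.abelian_group_axioms in auto)
  thus ?case using asum.zero[of A ?G] by simp
 next
  case (step g x)
  then obtain k s where g: "g = k *:[C] s" "k \<in>. K" "s \<in> S" by blast
  have "\<pi> g \<in> ?G" using g galg_homD(5)[OF \<pi> g(2) Sc[OF g(3)]] by blast
  moreover have "g \<in>. C" using g Sc by simp
  moreover from this have "\<pi> (g +[C] x) = \<pi> g +[A] \<pi> x" using galg_homD(3)[OF \<pi>] step.IH by blast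
  ultimately show ?case using asum.step[of "\<pi> g" ?G "\<pi> x" A] step.IH by simp
 qed
 have "component A d \<subseteq> asum A ?G"
 proof
  fix a assume a: "a \<in> component A d"
  have "\<iota> a \<in> component C d" using galg_homD(6)[OF \<iota> a] .
  hence "\<pi> (\<iota> a) \<in> asum A ?G" using S(3) gen by blast
  thus "a \<in> asum A ?G" using eq comp_carrier[OF a] by simp
 qed
 moreover have "\<pi> ` S \<subseteq> component A d" using S(2) galg_homD(6)[OF \<pi>] by blast
 ultimately show "\<exists>S. finite S \<and> S \<subseteq> component A d \<and>
   component A d \<subseteq> asum A {k *:[A] s | k s. k \<in>. K \<and> s \<in> S}"
  using S(1) by blast
qed

end

text \<open>As the augmentation is onto, \<open>P 0\<close> has a generator of degree 0; the coefficient at this generator maps the components of the locally finite module \<open>P 0\<close> onto those of \<open>A\<close>.\<close>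
lemma (in resolution) resolution_fin_comps: fin_comps
 unfolding fin_comps_def
proof
 fix d
 have "\<exists>i e. gens P 0 i = Some e \<and> aug P (single A 1[A] i) ~= 0[K]"
 proof (rule ccontr)
  assume neg: "\<not> ?thesis"
  obtain y where y: "y \<in> component (T 0) 0" "aug P y = 1[K]" using aug_onto[of "1[K]" 0] by auto
  have z: "(\<lambda>x. 0[K]) \<in> semihom id A (T 0) (trivial_module K A) 0"
   using triv.semihom_const_zero[of A id "T 0" 0] by simp
  have "aug P y = 0[K]"
   by (rule fm_hom_unique[OF aug_hom z triv.N.abelian_group_axioms _ fm_compD(1)[OF y(1)]]) (use neg in blast)
  thus False using y(2) by simp
 qed
 then obtain i e where i: "gens P 0 i = Some e" "aug P (single A 1[A] i) ~= 0[K]" by blast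
 have "single A 1[A] i \<in> component (T 0) e"
  using single_comp[where i = i and \<beta> = "gens P 0", OF one_comp i(1)] by simp
 from semihomD(4)[OF aug_hom this] have e0: "e = 0" using i(2) by (auto split: if_splits)
 have "locally_finite K A (T 0)" using res unfolding free_resolution_def by blast
 hence "T.fdim 0 (component (T 0) (int d))" using T.locally_finite_iff by blast
 then obtain S where S: "finite S" "S \<subseteq> component (T 0) (int d)" "component (T 0) (int d) \<subseteq> T.lspan 0 S"
  unfolding T.fdim_def by blast
 let ?S = "(\<lambda>x. x i) ` S"
 let ?G = "{k *:[A] s | k s. k \<in>. K \<and> s \<in> ?S}"
 have SA: "?S \<subseteq> component A d"
  using S(2) fm_compD(2)[where \<beta> = "gens P 0" and m = "int d" and i = i and d = 0] i(1) e0 by auto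
 have gen: "x i \<in> asum A ?G" if "x \<in> T.lspan 0 S" for x
  using that
 proof induction
  case zero
  thus ?case using asum.zero[of A ?G] by simp
 next
  case (step g x)
  then obtain k s where g: "g = T.sc 0 k s" "k \<in>. K" "s \<in> S" unfolding T.scs_def by blast
  have "s i \<in>. A" using g(3) SA comp_carrier by blast
  hence "g i = k *:[A] s i" using g scalar_mult[of k "s i"] by (simp add: T.sc_def)
  hence "g i \<in> ?G" using g by blast
  from asum.step[OF this step.IH] show ?case by simp
 qed
 have "component A d \<subseteq> asum A ?G"
 proof
  fix a assume a: "a \<in> component A d"
  have "single A a i \<in> component (T 0) (int d)"
   using single_comp[where i = i and \<beta> = "gens P 0", OF a i(1)] e0 by simp
  hence "single A a i i \<in> asum A ?G" using S(3) gen by blast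
  thus "a \<in> asum A ?G" by (simp add: single_def)
 qed
 thus "\<exists>S. finite S \<and> S \<subseteq> component A d \<and>
   component A d \<subseteq> asum A {k *:[A] s | k s. k \<in>. K \<and> s \<in> S}"
  using S(1) SA by blast
qed

text \<open>The differential takes values in \<open>A\<^sub>+ P\<close>.\<close>
definition minimal_res where
 "minimal_res K A P \<longleftrightarrow> resolution K A P \<and> (\<forall>n. good_gens (gens P n)) \<and>
  (\<forall>n. \<forall>x\<in>carrier (term_module A P (Suc n)). \<forall>i. augmentation K A (diff P n x i) = 0[K])"

context connected_graded_algebra
begin

text \<open>Graded submodules of \<open>A\<^sub>+ F\<close>; the kernel of a minimal cover is of this kind, so that the construction can be iterated.\<close>
definition gsub :: "(nat => int option) => (nat => 'a) set => bool" where
 "gsub \<beta> N \<longleftrightarrow> N \<subseteq> carrier (F \<beta>) \<and> 0[F \<beta>] \<in> N \<and>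
  (\<forall>x\<in>N. \<forall>y\<in>N. x +[F \<beta>] y \<in> N) \<and> (\<forall>a\<in>carrier A. \<forall>x\<in>N. a *:[F \<beta>] x \<in> N) \<and>
  (\<forall>x\<in>N. \<forall>m. pr \<beta> m x \<in> N) \<and> (\<forall>x\<in>N. \<forall>i. eps (x i) = 0[K])"

lemma gsub_cover:
 assumes fin_comps "good_gens \<beta>" "gsub \<beta> N"
 shows "\<exists>\<beta>' \<Psi>. good_gens \<beta>' \<and> \<Psi> \<in> semihom id A (F \<beta>') (F \<beta>) 0 \<and> \<Psi> ` carrier (F \<beta>') = N \<and>
  gsub \<beta>' {z \<in> carrier (F \<beta>'). \<Psi> z = 0[F \<beta>]}"
proof -
 interpret N: graded_mod K A "F \<beta>" by (rule fm_graded_mod)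
 note N = assms(3)[unfolded gsub_def]
 define M where "M j = N \<inter> component (F \<beta>) j" for j
 have "N.fdim (M j)" for j
 proof -
  obtain S where S: "finite S" "S \<subseteq> component (F \<beta>) j" "component (F \<beta>) j \<subseteq> N.lspan S"
   using fm_fdim[OF assms(1,2), of j] unfolding N.fdim_def by blast
  show ?thesis
  proof (rule N.fdim_subspace[OF S(1)])
   show "S \<subseteq> carrier (F \<beta>)" using S(2) N.ncomp_carrier by blast
   show "M j \<subseteq> N.lspan S" using S(3) by (auto simp: M_def)
   show "N.sc k x \<in> M j" if "k \<in>. K" "x \<in> M j" for k x
   proof -
    have "N.sc k x \<in> N" using that N unfolding M_def N.sc_def by blast
    thus ?thesis using that N.sc_comp unfolding M_def by blast
   qed
   show "0[F \<beta>] \<in> M j" using N N.ncomp_zero unfolding M_def by blast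
   show "x +[F \<beta>] y \<in> M j" if "x \<in> M j" "y \<in> M j" for x y
    using that N N.ncomp_add unfolding M_def by blast
  qed
 qed
 hence "\<exists>\<beta>' \<Psi>. good_gens \<beta>' \<and> \<Psi> \<in> semihom id A (F \<beta>') (F \<beta>) 0 \<and>
  (\<forall>j. \<Psi> ` component (F \<beta>') j = M j) \<and>
  (\<forall>z\<in>carrier (F \<beta>'). \<Psi> z = 0[F \<beta>] --> (\<forall>i. eps (z i) = 0[K]))"
 proof (rule min_cover[OF connected_graded_algebra_axioms galg_hom_id, rotated -1])
  show "M j \<subseteq> component (F \<beta>) j" for j by (auto simp: M_def)
  show "0[F \<beta>] \<in> M j" for j using N N.ncomp_zero unfolding M_def by blast
  show "x +[F \<beta>] y \<in> M j" if "x \<in> M j" "y \<in> M j" for x y j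
   using that N N.ncomp_add unfolding M_def by blast
  show "id a *:[F \<beta>] x \<in> M (int i + j)" if "a \<in> component A i" "x \<in> M j" for a x i j
   using that N N.ncomp_smult comp_carrier unfolding M_def id_apply by blast
  show "M j \<subseteq> {0[F \<beta>]}" if j: "j < 0" for j
  proof
   fix x assume "x \<in> M j"
   hence x: "x \<in> component (F \<beta>) j" by (simp add: M_def)
   have "x i = 0[A]" for i
   proof (cases "\<beta> i")
    case None
    thus ?thesis using fm_compD(1)[OF x] by (simp add: free_module_carrier)
   next
    case (Some d)
    hence "0 \<le> d" using assms(2) by (auto simp: good_gens_def)
    thus ?thesis using fm_compD(3)[OF x Some] j by simp
   qed
   thus "x \<in> {0[F \<beta>]}" by auto
  qed
 qed
 then obtain \<beta>' \<Psi> where \<Psi>: "good_gens \<beta>'" "\<Psi> \<in> semihom id A (F \<beta>') (F \<beta>) 0"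
  and \<Psi>3: "\<forall>j. \<Psi> ` component (F \<beta>') j = M j"
  and \<Psi>4: "\<forall>z\<in>carrier (F \<beta>'). \<Psi> z = 0[F \<beta>] --> (\<forall>i. eps (z i) = 0[K])"
  by (elim exE conjE)
 have "\<Psi> z \<in> N" if "z \<in>. F \<beta>'" for z
  using that
 proof (induction rule: fm_hom_induct)
  case (hom m x)
  thus ?case using \<Psi>3[THEN spec[of _ m]] unfolding M_def by blast
 next
  case (add y z)
  have "\<Psi> (\<lambda>i. y i +[A] z i) = \<Psi> y +[F \<beta>] \<Psi> z" using semihomD(2)[OF \<Psi>(2) add(1,2)] by simp
  thus ?case using N add(3,4) by metis
 qed
 moreover have "x \<in> \<Psi> ` carrier (F \<beta>')" if x: "x \<in> N" for x
 proof (rule fm_of_parts[of x \<beta>])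
  show "x \<in>. F \<beta>" using x N by blast
  show "pr \<beta> m x \<in> \<Psi> ` carrier (F \<beta>')" for m
  proof -
   have "pr \<beta> m x \<in> M m" using x N pr_comp[of x \<beta> m] unfolding M_def by blast
   hence "pr \<beta> m x \<in> \<Psi> ` component (F \<beta>') m" using \<Psi>3 by simp
   thus ?thesis using fm_compD(1) by blast
  qed
  show "(\<lambda>i. 0[A]) \<in> \<Psi> ` carrier (F \<beta>')"
   using semihom_zero[OF fm_group fm_group \<Psi>(2)] abelian_group.axioms fm_group[of \<beta>']
   by (intro image_eqI[of _ _ "0[F \<beta>']"]) (simp_all add: free_module_carrier)
  show "\<Psi> ` carrier (F \<beta>') \<subseteq> carrier (F \<beta>)" using semihomD(1)[OF \<Psi>(2)] by blast
  fix y z assume "y \<in> \<Psi> ` carrier (F \<beta>')" "z \<in> \<Psi> ` carrier (F \<beta>')"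
  then obtain y' z' where yz: "y' \<in>. F \<beta>'" "y = \<Psi> y'" "z' \<in>. F \<beta>'" "z = \<Psi> z'" by blast
  hence "(\<lambda>i. y i +[A] z i) = \<Psi> (\<lambda>i. y' i +[A] z' i)"
   using semihomD(2)[OF \<Psi>(2) yz(1,3)] by simp
  thus "(\<lambda>i. y i +[A] z i) \<in> \<Psi> ` carrier (F \<beta>')" using fm_add_closed[OF yz(1,3)] by blast
 qed
 ultimately have img: "\<Psi> ` carrier (F \<beta>') = N" by blast
 have "gsub \<beta>' {z \<in> carrier (F \<beta>'). \<Psi> z = 0[F \<beta>]}"
  unfolding gsub_def
 proof (intro conjI ballI allI)
  interpret N': graded_mod K A "F \<beta>'" by (rule fm_graded_mod)
  let ?Z = "{z \<in> carrier (F \<beta>'). \<Psi> z = 0[F \<beta>]}"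
  show "?Z \<subseteq> carrier (F \<beta>')" by blast
  show "0[F \<beta>'] \<in> ?Z" using semihom_zero[OF fm_group fm_group \<Psi>(2)] N'.N.zero_closed by blast
  fix x assume x: "x \<in> ?Z"
  show "eps (x i) = 0[K]" for i using x \<Psi>4 by blast
  show "x +[F \<beta>'] y \<in> ?Z" if y: "y \<in> ?Z" for y
   using x y semihomD(2)[OF \<Psi>(2), of x y] N'.N.a_closed[of x y] N.N.l_zero[OF N.N.zero_closed] by simp
  show "a *:[F \<beta>'] x \<in> ?Z" if a: "a \<in>. A" for a
   using x a semihomD(3)[OF \<Psi>(2) a, of x] N'.smult_closed[OF a, of x] N.smult_zero_r[OF a] by simp
  fix m
  have "pr \<beta> (m + 0) (\<Psi> x) = \<Psi> (pr \<beta>' m x)"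
   by (rule pr_hom[OF \<Psi>(2)]) (use x in "simp_all add: connected_graded_algebra_axioms")
  moreover have "pr \<beta> (m + 0) 0[F \<beta>] = 0[F \<beta>]" using pr_of_comp[OF N.ncomp_zero[of m], of m] by simp
  moreover have "pr \<beta>' m x \<in>. F \<beta>'" using fm_compD(1)[OF pr_comp] x by blast
  ultimately show "pr \<beta>' m x \<in> ?Z" using x by simp
 qed
 thus ?thesis using \<Psi>(1,2) img by blast
qed

text \<open>Each term is a minimal cover of the kernel of the preceding differential.\<close>
lemma minimal_resolution_exists:
 assumes fc: fin_comps
 shows "\<exists>P. minimal_res K A P"
proof -
 define \<beta>0 :: "nat => int option" where "\<beta>0 = (\<lambda>i. if i = 0 then Some 0 else None)"
 define a0 where "a0 = (\<lambda>x\<in>carrier (F \<beta>0). eps (x 0))"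
 define N0 where "N0 = {x \<in> carrier (F \<beta>0). eps (x 0) = 0[K]}"
 have \<beta>00: "\<beta>0 0 = Some 0" by (simp add: \<beta>0_def)
 have good0: "good_gens \<beta>0" by (auto simp: good_gens_def \<beta>0_def)
 interpret F0: graded_mod K A "F \<beta>0" by (rule fm_graded_mod)
 have sub0: "gsub \<beta>0 N0"
  unfolding gsub_def
 proof (intro conjI ballI allI)
  show "N0 \<subseteq> carrier (F \<beta>0)" by (auto simp: N0_def)
  show "0[F \<beta>0] \<in> N0" using F0.N.zero_closed by (simp add: N0_def)
  fix x assume x: "x \<in> N0"
  hence xc: "x \<in>. F \<beta>0" "eps (x 0) = 0[K]" by (auto simp: N0_def)
  note x0 = fm_coeff[OF xc(1)]
  show "eps (x i) = 0[K]" for i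
   using xc by (cases "i = 0") (simp_all add: free_module_carrier \<beta>0_def)
  show "x +[F \<beta>0] y \<in> N0" if "y \<in> N0" for y
  proof -
   have yc: "y \<in>. F \<beta>0" "eps (y 0) = 0[K]" using that by (auto simp: N0_def)
   thus ?thesis using xc fm_add_closed[OF xc(1) yc(1)] eps_add[OF x0 fm_coeff[OF yc(1)]] by (simp add: N0_def)
  qed
  show "a *:[F \<beta>0] x \<in> N0" if a: "a \<in>. A" for a
   using fm_smult_closed[OF a xc(1)] eps_mult[OF a x0] xc(2) a by (simp add: N0_def)
  fix m
  have "eps (pr \<beta>0 m x 0) = 0[K]"
  proof (cases "0 \<le> m")
   case True
   hence p: "pr \<beta>0 m x 0 = hom_part A (x 0) (nat m)" by (simp add: pr_def \<beta>00)
   show ?thesis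
   proof (cases "nat m = 0")
    case True
    thus ?thesis using p eps_spec[OF x0] xc(2) by simp
   next
    case False
    thus ?thesis using p eps_pos[OF hom_part_comp[OF x0]] by simp
   qed
  qed (simp add: pr_def \<beta>00)
  thus "pr \<beta>0 m x \<in> N0" using fm_compD(1)[OF pr_comp[OF xc(1)]] by (simp add: N0_def)
 qed
 have a0: "a0 \<in> graded_hom A (F \<beta>0) (trivial_module K A) 0"
  unfolding graded_hom_iff
 proof
  show "a0 \<in> semihom id A (F \<beta>0) (trivial_module K A) 0"
  proof (rule semihomI)
   fix x assume x: "x \<in>. F \<beta>0"
   note x0 = fm_coeff[OF x]
   show "a0 x \<in>. trivial_module K A" using x x0 by (simp add: a0_def)
   show "a0 (x +[F \<beta>0] y) = a0 x +[trivial_module K A] a0 y" if y: "y \<in>. F \<beta>0" for y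
    using x y fm_add_closed[OF x y] eps_add[OF x0 fm_coeff[OF y]] by (simp add: a0_def)
   show "a0 (a *:[F \<beta>0] x) = id a *:[trivial_module K A] a0 x" if a: "a \<in>. A" for a
    using x fm_smult_closed[OF a x] eps_mult[OF a x0] by (simp add: a0_def eps_def)
  next
   fix j x assume x: "x \<in> component (F \<beta>0) j"
   have xc: "x \<in>. F \<beta>0" by (rule fm_compD(1)[OF x])
   have "eps (x 0) = 0[K]" if "j ~= 0"
    using fm_compD(2,3)[OF x \<beta>00] that eps_pos[of "x 0" "nat j"] by (cases "0 \<le> j") auto
   thus "a0 x \<in> component (trivial_module K A) (j + 0)"
    using xc fm_coeff[OF xc] by (simp add: a0_def)
  qed
 qed (simp add: a0_def)
 define St where "St s \<longleftrightarrow> good_gens (fst s) \<and> gsub (fst s) (snd s)" for s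
 define Rel where "Rel s s' \<longleftrightarrow> (\<exists>\<Psi>\<in>semihom id A (F (fst s')) (F (fst s)) 0.
  \<Psi> ` carrier (F (fst s')) = snd s \<and> snd s' = {z \<in> carrier (F (fst s')). \<Psi> z = 0[F (fst s)]})" for s s'
 have "\<exists>f. f 0 = (\<beta>0, N0) \<and> (\<forall>n. St (f n) \<and> Rel (f n) (f (Suc n)))"
 proof -
  have "\<exists>f. \<forall>n. (St (f n) \<and> (n = 0 --> f n = (\<beta>0, N0))) \<and> Rel (f n) (f (Suc n))"
  proof (rule dependent_nat_choice)
   show "\<exists>s. St s \<and> (0 = 0 --> s = (\<beta>0, N0))" for s using good0 sub0 by (simp add: St_def)
   fix s and n :: nat assume "St s \<and> (n = 0 --> s = (\<beta>0, N0))"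
   hence s: "good_gens (fst s)" "gsub (fst s) (snd s)" by (auto simp: St_def)
   from gsub_cover[OF fc this] obtain \<beta>' \<Psi> where c: "good_gens \<beta>'" "\<Psi> \<in> semihom id A (F \<beta>') (F (fst s)) 0"
    "\<Psi> ` carrier (F \<beta>') = snd s" "gsub \<beta>' {z \<in> carrier (F \<beta>'). \<Psi> z = 0[F (fst s)]}" by blast
   hence "St (\<beta>', {z \<in> carrier (F \<beta>'). \<Psi> z = 0[F (fst s)]}) \<and> Rel s (\<beta>', {z \<in> carrier (F \<beta>'). \<Psi> z = 0[F (fst s)]})"
    unfolding St_def Rel_def fst_conv snd_conv by blast
   thus "\<exists>s'. (St s' \<and> (Suc n = 0 --> s' = (\<beta>0, N0))) \<and> Rel s s'" by blast
  qed
  thus ?thesis by blast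
 qed
 then obtain f where f0: "f 0 = (\<beta>0, N0)" and fSt: "\<And>n. St (f n)" and fRel: "\<And>n. Rel (f n) (f (Suc n))" by blast
 define b where "b n = fst (f n)" for n
 define N where "N n = snd (f n)" for n
 have "\<forall>n. \<exists>\<Psi>. \<Psi> \<in> semihom id A (F (b (Suc n))) (F (b n)) 0 \<and> \<Psi> ` carrier (F (b (Suc n))) = N n \<and>
   N (Suc n) = {z \<in> carrier (F (b (Suc n))). \<Psi> z = 0[F (b n)]}"
  using fRel unfolding Rel_def b_def N_def by blast
 from choice[OF this] obtain \<Psi> where \<Psi>': "\<forall>n. \<Psi> n \<in> semihom id A (F (b (Suc n))) (F (b n)) 0 \<and>
   \<Psi> n ` carrier (F (b (Suc n))) = N n \<and>
   N (Suc n) = {z \<in> carrier (F (b (Suc n))). \<Psi> n z = 0[F (b n)]}" ..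
 have \<Psi>: "\<Psi> n \<in> semihom id A (F (b (Suc n))) (F (b n)) 0"
  "\<Psi> n ` carrier (F (b (Suc n))) = N n"
  "N (Suc n) = {z \<in> carrier (F (b (Suc n))). \<Psi> n z = 0[F (b n)]}" for n
  using \<Psi>'[THEN spec[of _ n]] by (blast, blast, blast)
 define P where "P = \<lparr>gens = b, diff = (\<lambda>n. restrict (\<Psi> n) (carrier (F (b (Suc n))))), aug = a0\<rparr>"
 have P: "gens P = b" "diff P = (\<lambda>n. restrict (\<Psi> n) (carrier (F (b (Suc n)))))" "aug P = a0" by (simp_all add: P_def)
 have b0: "b 0 = \<beta>0" "N 0 = N0" using f0 by (simp_all add: b_def N_def)
 have good: "good_gens (b n)" and sub: "gsub (b n) (N n)" for n using fSt[of n] by (auto simp: St_def b_def N_def)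
 have dimg: "diff P n ` carrier (F (b (Suc n))) = N n" for n
  unfolding P(2) using \<Psi>(2)[of n] by (simp add: image_def)
 have "free_resolution K A P"
  unfolding free_resolution_def P(1)
 proof (intro conjI allI)
  show "locally_finite K A (F (b n))" for n
   using graded_mod.locally_finite_iff[OF fm_graded_mod] fm_fdim[OF fc good] by blast
  show "diff P n \<in> graded_hom A (F (b (Suc n))) (F (b n)) 0" for n
   unfolding P(2) by (rule graded_mod.semihom_restrict[OF fm_graded_mod \<Psi>(1)])
  show "aug P \<in> graded_hom A (F (b 0)) (trivial_module K A) 0" unfolding P(3) b0 by (rule a0)
  have "k \<in> aug P ` carrier (F (b 0))" if k: "k \<in>. K" for k
  proof -
   have c: "single A (k *:[A] 1[A]) 0 \<in>. F \<beta>0" using single_carrier[of "k *:[A] 1[A]" \<beta>0 0 0] k \<beta>00 by simp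
   hence "a0 (single A (k *:[A] 1[A]) 0) = k" using k by (simp add: a0_def) (simp add: single_def)
   thus ?thesis unfolding P(3) b0 using c by (metis imageI)
  qed
  moreover have "aug P x \<in>. K" if "x \<in>. F (b 0)" for x
   using that fm_coeff[of x] unfolding P(3) b0 by (simp add: a0_def)
  ultimately show "aug P ` carrier (F (b 0)) = carrier K" by blast
  have "{x \<in> carrier (F (b 0)). aug P x = 0[K]} = N 0"
   unfolding P(3) b0 N0_def a0_def by auto
  thus "{x \<in> carrier (F (b 0)). aug P x = 0[K]} = diff P 0 ` carrier (F (b 1))"
   using dimg[of 0] by simp
  show "{x \<in> carrier (F (b (Suc n))). diff P n x = 0[F (b n)]} = diff P (Suc n) ` carrier (F (b (Suc (Suc n))))" for n
  proof -
   have "{x \<in> carrier (F (b (Suc n))). diff P n x = 0[F (b n)]} = N (Suc n)"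
    unfolding \<Psi>(3) P(2) by auto
   thus ?thesis using dimg by simp
  qed
 qed
 moreover have "eps (diff P n x i) = 0[K]" if "x \<in>. F (b (Suc n))" for n x i
  using dimg[of n] sub[of n] that unfolding gsub_def by blast
 ultimately show ?thesis
  unfolding minimal_res_def resolution_def resolution_axioms_def
  using good connected_graded_algebra_axioms by (auto simp: P(1) eps_def)
qed

end

section \<open>Linear contractions of resolutions\<close>

text \<open>The field as a graded algebra. A minimal cover over it is a basis of a graded vector space.\<close>
definition scalar_algebra :: "'k ring => (nat, 'k, 'k) graded_module" where
 "scalar_algebra K = \<lparr>carrier = carrier K, mult = mult K, one = one K, zero = zero K, add = add K,
   smult = mult K, component = (\<lambda>d. if d = 0 then carrier K else {0[K]})\<rparr>"

lemma scalar_algebra_simps [simp]: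
 "carrier (scalar_algebra K) = carrier K" "x *[scalar_algebra K] y = x *[K] y"
 "1[scalar_algebra K] = 1[K]" "0[scalar_algebra K] = 0[K]"
 "x +[scalar_algebra K] y = x +[K] y" "k *:[scalar_algebra K] x = k *[K] x"
 "component (scalar_algebra K) d = (if d = 0 then carrier K else {0[K]})"
 by (simp_all add: scalar_algebra_def)

lemma scalar_algebra_connected:
 assumes "field K"
 shows "connected_graded_algebra K (scalar_algebra K)"
proof -
 interpret K: field K by fact
 let ?S = "scalar_algebra K"
 have ring: "ring ?S"
 proof (rule ringI)
  show "abelian_group ?S"
   by (rule abelian_groupI) (auto simp: K.a_ac intro: bexI[of _ "-[K] _"] K.l_neg)
  show "Group.monoid ?S" by (rule monoidI) (auto simp: K.m_assoc)
 qed (auto simp: K.l_distr K.r_distr)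
 interpret S: ring ?S by (rule ring)
 have mod: "module K ?S"
  by (rule moduleI) (auto simp: K.cring_axioms S.abelian_group_axioms K.l_distr K.r_distr K.m_assoc)
 have neg: "-[?S] x = -[K] x" if "x \<in>. K" for x
  using S.minus_equality[of "-[K] x" x] that by (simp add: K.l_neg)
 have sub: "submodule (component ?S i) K ?S" for i
  by (rule module.submoduleI[OF mod]) (auto simp: neg split: if_splits)
 have "is_grading ?S"
  unfolding is_grading_def
 proof (intro conjI allI ballI)
  fix i show "additive_subgroup (component ?S i) ?S"
   using submodule.axioms(1)[OF sub] by (simp add: additive_subgroup_def)
 next
  fix x assume "x \<in>. ?S"
  hence x: "x \<in>. K" by simp
  show "\<exists>!c. decomposes ?S x c"
  proof (rule ex1I)
   let ?c = "\<lambda>i::nat. if i = 0 then x else 0[K]"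
   have "finite {i. ?c i ~= 0[?S]}" by (rule finite_subset[of _ "{0}"]) auto
   moreover have "finsum ?S ?c {i. ?c i ~= 0[?S]} = finsum ?S ?c {0}"
    by (rule S.finsum_superset) (use x in auto)
   moreover have "finsum ?S ?c {0} = x" using x by simp
   ultimately show "decomposes ?S x ?c" using x unfolding decomposes_def by simp
   fix c assume c: "decomposes ?S x c"
   hence ci: "c i \<in> component ?S i" and xc: "x = finsum ?S c {i. c i ~= 0[?S]}" for i
    unfolding decomposes_def by blast+
   have c0: "c i = 0[K]" if "i ~= 0" for i using ci[of i] that by simp
   have c00: "c 0 \<in>. K" using ci[of 0] by simp
   have "finsum ?S c {i. c i ~= 0[?S]} = finsum ?S c {0}"
    by (rule S.finsum_superset) (use c0 c00 in auto)
   hence "x = c 0" using xc c00 by simp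
   thus "c = ?c" using c0 by auto
  qed
 qed
 thus ?thesis
 proof (intro connected_graded_algebra.intro assms ring mod sub)
  show "component ?S 0 = (\<lambda>k. k *:[?S] 1[?S]) ` carrier K" by (force simp: image_iff)
 qed (auto simp: K.m_assoc K.m_lcomm split: if_splits)
qed

definition klin where
 "klin K A M N = {f. (\<forall>x\<in>carrier M. f x \<in>. N) \<and>
  (\<forall>x\<in>carrier M. \<forall>y\<in>carrier M. f (x +[M] y) = f x +[N] f y) \<and>
  (\<forall>k\<in>carrier K. \<forall>x\<in>carrier M. f ((k *:[A] 1[A]) *:[M] x) = (k *:[A] 1[A]) *:[N] f x) \<and>
  (\<forall>j. \<forall>x\<in>component M j. f x \<in> component N j)}"

lemma klinD:
 assumes "f \<in> klin K A M N"
 shows "x \<in>. M ==> f x \<in>. N"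
  and "x \<in>. M ==> y \<in>. M ==> f (x +[M] y) = f x +[N] f y"
  and "k \<in>. K ==> x \<in>. M ==> f ((k *:[A] 1[A]) *:[M] x) = (k *:[A] 1[A]) *:[N] f x"
  and "x \<in> component M j ==> f x \<in> component N j"
 using assms unfolding klin_def by blast+

lemma klinI:
 assumes "\<And>x. x \<in>. M ==> f x \<in>. N"
  and "\<And>x y. x \<in>. M ==> y \<in>. M ==> f (x +[M] y) = f x +[N] f y"
  and "\<And>k x. k \<in>. K ==> x \<in>. M ==> f ((k *:[A] 1[A]) *:[M] x) = (k *:[A] 1[A]) *:[N] f x"
  and "\<And>j x. x \<in> component M j ==> f x \<in> component N j"
 shows "f \<in> klin K A M N"
 using assms unfolding klin_def by blast

text \<open>A minimal cover of \<open>F \<beta>\<close> over the field is bijective, since an element of its kernel has all coefficients 0. So \<open>F \<beta>\<close> is free over \<open>K\<close>, and \<open>lift_step\<close> applies.\<close>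
lemma (in connected_graded_algebra) klin_lift:
 assumes fc: fin_comps and good: "good_gens \<beta>"
  and N': "graded_mod K A N'" and N: "graded_mod K A N"
  and d: "d \<in> semihom id A N' N 0" and f: "f \<in> klin K A (F \<beta>) N"
  and ex: "\<And>j x. x \<in> component (F \<beta>) j ==> \<exists>y\<in>component N' j. d y = f x"
 shows "\<exists>g\<in>klin K A (F \<beta>) N'. \<forall>x\<in>carrier (F \<beta>). d (g x) = f x"
proof -
 let ?S = "scalar_algebra K"
 interpret S: connected_graded_algebra K ?S by (rule scalar_algebra_connected[OF field])
 interpret M: graded_mod K A "F \<beta>" by (rule fm_graded_mod)
 interpret N': graded_mod K A N' by fact
 interpret N: graded_mod K A N by fact
 define u where "u k = k *:[A] 1[A]" for k
 have u: "galg_hom K ?S A u"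
  unfolding galg_hom_def
 proof (intro conjI ballI allI)
  show "u \<in> ring_hom ?S A"
  proof (rule ring_hom_memI)
   fix x y assume "x \<in>. ?S" "y \<in>. ?S"
   thus "u (x *[?S] y) = u x *[A] u y" "u (x +[?S] y) = u x +[A] u y"
    by (simp_all add: u_def scalar_mult KA.smult_assoc1 KA.smult_l_distr)
  qed (simp_all add: u_def)
  show "u ` component ?S i \<subseteq> component A i" for i
   using comp_smult[OF _ one_comp] by (auto simp: u_def)
 qed (simp add: u_def KA.smult_assoc1)
 have Seps: "S.eps k = k" if "k \<in>. K" for k using S.eps_scalar[of k] that by simp
 have "\<exists>\<gamma> \<Psi>. good_gens \<gamma> \<and> \<Psi> \<in> semihom u ?S (S.F \<gamma>) (F \<beta>) 0 \<and>
  (\<forall>j. \<Psi> ` component (S.F \<gamma>) j = component (F \<beta>) j) \<and>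
  (\<forall>z\<in>carrier (S.F \<gamma>). \<Psi> z = 0[F \<beta>] --> (\<forall>i. S.eps (z i) = 0[K]))"
 proof (rule S.min_cover[OF connected_graded_algebra_axioms u])
  show "u a *:[F \<beta>] x \<in> component (F \<beta>) (int i + j)" if "a \<in> component ?S i" "x \<in> component (F \<beta>) j" for a x i j
   by (rule M.ncomp_smult[OF galg_homD(6)[OF u that(1)] that(2)])
  show "component (F \<beta>) j \<subseteq> {0[F \<beta>]}" if j: "j < 0" for j
  proof
   fix x assume x: "x \<in> component (F \<beta>) j"
   have "x i = 0[A]" for i
   proof (cases "\<beta> i")
    case None
    thus ?thesis using fm_compD(1)[OF x] by (simp add: free_module_carrier)
   next
    case (Some d)
    hence "0 \<le> d" using good by (auto simp: good_gens_def)
    thus ?thesis using fm_compD(3)[OF x Some] j by simp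
   qed
   thus "x \<in> {0[F \<beta>]}" by auto
  qed
 qed (use M.ncomp_zero M.ncomp_add fm_fdim[OF fc good] in blast)+
 then obtain \<gamma> \<Psi> where \<Psi>: "\<Psi> \<in> semihom u ?S (S.F \<gamma>) (F \<beta>) 0"
  and img: "\<forall>j. \<Psi> ` component (S.F \<gamma>) j = component (F \<beta>) j"
  and min: "\<forall>z\<in>carrier (S.F \<gamma>). \<Psi> z = 0[F \<beta>] --> (\<forall>i. S.eps (z i) = 0[K])"
  by (elim exE conjE)
 interpret D: graded_mod K ?S "S.F \<gamma>" by (rule S.fm_graded_mod)
 have \<Psi>0: "z = 0[S.F \<gamma>]" if z: "z \<in>. S.F \<gamma>" "\<Psi> z = 0[F \<beta>]" for z
 proof
  fix i
  have "z i \<in>. K" using S.fm_coeff[OF z(1)] by simp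
  moreover have "S.eps (z i) = 0[K]" using min z by blast
  ultimately show "z i = 0[S.F \<gamma>] i" using Seps by simp
 qed
 have inj: "z = z'" if z: "z \<in>. S.F \<gamma>" "z' \<in>. S.F \<gamma>" "\<Psi> z = \<Psi> z'" for z z'
 proof -
  have "\<Psi> (z +[S.F \<gamma>] -[S.F \<gamma>] z') = \<Psi> z +[F \<beta>] -[F \<beta>] \<Psi> z'"
   using semihomD(2)[OF \<Psi> z(1) D.N.a_inv_closed[OF z(2)]] semihom_neg[OF S.fm_group fm_group \<Psi> z(2)] by metis
  also have "\<dots> = 0[F \<beta>]" unfolding z(3) by (rule M.N.r_neg[OF semihomD(1)[OF \<Psi> z(2)]])
  finally have "z +[S.F \<gamma>] -[S.F \<gamma>] z' = 0[S.F \<gamma>]"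
   using \<Psi>0 D.N.a_closed[OF z(1) D.N.a_inv_closed[OF z(2)]] by blast
  thus ?thesis
   using D.N.minus_equality[OF _ D.N.a_inv_closed[OF z(2)] z(1)] D.N.minus_minus[OF z(2)] by metis
 qed
 have surj: "\<exists>z\<in>carrier (S.F \<gamma>). \<Psi> z = x" if "x \<in>. F \<beta>" for x
  using that
 proof (induction rule: fm_hom_induct)
  case (hom m x)
  hence "x \<in> \<Psi> ` component (S.F \<gamma>) m" using img by blast
  thus ?case using fm_compD(1) by blast
 next
  case (add x y)
  then obtain z z' where z: "z \<in>. S.F \<gamma>" "\<Psi> z = x" "z' \<in>. S.F \<gamma>" "\<Psi> z' = y" by blast
  have "\<Psi> (z +[S.F \<gamma>] z') = (\<lambda>i. x i +[A] y i)" using semihomD(2)[OF \<Psi> z(1,3)] z by simp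
  thus ?case using D.N.a_closed[OF z(1,3)] by blast
 qed
 define \<Theta> where "\<Theta> x = (SOME z. z \<in>. S.F \<gamma> \<and> \<Psi> z = x)" for x
 have \<Theta>: "\<Theta> x \<in>. S.F \<gamma>" "\<Psi> (\<Theta> x) = x" if "x \<in>. F \<beta>" for x
  using someI_ex[of "\<lambda>z. z \<in>. S.F \<gamma> \<and> \<Psi> z = x"] surj[OF that] unfolding \<Theta>_def by blast+
 have \<Theta>eq: "\<Theta> x = z" if "z \<in>. S.F \<gamma>" "\<Psi> z = x" for x z
  using inj \<Theta>[of x] that semihomD(1)[OF \<Psi>] by metis
 have f\<Psi>: "(\<lambda>z. f (\<Psi> z)) \<in> semihom u ?S (S.F \<gamma>) N 0"
 proof (rule semihomI)
  fix z assume z: "z \<in>. S.F \<gamma>"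
  show "f (\<Psi> z) \<in>. N" using klinD(1)[OF f semihomD(1)[OF \<Psi> z]] .
  show "f (\<Psi> (z +[S.F \<gamma>] z')) = f (\<Psi> z) +[N] f (\<Psi> z')" if z': "z' \<in>. S.F \<gamma>" for z'
   using semihomD(2)[OF \<Psi> z z'] klinD(2)[OF f semihomD(1)[OF \<Psi> z] semihomD(1)[OF \<Psi> z']] by metis
  show "f (\<Psi> (a *:[S.F \<gamma>] z)) = u a *:[N] f (\<Psi> z)" if a: "a \<in>. ?S" for a
   using semihomD(3)[OF \<Psi> a z] klinD(3)[OF f _ semihomD(1)[OF \<Psi> z], of a] a unfolding u_def by simp
 next
  fix j z assume z: "z \<in> component (S.F \<gamma>) j"
  have "\<Psi> z \<in> component (F \<beta>) j" using semihomD(4)[OF \<Psi> z] by simp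
  thus "f (\<Psi> z) \<in> component N (j + 0)" using klinD(4)[OF f] by simp
 qed
 have "\<exists>g\<in>semihom u ?S (S.F \<gamma>) N' 0. \<forall>z\<in>carrier (S.F \<gamma>). d (g z) = f (\<Psi> z)"
 proof (rule S.lift_step[OF N' N u d f\<Psi>])
  fix j z assume z: "z \<in> component (S.F \<gamma>) j"
  have "\<Psi> z \<in> component (F \<beta>) j" using semihomD(4)[OF \<Psi> z] by simp
  from ex[OF this] show "\<exists>y\<in>component N' (j + 0). d y = f (\<Psi> z)" by simp
 qed
 then obtain g where g: "g \<in> semihom u ?S (S.F \<gamma>) N' 0" "\<And>z. z \<in>. S.F \<gamma> ==> d (g z) = f (\<Psi> z)" by blast
 have "(\<lambda>x. g (\<Theta> x)) \<in> klin K A (F \<beta>) N'"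
 proof (rule klinI)
  fix x assume x: "x \<in>. F \<beta>"
  show "g (\<Theta> x) \<in>. N'" by (rule semihomD(1)[OF g(1) \<Theta>(1)[OF x]])
  show "g (\<Theta> (x +[F \<beta>] y)) = g (\<Theta> x) +[N'] g (\<Theta> y)" if y: "y \<in>. F \<beta>" for y
  proof -
   have "\<Theta> (x +[F \<beta>] y) = \<Theta> x +[S.F \<gamma>] \<Theta> y"
    by (rule \<Theta>eq[OF D.N.a_closed[OF \<Theta>(1)[OF x] \<Theta>(1)[OF y]]])
     (simp only: semihomD(2)[OF \<Psi> \<Theta>(1)[OF x] \<Theta>(1)[OF y]] \<Theta>(2)[OF x] \<Theta>(2)[OF y])
   thus ?thesis using semihomD(2)[OF g(1) \<Theta>(1)[OF x] \<Theta>(1)[OF y]] by simp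
  qed
  show "g (\<Theta> ((k *:[A] 1[A]) *:[F \<beta>] x)) = (k *:[A] 1[A]) *:[N'] g (\<Theta> x)" if k: "k \<in>. K" for k
  proof -
   have k': "k \<in>. ?S" using k by simp
   have "\<Theta> (u k *:[F \<beta>] x) = k *:[S.F \<gamma>] \<Theta> x"
    by (rule \<Theta>eq[OF D.smult_closed[OF k' \<Theta>(1)[OF x]]])
     (simp only: semihomD(3)[OF \<Psi> k' \<Theta>(1)[OF x]] \<Theta>(2)[OF x])
   hence "g (\<Theta> (u k *:[F \<beta>] x)) = u k *:[N'] g (\<Theta> x)"
    using semihomD(3)[OF g(1) k' \<Theta>(1)[OF x]] by metis
   thus ?thesis unfolding u_def .
  qed
 next
  fix j x assume x: "x \<in> component (F \<beta>) j"
  have "component (F \<beta>) j = \<Psi> ` component (S.F \<gamma>) j" using img by simp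
  hence "x \<in> \<Psi> ` component (S.F \<gamma>) j" using x by blast
  then obtain z where z: "z \<in> component (S.F \<gamma>) j" "\<Psi> z = x" by blast
  have "\<Theta> x = z" by (rule \<Theta>eq[OF fm_compD(1)[OF z(1)] z(2)])
  thus "g (\<Theta> x) \<in> component N' j" using semihomD(4)[OF g(1) z(1)] by simp
 qed
 moreover have "\<forall>x\<in>carrier (F \<beta>). d (g (\<Theta> x)) = f x"
  using g(2)[OF \<Theta>(1)] \<Theta>(2) by simp
 ultimately show ?thesis by (intro bexI[where x = "\<lambda>x. g (\<Theta> x)"])
qed

text \<open>The map \<open>s n\<close> is a linear lift of \<open>x \<mapsto> x - s (n - 1) (d x)\<close> along the differential; this map takes cycles as values because of the identity for \<open>n - 1\<close>. In degree 0 the role of \<open>s (n - 1) \<circ> d\<close> is played by \<open>x \<mapsto> aug P x e\<close>.\<close>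
lemma (in resolution) contraction_exists:
 assumes good: "\<And>n. good_gens (gens P n)"
 shows "\<exists>s e. e \<in> component (T 0) 0 \<and> aug P e = 1[K] \<and> (\<forall>n. s n \<in> klin K A (T n) (T (Suc n))) \<and>
  (\<forall>x\<in>carrier (T 0). diff P 0 (s 0 x) +[T 0] T.sc 0 (aug P x) e = x) \<and>
  (\<forall>n. \<forall>x\<in>carrier (T (Suc n)). diff P (Suc n) (s (Suc n) x) +[T (Suc n)] s n (diff P n x) = x)"
proof -
 note fc = resolution_fin_comps
 obtain e where e: "e \<in> component (T 0) 0" "aug P e = 1[K]" using aug_onto[of "1[K]" 0] by auto
 have ec: "e \<in>. T 0" by (rule fm_compD(1)[OF e(1)])
 have augK: "aug P x \<in>. K" if "x \<in>. T 0" for x using semihomD(1)[OF aug_hom that] by simp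
 have aug_sc: "aug P (T.sc 0 k x) = k *[K] aug P x" if "k \<in>. K" "x \<in>. T 0" for k x
  using semihomD(3)[OF aug_hom _ that(2), of "k *:[A] 1[A]"] that eps_scalar[OF that(1)]
  by (simp add: T.sc_def eps_def)
 have cancel: "u +[T n] v = x" if "u = x +[T n] -[T n] v" "x \<in>. T n" "v \<in>. T n" for u v x n
  using that T.N.a_assoc T.N.a_inv_closed T.N.l_neg T.N.r_zero by metis
 have klin_id_minus: "(\<lambda>x. x +[T n] -[T n] h x) \<in> klin K A (T n) (T n)"
  if h: "h \<in> klin K A (T n) (T n)" for h n
 proof (rule klinI)
  fix x assume x: "x \<in>. T n"
  note hx = klinD(1)[OF h x]
  show "x +[T n] -[T n] h x \<in>. T n" by (rule T.N.a_closed[OF x T.N.a_inv_closed[OF hx]])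
  show "(x +[T n] y) +[T n] -[T n] h (x +[T n] y) = (x +[T n] -[T n] h x) +[T n] (y +[T n] -[T n] h y)"
   if y: "y \<in>. T n" for y
   unfolding klinD(2)[OF h x y] T.N.minus_add[OF hx klinD(1)[OF h y]]
   using x y hx klinD(1)[OF h y] T.N.a_inv_closed T.N.a_closed T.N.a_assoc T.N.a_lcomm by metis
  show "(k *:[A] 1[A]) *:[T n] x +[T n] -[T n] h ((k *:[A] 1[A]) *:[T n] x) =
    (k *:[A] 1[A]) *:[T n] (x +[T n] -[T n] h x)" if k: "k \<in>. K" for k
  proof -
   have kA: "k *:[A] 1[A] \<in>. A" using k by simp
   show ?thesis
    unfolding klinD(3)[OF h k x] T.smult_r_distr[OF kA x T.N.a_inv_closed[OF hx]] T.smult_neg[OF kA hx] ..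
  qed
 next
  fix j x assume "x \<in> component (T n) j"
  thus "x +[T n] -[T n] h x \<in> component (T n) j"
   using T.ncomp_add T.ncomp_neg klinD(4)[OF h] by blast
 qed
 define R where "R n s \<longleftrightarrow> s \<in> klin K A (T n) (T (Suc n)) \<and>
  (\<forall>x\<in>carrier (T (Suc n)). diff P n (s (diff P n x)) = diff P n x) \<and>
  (n = 0 --> (\<forall>x\<in>carrier (T 0). diff P 0 (s x) +[T 0] T.sc 0 (aug P x) e = x))" for n s
 have "\<exists>s. R 0 s"
 proof -
  define h where "h x = T.sc 0 (aug P x) e" for x
  have h: "h \<in> klin K A (T 0) (T 0)"
  proof (rule klinI)
   fix x assume x: "x \<in>. T 0"
   show "h x \<in>. T 0" unfolding h_def by (rule T.sc_closed[OF augK[OF x] ec])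
   show "h (x +[T 0] y) = h x +[T 0] h y" if y: "y \<in>. T 0" for y
    using semihomD(2)[OF aug_hom x y] T.sc_add_l[OF augK[OF x] augK[OF y] ec] unfolding h_def by simp
   show "h ((k *:[A] 1[A]) *:[T 0] x) = (k *:[A] 1[A]) *:[T 0] h x" if k: "k \<in>. K" for k
    using aug_sc[OF k x] T.sc_assoc[OF k augK[OF x] ec] unfolding h_def T.sc_def[of 0 k] by simp
  next
   fix j x assume x: "x \<in> component (T 0) j"
   show "h x \<in> component (T 0) j"
   proof (cases "j = 0")
    case True
    thus ?thesis unfolding h_def using T.sc_comp[OF augK[OF fm_compD(1)[OF x]] e(1)] by simp
   next
    case False
    hence "aug P x = 0[K]" using semihomD(4)[OF aug_hom x] by simp
    hence "h x = 0[T 0]" unfolding h_def using T.sc_zero_l[OF ec] by simp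
    thus ?thesis using T.ncomp_zero by simp
   qed
  qed
  have "\<exists>s\<in>klin K A (T 0) (T (Suc 0)). \<forall>x\<in>carrier (T 0). diff P 0 (s x) = x +[T 0] -[T 0] h x"
  proof (rule klin_lift[OF fc good fm_graded_mod fm_graded_mod d_hom klin_id_minus[OF h]])
   fix j x assume x: "x \<in> component (T 0) j"
   have xc: "x \<in>. T 0" by (rule fm_compD(1)[OF x])
   have hx: "h x \<in>. T 0" by (rule klinD(1)[OF h xc])
   have "aug P (h x) = aug P x" unfolding h_def using aug_sc[OF augK[OF xc] ec] e(2) augK[OF xc] by simp
   hence "aug P (x +[T 0] -[T 0] h x) = 0[K]"
    using semihomD(2)[OF aug_hom xc T.N.a_inv_closed[OF hx]]
     semihom_neg[OF fm_group triv.N.abelian_group_axioms aug_hom hx] tm_uminus[OF augK[OF xc]] augK[OF xc]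
    by (simp add: K.r_neg)
   thus "\<exists>y\<in>component (T (Suc 0)) j. diff P 0 y = x +[T 0] -[T 0] h x"
    by (intro exact0 klinD(4)[OF klin_id_minus[OF h] x])
  qed
  then obtain s where s: "s \<in> klin K A (T 0) (T (Suc 0))"
   "\<And>x. x \<in>. T 0 ==> diff P 0 (s x) = x +[T 0] -[T 0] h x" by blast
  have a: "diff P 0 (s x) +[T 0] T.sc 0 (aug P x) e = x" if x: "x \<in>. T 0" for x
   using cancel[OF s(2)[OF x] x klinD(1)[OF h x]] unfolding h_def .
  have "diff P 0 (s (diff P 0 x)) = diff P 0 x" if x: "x \<in>. T (Suc 0)" for x
  proof -
   have "T.sc 0 (aug P (diff P 0 x)) e = 0[T 0]" using aug_d[OF x] T.sc_zero_l[OF ec] by simp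
   thus ?thesis
    using a[OF d_closed[OF x]] T.N.r_zero[OF d_closed[OF klinD(1)[OF s(1) d_closed[OF x]]]] by metis
  qed
  hence "R 0 s" unfolding R_def using s(1) a by blast
  thus ?thesis by blast
 qed
 moreover have "\<exists>s'. R (Suc n) s' \<and> (\<forall>x\<in>carrier (T (Suc n)). diff P (Suc n) (s' x) +[T (Suc n)] s (diff P n x) = x)"
  if R: "R n s" for n s
 proof -
  have s: "s \<in> klin K A (T n) (T (Suc n))"
   and sd: "\<And>x. x \<in>. T (Suc n) ==> diff P n (s (diff P n x)) = diff P n x"
   using R unfolding R_def by blast+
  define h where "h x = s (diff P n x)" for x
  have h: "h \<in> klin K A (T (Suc n)) (T (Suc n))"
  proof (rule klinI)
   fix x assume x: "x \<in>. T (Suc n)"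
   note dx = d_closed[OF x]
   show "h x \<in>. T (Suc n)" unfolding h_def by (rule klinD(1)[OF s dx])
   show "h (x +[T (Suc n)] y) = h x +[T (Suc n)] h y" if y: "y \<in>. T (Suc n)" for y
    unfolding h_def semihomD(2)[OF d_hom x y] by (rule klinD(2)[OF s dx d_closed[OF y]])
   show "h ((k *:[A] 1[A]) *:[T (Suc n)] x) = (k *:[A] 1[A]) *:[T (Suc n)] h x" if k: "k \<in>. K" for k
   proof -
    have kA: "k *:[A] 1[A] \<in>. A" using k by simp
    show ?thesis unfolding h_def semihomD(3)[OF d_hom kA x] id_apply by (rule klinD(3)[OF s k dx])
   qed
  next
   fix j x assume x: "x \<in> component (T (Suc n)) j"
   have "diff P n x \<in> component (T n) j" using semihomD(4)[OF d_hom x] by simp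
   thus "h x \<in> component (T (Suc n)) j" unfolding h_def by (rule klinD(4)[OF s])
  qed
  have "\<exists>s'\<in>klin K A (T (Suc n)) (T (Suc (Suc n))).
    \<forall>x\<in>carrier (T (Suc n)). diff P (Suc n) (s' x) = x +[T (Suc n)] -[T (Suc n)] h x"
  proof (rule klin_lift[OF fc good fm_graded_mod fm_graded_mod d_hom klin_id_minus[OF h]])
   fix j x assume x: "x \<in> component (T (Suc n)) j"
   have xc: "x \<in>. T (Suc n)" by (rule fm_compD(1)[OF x])
   have hx: "h x \<in>. T (Suc n)" by (rule klinD(1)[OF h xc])
   have "diff P n (x +[T (Suc n)] -[T (Suc n)] h x) = diff P n x +[T n] -[T n] diff P n x"
    unfolding semihomD(2)[OF d_hom xc T.N.a_inv_closed[OF hx]] semihom_neg[OF fm_group fm_group d_hom hx]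
    unfolding h_def sd[OF xc] ..
   also have "\<dots> = 0[T n]" by (rule T.N.r_neg[OF d_closed[OF xc]])
   finally show "\<exists>y\<in>component (T (Suc (Suc n))) j. diff P (Suc n) y = x +[T (Suc n)] -[T (Suc n)] h x"
    by (intro exact klinD(4)[OF klin_id_minus[OF h] x])
  qed
  then obtain s' where s': "s' \<in> klin K A (T (Suc n)) (T (Suc (Suc n)))"
   "\<And>x. x \<in>. T (Suc n) ==> diff P (Suc n) (s' x) = x +[T (Suc n)] -[T (Suc n)] h x" by blast
  have a: "diff P (Suc n) (s' x) +[T (Suc n)] s (diff P n x) = x" if x: "x \<in>. T (Suc n)" for x
   using cancel[OF s'(2)[OF x] x klinD(1)[OF h x]] unfolding h_def .
  have sz: "s 0[T n] = 0[T (Suc n)]"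
   by (rule additive_zero[OF fm_group fm_group]) (use klinD[OF s] in blast)+
  have "diff P (Suc n) (s' (diff P (Suc n) x)) = diff P (Suc n) x" if x: "x \<in>. T (Suc (Suc n))" for x
   using a[OF d_closed[OF x]] sz d_d[OF x]
    T.N.r_zero[OF d_closed[OF klinD(1)[OF s'(1) d_closed[OF x]]]] by metis
  hence "R (Suc n) s'" unfolding R_def using s'(1) by blast
  thus ?thesis using a by blast
 qed
 ultimately obtain s where s: "\<And>n. R n (s n)"
  "\<And>n. \<forall>x\<in>carrier (T (Suc n)). diff P (Suc n) (s (Suc n) x) +[T (Suc n)] s n (diff P n x) = x"
  using dependent_nat_choice[of R "\<lambda>n s s'. \<forall>x\<in>carrier (T (Suc n)). diff P (Suc n) (s' x) +[T (Suc n)] s (diff P n x) = x"]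
  by blast
 have "\<forall>n. s n \<in> klin K A (T n) (T (Suc n))"
  "\<forall>x\<in>carrier (T 0). diff P 0 (s 0 x) +[T 0] T.sc 0 (aug P x) e = x"
  using s(1) unfolding R_def by blast+
 thus ?thesis using e s(2) by blast
qed

section \<open>The twisted tensor product\<close>

lemma (in abelian_group) finsum_Sigma:
 assumes "finite I" "\<And>i. i \<in> I ==> finite (J i)" "\<And>i j. i \<in> I ==> j \<in> J i ==> f i j \<in>. G"
 shows "finsum G (\<lambda>(i, j). f i j) (Sigma I J) = finsum G (\<lambda>i. finsum G (f i) (J i)) I"
 using assms
proof (induction I rule: finite_induct)
 case (insert i I)
 have eq: "Sigma (insert i I) J = (Pair i ` J i) \<union> Sigma I J" by auto
 have f: "f i \<in> J i \<rightarrow> carrier G" using insert.prems(2) by auto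
 have "finsum G (\<lambda>(i, j). f i j) (Sigma (insert i I) J) =
   finsum G (\<lambda>(i, j). f i j) (Pair i ` J i) \<oplus> finsum G (\<lambda>(i, j). f i j) (Sigma I J)"
  unfolding eq by (rule finsum_Un_disjoint) (use insert in auto)
 also have "finsum G (\<lambda>(i, j). f i j) (Pair i ` J i) = finsum G (\<lambda>j. f i j) (J i)"
  by (subst finsum_reindex) (use f in "auto simp: inj_on_def")
 also have "finsum G (\<lambda>(i, j). f i j) (Sigma I J) = finsum G (\<lambda>i. finsum G (f i) (J i)) I"
  using insert by simp
 also have "finsum G (f i) (J i) \<oplus> finsum G (\<lambda>i. finsum G (f i) (J i)) I = finsum G (\<lambda>i. finsum G (f i) (J i)) (insert i I)"
  by (rule finsum_insert[symmetric]) (use insert f in "auto intro!: finsum_closed")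
 finally show ?case .
qed simp

text \<open>The projections \<open>p n\<close> compute the parts of every decomposition, which gives uniqueness.\<close>
lemma is_gradingI:
 assumes "abelian_group M" and sub: "\<And>i. additive_subgroup (component M i) M"
  and p: "\<And>n x. x \<in>. M ==> p n x \<in>. M"
   "\<And>n x y. x \<in>. M ==> y \<in>. M ==> p n (x +[M] y) = p n x +[M] p n y"
   "\<And>n m x. x \<in> component M m ==> p n x = (if n = m then x else 0[M])"
  and gen: "\<And>x. x \<in>. M ==> x \<in> asum M (\<Union>i. component M i)"
 shows "is_grading M"
 unfolding is_grading_def
proof (intro conjI allI ballI sub)
 interpret M: abelian_group M by fact
 have cc: "x \<in>. M" if "x \<in> component M i" for x i
  using that additive_subgroup.a_subset[OF sub] by blast
 have cz: "0[M] \<in> component M i" for i using additive_subgroup.zero_closed[OF sub] .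
 fix x assume "x \<in>. M"
 from gen[OF this] have "\<exists>c. decomposes M x c"
 proof induction
  case zero
  thus ?case using cz by (intro exI[of _ "\<lambda>i. 0[M]"]) (simp add: decomposes_def)
 next
  case (step g x)
  obtain m where g: "g \<in> component M m" using step.hyps(1) by blast
  obtain c where c: "\<And>i. c i \<in> component M i" "finite {i. c i ~= 0[M]}" "x = finsum M c {i. c i ~= 0[M]}"
   using step.IH unfolding decomposes_def by blast
  let ?e = "\<lambda>i. if i = m then g else 0[M]"
  let ?J = "insert m {i. c i ~= 0[M]}"
  have ec: "?e i \<in> component M i" for i using g cz by auto
  have s: "?e i +[M] c i \<in> component M i" for i using additive_subgroup.a_closed[OF sub ec c(1)] .
  have cM: "c i \<in>. M" "?e i \<in>. M" for i using cc[OF c(1)] cc[OF ec] by blast+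
  have J: "finite ?J" "{i. ?e i +[M] c i ~= 0[M]} \<subseteq> ?J" using c(2) by auto
  have h1: "finsum M ?e {m} = finsum M ?e ?J" by (rule M.finsum_superset) (use J cM(2) in auto)
  have h2: "finsum M ?e {m} = g" using cc[OF g] by simp
  have h3: "finsum M c {i. c i ~= 0[M]} = finsum M c ?J"
   by (rule M.finsum_superset) (use J cM(1) in auto)
  have h4: "finsum M (\<lambda>i. ?e i +[M] c i) ?J = finsum M ?e ?J +[M] finsum M c ?J"
   by (rule M.finsum_addf) (use cM(1) cc[OF g] in auto)
  have h5: "finsum M (\<lambda>i. ?e i +[M] c i) {i. ?e i +[M] c i ~= 0[M]} = finsum M (\<lambda>i. ?e i +[M] c i) ?J"
   by (rule M.finsum_superset[OF J]) (use cM(1) cc[OF g] in auto)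
  have "g +[M] x = finsum M (\<lambda>i. ?e i +[M] c i) {i. ?e i +[M] c i ~= 0[M]}"
   unfolding h5 h4 h1[symmetric] h2 h3[symmetric] c(3)[symmetric] ..
  hence "decomposes M (g +[M] x) (\<lambda>i. ?e i +[M] c i)"
   unfolding decomposes_def using s finite_subset[OF J(2,1)] by blast
  thus ?case by blast
 qed
 moreover have "c = (\<lambda>n. p n x)" if c: "decomposes M x c" for c
 proof
  fix n
  let ?J = "insert n {i. c i ~= 0[M]}"
  have c': "\<And>i. c i \<in> component M i" "finite ?J" "x = finsum M c {i. c i ~= 0[M]}"
   using c unfolding decomposes_def by auto
  have cM: "c i \<in>. M" for i using cc[OF c'(1)] .
  have "x = finsum M c ?J" unfolding c'(3)
   by (rule M.finsum_superset) (use c'(2) cM in auto)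
  hence "p n x = p n (finsum M c ?J)" by simp
  also have "\<dots> = finsum M (\<lambda>i. p n (c i)) ?J"
   by (rule additive_finsum[OF assms(1) assms(1) c'(2)]) (use p(1,2) cM in auto)
  also have "\<dots> = finsum M (\<lambda>i. p n (c i)) {n}"
   by (rule M.finsum_superset[symmetric]) (use c'(2) cM p(1) p(3)[OF c'(1)] in auto)
  also have "\<dots> = c n" using p(3)[OF c'(1), of n n] cM by simp
  finally show "c n = p n x" ..
 qed
 ultimately show "\<exists>!c. decomposes M x c" by blast
qed

locale twisted = A: connected_graded_algebra K A + B: connected_graded_algebra K B
 for K :: "'k ring" and A :: "(nat, 'k, 'a) graded_module" and B :: "(nat, 'k, 'b) graded_module" +
 fixes \<sigma> :: "'a => 'a"
 assumes sigma: "\<sigma> \<in> graded_alg_iso K A A"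
begin

abbreviation "FS \<equiv> formal_sums K (carrier B \<times> carrier A)"
abbreviation "BS \<equiv> bilinear_span K B A"
abbreviation "T \<equiv> tensor_space K B A"
abbreviation "C \<equiv> twisted_tensor K B \<sigma> A"
abbreviation pt (infixl "\<diamondop>" 75) where "b \<diamondop> a \<equiv> pure_tensor K B A b a"
abbreviation "ev b a \<equiv> basis_vector K (b, a)"

lemma FS_simps:
 "f \<in>. FS \<longleftrightarrow> (\<forall>s. f s \<in>. K) \<and> finite {s. f s ~= 0[K]} \<and>
  (\<forall>s. s \<notin> carrier B \<times> carrier A --> f s = 0[K])"
 "0[FS] = (\<lambda>s. 0[K])" "f +[FS] g = (\<lambda>s. f s +[K] g s)" "k *:[FS] f = (\<lambda>s. k *[K] f s)"
 by (simp_all add: formal_sums_def)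

lemma FS_add_closed:
 assumes "f \<in>. FS" "g \<in>. FS"
 shows "(\<lambda>s. f s +[K] g s) \<in>. FS"
proof -
 have "{s. f s +[K] g s ~= 0[K]} \<subseteq> {s. f s ~= 0[K]} \<union> {s. g s ~= 0[K]}" by auto
 moreover have "finite ({s. f s ~= 0[K]} \<union> {s. g s ~= 0[K]})" using assms unfolding FS_simps by simp
 ultimately have "finite {s. f s +[K] g s ~= 0[K]}" by (rule finite_subset)
 thus ?thesis using assms unfolding FS_simps by simp
qed

lemma FS_smult_closed:
 assumes "k \<in>. K" "f \<in>. FS"
 shows "(\<lambda>s. k *[K] f s) \<in>. FS"
proof -
 have "{s. k *[K] f s ~= 0[K]} \<subseteq> {s. f s ~= 0[K]}" using assms(1) by auto
 moreover have "finite {s. f s ~= 0[K]}" using assms unfolding FS_simps by simp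
 ultimately have "finite {s. k *[K] f s ~= 0[K]}" by (rule finite_subset)
 thus ?thesis using assms unfolding FS_simps by simp
qed

lemma FS_coeff: "f \<in>. FS ==> f s \<in>. K"
 unfolding FS_simps by blast

lemma FS_supp:
 assumes "f \<in>. FS" "f s ~= 0[K]"
 shows "fst s \<in>. B" "snd s \<in>. A"
proof -
 have "s \<in> carrier B \<times> carrier A" using assms unfolding FS_simps by blast
 thus "fst s \<in>. B" "snd s \<in>. A" by auto
qed

lemma FS_module: "module K FS"
proof (rule moduleI)
 show "cring K" by (rule A.K.cring_axioms)
 show "abelian_group FS"
 proof (rule abelian_groupI)
  fix f g assume f: "f \<in>. FS" and g: "g \<in>. FS"
  show "f +[FS] g \<in>. FS" using FS_add_closed[OF f g] by (simp only: FS_simps(3))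
  show "f +[FS] g = g +[FS] f"
   unfolding FS_simps(3) by (intro ext A.K.a_comm FS_coeff f g)
  fix h assume h: "h \<in>. FS"
  show "f +[FS] g +[FS] h = f +[FS] (g +[FS] h)"
   unfolding FS_simps(3) by (intro ext A.K.a_assoc FS_coeff f g h)
 next
  show "0[FS] \<in>. FS" unfolding FS_simps by simp
  fix f assume f: "f \<in>. FS"
  show "0[FS] +[FS] f = f" unfolding FS_simps(2,3) by (intro ext A.K.l_zero FS_coeff f)
  have "(\<lambda>s. -[K] 1[K] *[K] f s) \<in>. FS" by (rule FS_smult_closed[OF _ f]) simp
  moreover have "(\<lambda>s. -[K] 1[K] *[K] f s) +[FS] f = 0[FS]"
   unfolding FS_simps(2,3) using FS_coeff[OF f] by (simp add: A.K.l_minus A.K.l_neg)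
  ultimately show "\<exists>g\<in>carrier FS. g +[FS] f = 0[FS]" by blast
 qed
 fix a f assume a: "a \<in>. K" and f: "f \<in>. FS"
 show "a *:[FS] f \<in>. FS" using FS_smult_closed[OF a f] by (simp only: FS_simps(4))
 show "(a +[K] b) *:[FS] f = a *:[FS] f +[FS] b *:[FS] f" "(a *[K] b) *:[FS] f = a *:[FS] (b *:[FS] f)"
  if b: "b \<in>. K" for b
  unfolding FS_simps(3,4) using a b FS_coeff[OF f] by (simp_all add: A.K.l_distr A.K.m_assoc)
 show "a *:[FS] (f +[FS] g) = a *:[FS] f +[FS] a *:[FS] g" if g: "g \<in>. FS" for g
  unfolding FS_simps(3,4) using a FS_coeff[OF f] FS_coeff[OF g] by (simp add: A.K.r_distr)
next
 fix f assume f: "f \<in>. FS"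
 show "1[K] *:[FS] f = f" unfolding FS_simps(4) using FS_coeff[OF f] by simp
qed

sublocale FS: module K FS by (rule FS_module)

lemma ev_closed: "b \<in>. B ==> a \<in>. A ==> ev b a \<in>. FS"
 unfolding FS_simps by (auto simp: basis_vector_def)

lemma relations_closed: "bilinear_relations K B A \<subseteq> carrier FS"
 unfolding bilinear_relations_def Let_def
 by (auto intro!: FS.M.minus_closed FS.M.a_closed FS.smult_closed ev_closed)

lemma BS_submodule: "submodule BS K FS"
proof -
 have full: "submodule (carrier FS) K FS"
  by (rule FS.submoduleI) auto
 show ?thesis
  unfolding bilinear_span_def submodule_span_def
 proof (rule FS.submoduleI)
  show "\<Inter> {N. bilinear_relations K B A \<subseteq> N \<and> submodule N K FS} \<subseteq> carrier FS"
   using full relations_closed by blast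
  show "0[FS] \<in> \<Inter> {N. bilinear_relations K B A \<subseteq> N \<and> submodule N K FS}"
   using subgroup.one_closed[OF submodule.axioms(1)] by fastforce
 next
  fix x assume x: "x \<in> \<Inter> {N. bilinear_relations K B A \<subseteq> N \<and> submodule N K FS}"
  show "-[FS] x \<in> \<Inter> {N. bilinear_relations K B A \<subseteq> N \<and> submodule N K FS}"
  proof (rule InterI, elim CollectE conjE)
   fix N assume "bilinear_relations K B A \<subseteq> N" "submodule N K FS"
   thus "-[FS] x \<in> N" using x by (intro FS.submoduleE(3)) auto
  qed
  show "k *:[FS] x \<in> \<Inter> {N. bilinear_relations K B A \<subseteq> N \<and> submodule N K FS}" if "k \<in>. K" for k
  proof (rule InterI, elim CollectE conjE)
   fix N assume "bilinear_relations K B A \<subseteq> N" "submodule N K FS"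
   thus "k *:[FS] x \<in> N" using x that by (intro FS.submoduleE(4)) auto
  qed
  fix y assume y: "y \<in> \<Inter> {N. bilinear_relations K B A \<subseteq> N \<and> submodule N K FS}"
  show "x +[FS] y \<in> \<Inter> {N. bilinear_relations K B A \<subseteq> N \<and> submodule N K FS}"
  proof (rule InterI, elim CollectE conjE)
   fix N assume "bilinear_relations K B A \<subseteq> N" "submodule N K FS"
   thus "x +[FS] y \<in> N" using x y by (intro FS.submoduleE(5)) auto
  qed
 qed
qed

sublocale q: quotient K FS BS
 unfolding quotient_def using FS_module BS_submodule by blast

lemma T_eq: "T = quotient_module FS BS"
 by (simp add: tensor_space_def)

sublocale T: module K T
 unfolding T_eq by (rule q.quotient_is_module)

lemma pt_eq: "b \<diamondop> a = q.cls (ev b a)"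
 by (simp add: pure_tensor_def)

lemma BS_rel: "x \<in> bilinear_relations K B A ==> x \<in> BS"
 unfolding bilinear_span_def submodule_span_def by blast

lemma pt_closed [simp]: "b \<in>. B ==> a \<in>. A ==> b \<diamondop> a \<in>. T"
 unfolding T_eq q.carrier_Q pt_eq using ev_closed by blast

lemma pt_add_l:
 assumes "b \<in>. B" "b' \<in>. B" "a \<in>. A"
 shows "(b +[B] b') \<diamondop> a = b \<diamondop> a +[T] b' \<diamondop> a"
proof -
 have "ev (b +[B] b') a -[FS] (ev b a +[FS] ev b' a) \<in> BS"
  by (rule BS_rel) (use assms in "unfold bilinear_relations_def Let_def, blast")
 thus ?thesis
  unfolding T_eq pt_eq q.cls_add[OF ev_closed[OF assms(1,3)] ev_closed[OF assms(2,3)]]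
  using q.cls_eq_iff[OF ev_closed[OF B.A.a_closed[OF assms(1,2)] assms(3)]
   FS.M.a_closed[OF ev_closed[OF assms(1,3)] ev_closed[OF assms(2,3)]]] by blast
qed

lemma pt_add_r:
 assumes "b \<in>. B" "a \<in>. A" "a' \<in>. A"
 shows "b \<diamondop> (a +[A] a') = b \<diamondop> a +[T] b \<diamondop> a'"
proof -
 have "ev b (a +[A] a') -[FS] (ev b a +[FS] ev b a') \<in> BS"
  by (rule BS_rel) (use assms in "unfold bilinear_relations_def Let_def, blast")
 thus ?thesis
  unfolding T_eq pt_eq q.cls_add[OF ev_closed[OF assms(1,2)] ev_closed[OF assms(1,3)]]
  using q.cls_eq_iff[OF ev_closed[OF assms(1) A.A.a_closed[OF assms(2,3)]]
   FS.M.a_closed[OF ev_closed[OF assms(1,2)] ev_closed[OF assms(1,3)]]] by blast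
qed

lemma pt_smult_l:
 assumes "k \<in>. K" "b \<in>. B" "a \<in>. A"
 shows "(k *:[B] b) \<diamondop> a = k *:[T] (b \<diamondop> a)"
proof -
 have "ev (k *:[B] b) a -[FS] (k *:[FS] ev b a) \<in> BS"
  by (rule BS_rel) (use assms in "unfold bilinear_relations_def Let_def, blast")
 thus ?thesis
  unfolding T_eq pt_eq q.cls_smult[OF assms(1) ev_closed[OF assms(2,3)]]
  using q.cls_eq_iff[OF ev_closed[OF B.KA.smult_closed[OF assms(1,2)] assms(3)]
   FS.smult_closed[OF assms(1) ev_closed[OF assms(2,3)]]] by blast
qed

lemma pt_smult_r:
 assumes "k \<in>. K" "b \<in>. B" "a \<in>. A"
 shows "b \<diamondop> (k *:[A] a) = k *:[T] (b \<diamondop> a)"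
proof -
 have "ev b (k *:[A] a) -[FS] (k *:[FS] ev b a) \<in> BS"
  by (rule BS_rel) (use assms in "unfold bilinear_relations_def Let_def, blast")
 thus ?thesis
  unfolding T_eq pt_eq q.cls_smult[OF assms(1) ev_closed[OF assms(2,3)]]
  using q.cls_eq_iff[OF ev_closed[OF assms(2) A.KA.smult_closed[OF assms(1,3)]]
   FS.smult_closed[OF assms(1) ev_closed[OF assms(2,3)]]] by blast
qed

lemma T_expand:
 assumes "f \<in>. FS"
 shows "q.cls f = (\<Oplus>\<^bsub>T\<^esub>s\<in>{s. f s ~= 0[K]}. f s *:[T] (fst s \<diamondop> snd s))"
proof -
 have s: "fst s \<in>. B \<and> snd s \<in>. A" if "f s ~= 0[K]" for s
  using FS_supp[OF assms that] by blast
 have "q.cls (\<lambda>s. if s \<in> J then f s else 0[K]) = (\<Oplus>\<^bsub>T\<^esub>s\<in>J. f s *:[T] (fst s \<diamondop> snd s))"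
  if "finite J" "J \<subseteq> {s. f s ~= 0[K]}" for J
  using that
 proof (induction J rule: finite_induct)
  case empty
  have "q.cls (\<lambda>s. 0[K]) = 0[T]" using q.cls_zero unfolding T_eq FS_simps(2) .
  thus ?case by simp
 next
  case (insert t J)
  obtain b a where t: "t = (b, a)" by (cases t)
  have ba: "b \<in>. B" "a \<in>. A" using s[of t] insert.prems t by auto
  have ft: "f t \<in>. K" by (rule FS_coeff[OF assms])
  have c1: "(\<lambda>s. if s \<in> J then f s else 0[K]) \<in>. FS"
   unfolding FS_simps(1)
   by (intro conjI allI rev_finite_subset[OF insert.hyps(1)]) (use assms in "auto simp: FS_simps(1)")
  have c2: "f t *:[FS] ev b a \<in>. FS" by (rule FS.smult_closed[OF ft ev_closed[OF ba]])
  have "(\<lambda>s. if s \<in> insert t J then f s else 0[K]) = f t *:[FS] ev b a +[FS] (\<lambda>s. if s \<in> J then f s else 0[K])"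
   unfolding FS_simps(3,4) using insert.hyps(2) t FS_coeff[OF assms] by (auto simp: basis_vector_def)
  hence "q.cls (\<lambda>s. if s \<in> insert t J then f s else 0[K]) =
    f t *:[T] (b \<diamondop> a) +[T] q.cls (\<lambda>s. if s \<in> J then f s else 0[K])"
   unfolding T_eq pt_eq q.cls_smult[OF ft ev_closed[OF ba]] q.cls_add[OF c2 c1] by simp
  also have "\<dots> = (\<Oplus>\<^bsub>T\<^esub>s\<in>insert t J. f s *:[T] (fst s \<diamondop> snd s))"
  proof -
   have "(\<Oplus>\<^bsub>T\<^esub>s\<in>insert t J. f s *:[T] (fst s \<diamondop> snd s)) =
     f t *:[T] (fst t \<diamondop> snd t) +[T] (\<Oplus>\<^bsub>T\<^esub>s\<in>J. f s *:[T] (fst s \<diamondop> snd s))"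
    by (rule T.M.finsum_insert[OF insert.hyps])
     (use insert.prems s FS_coeff[OF assms] in "auto intro!: T.smult_closed pt_closed")
   thus ?thesis using insert t by simp
  qed
  finally show ?case .
 qed
 from this[of "{s. f s ~= 0[K]}"]
 have "q.cls (\<lambda>s. if s \<in> {s. f s ~= 0[K]} then f s else 0[K]) = (\<Oplus>\<^bsub>T\<^esub>s\<in>{s. f s ~= 0[K]}. f s *:[T] (fst s \<diamondop> snd s))"
  using assms unfolding FS_simps(1) by blast
 moreover have "(\<lambda>s. if s \<in> {s. f s ~= 0[K]} then f s else 0[K]) = f" by auto
 ultimately show ?thesis by simp
qed

lemma T_induct [consumes 1, case_names pure add]:
 assumes "X \<in>. T" and pure: "\<And>i j b a. b \<in> component B i ==> a \<in> component A j ==> Q (b \<diamondop> a)"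
  and add: "\<And>X Y. X \<in>. T ==> Y \<in>. T ==> Q X ==> Q Y ==> Q (X +[T] Y)"
 shows "Q X"
proof -
 have ba: "Q (b \<diamondop> a)" if a: "a \<in>. A" and b: "b \<in>. B" for b a
  using b
 proof (induction rule: B.graded_induct)
  case (hom i b)
  note bi = this
  note b = B.comp_carrier[OF bi]
  show ?case
   using a
  proof (induction rule: A.graded_induct)
   case (hom j a)
   thus ?case using pure bi by blast
  next
   case (add x y)
   thus ?case using pt_add_r[OF b add(1,2)] assms(3) pt_closed[OF b] by simp
  qed
 next
  case (add x y)
  thus ?case using pt_add_l[OF add(1,2) a] assms(3) pt_closed[OF _ a] by simp
 qed
 obtain f where f: "f \<in>. FS" "X = q.cls f" using assms(1) unfolding T_eq q.carrier_Q by blast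
 have z: "Q 0[T]"
  using ba[OF A.A.zero_closed B.A.zero_closed] pt_smult_l[OF A.K.zero_closed B.A.zero_closed A.A.zero_closed] by simp
 have "X \<in> {X \<in> carrier T. Q X}"
  unfolding f(2) T_expand[OF f(1)]
 proof (rule T.M.finsum_in_closed)
  show "finite {s. f s ~= 0[K]}" using f(1) unfolding FS_simps by blast
  fix s assume "s \<in> {s. f s ~= 0[K]}"
  hence s: "fst s \<in>. B" "snd s \<in>. A"
   using FS_supp[OF f(1)] by blast+
  have fs: "f s \<in>. K" by (rule FS_coeff[OF f(1)])
  have "f s *:[T] (fst s \<diamondop> snd s) = (f s *:[B] fst s) \<diamondop> snd s" using pt_smult_l[OF fs s] by simp
  thus "f s *:[T] (fst s \<diamondop> snd s) \<in> {X \<in> carrier T. Q X}"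
   using ba s fs by simp
 qed (use z assms(3) in auto)
 thus ?thesis by blast
qed

text \<open>A formal sum of pairs is sent to the sum of the values of \<open>\<psi>\<close>. The formal sums all of whose scalar multiples are sent to zero form a submodule, and it contains the bilinear relations.\<close>
lemma tensor_lift:
 assumes N: "abelian_group N" and c: "\<And>b a. b \<in>. B ==> a \<in>. A ==> \<psi> b a \<in>. N"
  and al: "\<And>b b' a. b \<in>. B ==> b' \<in>. B ==> a \<in>. A ==> \<psi> (b +[B] b') a = \<psi> b a +[N] \<psi> b' a"
  and ar: "\<And>b a a'. b \<in>. B ==> a \<in>. A ==> a' \<in>. A ==> \<psi> b (a +[A] a') = \<psi> b a +[N] \<psi> b a'"
  and bal: "\<And>k b a. k \<in>. K ==> b \<in>. B ==> a \<in>. A ==> \<psi> (k *:[B] b) a = \<psi> b (k *:[A] a)"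
 shows "\<exists>L. (\<forall>X\<in>carrier T. L X \<in>. N) \<and> (\<forall>X\<in>carrier T. \<forall>Y\<in>carrier T. L (X +[T] Y) = L X +[N] L Y) \<and>
  (\<forall>b\<in>carrier B. \<forall>a\<in>carrier A. L (b \<diamondop> a) = \<psi> b a)"
proof -
 interpret N: abelian_group N by fact
 define t where "t f s = \<psi> (f s *:[B] fst s) (snd s)" for f and s :: "'b \<times> 'a"
 define L0 where "L0 f = finsum N (t f) {s. f s ~= 0[K]}" for f
 have supp: "fst s \<in>. B" "snd s \<in>. A" if "f \<in>. FS" "f s ~= 0[K]" for f s
  using FS_supp[OF that] by blast+
 have \<psi>0: "\<psi> 0[B] a = 0[N]" if "a \<in>. A" for a
  by (rule additive_zero[OF B.A.abelian_group_axioms N]) (use c al that in auto)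
 have tc: "t f s \<in>. N" if "f \<in>. FS" "fst s \<in>. B" "snd s \<in>. A" for f s
  unfolding t_def using c FS_coeff[OF that(1)] that by simp
 have L0J: "L0 f = finsum N (t f) J"
  if "f \<in>. FS" "finite J" "{s. f s ~= 0[K]} \<subseteq> J" "J \<subseteq> carrier B \<times> carrier A" for f J
  unfolding L0_def
  by (rule N.finsum_superset[OF that(2,3)]) (use that(4) tc[OF that(1)] \<psi>0 in "auto simp: t_def")
 have L0c: "L0 f \<in>. N" if "f \<in>. FS" for f
  unfolding L0_def using tc[OF that] supp[OF that] by (intro N.finsum_closed) auto
 have L0add: "L0 (f +[FS] g) = L0 f +[N] L0 g" if f: "f \<in>. FS" and g: "g \<in>. FS" for f g
 proof -
  let ?J = "{s. f s ~= 0[K]} \<union> {s. g s ~= 0[K]}"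
  have J: "finite ?J" "?J \<subseteq> carrier B \<times> carrier A" using f g unfolding FS_simps by auto
  have s: "{s. (f +[FS] g) s ~= 0[K]} \<subseteq> ?J" unfolding FS_simps(3) by auto
  have tt: "t (f +[FS] g) s = t f s +[N] t g s" if "s \<in> ?J" for s
  proof -
   have sc: "fst s \<in>. B" "snd s \<in>. A" using that J(2) by auto
   show ?thesis unfolding t_def FS_simps(3)
    using sc FS_coeff[OF f] FS_coeff[OF g] by (simp add: B.KA.smult_l_distr al)
  qed
  have "L0 (f +[FS] g) = finsum N (t (f +[FS] g)) ?J" by (rule L0J[OF FS.M.a_closed[OF f g] J(1) s J(2)])
  also have "\<dots> = finsum N (\<lambda>s. t f s +[N] t g s) ?J"
   by (rule N.finsum_cong') (use tt tc[OF f] tc[OF g] J(2) in auto)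
  also have "\<dots> = finsum N (t f) ?J +[N] finsum N (t g) ?J"
   by (rule N.finsum_addf) (use tc[OF f] tc[OF g] J(2) in auto)
  also have "\<dots> = L0 f +[N] L0 g" using L0J[OF f J(1) Un_upper1 J(2)] L0J[OF g J(1) Un_upper2 J(2)] by simp
  finally show ?thesis .
 qed
 have L0ev: "L0 (k *:[FS] ev b a) = \<psi> (k *:[B] b) a" if k: "k \<in>. K" "b \<in>. B" "a \<in>. A" for k b a
 proof -
  have "L0 (k *:[FS] ev b a) = finsum N (t (k *:[FS] ev b a)) {(b, a)}"
   by (rule L0J[OF FS.smult_closed[OF k(1) ev_closed[OF k(2,3)]]]) (use k in "auto simp: FS_simps(4) basis_vector_def")
  also have "\<dots> = t (k *:[FS] ev b a) (b, a)"
   using tc[OF FS.smult_closed[OF k(1) ev_closed[OF k(2,3)]], of "(b, a)"] k by simp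
  finally show ?thesis using k by (simp add: t_def FS_simps(4) basis_vector_def)
 qed
 \<comment> \<open>Quantifying over \<open>k\<close> makes this a submodule although \<open>N\<close> carries no scalars.\<close>
 define W where "W = {f \<in> carrier FS. \<forall>k\<in>carrier K. L0 (k *:[FS] f) = 0[N]}"
 have Lk: "L0 (k *:[FS] (f +[FS] g)) = L0 (k *:[FS] f) +[N] L0 (k *:[FS] g)"
  if "k \<in>. K" "f \<in>. FS" "g \<in>. FS" for k f g
  unfolding FS.smult_r_distr[OF that] by (rule L0add[OF FS.smult_closed[OF that(1,2)] FS.smult_closed[OF that(1,3)]])
 have Lkc: "L0 (k *:[FS] f) \<in>. N" if "k \<in>. K" "f \<in>. FS" for k f
  by (rule L0c[OF FS.smult_closed[OF that]])
 have Lkneg: "L0 (k *:[FS] (-[FS] f)) = -[N] L0 (k *:[FS] f)" if "k \<in>. K" "f \<in>. FS" for k f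
  by (rule additive_neg[where f = "\<lambda>f. L0 (k *:[FS] f)", OF FS.M.abelian_group_axioms N])
   (use Lk Lkc that in blast)+
 have Lkz: "L0 (k *:[FS] 0[FS]) = 0[N]" if "k \<in>. K" for k
  by (rule additive_zero[where f = "\<lambda>f. L0 (k *:[FS] f)", OF FS.M.abelian_group_axioms N])
   (use Lk Lkc that in blast)+
 have Wsub: "submodule W K FS"
 proof (rule FS.submoduleI)
  show "W \<subseteq> carrier FS" by (auto simp: W_def)
  show "0[FS] \<in> W" using Lkz by (simp add: W_def)
  show "-[FS] f \<in> W" if "f \<in> W" for f
   using that Lkneg FS.M.a_inv_closed N.add.inv_one unfolding W_def by simp
  show "f +[FS] g \<in> W" if "f \<in> W" "g \<in> W" for f g
   using that Lk FS.M.a_closed unfolding W_def by simp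
  show "l *:[FS] f \<in> W" if "l \<in>. K" "f \<in> W" for l f
   using that FS.smult_assoc1[symmetric] FS.smult_closed unfolding W_def by simp
 qed
 have diffW: "f -[FS] g \<in> W" if "f \<in>. FS" "g \<in>. FS"
  "\<And>k. k \<in>. K ==> L0 (k *:[FS] f) = L0 (k *:[FS] g)" for f g
  unfolding W_def FS.M.minus_eq
  using that Lk[OF _ that(1) FS.M.a_inv_closed[OF that(2)]] Lkneg[OF _ that(2)] N.r_neg[OF Lkc[OF _ that(2)]]
   FS.M.a_closed[OF that(1) FS.M.a_inv_closed[OF that(2)]] by simp
 have "bilinear_relations K B A \<subseteq> W"
  unfolding bilinear_relations_def Let_def
 proof (intro Un_least subsetI; elim CollectE exE conjE; hypsubst)
  fix b b' a assume h: "b \<in>. B" "b' \<in>. B" "a \<in>. A"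
  show "ev (b +[B] b') a -[FS] (ev b a +[FS] ev b' a) \<in> W"
   by (rule diffW) (use h ev_closed in "simp_all add: Lk L0ev B.KA.smult_r_distr al")
 next
  fix b a a' assume h: "b \<in>. B" "a \<in>. A" "a' \<in>. A"
  show "ev b (a +[A] a') -[FS] (ev b a +[FS] ev b a') \<in> W"
   by (rule diffW) (use h ev_closed in "simp_all add: Lk L0ev ar")
 next
  fix k b a assume h: "k \<in>. K" "b \<in>. B" "a \<in>. A"
  show "ev (k *:[B] b) a -[FS] k *:[FS] ev b a \<in> W"
   by (rule diffW) (use h ev_closed in "simp_all add: L0ev flip: FS.smult_assoc1 B.KA.smult_assoc1")
  show "ev b (k *:[A] a) -[FS] k *:[FS] ev b a \<in> W"
  proof (rule diffW)
   fix l assume l: "l \<in>. K"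
   have "L0 (l *:[FS] ev b (k *:[A] a)) = \<psi> (l *:[B] b) (k *:[A] a)" using L0ev[OF l h(2)] h by simp
   also have "\<dots> = \<psi> (k *:[B] (l *:[B] b)) a" using bal[OF h(1) _ h(3)] l h(2) by simp
   also have "k *:[B] (l *:[B] b) = (l *[K] k) *:[B] b"
    using l h by (simp add: A.K.m_comm flip: B.KA.smult_assoc1)
   also have "\<psi> ((l *[K] k) *:[B] b) a = L0 (l *:[FS] (k *:[FS] ev b a))"
    using L0ev[of "l *[K] k" b a] l h FS.smult_assoc1[OF l h(1) ev_closed[OF h(2,3)]] by simp
   finally show "L0 (l *:[FS] ev b (k *:[A] a)) = L0 (l *:[FS] (k *:[FS] ev b a))" .
  qed (use h ev_closed in auto)
 qed
 hence SW: "BS \<subseteq> W" unfolding bilinear_span_def submodule_span_def using Wsub by blast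
 have BS0: "L0 f = 0[N]" if "f \<in> BS" for f
 proof -
  have f: "f \<in>. FS" "L0 (1[K] *:[FS] f) = 0[N]"
   using subsetD[OF SW that] A.K.one_closed unfolding W_def by blast+
  thus ?thesis by (simp only: FS.smult_one)
 qed
 define L where "L X = L0 (SOME f. f \<in> X)" for X
 have Lcls: "L (q.cls f) = L0 f" if f: "f \<in>. FS" for f
 proof -
  let ?g = "SOME g. g \<in> q.cls f"
  have "?g \<in> q.cls f" using someI[of "\<lambda>g. g \<in> q.cls f", OF q.cls_self[OF f]] .
  hence g: "?g \<in>. FS" "q.cls ?g = q.cls f" using q.cls_mem[OF f] by blast+
  hence d: "?g -[FS] f \<in> BS" using q.cls_eq_iff[OF g(1) f] by blast
  have "L0 ?g = L0 ((?g -[FS] f) +[FS] f)"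
   using g(1) f by (simp add: FS.M.minus_eq FS.M.a_assoc FS.M.l_neg)
  also have "\<dots> = L0 f" using L0add[OF FS.M.minus_closed[OF g(1) f] f] BS0[OF d] L0c[OF f] by simp
  finally show ?thesis unfolding L_def .
 qed
 have "L X \<in>. N" if "X \<in>. T" for X
  using that Lcls L0c unfolding T_eq q.carrier_Q by auto
 moreover have "L (X +[T] Y) = L X +[N] L Y" if X: "X \<in>. T" and Y: "Y \<in>. T" for X Y
 proof -
  obtain f g where f: "f \<in>. FS" "X = q.cls f" and g: "g \<in>. FS" "Y = q.cls g"
   using X Y unfolding T_eq q.carrier_Q by blast
  have "X +[T] Y = q.cls (f +[FS] g)" unfolding f(2) g(2) T_eq by (rule q.cls_add[OF f(1) g(1)])
  thus ?thesis using Lcls[OF FS.M.a_closed[OF f(1) g(1)]] Lcls[OF f(1)] Lcls[OF g(1)] L0add[OF f(1) g(1)] f(2) g(2) by simp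
 qed
 moreover have "L (b \<diamondop> a) = \<psi> b a" if "b \<in>. B" "a \<in>. A" for b a
  unfolding pt_eq using Lcls[OF ev_closed[OF that]] L0ev[OF A.K.one_closed that] FS.smult_one[OF ev_closed[OF that]] that by simp
 ultimately show ?thesis by blast
qed

end

context twisted
begin

lemma sigma_hom: "galg_hom K A A \<sigma>"
 using sigma unfolding graded_alg_iso_def galg_hom_def ring_iso_def by auto

lemma sigma_pow_hom: "galg_hom K A A (\<sigma> ^^ n)"
proof (induction n)
 case (Suc n)
 show ?case unfolding funpow.simps by (rule galg_hom_comp[OF Suc sigma_hom])
qed (use galg_hom_id in "simp add: id_def")

lemma sigma_bij: "bij_betw \<sigma> (carrier A) (carrier A)"
 using sigma unfolding graded_alg_iso_def ring_iso_def by auto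

definition \<tau> where "\<tau> = inv_into (carrier A) \<sigma>"

lemma tau_inverse: "a \<in>. A ==> \<sigma> (\<tau> a) = a" "a \<in>. A ==> \<tau> (\<sigma> a) = a"
 unfolding \<tau>_def using sigma_bij bij_betw_inv_into_right bij_betw_inv_into_left by fast+

lemma tau_closed: "a \<in>. A ==> \<tau> a \<in>. A"
 unfolding \<tau>_def using bij_betwE[OF bij_betw_inv_into[OF sigma_bij]] by blast

lemma tau_hom: "galg_hom K A A \<tau>"
proof -
 note s = galg_homD[OF sigma_hom]
 have inj: "x = y" if "x \<in>. A" "y \<in>. A" "\<sigma> x = \<sigma> y" for x y
  using that tau_inverse(2) by metis
 show ?thesis
  unfolding galg_hom_def
 proof (intro conjI ballI allI)
  show "\<tau> \<in> ring_hom A A"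
  proof (rule ring_hom_memI)
   fix x y assume xy: "x \<in>. A" "y \<in>. A"
   note t = tau_closed[OF xy(1)] tau_closed[OF xy(2)]
   show "\<tau> (x *[A] y) = \<tau> x *[A] \<tau> y"
    by (rule inj) (use xy t s(2)[OF t] tau_inverse(1) tau_closed in simp_all)
   show "\<tau> (x +[A] y) = \<tau> x +[A] \<tau> y"
    by (rule inj) (use xy t s(3)[OF t] tau_inverse(1) tau_closed in simp_all)
  qed (use tau_closed tau_inverse(2)[OF A.A.one_closed] s(4) in auto)
  fix k x assume k: "k \<in>. K" and x: "x \<in>. A"
  show "\<tau> (k *:[A] x) = k *:[A] \<tau> x"
   by (rule inj) (use k x s(5)[OF k tau_closed[OF x]] tau_inverse(1) tau_closed in simp_all)
 next
  fix i
  have eq: "\<sigma> ` component A i = component A i" using sigma unfolding graded_alg_iso_def by blast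
  show "\<tau> ` component A i \<subseteq> component A i"
  proof (rule image_subsetI)
   fix x assume "x \<in> component A i"
   then obtain y where "y \<in> component A i" "x = \<sigma> y" using eq by blast
   thus "\<tau> x \<in> component A i" using tau_inverse(2)[OF A.comp_carrier] by simp
  qed
 qed
qed

lemma tau_pow_hom: "galg_hom K A A (\<tau> ^^ n)"
proof (induction n)
 case (Suc n)
 show ?case unfolding funpow.simps by (rule galg_hom_comp[OF Suc tau_hom])
qed (use galg_hom_id in "simp add: id_def")

lemma sigma_tau_pow:
 assumes "a \<in>. A"
 shows "(\<sigma> ^^ n) ((\<tau> ^^ n) a) = a"
proof (induction n)
 case (Suc n)
 have "(\<tau> ^^ n) a \<in>. A" using galg_homD(1)[OF tau_pow_hom assms] .
 hence "(\<sigma> ^^ n) (\<sigma> (\<tau> ((\<tau> ^^ n) a))) = (\<sigma> ^^ n) ((\<tau> ^^ n) a)" using tau_inverse(1) by simp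
 thus ?case using Suc by (simp add: funpow_swap1)
qed simp

lemma tau_sigma_pow:
 assumes "a \<in>. A"
 shows "(\<tau> ^^ n) ((\<sigma> ^^ (n + m)) a) = (\<sigma> ^^ m) a"
proof (induction n)
 case (Suc n)
 have c: "(\<sigma> ^^ (n + m)) a \<in>. A" using galg_homD(1)[OF sigma_pow_hom assms] .
 have "(\<tau> ^^ Suc n) ((\<sigma> ^^ (Suc n + m)) a) = (\<tau> ^^ n) (\<tau> (\<sigma> ((\<sigma> ^^ (n + m)) a)))"
  by (simp add: funpow_swap1)
 thus ?case using Suc tau_inverse(2)[OF c] by simp
qed simp

lemma C_simps [simp]:
 "carrier C = carrier T" "0[C] = 0[T]" "x +[C] y = x +[T] y" "k *:[C] x = k *:[T] x"
 "1[C] = 1[B] \<diamondop> 1[A]" "x *[C] y = twisted_mult K B \<sigma> A x y"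
 by (simp_all add: twisted_tensor_def Let_def)

text \<open>The homogeneous pure tensors of degree \<open>n\<close>.\<close>
definition hpt where "hpt n = {b \<diamondop> a | b a. \<exists>i j. i + j = n \<and> b \<in> component B i \<and> a \<in> component A j}"

lemma hpt_closed: "hpt n \<subseteq> carrier T"
 unfolding hpt_def using A.comp_carrier B.comp_carrier by auto

lemma hptI: "b \<in> component B i ==> a \<in> component A j ==> i + j = n ==> b \<diamondop> a \<in> hpt n"
 unfolding hpt_def by blast

lemma hpt_submodule: "submodule (asum T (hpt n)) K T"
proof (rule T.submoduleI)
 show sub: "asum T (hpt n) \<subseteq> carrier T" by (rule T.M.asum_carrier[OF hpt_closed])
 show "0[T] \<in> asum T (hpt n)" by (rule asum.zero)
 show "x +[T] y \<in> asum T (hpt n)" if "x \<in> asum T (hpt n)" "y \<in> asum T (hpt n)" for x y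
  by (rule T.M.asum_add[OF hpt_closed that])
 show sm: "k *:[T] x \<in> asum T (hpt n)" if k: "k \<in>. K" and x: "x \<in> asum T (hpt n)" for k x
 proof (rule T.M.asum_image[OF T.M.abelian_group_axioms hpt_closed hpt_closed _ _ _ x])
  fix s assume "s \<in> hpt n"
  then obtain b a i j where s: "s = b \<diamondop> a" "i + j = n" "b \<in> component B i" "a \<in> component A j"
   unfolding hpt_def by blast
  have "k *:[T] s = (k *:[B] b) \<diamondop> a"
   using s pt_smult_l[OF k B.comp_carrier[OF s(3)] A.comp_carrier[OF s(4)]] by simp
  hence "k *:[T] s \<in> hpt n" using hptI[OF B.comp_smult[OF k s(3)] s(4,2)] by simp
  thus "k *:[T] s \<in> asum T (hpt n)" using T.M.asum_incl[OF _ hpt_closed] by blast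
 qed (use k T.smult_r_distr in auto)
 show "-[T] x \<in> asum T (hpt n)" if x: "x \<in> asum T (hpt n)" for x
 proof -
  have "(-[K] 1[K]) *:[T] x = -[T] x"
   using T.smult_l_minus[OF A.K.one_closed, of x] x sub T.smult_one by auto
  thus ?thesis using sm[of "-[K] 1[K]" x] x by simp
 qed
qed

lemma C_comp: "component C n = asum T (hpt n)"
proof -
 have "component C n = submodule_span K T (hpt n)"
  by (simp add: twisted_tensor_def Let_def hpt_def)
 also have "\<dots> = asum T (hpt n)"
  unfolding submodule_span_def
 proof
  show "\<Inter> {N. hpt n \<subseteq> N \<and> submodule N K T} \<subseteq> asum T (hpt n)"
   using hpt_submodule T.M.asum_incl[OF _ hpt_closed] by blast
  show "asum T (hpt n) \<subseteq> \<Inter> {N. hpt n \<subseteq> N \<and> submodule N K T}"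
  proof (rule Inter_greatest, elim CollectE conjE)
   fix N assume N: "hpt n \<subseteq> N" "submodule N K T"
   show "asum T (hpt n) \<subseteq> N"
   proof (rule asum_subset[OF N(1)])
    show "0[T] \<in> N" using subgroup.one_closed[OF submodule.axioms(1)[OF N(2)]] by simp
    show "x +[T] y \<in> N" if "x \<in> N" "y \<in> N" for x y using T.submoduleE(5)[OF N(2)] that by blast
   qed
  qed
 qed
 finally show ?thesis .
qed

lemma pt_zero: "a \<in>. A ==> 0[B] \<diamondop> a = 0[T]" "b \<in>. B ==> b \<diamondop> 0[A] = 0[T]"
 using pt_smult_l[OF A.K.zero_closed B.A.zero_closed, of a] pt_smult_r[OF A.K.zero_closed _ A.A.zero_closed, of b] by simp_all

lemma comp_induct [consumes 1, case_names pure add]: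
 assumes "X \<in> component C n"
  and pure: "\<And>i j b a. b \<in> component B i ==> a \<in> component A j ==> i + j = n ==> Q (b \<diamondop> a)"
  and add: "\<And>X Y. X \<in>. T ==> Y \<in>. T ==> Q X ==> Q Y ==> Q (X +[T] Y)"
 shows "Q X"
 using assms(1) unfolding C_comp
proof induction
 case zero
 have "Q (0[B] \<diamondop> 0[A])" by (rule pure[of _ n _ 0]) auto
 thus ?case using pt_zero(1)[OF A.A.zero_closed] by simp
next
 case (step g X)
 hence "Q g" using pure unfolding hpt_def by blast
 moreover have "g \<in>. T" "X \<in>. T"
  using step hpt_closed T.M.asum_carrier[OF hpt_closed] by blast+
 ultimately show ?case using add step.IH by blast
qed

lemma C_comp_carrier: "X \<in> component C n ==> X \<in>. T"
 unfolding C_comp using T.M.asum_carrier[OF hpt_closed] by blast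

lemma pt_comp: "b \<in> component B i ==> a \<in> component A j ==> b \<diamondop> a \<in> component C (i + j)"
 unfolding C_comp by (rule T.M.asum_incl[OF hptI[OF _ _ refl] hpt_closed])

section \<open>The multiplication of the twisted tensor product\<close>

text \<open>The product of two pure tensors in the twisted algebra.\<close>
definition M4 where "M4 b1 a1 b2 a2 = (\<Oplus>\<^bsub>T\<^esub>j\<in>{j. hom_part B b2 j ~= 0[B]}.
 (b1 *[B] hom_part B b2 j) \<diamondop> ((\<sigma> ^^ j) a1 *[A] a2))"

lemma M4_term:
 assumes "b1 \<in>. B" "a1 \<in>. A" "b2 \<in>. B" "a2 \<in>. A"
 shows "(b1 *[B] hom_part B b2 j) \<diamondop> ((\<sigma> ^^ j) a1 *[A] a2) \<in>. T"
 using assms B.comp_carrier[OF B.hom_part_comp[OF assms(3)]] galg_homD(1)[OF sigma_pow_hom] by simp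

lemma M4_superset:
 assumes "b1 \<in>. B" "a1 \<in>. A" "b2 \<in>. B" "a2 \<in>. A"
  "finite J" "{j. hom_part B b2 j ~= 0[B]} \<subseteq> J"
 shows "M4 b1 a1 b2 a2 = (\<Oplus>\<^bsub>T\<^esub>j\<in>J. (b1 *[B] hom_part B b2 j) \<diamondop> ((\<sigma> ^^ j) a1 *[A] a2))"
 unfolding M4_def
proof (rule T.M.finsum_superset[OF assms(5,6)])
 fix j assume "j \<in> J - {j. hom_part B b2 j ~= 0[B]}"
 thus "(b1 *[B] hom_part B b2 j) \<diamondop> ((\<sigma> ^^ j) a1 *[A] a2) = 0[T]"
  using assms galg_homD(1)[OF sigma_pow_hom] by (simp add: pt_zero)
qed (rule M4_term[OF assms(1-4)])

lemma M4_closed: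
 "b1 \<in>. B ==> a1 \<in>. A ==> b2 \<in>. B ==> a2 \<in>. A ==> M4 b1 a1 b2 a2 \<in>. T"
 unfolding M4_def using M4_term by (intro T.M.finsum_closed) auto

lemma M4_hom:
 assumes "b1 \<in>. B" "a1 \<in>. A" "b2 \<in> component B j" "a2 \<in>. A"
 shows "M4 b1 a1 b2 a2 = (b1 *[B] b2) \<diamondop> ((\<sigma> ^^ j) a1 *[A] a2)"
proof -
 have b2: "b2 \<in>. B" using B.comp_carrier[OF assms(3)] .
 have "M4 b1 a1 b2 a2 = (\<Oplus>\<^bsub>T\<^esub>j\<in>{j}. (b1 *[B] hom_part B b2 j) \<diamondop> ((\<sigma> ^^ j) a1 *[A] a2))"
  by (rule M4_superset[OF assms(1,2) b2 assms(4)]) (auto simp: B.hom_part_of_comp[OF assms(3)])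
 also have "\<dots> = (b1 *[B] hom_part B b2 j) \<diamondop> ((\<sigma> ^^ j) a1 *[A] a2)"
  using M4_term[OF assms(1,2) b2 assms(4)] by simp
 finally show ?thesis by (simp add: B.hom_part_of_comp[OF assms(3)])
qed

lemma M4_add:
 assumes b1: "b1 \<in>. B" and a1: "a1 \<in>. A" and b2: "b2 \<in>. B" and a2: "a2 \<in>. A"
 shows "b1' \<in>. B ==> M4 (b1 +[B] b1') a1 b2 a2 = M4 b1 a1 b2 a2 +[T] M4 b1' a1 b2 a2"
  and "a1' \<in>. A ==> M4 b1 (a1 +[A] a1') b2 a2 = M4 b1 a1 b2 a2 +[T] M4 b1 a1' b2 a2"
  and "b2' \<in>. B ==> M4 b1 a1 (b2 +[B] b2') a2 = M4 b1 a1 b2 a2 +[T] M4 b1 a1 b2' a2"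
  and "a2' \<in>. A ==> M4 b1 a1 b2 (a2 +[A] a2') = M4 b1 a1 b2 a2 +[T] M4 b1 a1 b2 a2'"
proof -
 have h: "hom_part B b j \<in>. B" if "b \<in>. B" for b j using B.comp_carrier[OF B.hom_part_comp[OF that]] .
 have s: "(\<sigma> ^^ j) a \<in>. A" if "a \<in>. A" for a j using galg_homD(1)[OF sigma_pow_hom that] .
 note simps = h s galg_homD(3)[OF sigma_pow_hom] B.A.l_distr B.A.r_distr A.A.l_distr A.A.r_distr pt_add_l pt_add_r
 show "M4 (b1 +[B] b1') a1 b2 a2 = M4 b1 a1 b2 a2 +[T] M4 b1' a1 b2 a2" if "b1' \<in>. B"
  unfolding M4_def
  by (subst T.M.finsum_addf[symmetric]) (use that b1 a1 b2 a2 in "auto simp: simps intro!: T.M.finsum_cong'")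
 show "M4 b1 (a1 +[A] a1') b2 a2 = M4 b1 a1 b2 a2 +[T] M4 b1 a1' b2 a2" if "a1' \<in>. A"
  unfolding M4_def
  by (subst T.M.finsum_addf[symmetric]) (use that b1 a1 b2 a2 in "auto simp: simps intro!: T.M.finsum_cong'")
 show "M4 b1 a1 b2 (a2 +[A] a2') = M4 b1 a1 b2 a2 +[T] M4 b1 a1 b2 a2'" if "a2' \<in>. A"
  unfolding M4_def
  by (subst T.M.finsum_addf[symmetric]) (use that b1 a1 b2 a2 in "auto simp: simps intro!: T.M.finsum_cong'")
 show "M4 b1 a1 (b2 +[B] b2') a2 = M4 b1 a1 b2 a2 +[T] M4 b1 a1 b2' a2" if b2': "b2' \<in>. B"
 proof -
  let ?J = "{j. hom_part B b2 j ~= 0[B]} \<union> {j. hom_part B b2' j ~= 0[B]}"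
  have J: "finite ?J" using B.hom_part_finite b2 b2' by blast
  have s': "{j. hom_part B (b2 +[B] b2') j ~= 0[B]} \<subseteq> ?J" using B.hom_part_add[OF b2 b2'] by auto
  show ?thesis
   unfolding M4_superset[OF b1 a1 B.A.a_closed[OF b2 b2'] a2 J s'] M4_superset[OF b1 a1 b2 a2 J Un_upper1]
    M4_superset[OF b1 a1 b2' a2 J Un_upper2] B.hom_part_add[OF b2 b2']
   by (subst T.M.finsum_addf[symmetric]) (use b1 a1 b2 a2 b2' in "auto simp: simps intro!: T.M.finsum_cong'")
 qed
qed

lemma M4_bal1:
 assumes "k \<in>. K" "b1 \<in>. B" "a1 \<in>. A" "b2 \<in>. B" "a2 \<in>. A"
 shows "M4 (k *:[B] b1) a1 b2 a2 = M4 b1 (k *:[A] a1) b2 a2"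
 unfolding M4_def
proof (rule T.M.finsum_cong'[OF refl])
 fix j
 have h: "hom_part B b2 j \<in>. B" "(\<sigma> ^^ j) a1 \<in>. A"
  using B.comp_carrier[OF B.hom_part_comp[OF assms(4)]] galg_homD(1)[OF sigma_pow_hom assms(3)] by auto
 show "(k *:[B] b1 *[B] hom_part B b2 j) \<diamondop> ((\<sigma> ^^ j) a1 *[A] a2) =
   (b1 *[B] hom_part B b2 j) \<diamondop> ((\<sigma> ^^ j) (k *:[A] a1) *[A] a2)"
  using assms h galg_homD(5)[OF sigma_pow_hom assms(1,3)]
  by (simp add: pt_smult_l pt_smult_r flip: B.smult_mult_left A.smult_mult_left)
qed (use M4_term[OF assms(2) A.KA.smult_closed[OF assms(1,3)] assms(4,5)] in auto)

lemma M4_bal2: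
 assumes "k \<in>. K" "b1 \<in>. B" "a1 \<in>. A" "b2 \<in>. B" "a2 \<in>. A"
 shows "M4 b1 a1 (k *:[B] b2) a2 = M4 b1 a1 b2 (k *:[A] a2)"
 using assms(4)
proof (induction rule: B.graded_induct)
 case (hom j b)
 have h: "b \<in>. B" "(\<sigma> ^^ j) a1 \<in>. A"
  using B.comp_carrier[OF hom] galg_homD(1)[OF sigma_pow_hom assms(3)] by auto
 show ?case
  unfolding M4_hom[OF assms(2,3) B.comp_smult[OF assms(1) hom] assms(5)] M4_hom[OF assms(2,3) hom A.KA.smult_closed[OF assms(1,5)]]
  using assms h by (simp add: pt_smult_l pt_smult_r flip: B.smult_mult_right A.smult_mult_right)
next
 case (add x y)
 have kx: "k *:[B] x \<in>. B" "k *:[B] y \<in>. B" "k *:[A] a2 \<in>. A" using add assms by auto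
 show ?case
  unfolding B.KA.smult_r_distr[OF assms(1) add(1,2)] M4_add(3)[OF assms(2,3) kx(1) assms(5) kx(2)]
   M4_add(3)[OF assms(2,3) add(1) kx(3) add(2)] add(3,4) ..
qed

text \<open>The biadditive extension is obtained from \<open>tensor_lift\<close>, first in the left and then in the right factor.\<close>
lemma mult_exists:
 "\<exists>\<mu>. (\<forall>X\<in>carrier T. \<forall>Y\<in>carrier T. \<mu> X Y \<in>. T) \<and>
  (\<forall>X\<in>carrier T. \<forall>X'\<in>carrier T. \<forall>Y\<in>carrier T. \<mu> (X +[T] X') Y = \<mu> X Y +[T] \<mu> X' Y) \<and>
  (\<forall>X\<in>carrier T. \<forall>Y\<in>carrier T. \<forall>Y'\<in>carrier T. \<mu> X (Y +[T] Y') = \<mu> X Y +[T] \<mu> X Y') \<and>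
  (\<forall>b1\<in>carrier B. \<forall>a1\<in>carrier A. \<forall>b2\<in>carrier B. \<forall>a2\<in>carrier A. \<mu> (b1 \<diamondop> a1) (b2 \<diamondop> a2) = M4 b1 a1 b2 a2)"
proof -
 have "\<exists>R. b2 \<in>. B --> a2 \<in>. A --> (\<forall>X\<in>carrier T. R X \<in>. T) \<and>
   (\<forall>X\<in>carrier T. \<forall>Y\<in>carrier T. R (X +[T] Y) = R X +[T] R Y) \<and>
   (\<forall>b\<in>carrier B. \<forall>a\<in>carrier A. R (b \<diamondop> a) = M4 b a b2 a2)" for b2 a2
 proof (cases "b2 \<in>. B \<and> a2 \<in>. A")
  case True
  hence "\<exists>R. (\<forall>X\<in>carrier T. R X \<in>. T) \<and>
   (\<forall>X\<in>carrier T. \<forall>Y\<in>carrier T. R (X +[T] Y) = R X +[T] R Y) \<and>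
   (\<forall>b\<in>carrier B. \<forall>a\<in>carrier A. R (b \<diamondop> a) = M4 b a b2 a2)"
   by (intro tensor_lift[OF T.M.abelian_group_axioms]) (simp_all add: M4_closed M4_add M4_bal1)
  thus ?thesis by blast
 qed blast
 hence "\<forall>b2. \<exists>F. \<forall>a2. b2 \<in>. B --> a2 \<in>. A --> (\<forall>X\<in>carrier T. F a2 X \<in>. T) \<and>
   (\<forall>X\<in>carrier T. \<forall>Y\<in>carrier T. F a2 (X +[T] Y) = F a2 X +[T] F a2 Y) \<and>
   (\<forall>b\<in>carrier B. \<forall>a\<in>carrier A. F a2 (b \<diamondop> a) = M4 b a b2 a2)" by (intro allI choice)
 from choice[OF this] obtain R where RR: "\<forall>b2 a2. b2 \<in>. B --> a2 \<in>. A -->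
   (\<forall>X\<in>carrier T. R b2 a2 X \<in>. T) \<and>
   (\<forall>X\<in>carrier T. \<forall>Y\<in>carrier T. R b2 a2 (X +[T] Y) = R b2 a2 X +[T] R b2 a2 Y) \<and>
   (\<forall>b\<in>carrier B. \<forall>a\<in>carrier A. R b2 a2 (b \<diamondop> a) = M4 b a b2 a2)" ..
 have R: "\<And>b2 a2 X. b2 \<in>. B ==> a2 \<in>. A ==> X \<in>. T ==> R b2 a2 X \<in>. T"
  "\<And>b2 a2 X Y. b2 \<in>. B ==> a2 \<in>. A ==> X \<in>. T ==> Y \<in>. T ==>
   R b2 a2 (X +[T] Y) = R b2 a2 X +[T] R b2 a2 Y"
  "\<And>b2 a2 b a. b2 \<in>. B ==> a2 \<in>. A ==> b \<in>. B ==> a \<in>. A ==>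
   R b2 a2 (b \<diamondop> a) = M4 b a b2 a2" using RR by simp_all
 have Radd1: "R (b +[B] b') a X = R b a X +[T] R b' a X"
  if h: "b \<in>. B" "b' \<in>. B" "a \<in>. A" and X: "X \<in>. T" for b b' a X
  using X
 proof (induction rule: T_induct)
  case (pure i j b1 a1)
  note p = B.comp_carrier[OF pure(1)] A.comp_carrier[OF pure(2)]
  show ?case using p h M4_add(3)[OF p h(1,3,2)] by (simp add: R(3))
 next
  case (add X Y)
  thus ?case using h R(1) by (simp add: R(2) T.M.a_ac)
 qed
 have Radd2: "R b (a +[A] a') X = R b a X +[T] R b a' X"
  if h: "b \<in>. B" "a \<in>. A" "a' \<in>. A" and X: "X \<in>. T" for b a a' X
  using X
 proof (induction rule: T_induct)
  case (pure i j b1 a1)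
  note p = B.comp_carrier[OF pure(1)] A.comp_carrier[OF pure(2)]
  show ?case using p h M4_add(4)[OF p h] by (simp add: R(3))
 next
  case (add X Y)
  thus ?case using h R(1) by (simp add: R(2) T.M.a_ac)
 qed
 have Rbal: "R (k *:[B] b) a X = R b (k *:[A] a) X"
  if h: "k \<in>. K" "b \<in>. B" "a \<in>. A" and X: "X \<in>. T" for k b a X
  using X
 proof (induction rule: T_induct)
  case (pure i j b1 a1)
  note p = B.comp_carrier[OF pure(1)] A.comp_carrier[OF pure(2)]
  show ?case using p h M4_bal2[OF h(1) p h(2,3)] by (simp add: R(3))
 next
  case (add X Y)
  thus ?case using h by (simp add: R(2))
 qed
 have "\<exists>L. X \<in>. T --> (\<forall>Y\<in>carrier T. L Y \<in>. T) \<and>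
   (\<forall>Y\<in>carrier T. \<forall>Y'\<in>carrier T. L (Y +[T] Y') = L Y +[T] L Y') \<and>
   (\<forall>b\<in>carrier B. \<forall>a\<in>carrier A. L (b \<diamondop> a) = R b a X)" for X
 proof (cases "X \<in>. T")
  case True
  hence "\<exists>L. (\<forall>Y\<in>carrier T. L Y \<in>. T) \<and>
   (\<forall>Y\<in>carrier T. \<forall>Y'\<in>carrier T. L (Y +[T] Y') = L Y +[T] L Y') \<and>
   (\<forall>b\<in>carrier B. \<forall>a\<in>carrier A. L (b \<diamondop> a) = R b a X)"
   by (intro tensor_lift[OF T.M.abelian_group_axioms]) (simp_all add: R(1) Radd1 Radd2 Rbal)
  thus ?thesis by blast
 qed blast
 hence "\<forall>X. \<exists>L. X \<in>. T --> (\<forall>Y\<in>carrier T. L Y \<in>. T) \<and>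
   (\<forall>Y\<in>carrier T. \<forall>Y'\<in>carrier T. L (Y +[T] Y') = L Y +[T] L Y') \<and>
   (\<forall>b\<in>carrier B. \<forall>a\<in>carrier A. L (b \<diamondop> a) = R b a X)" by (rule allI)
 from choice[OF this] obtain \<mu> where mm: "\<forall>X. X \<in>. T --> (\<forall>Y\<in>carrier T. \<mu> X Y \<in>. T) \<and>
   (\<forall>Y\<in>carrier T. \<forall>Y'\<in>carrier T. \<mu> X (Y +[T] Y') = \<mu> X Y +[T] \<mu> X Y') \<and>
   (\<forall>b\<in>carrier B. \<forall>a\<in>carrier A. \<mu> X (b \<diamondop> a) = R b a X)" ..
 have m: "\<And>X Y. X \<in>. T ==> Y \<in>. T ==> \<mu> X Y \<in>. T"
  "\<And>X Y Y'. X \<in>. T ==> Y \<in>. T ==> Y' \<in>. T ==> \<mu> X (Y +[T] Y') = \<mu> X Y +[T] \<mu> X Y'"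
  "\<And>X b a. X \<in>. T ==> b \<in>. B ==> a \<in>. A ==> \<mu> X (b \<diamondop> a) = R b a X"
  using mm by simp_all
 have "\<mu> (X +[T] X') Y = \<mu> X Y +[T] \<mu> X' Y" if h: "X \<in>. T" "X' \<in>. T" and Y: "Y \<in>. T" for X X' Y
  using Y
 proof (induction rule: T_induct)
  case (pure i j b a)
  note p = B.comp_carrier[OF pure(1)] A.comp_carrier[OF pure(2)]
  show ?case using p h by (simp add: m(3) R(2))
 next
  case (add Y Y')
  thus ?case using h m(1) by (simp add: m(2) T.M.a_ac)
 qed
 thus ?thesis using m R(3) by (intro exI[of _ \<mu>]) simp
qed

definition \<mu> where "\<mu> = (SOME \<mu>. (\<forall>X\<in>carrier T. \<forall>Y\<in>carrier T. \<mu> X Y \<in>. T) \<and>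
  (\<forall>X\<in>carrier T. \<forall>X'\<in>carrier T. \<forall>Y\<in>carrier T. \<mu> (X +[T] X') Y = \<mu> X Y +[T] \<mu> X' Y) \<and>
  (\<forall>X\<in>carrier T. \<forall>Y\<in>carrier T. \<forall>Y'\<in>carrier T. \<mu> X (Y +[T] Y') = \<mu> X Y +[T] \<mu> X Y') \<and>
  (\<forall>b1\<in>carrier B. \<forall>a1\<in>carrier A. \<forall>b2\<in>carrier B. \<forall>a2\<in>carrier A. \<mu> (b1 \<diamondop> a1) (b2 \<diamondop> a2) = M4 b1 a1 b2 a2))"

lemma mu:
 "X \<in>. T ==> Y \<in>. T ==> \<mu> X Y \<in>. T"
 "X \<in>. T ==> X' \<in>. T ==> Y \<in>. T ==> \<mu> (X +[T] X') Y = \<mu> X Y +[T] \<mu> X' Y"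
 "X \<in>. T ==> Y \<in>. T ==> Y' \<in>. T ==> \<mu> X (Y +[T] Y') = \<mu> X Y +[T] \<mu> X Y'"
 "b1 \<in>. B ==> a1 \<in>. A ==> b2 \<in>. B ==> a2 \<in>. A ==> \<mu> (b1 \<diamondop> a1) (b2 \<diamondop> a2) = M4 b1 a1 b2 a2"
 using someI_ex[OF mult_exists, folded \<mu>_def] by simp_all

lemma mu_hom:
 "b1 \<in>. B ==> a1 \<in>. A ==> b2 \<in> component B j ==> a2 \<in>. A ==>
  \<mu> (b1 \<diamondop> a1) (b2 \<diamondop> a2) = (b1 *[B] b2) \<diamondop> ((\<sigma> ^^ j) a1 *[A] a2)"
 using mu(4) M4_hom B.comp_carrier by simp

lemma mu_smult:
 assumes k: "k \<in>. K" and X: "X \<in>. T" and Y: "Y \<in>. T"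
 shows "\<mu> (k *:[T] X) Y = k *:[T] \<mu> X Y" "\<mu> X (k *:[T] Y) = k *:[T] \<mu> X Y"
proof -
 have "\<mu> (k *:[T] X) Y = k *:[T] \<mu> X Y \<and> \<mu> X (k *:[T] Y) = k *:[T] \<mu> X Y"
  using X
 proof (induction rule: T_induct)
  case (pure i j b1 a1)
  note p = B.comp_carrier[OF pure(1)] A.comp_carrier[OF pure(2)]
  show ?case
   using Y
  proof (induction rule: T_induct)
   case (pure i' j' b2 a2)
   note p' = B.comp_carrier[OF pure(1)] A.comp_carrier[OF pure(2)]
   have s: "(\<sigma> ^^ i') a1 \<in>. A" using galg_homD(1)[OF sigma_pow_hom p(2)] .
   have "\<mu> (k *:[T] (b1 \<diamondop> a1)) (b2 \<diamondop> a2) = \<mu> ((k *:[B] b1) \<diamondop> a1) (b2 \<diamondop> a2)"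
    "\<mu> (b1 \<diamondop> a1) (k *:[T] (b2 \<diamondop> a2)) = \<mu> (b1 \<diamondop> a1) ((k *:[B] b2) \<diamondop> a2)"
    using pt_smult_l[OF k p] pt_smult_l[OF k p'] by simp_all
   thus ?case
    unfolding mu_hom[OF p B.comp_smult[OF k pure(1)] p'(2)] mu_hom[OF p pure(1) p'(2)]
     mu_hom[OF B.KA.smult_closed[OF k p(1)] p(2) pure(1) p'(2)]
    using k p p' s by (simp add: pt_smult_l flip: B.smult_mult_left B.smult_mult_right)
  next
   case (add Y Y')
   thus ?case using k p mu(1) by (simp add: mu(3) T.smult_r_distr)
  qed
 next
  case (add X X')
  thus ?case using k Y mu(1) by (simp add: mu(2) T.smult_r_distr)
 qed
 thus "\<mu> (k *:[T] X) Y = k *:[T] \<mu> X Y" "\<mu> X (k *:[T] Y) = k *:[T] \<mu> X Y" by auto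
qed

text \<open>Expanding the chosen representatives into pure tensors turns both sides into the same sum of products of pure tensors.\<close>
lemma twisted_mult_eq:
 assumes X: "X \<in>. T" and Y: "Y \<in>. T"
 shows "twisted_mult K B \<sigma> A X Y = \<mu> X Y"
proof -
 define f where "f = (SOME f. f \<in> X)"
 define g where "g = (SOME g. g \<in> Y)"
 have rep: "(SOME f. f \<in> X) \<in>. FS \<and> q.cls (SOME f. f \<in> X) = X" if X: "X \<in>. T" for X
 proof -
  obtain h where h: "h \<in>. FS" "X = q.cls h" using X unfolding T_eq q.carrier_Q by blast
  have "(SOME f. f \<in> X) \<in> X"
   unfolding h(2) using someI[of "\<lambda>g. g \<in> q.cls h", OF q.cls_self[OF h(1)]] .
  thus ?thesis using q.cls_mem[OF h(1)] unfolding h(2) by blast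
 qed
 have f: "f \<in>. FS" "q.cls f = X" and g: "g \<in>. FS" "q.cls g = Y"
  using rep[OF X] rep[OF Y] by (auto simp: f_def g_def)
 let ?I = "{s. f s ~= 0[K]}" and ?J = "{t. g t ~= 0[K]}"
 let ?D = "\<lambda>t. {j. hom_part B (fst t) j ~= 0[B]}"
 have fin: "finite ?I" "finite ?J" using f(1) g(1) unfolding FS_simps by blast+
 have s: "fst s \<in>. B" "snd s \<in>. A" "f s \<in>. K" if "s \<in> ?I" for s
  using FS_supp[OF f(1)] FS_coeff[OF f(1)] that by auto
 have t: "fst t \<in>. B" "snd t \<in>. A" "g t \<in>. K" if "t \<in> ?J" for t
  using FS_supp[OF g(1)] FS_coeff[OF g(1)] that by auto
 let ?p = "\<lambda>s t j. (f s *[K] g t) *:[T] ((fst s *[B] hom_part B (fst t) j) \<diamondop> ((\<sigma> ^^ j) (snd s) *[A] snd t))"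
 have pc: "?p s' t' j \<in>. T" if "s' \<in> ?I" "t' \<in> ?J" for s' t' j
  using s[OF that(1)] t[OF that(2)] M4_term by simp
 have D: "finite (?D t')" if "t' \<in> ?J" for t' using B.hom_part_finite t(1)[OF that] by blast
 have "twisted_mult K B \<sigma> A X Y = finsum T (\<lambda>(s, t, j). ?p s t j) {(s, t, j). s \<in> ?I \<and> t \<in> ?J \<and> j \<in> ?D t}"
  unfolding twisted_mult_def Let_def f_def[symmetric] g_def[symmetric]
  by (rule arg_cong2[where f = "finsum T"]) auto
 also have "{(s, t, j). s \<in> ?I \<and> t \<in> ?J \<and> j \<in> ?D t} = Sigma ?I (\<lambda>s. Sigma ?J ?D)" by auto
 also have "finsum T (\<lambda>(s, t, j). ?p s t j) (Sigma ?I (\<lambda>s. Sigma ?J ?D)) =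
   finsum T (\<lambda>s. finsum T (\<lambda>(t, j). ?p s t j) (Sigma ?J ?D)) ?I"
  by (rule T.M.finsum_Sigma[where f = "\<lambda>s (t, j). ?p s t j"]) (use fin D pc in auto)
 also have "\<dots> = finsum T (\<lambda>s. finsum T (\<lambda>t. finsum T (?p s t) (?D t)) ?J) ?I"
 proof (rule T.M.finsum_cong'[OF refl])
  show "(\<lambda>s. finsum T (\<lambda>t. finsum T (?p s t) (?D t)) ?J) \<in> ?I \<rightarrow> carrier T"
   using pc by (intro funcsetI T.M.finsum_closed) auto
  show "finsum T (\<lambda>(t, j). ?p s' t j) (Sigma ?J ?D) = finsum T (\<lambda>t. finsum T (?p s' t) (?D t)) ?J" if "s' \<in> ?I" for s'
   by (rule T.M.finsum_Sigma) (use fin D pc that in auto)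
 qed
 also have "\<dots> = finsum T (\<lambda>s. finsum T (\<lambda>t. \<mu> (f s *:[T] (fst s \<diamondop> snd s)) (g t *:[T] (fst t \<diamondop> snd t))) ?J) ?I"
 proof -
  have e: "finsum T (?p s' t') (?D t') = \<mu> (f s' *:[T] (fst s' \<diamondop> snd s')) (g t' *:[T] (fst t' \<diamondop> snd t'))"
   if "s' \<in> ?I" "t' \<in> ?J" for s' t'
  proof -
   note st = s[OF that(1)] t[OF that(2)]
   have "\<mu> (f s' *:[T] (fst s' \<diamondop> snd s')) (g t' *:[T] (fst t' \<diamondop> snd t')) =
     (f s' *[K] g t') *:[T] M4 (fst s') (snd s') (fst t') (snd t')"
    using st mu(1) by (simp add: mu_smult mu(4) M4_closed A.K.m_comm flip: T.smult_assoc1)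
   also have "\<dots> = finsum T (?p s' t') (?D t')"
    unfolding M4_def
    by (rule additive_finsum[OF T.M.abelian_group_axioms T.M.abelian_group_axioms D[OF that(2)]])
     (use st M4_term T.smult_r_distr in auto)
   finally show ?thesis by simp
  qed
  show ?thesis
   by (rule T.M.finsum_cong'[OF refl] funcsetI T.M.finsum_closed e | use s t mu(1) in simp)+
 qed
 also have "\<dots> = finsum T (\<lambda>s. \<mu> (f s *:[T] (fst s \<diamondop> snd s)) Y) ?I"
 proof (rule T.M.finsum_cong'[OF refl])
  show "(\<lambda>s. \<mu> (f s *:[T] (fst s \<diamondop> snd s)) Y) \<in> ?I \<rightarrow> carrier T"
   using s Y mu(1) by auto
  show "finsum T (\<lambda>t. \<mu> (f s' *:[T] (fst s' \<diamondop> snd s')) (g t *:[T] (fst t \<diamondop> snd t))) ?J =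
    \<mu> (f s' *:[T] (fst s' \<diamondop> snd s')) Y" if "s' \<in> ?I" for s'
   unfolding g(2)[symmetric] T_expand[OF g(1)]
   by (rule additive_finsum[OF T.M.abelian_group_axioms T.M.abelian_group_axioms fin(2), symmetric])
    (use s[OF that] t mu in auto)
 qed
 also have "\<dots> = \<mu> X Y"
  unfolding f(2)[symmetric] T_expand[OF f(1)]
  by (rule additive_finsum[OF T.M.abelian_group_axioms T.M.abelian_group_axioms fin(1), where h = "\<lambda>X. \<mu> X Y", symmetric])
   (use s Y mu in auto)
 finally show ?thesis .
qed

text \<open>On pure tensors both sides equal \<open>b1 b2 b3 \<otimes> \<sigma>\<^sup>m(a1) \<sigma>\<^sup>n(a2) a3\<close>, where \<open>n\<close> is the degree of \<open>b3\<close> and \<open>m\<close> that of \<open>b2 b3\<close>.\<close>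
lemma mu_assoc:
 assumes X: "X \<in>. T" and Y: "Y \<in>. T" and Z: "Z \<in>. T"
 shows "\<mu> (\<mu> X Y) Z = \<mu> X (\<mu> Y Z)"
 using X
proof (induction rule: T_induct)
 case (pure i1 j1 b1 a1)
 note p1 = B.comp_carrier[OF pure(1)] A.comp_carrier[OF pure(2)]
 show ?case
  using Y
 proof (induction rule: T_induct)
  case (pure i2 j2 b2 a2)
  note p2 = B.comp_carrier[OF pure(1)] A.comp_carrier[OF pure(2)] and b2 = pure(1)
  show ?case
   using Z
  proof (induction rule: T_induct)
   case (pure i3 j3 b3 a3)
   note p3 = B.comp_carrier[OF pure(1)] A.comp_carrier[OF pure(2)] and b3 = pure(1)
   have s: "(\<sigma> ^^ n) a1 \<in>. A" "(\<sigma> ^^ n) a2 \<in>. A" for n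
    using galg_homD(1)[OF sigma_pow_hom] p1(2) p2(2) by auto
   have b23: "b2 *[B] b3 \<in> component B (i2 + i3)" by (rule B.component_mult[OF b2 b3])
   have e: "(\<sigma> ^^ i3) ((\<sigma> ^^ i2) a1) = (\<sigma> ^^ (i2 + i3)) a1" by (simp add: funpow_add add.commute[of i2 i3])
   have "\<mu> (\<mu> (b1 \<diamondop> a1) (b2 \<diamondop> a2)) (b3 \<diamondop> a3) =
     ((b1 *[B] b2) *[B] b3) \<diamondop> ((\<sigma> ^^ i3) ((\<sigma> ^^ i2) a1 *[A] a2) *[A] a3)"
    unfolding mu_hom[OF p1 b2 p2(2)] by (rule mu_hom) (use p1 p2 p3 s b3 in auto)
   also have "\<dots> = (b1 *[B] (b2 *[B] b3)) \<diamondop> ((\<sigma> ^^ (i2 + i3)) a1 *[A] ((\<sigma> ^^ i3) a2 *[A] a3))"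
    using galg_homD(2)[OF sigma_pow_hom s(1) p2(2)] p1 p2 p3 s e by (simp add: B.A.m_assoc A.A.m_assoc)
   also have "\<dots> = \<mu> (b1 \<diamondop> a1) (\<mu> (b2 \<diamondop> a2) (b3 \<diamondop> a3))"
    unfolding mu_hom[OF p2 b3 p3(2)] by (rule mu_hom[symmetric]) (use p1 p2 p3 s b23 in auto)
   finally show ?case .
  next
   case (add Z Z')
   thus ?case using p1 p2 mu(1) by (simp add: mu(3))
  qed
 next
  case (add Y Y')
  thus ?case using p1 Z mu(1) by (simp add: mu(2,3))
 qed
next
 case (add X X')
 thus ?case using Y Z mu(1) by (simp add: mu(2))
qed

lemma mu_one:
 assumes X: "X \<in>. T"
 shows "\<mu> (1[B] \<diamondop> 1[A]) X = X \<and> \<mu> X (1[B] \<diamondop> 1[A]) = X"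
 using X
proof (induction rule: T_induct)
 case (pure i j b a)
 note p = B.comp_carrier[OF pure(1)] A.comp_carrier[OF pure(2)]
 show ?case
  using p mu_hom[OF B.A.one_closed A.A.one_closed pure(1) p(2)] mu_hom[OF p B.one_comp A.A.one_closed]
   galg_homD(4)[OF sigma_pow_hom] by simp
next
 case (add X Y)
 thus ?case by (simp add: mu(2,3))
qed

lemma C_group: "abelian_group C"
 by (rule abelian_groupI) (auto simp: T.M.a_ac intro!: bexI[of _ "-[T] _"] T.M.l_neg)

lemma C_ring: "ring C"
proof (rule ringI[OF C_group])
 show "Group.monoid C"
  by (rule monoidI) (simp_all add: twisted_mult_eq mu(1) mu_assoc mu_one)
qed (simp_all add: twisted_mult_eq mu)

lemma C_module: "module K C"
 by (rule moduleI) (auto simp: A.K.cring_axioms C_group T.smult_l_distr T.smult_r_distr T.smult_assoc1)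

lemma C_submodule: "submodule (component C n) K C"
proof -
 have "a_inv C x = a_inv T x" if "x \<in>. T" for x
  by (rule abelian_group.minus_equality[OF C_group]) (use that in "simp_all add: T.M.l_neg")
 thus ?thesis
  using T.submoduleE[OF hpt_submodule[of n]] asum.zero[of T "hpt n"] T.M.asum_carrier[OF hpt_closed[of n]]
  by (intro module.submoduleI[OF C_module]) (auto simp: C_comp)
qed

text \<open>The projection sends \<open>b \<diamondop> a\<close> to the sum of the tensors of the parts of \<open>b\<close> and \<open>a\<close> whose degrees add up to \<open>n\<close>.\<close>
lemma C_projections:
 "\<exists>p. (\<forall>X\<in>carrier T. p X \<in>. T) \<and> (\<forall>X\<in>carrier T. \<forall>Y\<in>carrier T. p (X +[T] Y) = p X +[T] p Y) \<and>
  (\<forall>m. \<forall>X\<in>component C m. p X = (if n = m then X else 0[T]))"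
proof -
 define \<psi> where "\<psi> b a = (\<Oplus>\<^bsub>T\<^esub>i\<in>{..n}. hom_part B b i \<diamondop> hom_part A a (n - i))" for b a
 have hb: "hom_part B b i \<in>. B" if "b \<in>. B" for b i using B.comp_carrier[OF B.hom_part_comp[OF that]] .
 have ha: "hom_part A a i \<in>. A" if "a \<in>. A" for a i using A.comp_carrier[OF A.hom_part_comp[OF that]] .
 have hsb: "hom_part B (k *:[B] b) i = k *:[B] hom_part B b i" if k: "k \<in>. K" and "b \<in>. B" for k b i
  using that(2)
 proof (induction rule: B.graded_induct)
  case (hom j b)
  show ?case using B.hom_part_of_comp[OF hom] B.hom_part_of_comp[OF B.comp_smult[OF k hom]] k by simp
 next
  case (add x y)
  thus ?case using k hb by (simp add: B.KA.smult_r_distr B.hom_part_add)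
 qed
 have hsa: "hom_part A (k *:[A] a) i = k *:[A] hom_part A a i" if k: "k \<in>. K" and "a \<in>. A" for k a i
  using that(2)
 proof (induction rule: A.graded_induct)
  case (hom j b)
  show ?case using A.hom_part_of_comp[OF hom] A.hom_part_of_comp[OF A.comp_smult[OF k hom]] k by simp
 next
  case (add x y)
  thus ?case using k ha by (simp add: A.KA.smult_r_distr A.hom_part_add)
 qed
 have "\<exists>L. (\<forall>X\<in>carrier T. L X \<in>. T) \<and> (\<forall>X\<in>carrier T. \<forall>Y\<in>carrier T. L (X +[T] Y) = L X +[T] L Y) \<and>
  (\<forall>b\<in>carrier B. \<forall>a\<in>carrier A. L (b \<diamondop> a) = \<psi> b a)"
 proof (rule tensor_lift[OF T.M.abelian_group_axioms])
  show "\<psi> b a \<in>. T" if "b \<in>. B" "a \<in>. A" for b a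
   unfolding \<psi>_def using hb[OF that(1)] ha[OF that(2)] by (intro T.M.finsum_closed) auto
  show "\<psi> (b +[B] b') a = \<psi> b a +[T] \<psi> b' a" if "b \<in>. B" "b' \<in>. B" "a \<in>. A" for b b' a
   unfolding \<psi>_def
   by (subst T.M.finsum_addf[symmetric])
    (use hb[OF that(1)] hb[OF that(2)] ha[OF that(3)] B.hom_part_add[OF that(1,2)] in "auto simp: pt_add_l intro!: T.M.finsum_cong'")
  show "\<psi> b (a +[A] a') = \<psi> b a +[T] \<psi> b a'" if "b \<in>. B" "a \<in>. A" "a' \<in>. A" for b a a'
   unfolding \<psi>_def
   by (subst T.M.finsum_addf[symmetric])
    (use hb[OF that(1)] ha[OF that(2)] ha[OF that(3)] A.hom_part_add[OF that(2,3)] in "auto simp: pt_add_r intro!: T.M.finsum_cong'")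
  show "\<psi> (k *:[B] b) a = \<psi> b (k *:[A] a)" if "k \<in>. K" "b \<in>. B" "a \<in>. A" for k b a
   unfolding \<psi>_def hsb[OF that(1,2)] hsa[OF that(1,3)]
   by (rule T.M.finsum_cong'[OF refl]) (use that hb ha in "auto simp: pt_smult_l pt_smult_r")
 qed
 then obtain L where L: "\<And>X. X \<in>. T ==> L X \<in>. T"
  "\<And>X Y. X \<in>. T ==> Y \<in>. T ==> L (X +[T] Y) = L X +[T] L Y"
  "\<And>b a. b \<in>. B ==> a \<in>. A ==> L (b \<diamondop> a) = \<psi> b a" by blast
 have "L X = (if n = m then X else 0[T])" if "X \<in> component C m" for X m
  using that
 proof (induction rule: comp_induct)
  case (pure i j b a)
  note p = B.comp_carrier[OF pure(1)] A.comp_carrier[OF pure(2)]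
  have t: "hom_part B b i' \<diamondop> hom_part A a (n - i') = (if i' = i \<and> n - i' = j then b \<diamondop> a else 0[T])" for i'
   using B.hom_part_of_comp[OF pure(1)] A.hom_part_of_comp[OF pure(2)] p by (auto simp: pt_zero)
  show ?case
  proof (cases "n = m")
   case True
   have "\<psi> b a = (\<Oplus>\<^bsub>T\<^esub>i'\<in>{i}. hom_part B b i' \<diamondop> hom_part A a (n - i'))"
    unfolding \<psi>_def by (rule T.M.finsum_superset[symmetric]) (use t p True pure(3) in auto)
   thus ?thesis using t[of i] p True pure(3)[symmetric] L(3)[OF p] by simp
  next
   case False
   have "\<psi> b a = 0[T]"
    unfolding \<psi>_def by (rule T.M.add.finprod_one_eqI) (use t False pure(3) in auto)
   thus ?thesis using L(3)[OF p] False by simp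
  qed
 next
  case (add X Y)
  thus ?case using L(2) by simp
 qed
 thus ?thesis using L(1,2) by (intro exI[of _ L]) blast
qed

lemma C_grading: "is_grading C"
proof -
 from choice[OF allI[OF C_projections]] obtain p where
  p: "\<forall>n. (\<forall>X\<in>carrier T. p n X \<in>. T) \<and> (\<forall>X\<in>carrier T. \<forall>Y\<in>carrier T. p n (X +[T] Y) = p n X +[T] p n Y) \<and>
  (\<forall>m. \<forall>X\<in>component C m. p n X = (if n = m then X else 0[T]))" ..
 show ?thesis
 proof (rule is_gradingI[OF C_group, where p = p])
  show "additive_subgroup (component C i) C" for i
   using submodule.axioms(1)[OF C_submodule] by (simp add: additive_subgroup_def)
  fix X assume "X \<in>. C"
  hence "X \<in>. T" by simp
  thus "X \<in> asum C (\<Union>i. component C i)"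
  proof (induction rule: T_induct)
   case (pure i j b a)
   show ?case
    by (rule abelian_group.asum_incl[OF C_group]) (use pt_comp[OF pure] C_comp_carrier in auto)
  next
   case (add X Y)
   have "X +[C] Y \<in> asum C (\<Union>i. component C i)"
    by (rule abelian_group.asum_add[OF C_group _ add(3,4)]) (use C_comp_carrier in auto)
   thus ?case by simp
  qed
 qed (use p in simp_all)
qed

lemma C_connected_graded_algebra: "connected_graded_algebra K C"
proof (intro connected_graded_algebra.intro A.field C_ring C_module C_grading C_submodule)
 fix k x y assume "k \<in>. K" "x \<in>. C" "y \<in>. C"
 thus "k *:[C] (x *[C] y) = (k *:[C] x) *[C] y" "k *:[C] (x *[C] y) = x *[C] (k *:[C] y)"
  by (simp_all add: twisted_mult_eq mu_smult)
next
 fix i j X Y assume X: "X \<in> component C i" and Y: "Y \<in> component C j"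
 have "\<mu> X Y \<in> component C (i + j)"
  using X
 proof (induction rule: comp_induct)
  case (pure i1 j1 b1 a1)
  note p = B.comp_carrier[OF pure(1)] A.comp_carrier[OF pure(2)] and h = pure
  show ?case
   using Y
  proof (induction rule: comp_induct)
   case (pure i2 j2 b2 a2)
   have "(b1 *[B] b2) \<diamondop> ((\<sigma> ^^ i2) a1 *[A] a2) \<in> component C ((i1 + i2) + (j1 + j2))"
    by (intro pt_comp B.component_mult A.component_mult h(1) pure galg_homD(6)[OF sigma_pow_hom] h(2))
   moreover have "(i1 + i2) + (j1 + j2) = i + j" using h(3) pure(3) by simp
   ultimately show ?case using mu_hom[OF p pure(1) A.comp_carrier[OF pure(2)]] by simp
  next
   case (add X Y)
   thus ?case using p T.M.asum_add[OF hpt_closed] by (simp add: mu(3) C_comp)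
  qed
 next
  case (add X X')
  thus ?case using C_comp_carrier[OF Y] T.M.asum_add[OF hpt_closed] by (simp add: mu(2) C_comp)
 qed
 thus "X *[C] Y \<in> component C (i + j)"
  using C_comp_carrier[OF X] C_comp_carrier[OF Y] by (simp add: twisted_mult_eq)
next
 have "\<exists>L. (\<forall>X\<in>carrier T. L X \<in>. K) \<and> (\<forall>X\<in>carrier T. \<forall>Y\<in>carrier T. L (X +[T] Y) = L X +[K] L Y) \<and>
  (\<forall>b\<in>carrier B. \<forall>a\<in>carrier A. L (b \<diamondop> a) = B.eps b *[K] A.eps a)"
  by (rule tensor_lift[OF A.K.abelian_group_axioms])
   (simp_all add: A.eps_add B.eps_add A.K.l_distr A.K.r_distr A.eps_smult B.eps_smult A.K.m_assoc A.K.m_lcomm)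
 then obtain L where L: "\<And>X. X \<in>. T ==> L X \<in>. K"
  "\<And>X Y. X \<in>. T ==> Y \<in>. T ==> L (X +[T] Y) = L X +[K] L Y"
  "\<And>b a. b \<in>. B ==> a \<in>. A ==> L (b \<diamondop> a) = B.eps b *[K] A.eps a" by blast
 have "L 0[T] = 0[K]"
  by (rule additive_zero[OF T.M.abelian_group_axioms A.K.abelian_group_axioms]) (use L in auto)
 moreover have "L (1[B] \<diamondop> 1[A]) = 1[K]" using L(3) by simp
 ultimately have "1[B] \<diamondop> 1[A] ~= 0[T]" using A.K.one_not_zero by metis
 thus "1[C] ~= 0[C]" by simp
 show "component C 0 = (\<lambda>k. k *:[C] 1[C]) ` carrier K"
 proof
  show "component C 0 \<subseteq> (\<lambda>k. k *:[C] 1[C]) ` carrier K"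
  proof
   fix X assume "X \<in> component C 0"
   thus "X \<in> (\<lambda>k. k *:[C] 1[C]) ` carrier K"
   proof (induction rule: comp_induct)
    case (pure i j b a)
    hence b: "b = B.eps b *:[B] 1[B]" and a: "a = A.eps a *:[A] 1[A]"
     using B.comp0E A.comp0E by auto
    have k: "B.eps b \<in>. K" "A.eps a \<in>. K" using pure B.comp_carrier A.comp_carrier by auto
    have "b \<diamondop> a = (B.eps b *:[B] 1[B]) \<diamondop> (A.eps a *:[A] 1[A])" using b a by simp
    also have "\<dots> = (B.eps b *[K] A.eps a) *:[T] (1[B] \<diamondop> 1[A])"
     using k by (simp add: pt_smult_l pt_smult_r A.K.m_comm flip: T.smult_assoc1)
    finally show ?case using k by (intro image_eqI[of _ _ "B.eps b *[K] A.eps a"]) auto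
   next
    case (add X Y)
    then obtain k l where "k \<in>. K" "l \<in>. K" "X = k *:[T] (1[B] \<diamondop> 1[A])" "Y = l *:[T] (1[B] \<diamondop> 1[A])" by auto
    thus ?case by (intro image_eqI[of _ _ "k +[K] l"]) (auto simp: T.smult_l_distr)
   qed
  qed
  have "1[B] \<diamondop> 1[A] \<in> component C 0" using pt_comp[OF B.one_comp A.one_comp] by simp
  thus "(\<lambda>k. k *:[C] 1[C]) ` carrier K \<subseteq> component C 0"
   using T.submoduleE(4)[OF hpt_submodule[of 0]] by (auto simp: C_comp)
 qed
qed

end

section \<open>The factors are retracts of the twisted tensor product\<close>

lemma augmentation_galg_hom:
 assumes "connected_graded_algebra K A" "connected_graded_algebra K D"
 shows "galg_hom K A D (\<lambda>a. augmentation K A a *:[D] 1[D])"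
proof -
 interpret A: connected_graded_algebra K A by fact
 interpret D: connected_graded_algebra K D by fact
 have "A.eps a *:[D] 1[D] \<in> component D i" if "a \<in> component A i" for a i
 proof (cases "i = 0")
  case True
  thus ?thesis using that A.comp_carrier[OF that] D.comp_smult[OF _ D.one_comp] by simp
 next
  case False
  thus ?thesis using A.eps_pos[OF that] by simp
 qed
 thus ?thesis
  unfolding galg_hom_def A.eps_def[symmetric]
  by (auto intro!: ring_hom_memI simp: A.eps_mult A.eps_add A.eps_one A.eps_smult D.scalar_mult
    D.KA.smult_l_distr D.KA.smult_assoc1)
qed

context twisted
begin

declare C_simps [simp del]

sublocale C: connected_graded_algebra K C by (rule C_connected_graded_algebra)

lemmas ptC_closed [simp] = pt_closed[folded C_simps(1)]
 and ptC_add_l = pt_add_l[folded C_simps(3)] and ptC_add_r = pt_add_r[folded C_simps(3)]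
 and ptC_smult_l = pt_smult_l[folded C_simps(4)] and ptC_smult_r = pt_smult_r[folded C_simps(4)]
 and ptC_zero = pt_zero[folded C_simps(2)] and C_one = C_simps(5)
 and C_induct [consumes 1, case_names pure add] = T_induct[folded C_simps(1,3)]
 and C_comp_induct [consumes 1, case_names pure add] = comp_induct[folded C_simps(1,3)]

lemma C_mult:
 assumes "b1 \<in>. B" "a1 \<in>. A" "b2 \<in> component B j" "a2 \<in>. A"
 shows "(b1 \<diamondop> a1) *[C] (b2 \<diamondop> a2) = (b1 *[B] b2) \<diamondop> ((\<sigma> ^^ j) a1 *[A] a2)"
 using mu_hom[OF assms] twisted_mult_eq pt_closed assms B.comp_carrier[OF assms(3)] by (simp add: C_simps(6))

text \<open>The algebra is presented by its two factors and the rule \<open>(1 \<otimes> a) (b \<otimes> 1) = b \<otimes> \<sigma>\<^sup>j(a)\<close> for \<open>b\<close> of degree \<open>j\<close>.\<close>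
lemma universal_property:
 assumes D: "connected_graded_algebra K D" and g: "galg_hom K B D g" and h: "galg_hom K A D h"
  and comm: "\<And>j b a. b \<in> component B j ==> a \<in>. A ==> h a *[D] g b = g b *[D] h ((\<sigma> ^^ j) a)"
 shows "\<exists>\<pi>. galg_hom K C D \<pi> \<and> (\<forall>b\<in>carrier B. \<forall>a\<in>carrier A. \<pi> (b \<diamondop> a) = g b *[D] h a)"
proof -
 interpret D: connected_graded_algebra K D by fact
 note g1 = galg_homD[OF g] and h1 = galg_homD[OF h]
 have "\<exists>L. (\<forall>X\<in>carrier T. L X \<in>. D) \<and> (\<forall>X\<in>carrier T. \<forall>Y\<in>carrier T. L (X +[T] Y) = L X +[D] L Y) \<and>
  (\<forall>b\<in>carrier B. \<forall>a\<in>carrier A. L (b \<diamondop> a) = g b *[D] h a)"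
  by (rule tensor_lift[OF D.A.abelian_group_axioms])
   (simp_all add: g1(1,3,5) h1(1,3,5) D.A.l_distr D.A.r_distr flip: D.smult_mult_left D.smult_mult_right)
 then obtain L where LL: "(\<forall>X\<in>carrier C. L X \<in>. D) \<and>
  (\<forall>X\<in>carrier C. \<forall>Y\<in>carrier C. L (X +[C] Y) = L X +[D] L Y) \<and>
  (\<forall>b\<in>carrier B. \<forall>a\<in>carrier A. L (b \<diamondop> a) = g b *[D] h a)" unfolding C_simps ..
 hence L: "\<And>X. X \<in>. C ==> L X \<in>. D"
  "\<And>X Y. X \<in>. C ==> Y \<in>. C ==> L (X +[C] Y) = L X +[D] L Y"
  "\<And>b a. b \<in>. B ==> a \<in>. A ==> L (b \<diamondop> a) = g b *[D] h a" by simp_all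
 have mult: "L (X *[C] Y) = L X *[D] L Y" if X: "X \<in>. C" and Y: "Y \<in>. C" for X Y
  using X
 proof (induction rule: C_induct)
  case (pure i1 j1 b1 a1)
  note p1 = B.comp_carrier[OF pure(1)] A.comp_carrier[OF pure(2)]
  show ?case
   using Y
  proof (induction rule: C_induct)
   case (pure i2 j2 b2 a2)
   note p2 = B.comp_carrier[OF pure(1)] A.comp_carrier[OF pure(2)]
   note s = galg_homD(1)[OF sigma_pow_hom[of i2] p1(2)]
   have "g b1 *[D] (h a1 *[D] g b2) *[D] h a2 = g b1 *[D] (g b2 *[D] h ((\<sigma> ^^ i2) a1)) *[D] h a2"
    using comm[OF pure(1) p1(2)] by simp
   thus ?case
    unfolding C_mult[OF p1 pure(1) p2(2)] using p1 p2 s by (simp add: L(3) g1(1,2) h1(1,2) D.A.m_assoc)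
  next
   case (add Y Y')
   thus ?case using p1 L(1) by (simp add: L(2) C.A.r_distr D.A.r_distr)
  qed
 next
  case (add X X')
  thus ?case using Y L(1) by (simp add: L(2) C.A.l_distr D.A.l_distr)
 qed
 have smult: "L (k *:[C] X) = k *:[D] L X" if k: "k \<in>. K" and X: "X \<in>. C" for k X
  using X
 proof (induction rule: C_induct)
  case (pure i j b a)
  note p = B.comp_carrier[OF pure(1)] A.comp_carrier[OF pure(2)]
  show ?case
   unfolding ptC_smult_l[OF k p, symmetric] using p k
   by (simp add: L(3) g1(1,5) h1(1) flip: D.smult_mult_left)
 next
  case (add X Y)
  thus ?case using k L(1) by (simp add: L(2) C.KA.smult_r_distr D.KA.smult_r_distr)
 qed
 have comp: "L X \<in> component D n" if "X \<in> component C n" for X n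
  using that
 proof (induction rule: C_comp_induct)
  case (pure i j b a)
  show ?case
   using D.component_mult[OF g1(6)[OF pure(1)] h1(6)[OF pure(2)]] L(3) pure A.comp_carrier B.comp_carrier by simp
 next
  case (add X Y)
  thus ?case by (simp add: L(2) D.comp_add)
 qed
 have "L 1[C] = 1[D]" unfolding C_one by (simp add: L(3) g1(4) h1(4))
 hence "galg_hom K C D L"
  unfolding galg_hom_def using L mult smult comp by (auto intro!: ring_hom_memI)
 thus ?thesis using L(3) by blast
qed

lemma inl_hom: "galg_hom K B C (\<lambda>b. b \<diamondop> 1[A])"
proof -
 have "(x *[B] y) \<diamondop> 1[A] = (x \<diamondop> 1[A]) *[C] (y \<diamondop> 1[A])" if x: "x \<in>. B" and "y \<in>. B" for x y
  using that(2)
 proof (induction rule: B.graded_induct)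
  case (hom i y)
  thus ?case using C_mult[OF x _ hom] galg_homD(4)[OF sigma_pow_hom] by simp
 next
  case (add y z)
  thus ?case using x by (simp add: B.A.r_distr ptC_add_l C.A.r_distr)
 qed
 moreover have "x \<diamondop> 1[A] \<in> component C i" if "x \<in> component B i" for x i using pt_comp[OF that A.one_comp] by simp
 ultimately show ?thesis
  unfolding galg_hom_def by (auto intro!: ring_hom_memI simp: ptC_add_l ptC_smult_l C_one)
qed

lemma inr_hom: "galg_hom K A C (\<lambda>a. 1[B] \<diamondop> a)"
proof -
 have "1[B] \<diamondop> (x *[A] y) = (1[B] \<diamondop> x) *[C] (1[B] \<diamondop> y)" if "x \<in>. A" and "y \<in>. A" for x y
  using C_mult[OF _ that(1) B.one_comp that(2)] by simp
 moreover have "1[B] \<diamondop> x \<in> component C i" if "x \<in> component A i" for x i using pt_comp[OF B.one_comp that] by simp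
 ultimately show ?thesis
  unfolding galg_hom_def by (auto intro!: ring_hom_memI simp: ptC_add_r ptC_smult_r C_one)
qed

text \<open>In \<open>B\<close> scalars are central, and \<open>\<sigma>\<close> preserves the augmentation.\<close>
lemma prl_exists:
 "\<exists>\<pi>. galg_hom K C B \<pi> \<and> (\<forall>b\<in>carrier B. \<forall>a\<in>carrier A. \<pi> (b \<diamondop> a) = A.eps a *:[B] b)"
proof -
 have "\<exists>\<pi>. galg_hom K C B \<pi> \<and> (\<forall>b\<in>carrier B. \<forall>a\<in>carrier A. \<pi> (b \<diamondop> a) = id b *[B] (A.eps a *:[B] 1[B]))"
 proof (rule universal_property[OF B.connected_graded_algebra_axioms galg_hom_id])
  show "galg_hom K A B (\<lambda>a. A.eps a *:[B] 1[B])"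
   unfolding A.eps_def by (rule augmentation_galg_hom) unfold_locales
  fix j b a assume b: "b \<in> component B j" and a: "a \<in>. A"
  have "A.eps ((\<sigma> ^^ j) a) = A.eps a"
   unfolding A.eps_def by (rule galg_hom_aug[OF _ _ sigma_pow_hom a]) unfold_locales
  thus "(A.eps a *:[B] 1[B]) *[B] id b = id b *[B] (A.eps ((\<sigma> ^^ j) a) *:[B] 1[B])"
   using a B.comp_carrier[OF b] by (simp add: B.scalar_mult flip: B.smult_mult_right)
 qed
 thus ?thesis by (simp flip: B.smult_mult_right)
qed

text \<open>The augmentation of \<open>b\<close> vanishes unless \<open>b\<close> has degree 0, where \<open>\<sigma>\<^sup>0\<close> is the identity.\<close>
lemma prr_exists:
 "\<exists>\<pi>. galg_hom K C A \<pi> \<and> (\<forall>b\<in>carrier B. \<forall>a\<in>carrier A. \<pi> (b \<diamondop> a) = B.eps b *:[A] a)"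
proof -
 have "\<exists>\<pi>. galg_hom K C A \<pi> \<and> (\<forall>b\<in>carrier B. \<forall>a\<in>carrier A. \<pi> (b \<diamondop> a) = (B.eps b *:[A] 1[A]) *[A] id a)"
 proof (rule universal_property[OF A.connected_graded_algebra_axioms _ galg_hom_id])
  show "galg_hom K B A (\<lambda>a. B.eps a *:[A] 1[A])"
   unfolding B.eps_def by (rule augmentation_galg_hom) unfold_locales
  fix j b a assume b: "b \<in> component B j" and a: "a \<in>. A"
  have s: "(\<sigma> ^^ j) a \<in>. A" using galg_homD(1)[OF sigma_pow_hom a] .
  have "id a *[A] (B.eps b *:[A] 1[A]) = B.eps b *:[A] a"
   using a B.comp_carrier[OF b] by (simp flip: A.smult_mult_right)
  moreover have "(B.eps b *:[A] 1[A]) *[A] id ((\<sigma> ^^ j) a) = B.eps b *:[A] (\<sigma> ^^ j) a"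
   using s B.comp_carrier[OF b] by (simp add: A.scalar_mult)
  moreover have "B.eps b *:[A] (\<sigma> ^^ j) a = B.eps b *:[A] a"
   using B.eps_pos[OF b] a s by (cases "j = 0") simp_all
  ultimately show "id a *[A] (B.eps b *:[A] 1[A]) = (B.eps b *:[A] 1[A]) *[A] id ((\<sigma> ^^ j) a)" by simp
 qed
 thus ?thesis by (simp add: A.scalar_mult)
qed

end

text \<open>The components of a retract of \<open>C\<close> are finite-dimensional, so that it has a minimal resolution, to which \<open>gen_retract\<close> applies.\<close>
lemma K2_retract:
 assumes A: "connected_graded_algebra K A" and C: "connected_graded_algebra K C" "is_K2 K C"
  and \<iota>: "galg_hom K A C \<iota>" and \<pi>: "galg_hom K C A \<pi>" and eq: "\<And>a. a \<in>. A ==> \<pi> (\<iota> a) = a"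
 shows "is_K2 K A"
  and "\<exists>P. minimal_res K A P \<and> (\<forall>n m f. is_coc K A P n m f --> gen K A P n m f)"
proof -
 interpret A: connected_graded_algebra K A by fact
 from C(2)[unfolded is_K2_iff[OF C(1)]] obtain R where R: "resolution K C R"
  and all: "\<forall>n m f. is_coc K C R n m f --> gen K C R n m f" by (elim exE conjE)
 have "A.fin_comps"
  by (rule A.fin_comps_retract[OF C(1) resolution.resolution_fin_comps[OF R] \<iota> \<pi> eq])
 from A.minimal_resolution_exists[OF this] obtain P where P: "minimal_res K A P" ..
 hence rP: "resolution K A P" unfolding minimal_res_def by blast
 have gP: "\<forall>n m f. is_coc K A P n m f --> gen K A P n m f"
  using gen_retract[OF rP R \<iota> \<pi> eq] all by blast
 show "\<exists>P. minimal_res K A P \<and> (\<forall>n m f. is_coc K A P n m f --> gen K A P n m f)" using P gP by blast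
 show "is_K2 K A" unfolding is_K2_iff[OF A] using rP gP by blast
qed

lemma (in twisted) factors_K2:
 assumes "is_K2 K C"
 shows "is_K2 K A" "is_K2 K B"
proof -
 from prr_exists obtain \<pi> where p: "galg_hom K C A \<pi> \<and> (\<forall>b\<in>carrier B. \<forall>a\<in>carrier A. \<pi> (b \<diamondop> a) = B.eps b *:[A] a)" ..
 show "is_K2 K A"
  by (rule K2_retract(1)[OF _ _ assms inr_hom conjunct1[OF p]])
   (unfold_locales, use p in \<open>simp add: B.eps_one\<close>)
 from prl_exists obtain \<rho> where r: "galg_hom K C B \<rho> \<and> (\<forall>b\<in>carrier B. \<forall>a\<in>carrier A. \<rho> (b \<diamondop> a) = A.eps a *:[B] b)" ..
 show "is_K2 K B"
  by (rule K2_retract(1)[OF _ _ assms inl_hom conjunct1[OF r]])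
   (unfold_locales, use r in \<open>simp add: A.eps_one\<close>)
qed

section \<open>Tensor products of free modules\<close>

text \<open>A generator of the tensor product is a triple: the degree \<open>i\<close> of the left factor, a generator \<open>u\<close> of \<open>Q i\<close> and a generator \<open>v\<close> of the other factor.\<close>
definition enc :: "nat => nat => nat => nat" where "enc i u v = prod_encode (i, prod_encode (u, v))"
definition \<I> :: "nat => nat" where "\<I> w = fst (prod_decode w)"
definition \<U> :: "nat => nat" where "\<U> w = fst (prod_decode (snd (prod_decode w)))"
definition \<V> :: "nat => nat" where "\<V> w = snd (prod_decode (snd (prod_decode w)))"

lemma enc_simps [simp]: "\<I> (enc i u v) = i" "\<U> (enc i u v) = u" "\<V> (enc i u v) = v" "enc (\<I> w) (\<U> w) (\<V> w) = w"
 by (simp_all add: enc_def \<I>_def \<U>_def \<V>_def)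

lemma (in connected_graded_algebra) single_add:
 "a \<in>. A ==> b \<in>. A ==> single A (a +[A] b) i = (\<lambda>j. single A a i j +[A] single A b i j)"
 by (auto simp: single_def)

lemma (in connected_graded_algebra) single_mult:
 "a \<in>. A ==> b \<in>. A ==> (\<lambda>j. a *[A] single A b i j) = single A (a *[A] b) i"
 by (auto simp: single_def)

locale product = twisted K A B \<sigma> + P: resolution K A P + Q: resolution K B Q
 for K :: "'k ring" and A :: "(nat, 'k, 'a) graded_module" and B :: "(nat, 'k, 'b) graded_module"
  and \<sigma> :: "'a => 'a" and P :: "('k, 'a) free_complex" and Q :: "('k, 'b) free_complex" +
 assumes minP: "minimal_res K A P" and minQ: "minimal_res K B Q"
begin

lemma goodP: "good_gens (gens P n)" and goodQ: "good_gens (gens Q n)"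
 using minP minQ unfolding minimal_res_def by auto

lemma deg_nonneg: "gens P n v = Some e ==> 0 \<le> e" "gens Q n u = Some e ==> 0 \<le> e"
 using goodP goodQ unfolding good_gens_def by blast+

definition \<zeta> :: "nat => nat => int option" where
 "\<zeta> n w = (if \<I> w \<le> n then (case gens Q (\<I> w) (\<U> w) of None => None
  | Some d => (case gens P (n - \<I> w) (\<V> w) of None => None | Some e => Some (d + e))) else None)"

abbreviation "X n \<equiv> free_module C (\<zeta> n)"

lemma zeta_Some: "\<zeta> n w = Some m \<longleftrightarrow>
  \<I> w \<le> n \<and> (\<exists>d e. gens Q (\<I> w) (\<U> w) = Some d \<and> gens P (n - \<I> w) (\<V> w) = Some e \<and> m = d + e)"
 unfolding \<zeta>_def by (auto split: option.splits)

lemma zeta_enc: "gens Q i u = Some d ==> gens P j v = Some e ==> i + j = n ==> \<zeta> n (enc i u v) = Some (d + e)"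
 unfolding zeta_Some by auto

definition dg :: "nat => nat => nat" where "dg i u = nat (the (gens Q i u))"

text \<open>The tensor \<open>q \<boxtimes> p\<close> of \<open>q\<close> in \<open>Q i\<close> and \<open>p\<close> in the other factor, by its coefficients at pairs of generators. In \<open>b e\<^sub>u \<boxtimes> a f\<^sub>v\<close> the coefficient \<open>a\<close> has to pass the generator \<open>e\<^sub>u\<close>, which applies the inverse of \<open>\<sigma>\<close> as many times as the degree of \<open>e\<^sub>u\<close> says.\<close>
definition tn :: "nat => (nat => 'b) => (nat => 'a) => nat => ('b \<times> 'a => 'k) set" where
 "tn i q p = (\<lambda>w. if \<I> w = i then q (\<U> w) \<diamondop> (\<tau> ^^ dg i (\<U> w)) (p (\<V> w)) else 0[C])"

lemma tau_zero [simp]: "(\<tau> ^^ n) 0[A] = 0[A]"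
 using galg_homD(5)[OF tau_pow_hom A.K.zero_closed A.A.zero_closed] galg_homD(1)[OF tau_pow_hom A.A.zero_closed]
 by simp

lemma tau_closed' [simp]: "a \<in>. A ==> (\<tau> ^^ n) a \<in>. A"
 by (rule galg_homD(1)[OF tau_pow_hom])

lemma sigma_closed' [simp]: "a \<in>. A ==> (\<sigma> ^^ n) a \<in>. A"
 by (rule galg_homD(1)[OF sigma_pow_hom])

lemma tn_coeff: "q \<in>. Q.T i ==> p \<in>. P.T j ==> tn i q p w \<in>. C"
 unfolding tn_def using A.fm_coeff B.fm_coeff by simp

lemma tn_closed:
 assumes q: "q \<in>. Q.T i" and p: "p \<in>. P.T j" and n: "i + j = n"
 shows "tn i q p \<in>. X n"
 unfolding free_module_carrier
proof (intro conjI allI impI)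
 show "tn i q p w \<in>. C" for w by (rule tn_coeff[OF q p])
 have "{w. tn i q p w ~= 0[C]} \<subseteq> (\<lambda>(u, v). enc i u v) ` ({u. q u ~= 0[B]} \<times> {v. p v ~= 0[A]})"
 proof
  fix w assume "w \<in> {w. tn i q p w ~= 0[C]}"
  hence "\<I> w = i \<and> q (\<U> w) ~= 0[B] \<and> p (\<V> w) ~= 0[A]"
   unfolding tn_def using ptC_zero A.fm_coeff[OF p] B.fm_coeff[OF q] by (auto split: if_splits)
  thus "w \<in> (\<lambda>(u, v). enc i u v) ` ({u. q u ~= 0[B]} \<times> {v. p v ~= 0[A]})"
   by (intro image_eqI[of _ _ "(\<U> w, \<V> w)"]) auto
 qed
 thus "finite {w. tn i q p w ~= 0[C]}"
  by (rule finite_subset) (use p q in "simp add: free_module_carrier")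
 fix w assume z: "\<zeta> n w = None"
 show "tn i q p w = 0[C]"
 proof (cases "\<I> w = i")
  case True
  hence "gens Q i (\<U> w) = None \<or> gens P j (\<V> w) = None" using z n unfolding \<zeta>_def by (auto split: option.splits)
  thus ?thesis using True q p A.fm_coeff[OF p] B.fm_coeff[OF q]
   by (auto simp: free_module_carrier tn_def ptC_zero)
 qed (simp add: tn_def)
qed

lemma tn_comp:
 assumes q: "q \<in> component (Q.T i) d" and p: "p \<in> component (P.T j) e" and n: "i + j = n"
 shows "tn i q p \<in> component (X n) (d + e)"
proof (rule fm_compI[OF tn_closed[OF fm_compD(1)[OF q] fm_compD(1)[OF p] n]])
 fix w m assume "\<zeta> n w = Some m"
 then obtain d' e' where w: "gens Q (\<I> w) (\<U> w) = Some d'" "gens P (n - \<I> w) (\<V> w) = Some e'" "m = d' + e'"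
  unfolding zeta_Some by blast
 have c: "q (\<U> w) \<in>. B" "p (\<V> w) \<in>. A" using B.fm_coeff[OF fm_compD(1)[OF q]] A.fm_coeff[OF fm_compD(1)[OF p]] by auto
 have z: "tn i q p w = 0[C]" if "\<not> (d' \<le> d \<and> e' \<le> e)"
 proof (cases "\<I> w = i")
  case True
  hence j: "j = n - \<I> w" using n by simp
  hence "q (\<U> w) = 0[B] \<or> p (\<V> w) = 0[A]"
   using that fm_compD(3)[OF q, of "\<U> w" d'] fm_compD(3)[OF p, of "\<V> w" e'] w True by auto
  thus ?thesis using c by (auto simp: tn_def ptC_zero)
 qed (simp add: tn_def)
 show "tn i q p w = 0[C]" if "\<not> m \<le> d + e" using z that w by simp
 show "tn i q p w \<in> component C (nat (d + e - m))"
 proof (cases "\<I> w = i \<and> d' \<le> d \<and> e' \<le> e")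
  case True
  hence j: "j = n - \<I> w" using n by simp
  have "q (\<U> w) \<in> component B (nat (d - d'))" "p (\<V> w) \<in> component A (nat (e - e'))"
   using fm_compD(2)[OF q, of "\<U> w" d'] fm_compD(2)[OF p, of "\<V> w" e'] w True j by simp_all
  from pt_comp[OF this(1) galg_homD(6)[OF tau_pow_hom this(2)]]
  have t: "tn i q p w \<in> component C (nat (d - d') + nat (e - e'))" using True by (simp add: tn_def)
  have e: "nat (d - d') + nat (e - e') = nat (d + e - m)"
   using nat_add_distrib[of "d - d'" "e - e'"] True w(3) by (simp add: add_diff_add)
  show ?thesis using t unfolding e .
 next
  case False
  hence t0: "tn i q p w = 0[C]" using z by (cases "\<I> w = i") (blast, simp add: tn_def)
  show ?thesis unfolding t0 by (rule C.comp_zero)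
 qed
qed

text \<open>At a generator of degree \<open>e\<close> the coefficient of \<open>q\<close> has degree \<open>d - e\<close>; multiplying by it applies \<open>\<sigma>\<close> as often as \<open>\<tau>\<^sup>e \<circ> \<sigma>\<^sup>d\<close> does.\<close>
lemma tn_smult:
 assumes q: "q \<in> component (Q.T i) (int d)" and p: "p \<in>. P.T j" and b: "b \<in>. B" and a: "a \<in>. A"
 shows "(\<lambda>w. (b \<diamondop> a) *[C] tn i q p w) = tn i (\<lambda>u. b *[B] q u) (\<lambda>v. (\<sigma> ^^ d) a *[A] p v)"
proof
 fix w
 define u v where uv: "u = \<U> w" "v = \<V> w"
 have c: "q u \<in>. B" "p v \<in>. A" using B.fm_coeff[OF fm_compD(1)[OF q]] A.fm_coeff[OF p] by auto
 show "(b \<diamondop> a) *[C] tn i q p w = tn i (\<lambda>u. b *[B] q u) (\<lambda>v. (\<sigma> ^^ d) a *[A] p v) w"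
 proof (cases "\<I> w = i \<and> q u ~= 0[B]")
  case False
  thus ?thesis using c a b by (auto simp: tn_def ptC_zero simp flip: uv)
 next
  case True
  have "gens Q i u ~= None" using True fm_compD(1)[OF q] unfolding free_module_carrier by blast
  then obtain e where e: "gens Q i u = Some e" by blast
  have le: "e \<le> int d" "0 \<le> e" using fm_compD(3)[OF q e] True deg_nonneg(2)[OF e] by auto
  have qu: "q u \<in> component B (nat (int d - e))" by (rule fm_compD(2)[OF q e le(1)])
  have d: "d = dg i u + nat (int d - e)" using le e by (simp add: dg_def)
  have t: "(\<tau> ^^ dg i u) ((\<sigma> ^^ d) a) = (\<sigma> ^^ nat (int d - e)) a"
   by (subst d) (rule tau_sigma_pow[OF a])
  show ?thesis
   using True C_mult[OF b a qu tau_closed'[OF c(2)]] galg_homD(2)[OF tau_pow_hom sigma_closed'[OF a] c(2)] t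
   by (simp add: tn_def flip: uv)
 qed
qed

lemma tn_bal:
 assumes q: "q \<in>. Q.T i" and p: "p \<in>. P.T j" and k: "k \<in>. K"
 shows "tn i (\<lambda>u. (k *:[B] 1[B]) *[B] q u) p = tn i q (\<lambda>v. (k *:[A] 1[A]) *[A] p v)"
 using B.fm_coeff[OF q] A.fm_coeff[OF p] k galg_homD(5)[OF tau_pow_hom k]
 by (auto simp: fun_eq_iff tn_def B.scalar_mult A.scalar_mult ptC_smult_l ptC_smult_r)

section \<open>Biadditive maps on pairs of free modules\<close>

definition biadd :: "('c, 'm) ring_scheme => nat => nat => ((nat => 'b) => (nat => 'a) => 'c) => bool" where
 "biadd N i j \<psi> \<longleftrightarrow> (\<forall>q\<in>carrier (Q.T i). \<forall>p\<in>carrier (P.T j). \<psi> q p \<in>. N \<and>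
  (\<forall>q'\<in>carrier (Q.T i). \<psi> (\<lambda>u. q u +[B] q' u) p = \<psi> q p +[N] \<psi> q' p) \<and>
  (\<forall>p'\<in>carrier (P.T j). \<psi> q (\<lambda>u. p u +[A] p' u) = \<psi> q p +[N] \<psi> q p'))"

lemma biaddD:
 assumes "biadd N i j \<psi>" "q \<in>. Q.T i" "p \<in>. P.T j"
 shows "\<psi> q p \<in>. N"
  and "q' \<in>. Q.T i ==> \<psi> (\<lambda>u. q u +[B] q' u) p = \<psi> q p +[N] \<psi> q' p"
  and "p' \<in>. P.T j ==> \<psi> q (\<lambda>u. p u +[A] p' u) = \<psi> q p +[N] \<psi> q p'"
 using assms unfolding biadd_def by simp_all

lemma biadd_zero:
 assumes N: "abelian_group N" and \<psi>: "biadd N i j \<psi>"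
 shows "q \<in>. Q.T i ==> \<psi> q (\<lambda>v. 0[A]) = 0[N]" "p \<in>. P.T j ==> \<psi> (\<lambda>u. 0[B]) p = 0[N]"
 using additive_zero[OF A.fm_group[of "gens P j"] N, of "\<psi> q"] additive_zero[OF B.fm_group[of "gens Q i"] N, of "\<lambda>q. \<psi> q p"]
  biaddD[OF \<psi>] by simp_all

lemma biadd_eq:
 assumes N: "abelian_group N" and f: "biadd N i j f" and g: "biadd N i j g"
  and eq: "\<And>u v d e k l a b. gens Q i u = Some d ==> gens P j v = Some e ==> b \<in> component B k ==> a \<in> component A l ==>
   f (single B b u) (single A a v) = g (single B b u) (single A a v)"
  and q: "q \<in>. Q.T i" and p: "p \<in>. P.T j"
 shows "f q p = g q p"
 using q
proof (induction rule: B.fm_induct)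
 case zero
 thus ?case using biadd_zero(2)[OF N f p] biadd_zero(2)[OF N g p] by simp
next
 case (single u d k b)
 have s: "single B b u \<in>. Q.T i" using B.single_carrier single B.comp_carrier by blast
 show ?case
  using p
 proof (induction rule: A.fm_induct)
  case zero
  thus ?case using biadd_zero(1)[OF N f s] biadd_zero(1)[OF N g s] by simp
 next
  case (single v e l a)
  thus ?case using eq \<open>gens Q i u = Some d\<close> \<open>b \<in> component B k\<close> by blast
 next
  case (add y z)
  thus ?case using biaddD(3)[OF f s add(1,2)] biaddD(3)[OF g s add(1,2)] by simp
 qed
next
 case (add y z)
 thus ?case using biaddD(2)[OF f add(1) p add(2)] biaddD(2)[OF g add(1) p add(2)] by simp
qed

lemma biadd_tn: "i + j = n ==> biadd (X n) i j (tn i)"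
 unfolding biadd_def
proof (intro ballI conjI)
 fix q p assume c: "q \<in>. Q.T i" "p \<in>. P.T j" and n: "i + j = n"
 show "tn i q p \<in>. X n" by (rule tn_closed[OF c n])
 note cc = B.fm_coeff[OF c(1)] A.fm_coeff[OF c(2)]
 show "tn i (\<lambda>u. q u +[B] q' u) p = tn i q p +[X n] tn i q' p" if "q' \<in>. Q.T i" for q'
  using cc B.fm_coeff[OF that] by (auto simp: fun_eq_iff tn_def ptC_add_l)
 show "tn i q (\<lambda>u. p u +[A] p' u) = tn i q p +[X n] tn i q p'" if "p' \<in>. P.T j" for p'
  using cc A.fm_coeff[OF that] galg_homD(3)[OF tau_pow_hom] by (auto simp: fun_eq_iff tn_def ptC_add_r)
qed

lemma biadd_comp:
 assumes \<psi>: "biadd N i j \<psi>" and f: "\<And>x. x \<in>. N ==> f x \<in>. N'"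
  "\<And>x y. x \<in>. N ==> y \<in>. N ==> f (x +[N] y) = f x +[N'] f y"
 shows "biadd N' i j (\<lambda>q p. f (\<psi> q p))"
 unfolding biadd_def using biaddD[OF \<psi>] f by simp

lemma biadd_add:
 assumes "abelian_group N" "biadd N i j \<psi>" "biadd N i j \<chi>"
 shows "biadd N i j (\<lambda>q p. \<psi> q p +[N] \<chi> q p)"
proof -
 interpret N: abelian_group N by fact
 show ?thesis unfolding biadd_def using biaddD[OF assms(2)] biaddD[OF assms(3)] by (simp add: N.a_ac)
qed

lemma biadd_const_zero: "abelian_group N ==> biadd N i j (\<lambda>q p. 0[N])"
 unfolding biadd_def using abelian_groupE(2) abelian_group.r_neg abelian_monoid.l_zero[OF abelian_group.axioms(1)] by fastforce

lemma biadd_pre: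
 assumes \<psi>: "biadd N i' j' \<psi>"
  and f: "\<And>x. x \<in>. Q.T i ==> f x \<in>. Q.T i'"
   "\<And>x y. x \<in>. Q.T i ==> y \<in>. Q.T i ==> f (\<lambda>u. x u +[B] y u) = (\<lambda>u. f x u +[B] f y u)"
  and g: "\<And>x. x \<in>. P.T j ==> g x \<in>. P.T j'"
   "\<And>x y. x \<in>. P.T j ==> y \<in>. P.T j ==> g (\<lambda>u. x u +[A] y u) = (\<lambda>u. g x u +[A] g y u)"
 shows "biadd N i j (\<lambda>q p. \<psi> (f q) (g p))"
 unfolding biadd_def using biaddD[OF \<psi>] f g by simp

lemma tn_single:
 "tn i (single B b u) (single A a v) = single C (b \<diamondop> (\<tau> ^^ dg i u) a) (enc i u v)"
 if "b \<in>. B" "a \<in>. A"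
proof
 fix w
 have "w = enc i u v \<longleftrightarrow> \<I> w = i \<and> \<U> w = u \<and> \<V> w = v" by (metis enc_simps)
 thus "tn i (single B b u) (single A a v) w = single C (b \<diamondop> (\<tau> ^^ dg i u) a) (enc i u v) w"
  using that by (auto simp: tn_def single_def ptC_zero)
qed

text \<open>An element of \<open>C\<close> times a generator is a sum of tensors of homogeneous elements supported on one generator each.\<close>
lemma X_induct [consumes 1, case_names tn add]:
 assumes "x \<in>. X n"
  and tn: "\<And>i j d e q p. i + j = n ==> q \<in> component (Q.T i) (int d) ==> p \<in> component (P.T j) (int e) ==> S (tn i q p)"
  and add: "\<And>y z. y \<in>. X n ==> z \<in>. X n ==> S y ==> S z ==> S (\<lambda>w. y w +[C] z w)"
 shows "S x"
 using assms(1)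
proof (induction rule: C.fm_induct)
 case zero
 have "S (tn 0 (\<lambda>i. 0[B]) (\<lambda>i. 0[A]))"
  by (rule tn[of 0 n _ 0 _ 0]) (use P.T.ncomp_zero[where i = 0] Q.T.ncomp_zero[where i = 0] in auto)
 thus ?case by (simp add: tn_def ptC_zero if_distrib cong: if_cong)
next
 case (single w m k c)
 then obtain d e where w: "\<I> w \<le> n" "gens Q (\<I> w) (\<U> w) = Some d" "gens P (n - \<I> w) (\<V> w) = Some e"
  unfolding zeta_Some by blast
 show ?case
  using single(2)
 proof (induction rule: C_comp_induct)
  case (pure k l b a)
  note p = B.comp_carrier[OF pure(1)] A.comp_carrier[OF pure(2)]
  let ?a = "(\<sigma> ^^ dg (\<I> w) (\<U> w)) a"
  have "int k + d = int (k + nat d)" "int l + e = int (l + nat e)" using deg_nonneg w by auto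
  hence "single B b (\<U> w) \<in> component (Q.T (\<I> w)) (int (k + nat d))"
    "single A ?a (\<V> w) \<in> component (P.T (n - \<I> w)) (int (l + nat e))"
   using B.single_comp[OF pure(1), where \<beta> = "gens Q (\<I> w)"] A.single_comp[OF galg_homD(6)[OF sigma_pow_hom pure(2)], where \<beta> = "gens P (n - \<I> w)"] w by metis+
  from tn[OF _ this] have "S (tn (\<I> w) (single B b (\<U> w)) (single A ?a (\<V> w)))" using w(1) by simp
  moreover have "(\<tau> ^^ dg (\<I> w) (\<U> w)) ?a = a" using tau_sigma_pow[OF p(2), of _ 0] by simp
  ultimately show ?case using tn_single[OF p(1) sigma_closed'[OF p(2)]] by simp
 next
  case (add y z)
  thus ?case using assms(3)[of "single C y w" "single C z w"] C.single_carrier single(1) by (simp add: C.single_add)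
 qed
qed (rule add)

lemma X_eqI:
 assumes "\<And>y z. y \<in>. X n ==> z \<in>. X n ==> f (\<lambda>w. y w +[C] z w) = f y +[N] f z"
  and "\<And>y z. y \<in>. X n ==> z \<in>. X n ==> g (\<lambda>w. y w +[C] z w) = g y +[N] g z"
  and "\<And>i j q p. i + j = n ==> q \<in>. Q.T i ==> p \<in>. P.T j ==> f (tn i q p) = g (tn i q p)"
  and "x \<in>. X n"
 shows "f x = g x"
 using assms(4)
proof (induction rule: X_induct)
 case (tn i j d e q p)
 thus ?case using assms(3) fm_compD(1) by metis
qed (use assms(1,2) in simp)

text \<open>At each generator \<open>tensor_lift\<close> provides the map on the coefficient; the values are added up over the support.\<close>
lemma X_additive_exists:
 assumes N: "abelian_group N" and \<psi>: "\<And>i j. i + j = n ==> biadd N i j (\<psi> i j)"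
  and bal: "\<And>i j k q p. i + j = n ==> k \<in>. K ==> q \<in>. Q.T i ==> p \<in>. P.T j ==>
   \<psi> i j (\<lambda>u. (k *:[B] 1[B]) *[B] q u) p = \<psi> i j q (\<lambda>v. (k *:[A] 1[A]) *[A] p v)"
 shows "\<exists>H. (\<forall>x\<in>carrier (X n). H x \<in>. N) \<and>
  (\<forall>x\<in>carrier (X n). \<forall>y\<in>carrier (X n). H (\<lambda>w. x w +[C] y w) = H x +[N] H y) \<and>
  (\<forall>i j. i + j = n --> (\<forall>q\<in>carrier (Q.T i). \<forall>p\<in>carrier (P.T j). H (tn i q p) = \<psi> i j q p))"
proof -
 interpret N: abelian_group N by fact
 have "\<exists>L. \<zeta> n w ~= None --> (\<forall>c\<in>carrier C. L c \<in>. N) \<and>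
   (\<forall>c\<in>carrier C. \<forall>c'\<in>carrier C. L (c +[C] c') = L c +[N] L c') \<and>
   (\<forall>b\<in>carrier B. \<forall>a\<in>carrier A. L (b \<diamondop> a) =
    \<psi> (\<I> w) (n - \<I> w) (single B b (\<U> w)) (single A ((\<sigma> ^^ dg (\<I> w) (\<U> w)) a) (\<V> w)))" for w
 proof (cases "\<zeta> n w")
  case (Some m)
  define i j u v where d: "i = \<I> w" "j = n - \<I> w" "u = \<U> w" "v = \<V> w"
  have ij: "i + j = n" using Some unfolding zeta_Some d by auto
  have s: "single B b u \<in>. Q.T i" if "b \<in>. B" for b
   using Some B.single_carrier[OF that] unfolding zeta_Some d by blast
  have t: "single A a v \<in>. P.T j" if "a \<in>. A" for a
   using Some A.single_carrier[OF that] unfolding zeta_Some d by blast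
  have "\<exists>L. (\<forall>c\<in>carrier C. L c \<in>. N) \<and>
   (\<forall>c\<in>carrier C. \<forall>c'\<in>carrier C. L (c +[C] c') = L c +[N] L c') \<and>
   (\<forall>b\<in>carrier B. \<forall>a\<in>carrier A. L (b \<diamondop> a) = \<psi> i j (single B b u) (single A ((\<sigma> ^^ dg i u) a) v))"
   unfolding C_simps
  proof (rule tensor_lift[OF N])
   fix b a assume b: "b \<in>. B" and a: "a \<in>. A"
   note st = s[OF b] t[OF sigma_closed'[OF a]]
   show "\<psi> i j (single B b u) (single A ((\<sigma> ^^ dg i u) a) v) \<in>. N"
    by (rule biaddD(1)[OF \<psi>[OF ij] st])
   show "\<psi> i j (single B (b +[B] b') u) (single A ((\<sigma> ^^ dg i u) a) v) =
     \<psi> i j (single B b u) (single A ((\<sigma> ^^ dg i u) a) v) +[N] \<psi> i j (single B b' u) (single A ((\<sigma> ^^ dg i u) a) v)"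
    if b': "b' \<in>. B" for b'
    using biaddD(2)[OF \<psi>[OF ij] st s[OF b']] B.single_add[OF b b'] by simp
   show "\<psi> i j (single B b u) (single A ((\<sigma> ^^ dg i u) (a +[A] a')) v) =
     \<psi> i j (single B b u) (single A ((\<sigma> ^^ dg i u) a) v) +[N] \<psi> i j (single B b u) (single A ((\<sigma> ^^ dg i u) a') v)"
    if a': "a' \<in>. A" for a'
    using biaddD(3)[OF \<psi>[OF ij] st t[OF sigma_closed'[OF a']]] a a' galg_homD(3)[OF sigma_pow_hom a a']
    by (simp add: A.single_add)
   show "\<psi> i j (single B (k *:[B] b) u) (single A ((\<sigma> ^^ dg i u) a) v) =
     \<psi> i j (single B b u) (single A ((\<sigma> ^^ dg i u) (k *:[A] a)) v)" if k: "k \<in>. K" for k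
    using bal[OF ij k st] k a b galg_homD(5)[OF sigma_pow_hom k a]
    by (simp add: A.single_mult B.single_mult A.scalar_mult B.scalar_mult)
  qed
  thus ?thesis unfolding d by (elim exE) (rule exI, rule impI)
 qed simp
 hence "\<forall>w. \<exists>L. \<zeta> n w ~= None --> (\<forall>c\<in>carrier C. L c \<in>. N) \<and>
   (\<forall>c\<in>carrier C. \<forall>c'\<in>carrier C. L (c +[C] c') = L c +[N] L c') \<and>
   (\<forall>b\<in>carrier B. \<forall>a\<in>carrier A. L (b \<diamondop> a) =
    \<psi> (\<I> w) (n - \<I> w) (single B b (\<U> w)) (single A ((\<sigma> ^^ dg (\<I> w) (\<U> w)) a) (\<V> w)))" by (rule allI)
 from choice[OF this] obtain L where LL: "\<forall>w. \<zeta> n w ~= None --> (\<forall>c\<in>carrier C. L w c \<in>. N) \<and>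
   (\<forall>c\<in>carrier C. \<forall>c'\<in>carrier C. L w (c +[C] c') = L w c +[N] L w c') \<and>
   (\<forall>b\<in>carrier B. \<forall>a\<in>carrier A. L w (b \<diamondop> a) =
    \<psi> (\<I> w) (n - \<I> w) (single B b (\<U> w)) (single A ((\<sigma> ^^ dg (\<I> w) (\<U> w)) a) (\<V> w)))" ..
 have L: "\<And>w c. \<zeta> n w ~= None ==> c \<in>. C ==> L w c \<in>. N"
  "\<And>w c c'. \<zeta> n w ~= None ==> c \<in>. C ==> c' \<in>. C ==> L w (c +[C] c') = L w c +[N] L w c'"
  "\<And>w b a. \<zeta> n w ~= None ==> b \<in>. B ==> a \<in>. A ==> L w (b \<diamondop> a) =
    \<psi> (\<I> w) (n - \<I> w) (single B b (\<U> w)) (single A ((\<sigma> ^^ dg (\<I> w) (\<U> w)) a) (\<V> w))" using LL by simp_all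
 have L0: "L w 0[C] = 0[N]" if "\<zeta> n w ~= None" for w
  by (rule additive_zero[OF C.A.abelian_group_axioms N]) (use L that in auto)
 have nz: "\<zeta> n w ~= None" if "x \<in>. X n" "x w ~= 0[C]" for x w
  using that unfolding free_module_carrier by blast
 define H where "H x = (\<Oplus>\<^bsub>N\<^esub>w\<in>{w. x w ~= 0[C]}. L w (x w))" for x
 have Hs: "H x = (\<Oplus>\<^bsub>N\<^esub>w\<in>J. L w (x w))"
  if "x \<in>. X n" "finite J" "{w. x w ~= 0[C]} \<subseteq> J" "\<forall>w\<in>J. \<zeta> n w ~= None" for x J
  unfolding H_def by (rule N.finsum_superset[OF that(2,3)]) (use that C.fm_coeff[OF that(1)] L0 L(1) in auto)
 have Hc: "H x \<in>. N" if "x \<in>. X n" for x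
  unfolding H_def by (rule N.finsum_closed) (use L(1) nz[OF that] C.fm_coeff[OF that] in auto)
 have Ha: "H (\<lambda>w. x w +[C] y w) = H x +[N] H y" if x: "x \<in>. X n" and y: "y \<in>. X n" for x y
 proof -
  let ?J = "{w. x w ~= 0[C]} \<union> {w. y w ~= 0[C]}"
  have J: "finite ?J" using x y unfolding free_module_carrier by blast
  have z: "\<forall>w\<in>?J. \<zeta> n w ~= None" using nz[OF x] nz[OF y] by blast
  have s: "{w. x w +[C] y w ~= 0[C]} \<subseteq> ?J" by auto
  note c = C.fm_coeff[OF x] C.fm_coeff[OF y]
  show ?thesis
   unfolding Hs[OF C.fm_add_closed[OF x y] J s z] Hs[OF x J Un_upper1 z] Hs[OF y J Un_upper2 z]
   by (rule trans[OF N.finsum_cong'[OF refl] N.finsum_addf]) (use L(1,2) c z in auto)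
 qed
 have "H (tn i q p) = \<psi> i j q p" if ij: "i + j = n" and q: "q \<in>. Q.T i" and p: "p \<in>. P.T j" for i j q p
 proof (rule biadd_eq[OF N biadd_comp[where f = H, OF biadd_tn[OF ij]] \<psi>[OF ij] _ q p])
  fix u v d e k l b a assume g: "gens Q i u = Some d" "gens P j v = Some e" and "b \<in> component B k" "a \<in> component A l"
  hence c: "b \<in>. B" "a \<in>. A" using B.comp_carrier A.comp_carrier by auto
  let ?w = "enc i u v" and ?c = "b \<diamondop> (\<tau> ^^ dg i u) a"
  have z: "\<zeta> n ?w = Some (d + e)" by (rule zeta_enc[OF g ij])
  have "H (single C ?c ?w) = (\<Oplus>\<^bsub>N\<^esub>w\<in>{?w}. L w (single C ?c ?w w))"
   by (rule Hs[OF C.single_carrier[where \<beta> = "\<zeta> n", OF _ z]]) (use z c in "auto simp: single_def split: if_splits")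
  also have "\<dots> = L ?w ?c" using L(1)[of ?w ?c] z c by (simp add: single_def)
  also have "\<dots> = \<psi> i j (single B b u) (single A a v)"
   using L(3)[of ?w b "(\<tau> ^^ dg i u) a"] z c ij[symmetric] sigma_tau_pow[OF c(2)] by simp
  finally show "H (tn i (single B b u) (single A a v)) = \<psi> i j (single B b u) (single A a v)"
   using tn_single[OF c] by simp
 qed (use Hc Ha in simp_all)
 thus ?thesis using Hc Ha by (intro exI[of _ H]) simp
qed

text \<open>These conditions reflect the action of \<open>C\<close> in \<open>tn_smult\<close>, so that such a map induces a semilinear map of degree \<open>s\<close>.\<close>
definition bisemi where
 "bisemi \<phi> N s i j \<psi> \<longleftrightarrow> biadd N i j \<psi> \<and>
  (\<forall>d e. \<forall>q\<in>component (Q.T i) (int d). \<forall>p\<in>component (P.T j) (int e). \<psi> q p \<in> component N (int d + int e + s)) \<and>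
  (\<forall>d. \<forall>q\<in>component (Q.T i) (int d). \<forall>p\<in>carrier (P.T j). \<forall>b\<in>carrier B. \<forall>a\<in>carrier A.
   \<psi> (\<lambda>u. b *[B] q u) (\<lambda>v. (\<sigma> ^^ d) a *[A] p v) = \<phi> (b \<diamondop> a) *:[N] \<psi> q p)"

lemma bisemiD:
 assumes "bisemi \<phi> N s i j \<psi>"
 shows "biadd N i j \<psi>"
  and "q \<in> component (Q.T i) (int d) ==> p \<in> component (P.T j) (int e) ==> \<psi> q p \<in> component N (int d + int e + s)"
  and "q \<in> component (Q.T i) (int d) ==> p \<in>. P.T j ==> b \<in>. B ==> a \<in>. A ==>
   \<psi> (\<lambda>u. b *[B] q u) (\<lambda>v. (\<sigma> ^^ d) a *[A] p v) = \<phi> (b \<diamondop> a) *:[N] \<psi> q p"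
 using assms unfolding bisemi_def by blast+

text \<open>The map is defined on generators. Both sides of the formula are biadditive, and by semilinearity they agree on multiples of generators.\<close>
lemma X_hom_exists:
 assumes N: "graded_mod K D N" and \<phi>: "galg_hom K C D \<phi>"
  and \<psi>: "\<And>i j. i + j = n ==> bisemi \<phi> N s i j (\<psi> i j)"
 shows "\<exists>H\<in>semihom \<phi> C (X n) N s. \<forall>i j. i + j = n -->
  (\<forall>q\<in>carrier (Q.T i). \<forall>p\<in>carrier (P.T j). H (tn i q p) = \<psi> i j q p)"
proof -
 interpret N: graded_mod K D N by fact
 have y: "\<psi> (\<I> w) (n - \<I> w) (single B 1[B] (\<U> w)) (single A 1[A] (\<V> w)) \<in> component N (m + s)"
  if "\<zeta> n w = Some m" for w m
 proof -
  obtain d e where w: "\<I> w \<le> n" "gens Q (\<I> w) (\<U> w) = Some d" "gens P (n - \<I> w) (\<V> w) = Some e" "m = d + e"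
   using \<open>\<zeta> n w = Some m\<close> unfolding zeta_Some by blast
  have ij: "\<I> w + (n - \<I> w) = n" using w by simp
  have st: "single B 1[B] (\<U> w) \<in> component (Q.T (\<I> w)) (int (nat d))" "single A 1[A] (\<V> w) \<in> component (P.T (n - \<I> w)) (int (nat e))"
   using B.single_comp[where \<beta> = "gens Q (\<I> w)", OF B.one_comp w(2)] A.single_comp[where \<beta> = "gens P (n - \<I> w)", OF A.one_comp w(3)]
    deg_nonneg w by simp_all
  show ?thesis using bisemiD(2)[OF \<psi>[OF ij] st] deg_nonneg w by simp
 qed
 have "\<exists>H\<in>semihom \<phi> C (X n) N s. \<forall>w m. \<zeta> n w = Some m --> H (single C 1[C] w) =
   \<psi> (\<I> w) (n - \<I> w) (single B 1[B] (\<U> w)) (single A 1[A] (\<V> w))"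
  by (rule C.fm_ext[OF N \<phi> y])
 then obtain H where H: "H \<in> semihom \<phi> C (X n) N s" and H1: "\<forall>w m. \<zeta> n w = Some m --> H (single C 1[C] w) =
   \<psi> (\<I> w) (n - \<I> w) (single B 1[B] (\<U> w)) (single A 1[A] (\<V> w))" ..
 have "H (tn i q p) = \<psi> i j q p" if ij: "i + j = n" and q: "q \<in>. Q.T i" and p: "p \<in>. P.T j" for i j q p
 proof (rule biadd_eq[OF N.N.abelian_group_axioms biadd_comp[where f = H, OF biadd_tn[OF ij]] _ _ q p])
  show "biadd N i j (\<psi> i j)" by (rule bisemiD(1)[OF \<psi>[OF ij]])
  fix u v d e k l b a assume g: "gens Q i u = Some d" "gens P j v = Some e" and "b \<in> component B k" "a \<in> component A l"
  hence c: "b \<in>. B" "a \<in>. A" using B.comp_carrier A.comp_carrier by auto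
  let ?w = "enc i u v" and ?a = "(\<tau> ^^ dg i u) a"
  have z: "\<zeta> n ?w = Some (d + e)" by (rule zeta_enc[OF g ij])
  have e: "single B 1[B] u \<in> component (Q.T i) (int (dg i u))" "single A 1[A] v \<in>. P.T j"
   using B.single_comp[where \<beta> = "gens Q i", OF B.one_comp g(1)] g deg_nonneg(2)[OF g(1)] by (simp_all add: dg_def)
  have "H (single C (b \<diamondop> ?a) ?w) = H ((b \<diamondop> ?a) *:[X n] single C 1[C] ?w)"
   by (subst C.single_eq) (use c in simp_all)
  also have "\<dots> = \<phi> (b \<diamondop> ?a) *:[N] H (single C 1[C] ?w)"
   by (rule semihomD(3)[OF H]) (use c C.single_carrier[where \<beta> = "\<zeta> n", OF C.A.one_closed z] in simp_all)
  also have "H (single C 1[C] ?w) = \<psi> i j (single B 1[B] u) (single A 1[A] v)" using H1 z ij[symmetric] by simp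
  also have "\<phi> (b \<diamondop> ?a) *:[N] \<psi> i j (single B 1[B] u) (single A 1[A] v) =
    \<psi> i j (\<lambda>u'. b *[B] single B 1[B] u u') (\<lambda>v'. (\<sigma> ^^ dg i u) ?a *[A] single A 1[A] v v')"
   by (rule bisemiD(3)[OF \<psi>[OF ij] e c(1) tau_closed'[OF c(2)], symmetric])
  also have "\<dots> = \<psi> i j (single B b u) (single A a v)"
   using c by (simp add: sigma_tau_pow A.single_mult B.single_mult)
  finally show "H (tn i (single B b u) (single A a v)) = \<psi> i j (single B b u) (single A a v)"
   using tn_single[OF c] by simp
 qed (use semihomD(1)[OF H] semihomD(2)[OF H] in simp_all)
 thus ?thesis using H by (intro bexI[of _ H]) simp_all
qed

end

section \<open>Semilinear maps out of the tensor product\<close>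

lemma (in abelian_group) cancel_middle:
 assumes "a \<in>. G" "b \<in>. G" "y \<in>. G"
 shows "(a \<oplus> \<ominus> y) \<oplus> (b \<oplus> y) = a \<oplus> b" "(a \<oplus> y) \<oplus> (b \<oplus> \<ominus> y) = a \<oplus> b"
proof -
 have "(a \<oplus> \<ominus> y) \<oplus> (b \<oplus> y) = a \<oplus> b \<oplus> (\<ominus> y \<oplus> y)" "(a \<oplus> y) \<oplus> (b \<oplus> \<ominus> y) = a \<oplus> b \<oplus> (y \<oplus> \<ominus> y)"
  using assms by (simp_all only: a_ac a_closed a_inv_closed)
 thus "(a \<oplus> \<ominus> y) \<oplus> (b \<oplus> y) = a \<oplus> b" "(a \<oplus> y) \<oplus> (b \<oplus> \<ominus> y) = a \<oplus> b"
  using assms by (simp_all add: l_neg r_neg)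
qed

lemma semihom_id: "(\<lambda>x. x) \<in> semihom id A M M 0"
 by (rule semihomI) simp_all

context product
begin

declare free_module_simps [simp del]

sublocale X: graded_mod K C "X n" for n by (rule C.fm_graded_mod)

definition xmap where
 "xmap \<phi> n N s \<psi> = (SOME H. H \<in> semihom \<phi> C (X n) N s \<and> (\<forall>i j. i + j = n -->
  (\<forall>q\<in>carrier (Q.T i). \<forall>p\<in>carrier (P.T j). H (tn i q p) = \<psi> i j q p)))"

lemma xmap:
 assumes "graded_mod K D N" "galg_hom K C D \<phi>" "\<And>i j. i + j = n ==> bisemi \<phi> N s i j (\<psi> i j)"
 shows "xmap \<phi> n N s \<psi> \<in> semihom \<phi> C (X n) N s"
  and "i + j = n ==> q \<in>. Q.T i ==> p \<in>. P.T j ==> xmap \<phi> n N s \<psi> (tn i q p) = \<psi> i j q p"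
 using someI_ex[OF X_hom_exists[OF assms, unfolded Bex_def], folded xmap_def] by simp_all

lemma bisemi_tn:
 assumes f: "f \<in> semihom id B (Q.T i) (Q.T i') 0" and g: "g \<in> semihom id A (P.T j) (P.T j') s" and n: "i' + j' = n"
 shows "bisemi id (X n) s i j (\<lambda>q p. tn i' (f q) (g p))"
 unfolding bisemi_def
proof (intro conjI allI ballI)
 show "biadd (X n) i j (\<lambda>q p. tn i' (f q) (g p))"
  by (rule biadd_pre[OF biadd_tn[OF n]])
   (use semihomD(1)[OF f] semihomD(2)[OF f] semihomD(1)[OF g] semihomD(2)[OF g] in "simp_all add: free_module_simps")
 fix d e q p assume q: "q \<in> component (Q.T i) (int d)" and p: "p \<in> component (P.T j) (int e)"
 show "tn i' (f q) (g p) \<in> component (X n) (int d + int e + s)"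
  using tn_comp[OF semihomD(4)[OF f q] semihomD(4)[OF g p] n] by (simp add: add.assoc)
next
 fix d q p b a
 assume q: "q \<in> component (Q.T i) (int d)" and p: "p \<in>. P.T j" and b: "b \<in>. B" and a: "a \<in>. A"
 have "f q \<in> component (Q.T i') (int d)" using semihomD(4)[OF f q] by simp
 from tn_smult[OF this semihomD(1)[OF g p] b a]
 show "tn i' (f (\<lambda>u. b *[B] q u)) (g (\<lambda>v. (\<sigma> ^^ d) a *[A] p v)) = id (b \<diamondop> a) *:[X n] tn i' (f q) (g p)"
  using semihomD(3)[OF f b fm_compD(1)[OF q]] semihomD(3)[OF g sigma_closed'[OF a] p] by (simp add: free_module_simps)
qed

lemma bisemi_const_zero:
 assumes N: "graded_mod K D N" and \<phi>: "galg_hom K C D \<phi>"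
 shows "bisemi \<phi> N s i j (\<lambda>q p. 0[N])"
proof -
 interpret N: graded_mod K D N by fact
 show ?thesis unfolding bisemi_def using biadd_const_zero[OF N.N.abelian_group_axioms] galg_homD(1)[OF \<phi>] by simp
qed

lemma bisemi_add:
 assumes N: "graded_mod K D N" and \<phi>: "galg_hom K C D \<phi>" and \<psi>: "bisemi \<phi> N s i j \<psi>" and \<chi>: "bisemi \<phi> N s i j \<chi>"
 shows "bisemi \<phi> N s i j (\<lambda>q p. \<psi> q p +[N] \<chi> q p)"
proof -
 interpret N: graded_mod K D N by fact
 note c = biaddD(1)[OF bisemiD(1)[OF \<psi>] fm_compD(1)] biaddD(1)[OF bisemiD(1)[OF \<chi>] fm_compD(1)]
 show ?thesis
  unfolding bisemi_def using biadd_add[OF N.N.abelian_group_axioms bisemiD(1)[OF \<psi>] bisemiD(1)[OF \<chi>]]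
   bisemiD(2,3)[OF \<psi>] bisemiD(2,3)[OF \<chi>] c galg_homD(1)[OF \<phi>]
  by (simp add: N.ncomp_add N.smult_r_distr)
qed

lemma bisemi_uminus:
 assumes N: "graded_mod K D N" and \<phi>: "galg_hom K C D \<phi>" and \<psi>: "bisemi \<phi> N s i j \<psi>"
 shows "bisemi \<phi> N s i j (\<lambda>q p. -[N] \<psi> q p)"
proof -
 interpret N: graded_mod K D N by fact
 note c = biaddD(1)[OF bisemiD(1)[OF \<psi>] fm_compD(1)]
 have "biadd N i j (\<lambda>q p. -[N] \<psi> q p)"
  by (rule biadd_comp[OF bisemiD(1)[OF \<psi>]]) (simp_all add: N.N.minus_add)
 thus ?thesis
  unfolding bisemi_def using bisemiD(2,3)[OF \<psi>] c galg_homD(1)[OF \<phi>] by (simp add: N.ncomp_neg N.smult_neg)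
qed

section \<open>The tensor product of the resolutions\<close>

definition sg where "sg n i x = (if even i then x else -[X n] x)"

text \<open>The usual differential \<open>d q \<boxtimes> p + (-1)\<^sup>i q \<boxtimes> d p\<close>, where a term at the border is absent.\<close>
definition dp where
 "dp n i j q p = (case i of 0 => 0[X n] | Suc l => tn l (diff Q l q) p) +[X n]
  (case j of 0 => 0[X n] | Suc l => sg n i (tn i q (diff P l p)))"

definition dX where "dX n = xmap id (Suc n) (X n) 0 (dp n)"
definition augX where "augX = xmap id 0 (trivial_module K C) 0 (\<lambda>i j q p. aug Q q *[K] aug P p)"

lemma bisemi_dp:
 assumes "i + j = Suc n"
 shows "bisemi id (X n) 0 i j (dp n i j)"
 unfolding dp_def
proof (rule bisemi_add[OF X.graded_mod_axioms galg_hom_id])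
 note z = bisemi_const_zero[OF X.graded_mod_axioms galg_hom_id]
 show "bisemi id (X n) 0 i j (\<lambda>q p. case i of 0 => 0[X n] | Suc l => tn l (diff Q l q) p)"
  using z bisemi_tn[OF Q.d_hom semihom_id, where n = n] assms by (cases i) simp_all
 have "bisemi id (X n) 0 i j (\<lambda>q p. case j of 0 => 0[X n] | Suc l => tn i q (diff P l p))"
  using z bisemi_tn[OF semihom_id P.d_hom, where n = n] assms by (cases j) simp_all
 from this bisemi_uminus[OF X.graded_mod_axioms galg_hom_id this]
 show "bisemi id (X n) 0 i j (\<lambda>q p. case j of 0 => 0[X n] | Suc l => sg n i (tn i q (diff P l p)))"
  using z by (cases j; cases "even i") (simp_all add: sg_def)
qed

lemma dX_hom: "dX n \<in> semihom id C (X (Suc n)) (X n) 0"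
 unfolding dX_def by (rule xmap(1)[OF X.graded_mod_axioms galg_hom_id bisemi_dp])

lemma dX_tn: "i + j = Suc n ==> q \<in>. Q.T i ==> p \<in>. P.T j ==> dX n (tn i q p) = dp n i j q p"
 unfolding dX_def by (rule xmap(2)[OF X.graded_mod_axioms galg_hom_id bisemi_dp])

lemma eps_pt: "b \<in>. B ==> a \<in>. A ==> C.eps (b \<diamondop> a) = B.eps b *[K] A.eps a"
proof -
 assume b: "b \<in>. B" and a: "a \<in>. A"
 from prl_exists obtain \<pi> where p: "galg_hom K C B \<pi> \<and> (\<forall>b\<in>carrier B. \<forall>a\<in>carrier A. \<pi> (b \<diamondop> a) = A.eps a *:[B] b)" ..
 have "B.eps (\<pi> (b \<diamondop> a)) = C.eps (b \<diamondop> a)"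
  unfolding B.eps_def C.eps_def
  by (rule galg_hom_aug[OF C.connected_graded_algebra_axioms B.connected_graded_algebra_axioms conjunct1[OF p]]) (use a b in simp)
 thus ?thesis using p a b by (simp add: B.eps_smult A.K.m_comm)
qed

lemma augQ_smult: "q \<in>. Q.T 0 ==> b \<in>. B ==> aug Q (\<lambda>u. b *[B] q u) = B.eps b *[K] aug Q q"
 using semihomD(3)[OF Q.aug_hom, of b q] by (simp add: free_module_simps B.eps_def)

lemma augP_smult: "p \<in>. P.T 0 ==> a \<in>. A ==> aug P (\<lambda>u. a *[A] p u) = A.eps a *[K] aug P p"
 using semihomD(3)[OF P.aug_hom, of a p] by (simp add: free_module_simps A.eps_def)

lemma aug_closed [simp]: "q \<in>. Q.T 0 ==> aug Q q \<in>. K" "p \<in>. P.T 0 ==> aug P p \<in>. K"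
 using semihomD(1)[OF Q.aug_hom] semihomD(1)[OF P.aug_hom] by simp_all

lemma aug_add:
 "q \<in>. Q.T 0 ==> q' \<in>. Q.T 0 ==> aug Q (\<lambda>u. q u +[B] q' u) = aug Q q +[K] aug Q q'"
 "p \<in>. P.T 0 ==> p' \<in>. P.T 0 ==> aug P (\<lambda>u. p u +[A] p' u) = aug P p +[K] aug P p'"
 using semihomD(2)[OF Q.aug_hom] semihomD(2)[OF P.aug_hom] by (simp_all add: free_module_simps)

lemma aug_pos:
 "q \<in> component (Q.T 0) (int d) ==> d ~= 0 ==> aug Q q = 0[K]"
 "p \<in> component (P.T 0) (int d) ==> d ~= 0 ==> aug P p = 0[K]"
 using semihomD(4)[OF Q.aug_hom, of q "int d"] semihomD(4)[OF P.aug_hom, of p "int d"] by simp_all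

lemma eps_sigma: "a \<in>. A ==> A.eps ((\<sigma> ^^ d) a) = A.eps a"
 unfolding A.eps_def
 by (rule galg_hom_aug[OF A.connected_graded_algebra_axioms A.connected_graded_algebra_axioms sigma_pow_hom])

lemma bisemi_aug: "bisemi id (trivial_module K C) 0 0 0 (\<lambda>q p. aug Q q *[K] aug P p)"
 unfolding bisemi_def
proof (intro conjI allI ballI)
 show "biadd (trivial_module K C) 0 0 (\<lambda>q p. aug Q q *[K] aug P p)"
  unfolding biadd_def by (simp add: aug_add A.K.l_distr A.K.r_distr)
 fix d e q p assume q: "q \<in> component (Q.T 0) (int d)" and p: "p \<in> component (P.T 0) (int e)"
 show "aug Q q *[K] aug P p \<in> component (trivial_module K C) (int d + int e + 0)"
  using aug_pos(1)[OF q] aug_pos(2)[OF p] fm_compD(1)[OF q] fm_compD(1)[OF p]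
  by (cases "d = 0"; cases "e = 0") simp_all
next
 fix d q p b a
 assume q: "q \<in> component (Q.T 0) (int d)" and p: "p \<in>. P.T 0" and b: "b \<in>. B" and a: "a \<in>. A"
 show "aug Q (\<lambda>u. b *[B] q u) *[K] aug P (\<lambda>v. (\<sigma> ^^ d) a *[A] p v) =
   id (b \<diamondop> a) *:[trivial_module K C] (aug Q q *[K] aug P p)"
  using fm_compD(1)[OF q] p a b
  by (simp add: augQ_smult augP_smult eps_sigma eps_pt A.K.m_ac flip: C.eps_def)
qed

lemma augX_hom: "augX \<in> semihom id C (X 0) (trivial_module K C) 0"
 unfolding augX_def by (rule xmap(1)[OF C.tm_graded_mod galg_hom_id]) (use bisemi_aug in simp)

lemma augX_tn: "q \<in>. Q.T 0 ==> p \<in>. P.T 0 ==> augX (tn 0 q p) = aug Q q *[K] aug P p"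
 unfolding augX_def by (rule xmap(2)[OF C.tm_graded_mod galg_hom_id, where i = 0 and j = 0]) (use bisemi_aug in simp_all)

lemma tn_zero [simp]:
 "i + j = n ==> q \<in>. Q.T i ==> tn i q 0[P.T j] = 0[X n]"
 "i + j = n ==> p \<in>. P.T j ==> tn i 0[Q.T i] p = 0[X n]"
 using biadd_zero[OF X.N.abelian_group_axioms biadd_tn] by (simp_all add: free_module_simps)

lemma tn_add:
 "i + j = n ==> q \<in>. Q.T i ==> q' \<in>. Q.T i ==> p \<in>. P.T j ==>
  tn i (q +[Q.T i] q') p = tn i q p +[X n] tn i q' p"
 "i + j = n ==> q \<in>. Q.T i ==> p \<in>. P.T j ==> p' \<in>. P.T j ==>
  tn i q (p +[P.T j] p') = tn i q p +[X n] tn i q p'"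
 using biaddD[OF biadd_tn] by (simp_all add: free_module_simps)

lemma dX_closed: "x \<in>. X (Suc n) ==> dX n x \<in>. X n"
 by (rule semihomD(1)[OF dX_hom])

lemma dX_sg: "x \<in>. X (Suc n) ==> dX n (sg (Suc n) i x) = sg n i (dX n x)"
 unfolding sg_def using semihom_neg[OF C.fm_group C.fm_group dX_hom] by simp

lemma X_neg_zero: "-[X n] 0[X n] = 0[X n]"
 by (rule X.N.minus_equality) simp_all

lemma dX_left:
 assumes "l + j = Suc n" "q \<in>. Q.T (Suc l)" "p \<in>. P.T j"
 shows "dX n (tn l (diff Q l q) p) = (case j of 0 => 0[X n] | Suc m => sg n l (tn l (diff Q l q) (diff P m p)))"
proof -
 have q: "diff Q l q \<in>. Q.T l" by (rule Q.d_closed[OF assms(2)])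
 have "(case l of 0 => 0[X n] | Suc l' => tn l' (diff Q l' (diff Q l q)) p) = 0[X n]"
  using assms Q.d_d by (cases l) simp_all
 moreover have "(case j of 0 => 0[X n] | Suc m => sg n l (tn l (diff Q l q) (diff P m p))) \<in>. X n"
  using tn_closed[OF q P.d_closed] assms by (cases j) (simp_all add: sg_def)
 ultimately show ?thesis using dX_tn[OF assms(1) q assms(3)] by (simp add: dp_def)
qed

lemma dX_right:
 assumes "i + l = Suc n" "q \<in>. Q.T i" "p \<in>. P.T (Suc l)"
 shows "dX n (tn i q (diff P l p)) = (case i of 0 => 0[X n] | Suc m => tn m (diff Q m q) (diff P l p))"
proof -
 have p: "diff P l p \<in>. P.T l" by (rule P.d_closed[OF assms(3)])
 have "(case l of 0 => 0[X n] | Suc l' => sg n i (tn i q (diff P l' (diff P l p)))) = 0[X n]"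
  using assms P.d_d by (cases l) (simp_all add: sg_def)
 moreover have "(case i of 0 => 0[X n] | Suc m => tn m (diff Q m q) (diff P l p)) \<in>. X n"
  using tn_closed[OF Q.d_closed p] assms by (cases i) simp_all
 ultimately show ?thesis using dX_tn[OF assms(1,2) p] by (simp add: dp_def)
qed

lemma dX_dX:
 assumes "x \<in>. X (Suc (Suc n))"
 shows "dX n (dX (Suc n) x) = 0[X n]"
proof (rule X_eqI[where N = "X n" and f = "\<lambda>x. dX n (dX (Suc n) x)" and g = "\<lambda>x. 0[X n]", OF _ _ _ assms])
 fix y z assume "y \<in>. X (Suc (Suc n))" "z \<in>. X (Suc (Suc n))"
 thus "dX n (dX (Suc n) (\<lambda>w. y w +[C] z w)) = dX n (dX (Suc n) y) +[X n] dX n (dX (Suc n) z)"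
  using semihomD(2)[OF dX_hom[of "Suc n"]] semihomD(2)[OF dX_hom[of n]] dX_closed by (simp add: free_module_simps)
next
 fix i j q p assume ij: "i + j = Suc (Suc n)" and q: "q \<in>. Q.T i" and p: "p \<in>. P.T j"
 let ?L = "case i of 0 => 0[X (Suc n)] | Suc l => tn l (diff Q l q) p"
 let ?R = "case j of 0 => 0[X (Suc n)] | Suc l => tn i q (diff P l p)"
 have L: "?L \<in>. X (Suc n)" using ij q p tn_closed[OF Q.d_closed] by (cases i) simp_all
 have R: "?R \<in>. X (Suc n)" using ij q p tn_closed[OF _ P.d_closed] by (cases j) simp_all
 have "dp (Suc n) i j q p = ?L +[X (Suc n)] sg (Suc n) i ?R" by (cases j) (simp_all add: dp_def sg_def X_neg_zero)
 hence "dX n (dX (Suc n) (tn i q p)) = dX n ?L +[X n] sg n i (dX n ?R)"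
  using dX_tn[OF ij q p] semihomD(2)[OF dX_hom L, of "sg (Suc n) i ?R"] R dX_sg[OF R, of i] by (simp add: sg_def)
 also have "\<dots> = 0[X n]"
 proof (cases i)
  case 0
  thus ?thesis using ij q p dX_right[of 0 "Suc n" n q p] semihom_zero[OF C.fm_group C.fm_group dX_hom] by (simp add: sg_def)
 next
  case i: (Suc l)
  show ?thesis
  proof (cases j)
   case 0
   thus ?thesis using i ij q p dX_left[of l 0 n q p] semihom_zero[OF C.fm_group C.fm_group dX_hom] by (simp add: sg_def)
  next
   case j: (Suc m)
   have c: "tn l (diff Q l q) (diff P m p) \<in>. X n"
    using tn_closed[OF Q.d_closed P.d_closed] q p i j ij by simp
   show ?thesis using i j ij q p dX_left[of l j n q p] dX_right[of i m n q p] c by (simp add: sg_def X.N.l_neg X.N.r_neg)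
  qed
 qed
 finally show "dX n (dX (Suc n) (tn i q p)) = 0[X n]" .
qed simp

lemma augX_dX:
 assumes "x \<in>. X (Suc 0)"
 shows "augX (dX 0 x) = 0[K]"
proof (rule X_eqI[where N = K and f = "\<lambda>x. augX (dX 0 x)" and g = "\<lambda>x. 0[K]", OF _ _ _ assms])
 fix y z assume "y \<in>. X (Suc 0)" "z \<in>. X (Suc 0)"
 thus "augX (dX 0 (\<lambda>w. y w +[C] z w)) = augX (dX 0 y) +[K] augX (dX 0 z)"
  using semihomD(2)[OF dX_hom[of 0]] semihomD(2)[OF augX_hom] dX_closed by (simp add: free_module_simps)
next
 fix i j q p assume ij: "i + j = Suc 0" and q: "q \<in>. Q.T i" and p: "p \<in>. P.T j"
 consider "i = 0" "j = Suc 0" | "i = Suc 0" "j = 0" using ij by linarith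
 thus "augX (dX 0 (tn i q p)) = 0[K]"
 proof cases
  case 1
  thus ?thesis using dX_tn[OF ij q p] q p P.d_closed[of p 0] P.aug_d[of p] tn_closed[of q 0 "diff P 0 p" 0 0]
   by (simp add: dp_def sg_def augX_tn)
 next
  case 2
  thus ?thesis using dX_tn[OF ij q p] q p Q.d_closed[of q 0] Q.aug_d[of q] tn_closed[of "diff Q 0 q" 0 p 0 0]
   by (simp add: dp_def sg_def augX_tn)
 qed
qed simp

lemma tn_sc:
 "i + j = n ==> q \<in>. Q.T i ==> p \<in>. P.T j ==> k \<in>. K ==> tn i (Q.T.sc i k q) p = tn i q (P.T.sc j k p)"
 using tn_bal[of q i p j k] by (simp add: Q.T.sc_def P.T.sc_def free_module_simps)

text \<open>With contractions \<open>s\<close> of \<open>Q\<close> and \<open>t\<close> of \<open>P\<close>, and with \<open>e\<close> the chosen element of \<open>Q 0\<close> of augmentation 1, the contraction of \<open>X\<close> is \<open>q \<boxtimes> p \<mapsto> s q \<boxtimes> p\<close>, to which \<open>aug(q) e \<boxtimes> t p\<close> is added if \<open>q\<close> lies in \<open>Q 0\<close>.\<close>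
lemma X_contraction_exists:
 "\<exists>H e. e \<in>. X 0 \<and> augX e = 1[K] \<and> (\<forall>n. \<forall>x\<in>carrier (X n). H n x \<in>. X (Suc n)) \<and>
  (\<forall>n. H n 0[X n] = 0[X (Suc n)]) \<and>
  (\<forall>x\<in>carrier (X 0). dX 0 (H 0 x) +[X 0] X.sc 0 (augX x) e = x) \<and>
  (\<forall>n. \<forall>x\<in>carrier (X (Suc n)). dX (Suc n) (H (Suc n) x) +[X (Suc n)] H n (dX n x) = x)"
proof -
 obtain s e where Q0: "e \<in> component (Q.T 0) 0" "aug Q e = 1[K]" "\<forall>n. s n \<in> klin K B (Q.T n) (Q.T (Suc n))"
  "\<forall>x\<in>carrier (Q.T 0). diff Q 0 (s 0 x) +[Q.T 0] Q.T.sc 0 (aug Q x) e = x"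
  "\<forall>n. \<forall>x\<in>carrier (Q.T (Suc n)). diff Q (Suc n) (s (Suc n) x) +[Q.T (Suc n)] s n (diff Q n x) = x"
  using Q.contraction_exists[OF goodQ] by (elim exE conjE)
 obtain t f where P0: "f \<in> component (P.T 0) 0" "aug P f = 1[K]" "\<forall>n. t n \<in> klin K A (P.T n) (P.T (Suc n))"
  "\<forall>x\<in>carrier (P.T 0). diff P 0 (t 0 x) +[P.T 0] P.T.sc 0 (aug P x) f = x"
  "\<forall>n. \<forall>x\<in>carrier (P.T (Suc n)). diff P (Suc n) (t (Suc n) x) +[P.T (Suc n)] t n (diff P n x) = x"
  using P.contraction_exists[OF goodP] by (elim exE conjE)
 have e: "e \<in>. Q.T 0" and f: "f \<in>. P.T 0" using fm_compD(1) Q0(1) P0(1) by blast+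
 note s = klinD[OF spec[OF Q0(3)]] and t = klinD[OF spec[OF P0(3)]]
 have s_sc: "s i (Q.T.sc i k q) = Q.T.sc (Suc i) k (s i q)" if "k \<in>. K" "q \<in>. Q.T i" for i k q
  using s(3)[OF that] by (simp add: Q.T.sc_def)
 have t_sc: "t i (P.T.sc i k p) = P.T.sc (Suc i) k (t i p)" if "k \<in>. K" "p \<in>. P.T i" for i k p
  using t(3)[OF that] by (simp add: P.T.sc_def)
 define \<epsilon> where "\<epsilon> q = Q.T.sc 0 (aug Q q) e" for q
 have eps: "\<epsilon> q \<in>. Q.T 0" if "q \<in>. Q.T 0" for q
  unfolding \<epsilon>_def by (rule Q.T.sc_closed[OF aug_closed(1)[OF that] e])
 \<comment> \<open>The contraction on tensors.\<close>
 define \<psi> where "\<psi> n i j q p = tn (Suc i) (s i q) p +[X (Suc n)] (if i = 0 then tn 0 (\<epsilon> q) (t j p) else 0[X (Suc n)])" for n i j q p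
 have "\<exists>H. (\<forall>x\<in>carrier (X n). H x \<in>. X (Suc n)) \<and>
  (\<forall>x\<in>carrier (X n). \<forall>y\<in>carrier (X n). H (\<lambda>w. x w +[C] y w) = H x +[X (Suc n)] H y) \<and>
  (\<forall>i j. i + j = n --> (\<forall>q\<in>carrier (Q.T i). \<forall>p\<in>carrier (P.T j). H (tn i q p) = \<psi> n i j q p))" for n
 proof (rule X_additive_exists[OF X.N.abelian_group_axioms])
  fix i j assume ij: "i + j = n"
  have "biadd (X (Suc n)) i j (\<lambda>q p. tn (Suc i) (s i q) p)"
   by (rule biadd_pre[OF biadd_tn[of "Suc i" j]]) (use ij s in "simp_all add: free_module_simps")
  moreover have "biadd (X (Suc n)) i j (\<lambda>q p. if i = 0 then tn 0 (\<epsilon> q) (t j p) else 0[X (Suc n)])"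
  proof (cases "i = 0")
   case True
   have "biadd (X (Suc n)) 0 j (\<lambda>q p. tn 0 (\<epsilon> q) (t j p))"
   proof (rule biadd_pre[OF biadd_tn[of 0 "Suc j"]])
    show "\<epsilon> (\<lambda>u. x u +[B] y u) = (\<lambda>u. \<epsilon> x u +[B] \<epsilon> y u)" if "x \<in>. Q.T 0" "y \<in>. Q.T 0" for x y
     using Q.T.sc_add_l[of "aug Q x" "aug Q y" e 0] that e by (simp add: \<epsilon>_def aug_add free_module_simps)
   qed (use ij True t eps in "simp_all add: free_module_simps")
   thus ?thesis using True by simp
  qed (use biadd_const_zero[OF X.N.abelian_group_axioms] in simp)
  ultimately show "biadd (X (Suc n)) i j (\<psi> n i j)"
   unfolding \<psi>_def by (rule biadd_add[OF X.N.abelian_group_axioms])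
  fix k q p assume k: "k \<in>. K" and q: "q \<in>. Q.T i" and p: "p \<in>. P.T j"
  have "\<psi> n i j (Q.T.sc i k q) p = \<psi> n i j q (P.T.sc j k p)"
  proof -
   have "\<epsilon> (Q.T.sc 0 k q) = Q.T.sc 0 k (\<epsilon> q)" if "i = 0"
    using that q e k augQ_smult[of q "k *:[B] 1[B]"] Q.T.sc_assoc[of k "aug Q q" e 0]
    by (simp add: \<epsilon>_def Q.T.sc_def free_module_simps)
   thus ?thesis
    unfolding \<psi>_def
    using k q p ij s(1) t(1) eps tn_sc[of "Suc i" j "Suc n" "s i q" p k] tn_sc[of 0 "Suc j" "Suc n" "\<epsilon> q" "t j p" k]
    by (cases "i = 0") (simp_all add: s_sc t_sc)
  qed
  thus "\<psi> n i j (\<lambda>u. (k *:[B] 1[B]) *[B] q u) p = \<psi> n i j q (\<lambda>v. (k *:[A] 1[A]) *[A] p v)"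
   by (simp add: Q.T.sc_def P.T.sc_def free_module_simps)
 qed
 hence "\<forall>n. \<exists>H. (\<forall>x\<in>carrier (X n). H x \<in>. X (Suc n)) \<and>
  (\<forall>x\<in>carrier (X n). \<forall>y\<in>carrier (X n). H (\<lambda>w. x w +[C] y w) = H x +[X (Suc n)] H y) \<and>
  (\<forall>i j. i + j = n --> (\<forall>q\<in>carrier (Q.T i). \<forall>p\<in>carrier (P.T j). H (tn i q p) = \<psi> n i j q p))" by (rule allI)
 from choice[OF this] obtain H where HH: "\<forall>n. (\<forall>x\<in>carrier (X n). H n x \<in>. X (Suc n)) \<and>
  (\<forall>x\<in>carrier (X n). \<forall>y\<in>carrier (X n). H n (\<lambda>w. x w +[C] y w) = H n x +[X (Suc n)] H n y) \<and>
  (\<forall>i j. i + j = n --> (\<forall>q\<in>carrier (Q.T i). \<forall>p\<in>carrier (P.T j). H n (tn i q p) = \<psi> n i j q p))" ..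
 have Hc: "\<And>n x. x \<in>. X n ==> H n x \<in>. X (Suc n)"
  and Ha: "\<And>n x y. x \<in>. X n ==> y \<in>. X n ==> H n (x +[X n] y) = H n x +[X (Suc n)] H n y"
  and Ht: "\<And>n i j q p. i + j = n ==> q \<in>. Q.T i ==> p \<in>. P.T j ==> H n (tn i q p) = \<psi> n i j q p"
  using HH by (simp_all add: free_module_simps)
 have H0: "H n 0[X n] = 0[X (Suc n)]" for n
  by (rule additive_zero[OF C.fm_group C.fm_group]) (use Ha Hc in simp_all)
 have Hn: "H n (-[X n] x) = -[X (Suc n)] H n x" if "x \<in>. X n" for n x
  by (rule additive_neg[OF C.fm_group C.fm_group]) (use Ha Hc that in simp_all)
 have HS: "H n (tn (Suc i) q p) = tn (Suc (Suc i)) (s (Suc i) q) p"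
  if "Suc i + j = n" "q \<in>. Q.T (Suc i)" "p \<in>. P.T j" for n i j q p
  using Ht[OF that] tn_closed[OF s(1)[OF that(2)] that(3), of "Suc n"] that(1) by (simp add: \<psi>_def)
 have HZ: "H n (tn 0 q p) = tn (Suc 0) (s 0 q) p +[X (Suc n)] tn 0 (\<epsilon> q) (t n p)"
  if "q \<in>. Q.T 0" "p \<in>. P.T n" for n q p
  using Ht[of 0 n n q p] that by (simp add: \<psi>_def)
 have c0: "tn 0 e f \<in>. X 0" by (rule tn_closed[OF e f]) simp
 have main: "dX (Suc n) (H (Suc n) x) +[X (Suc n)] H n (dX n x) = x" if x: "x \<in>. X (Suc n)" for n x
 proof (rule X_eqI[where N = "X (Suc n)" and f = "\<lambda>x. dX (Suc n) (H (Suc n) x) +[X (Suc n)] H n (dX n x)" and g = "\<lambda>x. x", OF _ _ _ x])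
  fix y z assume y: "y \<in>. X (Suc n)" and z: "z \<in>. X (Suc n)"
  have "dX (Suc n) (H (Suc n) (y +[X (Suc n)] z)) +[X (Suc n)] H n (dX n (y +[X (Suc n)] z)) =
   (dX (Suc n) (H (Suc n) y) +[X (Suc n)] H n (dX n y)) +[X (Suc n)] (dX (Suc n) (H (Suc n) z) +[X (Suc n)] H n (dX n z))"
   using y z Hc dX_closed by (simp add: Ha semihomD(2)[OF dX_hom] X.N.a_ac)
  thus "dX (Suc n) (H (Suc n) (\<lambda>w. y w +[C] z w)) +[X (Suc n)] H n (dX n (\<lambda>w. y w +[C] z w)) =
   (dX (Suc n) (H (Suc n) y) +[X (Suc n)] H n (dX n y)) +[X (Suc n)] (dX (Suc n) (H (Suc n) z) +[X (Suc n)] H n (dX n z))"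
   by (simp add: free_module_simps)
 next
  fix i j q p assume ij: "i + j = Suc n" and q: "q \<in>. Q.T i" and p: "p \<in>. P.T j"
  show "dX (Suc n) (H (Suc n) (tn i q p)) +[X (Suc n)] H n (dX n (tn i q p)) = tn i q p"
  proof (cases i)
   case 0
   hence j: "j = Suc n" using ij by simp
   have q: "q \<in>. Q.T 0" and p: "p \<in>. P.T (Suc n)" using q p 0 j by simp_all
   note dp' = P.d_closed[OF p] and ds = Q.d_closed[OF s(1)[OF q]] and dt = P.d_closed[OF t(1)[OF p]] and td = t(1)[OF P.d_closed[OF p]]
   \<comment> \<open>This term appears in \<open>d H\<close> and in \<open>H d\<close> with opposite signs.\<close>
   let ?Y = "tn (Suc 0) (s 0 q) (diff P n p)"
   have c: "tn 0 (diff Q 0 (s 0 q)) p \<in>. X (Suc n)" "?Y \<in>. X (Suc n)"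
    "tn 0 (\<epsilon> q) (diff P (Suc n) (t (Suc n) p)) \<in>. X (Suc n)" "tn 0 (\<epsilon> q) (t n (diff P n p)) \<in>. X (Suc n)"
    using tn_closed q p s(1) eps dp' ds dt td by simp_all
   have "dX (Suc n) (H (Suc n) (tn 0 q p)) = dX (Suc n) (tn (Suc 0) (s 0 q) p) +[X (Suc n)] dX (Suc n) (tn 0 (\<epsilon> q) (t (Suc n) p))"
    unfolding HZ[OF q p] by (rule semihomD(2)[OF dX_hom]) (use tn_closed q p s(1)[OF q] t(1)[OF p] eps[OF q] in simp_all)
   also have "dX (Suc n) (tn (Suc 0) (s 0 q) p) = tn 0 (diff Q 0 (s 0 q)) p +[X (Suc n)] -[X (Suc n)] ?Y"
    using dX_tn[of "Suc 0" "Suc n" "Suc n" "s 0 q" p] s(1) q p by (simp add: dp_def sg_def)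
   also have "dX (Suc n) (tn 0 (\<epsilon> q) (t (Suc n) p)) = tn 0 (\<epsilon> q) (diff P (Suc n) (t (Suc n) p))"
    using dX_tn[of 0 "Suc (Suc n)" "Suc n" "\<epsilon> q" "t (Suc n) p"] t(1) eps q p c by (simp add: dp_def sg_def)
   finally have 1: "dX (Suc n) (H (Suc n) (tn 0 q p)) = tn 0 (diff Q 0 (s 0 q)) p +[X (Suc n)] -[X (Suc n)] ?Y +[X (Suc n)]
    tn 0 (\<epsilon> q) (diff P (Suc n) (t (Suc n) p))" .
   have "dX n (tn 0 q p) = tn 0 q (diff P n p)"
    using dX_tn[of 0 "Suc n" n q p] q p tn_closed[OF q dp', of n] by (simp add: dp_def sg_def)
   hence 2: "H n (dX n (tn 0 q p)) = ?Y +[X (Suc n)] tn 0 (\<epsilon> q) (t n (diff P n p))" using HZ[OF q dp'] by simp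
   have "diff P (Suc n) (t (Suc n) p) +[P.T (Suc n)] t n (diff P n p) = p" "diff Q 0 (s 0 q) +[Q.T 0] \<epsilon> q = q"
    using P0(5) Q0(4) q p by (simp_all add: \<epsilon>_def)
   hence "tn 0 (\<epsilon> q) (diff P (Suc n) (t (Suc n) p)) +[X (Suc n)] tn 0 (\<epsilon> q) (t n (diff P n p)) = tn 0 (\<epsilon> q) p"
    "tn 0 (diff Q 0 (s 0 q)) p +[X (Suc n)] tn 0 (\<epsilon> q) p = tn 0 q p"
    using tn_add(2)[of 0 "Suc n" "Suc n" "\<epsilon> q" "diff P (Suc n) (t (Suc n) p)" "t n (diff P n p)"]
     tn_add(1)[of 0 "Suc n" "Suc n" "diff Q 0 (s 0 q)" "\<epsilon> q" p] q p ds dt td eps by simp_all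
   thus ?thesis unfolding 0 1 2 using c X.N.cancel_middle(1)[OF c(1) _ c(2)] by (simp add: X.N.a_ac X.N.r_neg1 X.N.r_neg2)
  next
   case (Suc l)
   have q: "q \<in>. Q.T (Suc l)" and lj: "l + j = n" using q ij Suc by simp_all
   note ds = Q.d_closed[OF s(1)[OF q]] and sd = s(1)[OF Q.d_closed[OF q]]
   \<comment> \<open>In \<open>d H\<close> this term has the sign of \<open>i + 1\<close>, in \<open>H d\<close> the sign of \<open>i\<close>.\<close>
   define Y where "Y = (case j of 0 => 0[X (Suc n)] | Suc m => tn (Suc i) (s i q) (diff P m p))"
   have Y: "Y \<in>. X (Suc n)"
    unfolding Y_def using tn_closed[OF s(1)[OF q] P.d_closed] p ij Suc by (cases j) simp_all
   have c: "tn i (diff Q i (s i q)) p \<in>. X (Suc n)" "tn i (s l (diff Q l q)) p \<in>. X (Suc n)"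
    using tn_closed ds sd p ij Suc by simp_all
   have 1: "dX (Suc n) (H (Suc n) (tn i q p)) = tn i (diff Q i (s i q)) p +[X (Suc n)] sg (Suc n) (Suc i) Y"
    unfolding Suc HS[OF ij[unfolded Suc] q p] using dX_tn[of "Suc (Suc l)" j "Suc n" "s (Suc l) q" p] s(1)[OF q] p ij Suc
    by (cases j) (simp_all add: dp_def sg_def Y_def X_neg_zero)
   define Z where "Z = (case j of 0 => 0[X n] | Suc m => tn i q (diff P m p))"
   have Z: "Z \<in>. X n" unfolding Z_def using tn_closed[OF q P.d_closed] p ij Suc by (cases j) simp_all
   have l: "tn l (diff Q l q) p \<in>. X n" by (rule tn_closed[OF Q.d_closed[OF q] p lj])
   have "dX n (tn i q p) = tn l (diff Q l q) p +[X n] sg n i Z"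
    using dX_tn[of "Suc l" j n q p] q p ij Suc by (cases j) (simp_all add: dp_def sg_def Z_def X_neg_zero)
   hence "H n (dX n (tn i q p)) = H n (tn l (diff Q l q) p) +[X (Suc n)] sg (Suc n) i (H n Z)"
    using Ha[OF l, of "sg n i Z"] Hn[OF Z] Z by (simp add: sg_def)
   also have "H n Z = Y"
    using HS[of l _ n q] q p ij Suc P.d_closed H0 by (cases j) (simp_all add: Y_def Z_def)
   also have "H n (tn l (diff Q l q) p) = tn i (s l (diff Q l q)) p"
   proof (cases l)
    case 0
    have "\<epsilon> (diff Q l q) = 0[Q.T 0]" using Q.aug_d[of q] q 0 e Q.T.sc_zero_l by (simp add: \<epsilon>_def)
    thus ?thesis using HZ[of "diff Q l q" p n] Q.d_closed[OF q] p 0 lj Suc c(2)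
      tn_zero(2)[of 0 "Suc n" "Suc n" "t n p"] t(1)[of p n] by simp
   next
    case (Suc m)
    thus ?thesis using HS[of m j n "diff Q l q" p] Q.d_closed[OF q] p lj \<open>i = Suc l\<close> by simp
   qed
   finally have 2: "H n (dX n (tn i q p)) = tn i (s l (diff Q l q)) p +[X (Suc n)] sg (Suc n) i Y" .
   have "diff Q i (s i q) +[Q.T i] s l (diff Q l q) = q" using Q0(5) q Suc by simp
   hence "tn i (diff Q i (s i q)) p +[X (Suc n)] tn i (s l (diff Q l q)) p = tn i q p"
    using tn_add(1)[OF ij, of "diff Q i (s i q)" "s l (diff Q l q)" p] ds sd p Suc by simp
   thus ?thesis unfolding 1 2 using X.N.cancel_middle[OF c Y] by (cases "even i") (simp_all add: sg_def)
  qed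
 qed (simp add: free_module_simps)
 have main0: "dX 0 (H 0 x) +[X 0] X.sc 0 (augX x) (tn 0 e f) = x" if x: "x \<in>. X 0" for x
 proof (rule X_eqI[where N = "X 0" and f = "\<lambda>x. dX 0 (H 0 x) +[X 0] X.sc 0 (augX x) (tn 0 e f)" and g = "\<lambda>x. x", OF _ _ _ x])
  have ac: "augX y \<in>. K" if "y \<in>. X 0" for y using semihomD(1)[OF augX_hom that] by simp
  fix y z assume y: "y \<in>. X 0" and z: "z \<in>. X 0"
  have "dX 0 (H 0 (y +[X 0] z)) +[X 0] X.sc 0 (augX (y +[X 0] z)) (tn 0 e f) =
   (dX 0 (H 0 y) +[X 0] X.sc 0 (augX y) (tn 0 e f)) +[X 0] (dX 0 (H 0 z) +[X 0] X.sc 0 (augX z) (tn 0 e f))"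
   using y z Hc dX_closed ac c0 by (simp add: Ha semihomD(2)[OF dX_hom] semihomD(2)[OF augX_hom] X.sc_add_l X.N.a_ac)
  thus "dX 0 (H 0 (\<lambda>w. y w +[C] z w)) +[X 0] X.sc 0 (augX (\<lambda>w. y w +[C] z w)) (tn 0 e f) =
   (dX 0 (H 0 y) +[X 0] X.sc 0 (augX y) (tn 0 e f)) +[X 0] (dX 0 (H 0 z) +[X 0] X.sc 0 (augX z) (tn 0 e f))"
   by (simp add: free_module_simps)
 next
  fix i j q p assume ij: "i + j = 0" and "q \<in>. Q.T i" and "p \<in>. P.T j"
  hence q: "q \<in>. Q.T 0" and p: "p \<in>. P.T 0" and i: "i = 0" by simp_all
  note ds = Q.d_closed[OF s(1)[OF q]] and dt = P.d_closed[OF t(1)[OF p]]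
  have c: "tn 0 (diff Q 0 (s 0 q)) p \<in>. X 0" "tn 0 (\<epsilon> q) (diff P 0 (t 0 p)) \<in>. X 0"
   using tn_closed q p eps ds dt by simp_all
  have "dX 0 (H 0 (tn 0 q p)) = dX 0 (tn (Suc 0) (s 0 q) p) +[X 0] dX 0 (tn 0 (\<epsilon> q) (t 0 p))"
   unfolding HZ[OF q p] by (rule semihomD(2)[OF dX_hom]) (use tn_closed q p s(1)[OF q] t(1)[OF p] eps[OF q] in simp_all)
  also have "dX 0 (tn (Suc 0) (s 0 q) p) = tn 0 (diff Q 0 (s 0 q)) p"
   using dX_tn[of "Suc 0" 0 0 "s 0 q" p] s(1) q p c by (simp add: dp_def sg_def)
  also have "dX 0 (tn 0 (\<epsilon> q) (t 0 p)) = tn 0 (\<epsilon> q) (diff P 0 (t 0 p))"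
   using dX_tn[of 0 "Suc 0" 0 "\<epsilon> q" "t 0 p"] t(1) eps q p c by (simp add: dp_def sg_def)
  finally have 1: "dX 0 (H 0 (tn 0 q p)) = tn 0 (diff Q 0 (s 0 q)) p +[X 0] tn 0 (\<epsilon> q) (diff P 0 (t 0 p))" .
  have "X.sc 0 (aug Q q *[K] aug P p) (tn 0 e f) = tn 0 (\<epsilon> q) (P.T.sc 0 (aug P p) f)"
  proof -
   have k: "X.sc 0 k (tn 0 q' p') = tn 0 (Q.T.sc 0 k q') p'" if "k \<in>. K" "q' \<in>. Q.T 0" "p' \<in>. P.T 0" for k q' p'
    using that B.fm_coeff[OF that(2)] A.fm_coeff[OF that(3)] tn_coeff[OF that(2,3)]
    by (auto simp: fun_eq_iff X.sc_def Q.T.sc_def free_module_simps C.scalar_mult B.scalar_mult tn_def ptC_smult_l)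
   have "X.sc 0 (aug Q q *[K] aug P p) (tn 0 e f) = tn 0 (Q.T.sc 0 (aug P p) (\<epsilon> q)) f"
    using k[of "aug P p *[K] aug Q q" e f] q p e f Q.T.sc_assoc[of "aug P p" "aug Q q" e 0] by (simp add: \<epsilon>_def A.K.m_comm)
   thus ?thesis using tn_sc[of 0 0 0 "\<epsilon> q" f "aug P p"] eps[OF q] f p by simp
  qed
  hence 2: "X.sc 0 (augX (tn 0 q p)) (tn 0 e f) = tn 0 (\<epsilon> q) (P.T.sc 0 (aug P p) f)" using augX_tn[OF q p] by simp
  have c': "P.T.sc 0 (aug P p) f \<in>. P.T 0" using f p by simp
  hence c2: "tn 0 (\<epsilon> q) (P.T.sc 0 (aug P p) f) \<in>. X 0" using tn_closed eps[OF q] by simp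
  have "diff P 0 (t 0 p) +[P.T 0] P.T.sc 0 (aug P p) f = p" "diff Q 0 (s 0 q) +[Q.T 0] \<epsilon> q = q"
   using P0(4) Q0(4) q p by (simp_all add: \<epsilon>_def)
  hence "tn 0 (\<epsilon> q) (diff P 0 (t 0 p)) +[X 0] tn 0 (\<epsilon> q) (P.T.sc 0 (aug P p) f) = tn 0 (\<epsilon> q) p"
   "tn 0 (diff Q 0 (s 0 q)) p +[X 0] tn 0 (\<epsilon> q) p = tn 0 q p"
   using tn_add(2)[of 0 0 0 "\<epsilon> q" "diff P 0 (t 0 p)" "P.T.sc 0 (aug P p) f"]
    tn_add(1)[of 0 0 0 "diff Q 0 (s 0 q)" "\<epsilon> q" p] q p ds dt c' eps by simp_all
  thus "dX 0 (H 0 (tn i q p)) +[X 0] X.sc 0 (augX (tn i q p)) (tn 0 e f) = tn i q p"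
   unfolding i 1 2 using c c2 by (simp add: X.N.a_assoc)
 qed (simp add: free_module_simps)
 have "augX (tn 0 e f) = 1[K]" using augX_tn[OF e f] Q0(2) P0(2) by simp
 thus ?thesis using c0 Hc H0 main main0 by (intro exI[of _ H] exI[of _ "tn 0 e f"]) simp
qed

text \<open>The tensors of members of spanning sets span.\<close>
lemma C_fin_comps: "C.fin_comps"
 unfolding C.fin_comps_def
proof
 fix d
 from choice[OF P.resolution_fin_comps[unfolded A.fin_comps_def]] obtain S where
  S: "\<forall>d. finite (S d) \<and> S d \<subseteq> component A d \<and>
   component A d \<subseteq> asum A {k *:[A] s | k s. k \<in>. K \<and> s \<in> S d}" ..
 from choice[OF Q.resolution_fin_comps[unfolded B.fin_comps_def]] obtain R where
  R: "\<forall>d. finite (R d) \<and> R d \<subseteq> component B d \<and>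
   component B d \<subseteq> asum B {k *:[B] s | k s. k \<in>. K \<and> s \<in> R d}" ..
 define W where "W = (\<Union>i\<in>{..d}. (\<lambda>(b, a). b \<diamondop> a) ` (R i \<times> S (d - i)))"
 let ?G = "{k *:[C] s | k s. k \<in>. K \<and> s \<in> W}"
 have "finite W" unfolding W_def using R S by blast
 moreover have W: "W \<subseteq> component C d"
 proof
  fix x assume "x \<in> W"
  then obtain i b a where x: "i \<le> d" "b \<in> R i" "a \<in> S (d - i)" "x = b \<diamondop> a" unfolding W_def by auto
  have "b \<in> component B i" "a \<in> component A (d - i)" using x R S by blast+
  from pt_comp[OF this] show "x \<in> component C d" using x by simp
 qed
 moreover have "component C d \<subseteq> asum C ?G"
 proof
  have G: "?G \<subseteq> carrier C" using W C.comp_carrier by auto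
  fix x assume "x \<in> component C d"
  thus "x \<in> asum C ?G"
  proof (induction rule: C_comp_induct)
   case (pure i j b a)
   have b: "b \<in> asum B {k *:[B] s | k s. k \<in>. K \<and> s \<in> R i}" using pure(1) R by blast
   have a: "a \<in> asum A {k *:[A] s | k s. k \<in>. K \<and> s \<in> S j}" using pure(2) S by blast
   have RB: "{k *:[B] s | k s. k \<in>. K \<and> s \<in> R i} \<subseteq> carrier B" using R B.comp_carrier by blast
   have SA: "{k *:[A] s | k s. k \<in>. K \<and> s \<in> S j} \<subseteq> carrier A" using S A.comp_carrier by blast
   have ac: "a \<in>. A" by (rule A.comp_carrier[OF pure(2)])
   show ?case
   proof (rule B.A.asum_image[OF C.A.abelian_group_axioms RB G _ _ _ b, where h = "\<lambda>b. b \<diamondop> a"])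
    fix r assume "r \<in> {k *:[B] s | k s. k \<in>. K \<and> s \<in> R i}"
    then obtain k s where r: "r = k *:[B] s" "k \<in>. K" "s \<in> R i" by blast
    have s: "s \<in>. B" using r R B.comp_carrier by blast
    show "r \<diamondop> a \<in> asum C ?G"
    proof (rule A.A.asum_image[OF C.A.abelian_group_axioms SA G _ _ _ a, where h = "\<lambda>a. r \<diamondop> a"])
     fix t assume "t \<in> {k *:[A] s | k s. k \<in>. K \<and> s \<in> S j}"
     then obtain l u where t: "t = l *:[A] u" "l \<in>. K" "u \<in> S j" by blast
     have u: "u \<in>. A" using t S A.comp_carrier by blast
     have "r \<diamondop> t = (k *[K] l) *:[C] (s \<diamondop> u)"
      using r t s u by (simp add: ptC_smult_l ptC_smult_r A.K.m_comm flip: C.KA.smult_assoc1)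
     moreover have "s \<diamondop> u \<in> W" using r t pure(3) unfolding W_def by force
     ultimately show "r \<diamondop> t \<in> asum C ?G" using r t C.A.asum_incl[OF _ G] by blast
    qed (use r s in "auto simp: ptC_add_r ptC_zero")
   qed (use ac in "auto simp: ptC_add_l ptC_zero")
  next
   case (add X Y)
   thus ?case using C.A.asum_add[OF G] by simp
  qed
 qed
 ultimately show "\<exists>S. finite S \<and> S \<subseteq> component C d \<and>
   component C d \<subseteq> asum C {k *:[C] s | k s. k \<in>. K \<and> s \<in> S}" by (intro exI[of _ W]) simp
qed

lemma good_zeta: "good_gens (\<zeta> n)"
 unfolding good_gens_def
proof (intro conjI allI impI)
 show "0 \<le> d" if "\<zeta> n w = Some d" for w d using that deg_nonneg unfolding zeta_Some by fastforce
 fix m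
 have "{w. \<zeta> n w = Some m} \<subseteq> (\<Union>i\<in>{..n}. \<Union>d\<in>{0..m}.
   (\<lambda>(u, v). enc i u v) ` ({u. gens Q i u = Some d} \<times> {v. gens P (n - i) v = Some (m - d)}))"
 proof
  fix w assume "w \<in> {w. \<zeta> n w = Some m}"
  then obtain d e where w: "\<I> w \<le> n" "gens Q (\<I> w) (\<U> w) = Some d" "gens P (n - \<I> w) (\<V> w) = Some e" "m = d + e"
   unfolding zeta_Some by blast
  have "w \<in> (\<lambda>(u, v). enc (\<I> w) u v) ` ({u. gens Q (\<I> w) u = Some d} \<times> {v. gens P (n - \<I> w) v = Some (m - d)})"
   by (rule image_eqI[of _ _ "(\<U> w, \<V> w)"]) (use w in auto)
  moreover have "d \<in> {0..m}" using deg_nonneg w by fastforce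
  ultimately show "w \<in> (\<Union>i\<in>{..n}. \<Union>d\<in>{0..m}.
   (\<lambda>(u, v). enc i u v) ` ({u. gens Q i u = Some d} \<times> {v. gens P (n - i) v = Some (m - d)}))" using w(1) by blast
 qed
 thus "finite {w. \<zeta> n w = Some m}"
  by (rule finite_subset) (use goodP goodQ in "simp add: good_gens_def")
qed

definition XC where
 "XC = \<lparr>gens = \<zeta>, diff = (\<lambda>n. restrict (dX n) (carrier (X (Suc n)))), aug = restrict augX (carrier (X 0))\<rparr>"

lemma XC_simps [simp]: "gens XC = \<zeta>" "x \<in>. X (Suc n) ==> diff XC n x = dX n x" "x \<in>. X 0 ==> aug XC x = augX x"
 by (simp_all add: XC_def)

lemma XC_resolution: "resolution K C XC"
proof (unfold_locales, unfold free_resolution_def XC_simps(1), intro conjI allI)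
 obtain H e where e: "e \<in>. X 0" "augX e = 1[K]"
  and H: "\<forall>n. \<forall>x\<in>carrier (X n). H n x \<in>. X (Suc n)"
  and z: "\<forall>n. H n 0[X n] = 0[X (Suc n)]" and h0: "\<forall>x\<in>carrier (X 0). dX 0 (H 0 x) +[X 0] X.sc 0 (augX x) e = x"
  and hS: "\<forall>n. \<forall>x\<in>carrier (X (Suc n)). dX (Suc n) (H (Suc n) x) +[X (Suc n)] H n (dX n x) = x"
  using X_contraction_exists by (elim exE conjE)
 show "locally_finite K C (X n)" for n
  using X.locally_finite_iff C.fm_fdim[OF C_fin_comps good_zeta] by blast
 show "diff XC n \<in> graded_hom C (X (Suc n)) (X n) 0" for n
  unfolding XC_def using X.semihom_restrict[OF dX_hom] by simp
 show "aug XC \<in> graded_hom C (X 0) (trivial_module K C) 0"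
  unfolding XC_def using X.semihom_restrict[OF augX_hom] by simp
 show "aug XC ` carrier (X 0) = carrier K"
 proof
  show "aug XC ` carrier (X 0) \<subseteq> carrier K" using semihomD(1)[OF augX_hom] by auto
  show "carrier K \<subseteq> aug XC ` carrier (X 0)"
  proof
   fix k assume k: "k \<in>. K"
   have "augX (X.sc 0 k e) = k"
    using semihomD(3)[OF augX_hom, of "k *:[C] 1[C]" e] e k by (simp add: X.sc_def flip: C.eps_def)
   thus "k \<in> aug XC ` carrier (X 0)" using X.sc_closed[OF k e(1)] by (intro image_eqI[of _ _ "X.sc 0 k e"]) simp_all
  qed
 qed
 show "{x \<in> carrier (X 0). aug XC x = 0[K]} = diff XC 0 ` carrier (X 1)"
 proof
  show "{x \<in> carrier (X 0). aug XC x = 0[K]} \<subseteq> diff XC 0 ` carrier (X 1)"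
  proof
   fix x assume "x \<in> {x \<in> carrier (X 0). aug XC x = 0[K]}"
   hence x: "x \<in>. X 0" "augX x = 0[K]" by auto
   have "dX 0 (H 0 x) = x" using bspec[OF h0 x(1)] x e H dX_closed by (simp add: X.sc_zero_l)
   thus "x \<in> diff XC 0 ` carrier (X 1)" using H x(1) by (intro image_eqI[of _ _ "H 0 x"]) simp_all
  qed
  show "diff XC 0 ` carrier (X 1) \<subseteq> {x \<in> carrier (X 0). aug XC x = 0[K]}"
   using dX_closed augX_dX by auto
 qed
 show "{x \<in> carrier (X (Suc n)). diff XC n x = 0[X n]} = diff XC (Suc n) ` carrier (X (Suc (Suc n)))" for n
 proof
  show "{x \<in> carrier (X (Suc n)). diff XC n x = 0[X n]} \<subseteq> diff XC (Suc n) ` carrier (X (Suc (Suc n)))"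
  proof
   fix x assume "x \<in> {x \<in> carrier (X (Suc n)). diff XC n x = 0[X n]}"
   hence x: "x \<in>. X (Suc n)" "dX n x = 0[X n]" by auto
   have "dX (Suc n) (H (Suc n) x) \<in>. X (Suc n)" using H x(1) dX_closed by blast
   hence "dX (Suc n) (H (Suc n) x) = x" using bspec[OF spec[OF hS, of n] x(1)] x(2) z by simp
   thus "x \<in> diff XC (Suc n) ` carrier (X (Suc (Suc n)))" using H x(1) by (intro image_eqI[of _ _ "H (Suc n) x"]) simp_all
  qed
  show "diff XC (Suc n) ` carrier (X (Suc (Suc n))) \<subseteq> {x \<in> carrier (X (Suc n)). diff XC n x = 0[X n]}"
   using dX_closed dX_dX by auto
 qed
qed

end

section \<open>Cocycles on the tensor product\<close>

text \<open>In a minimal resolution the coefficients of a boundary have no constant term.\<close>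
lemma coordinate_cocycle:
 assumes min: "minimal_res K A P" and u: "gens P n u = Some d"
 shows "is_coc K A P n d (\<lambda>x. augmentation K A (x u))"
proof -
 interpret resolution K A P using min unfolding minimal_res_def by blast
 have "(\<lambda>x. eps (x u)) \<in> semihom id A (T n) (trivial_module K A) (- d)"
 proof (rule semihomI)
  fix j x assume x: "x \<in> component (T n) j"
  show "eps (x u) \<in> component (trivial_module K A) (j + - d)"
   using fm_coeff[OF fm_compD(1)[OF x], of u] fm_compD(2,3)[OF x u] eps_pos[of "x u" "nat (j - d)"] by (cases "d \<le> j") auto
 qed (use fm_coeff in "simp_all add: eps_add eps_mult flip: eps_def")
 thus ?thesis using min unfolding is_coc_def minimal_res_def eps_def by blast
qed

lemma (in graded_mod) sc_comm: "k \<in>. K ==> a \<in>. A ==> x \<in>. N ==> a *:[N] sc k x = sc k (a *:[N] x)"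
 by (simp add: sc_smult) (simp add: sc_def flip: smult_assoc A.smult_mult_right)

context product
begin

lemma d_sc:
 "k \<in>. K ==> p \<in>. P.T (Suc n) ==> diff P n (P.T.sc (Suc n) k p) = P.T.sc n k (diff P n p)"
 "k \<in>. K ==> q \<in>. Q.T (Suc n) ==> diff Q n (Q.T.sc (Suc n) k q) = Q.T.sc n k (diff Q n q)"
 using semihomD(3)[OF P.d_hom, of "k *:[A] 1[A]"] semihomD(3)[OF Q.d_hom, of "k *:[B] 1[B]"]
 by (simp_all add: P.T.sc_def Q.T.sc_def)

lemma X_chain_mapI:
 assumes N: "resolution K D R" and \<phi>: "\<And>c. c \<in>. C ==> \<phi> c \<in>. D"
  and F: "\<And>k. F k \<in> semihom \<phi> C (X (k + l)) (free_module D (gens R k)) s"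
  and eq: "\<And>k i j q p. i + j = Suc (k + l) ==> q \<in>. Q.T i ==> p \<in>. P.T j ==>
   diff R k (F (Suc k) (tn i q p)) = F k (dp (k + l) i j q p)"
 shows "chain_map \<phi> C XC l s D R F"
proof -
 interpret R: resolution K D R by fact
 have "diff R k (F (Suc k) x) = F k (dX (k + l) x)" if x: "x \<in>. X (Suc (k + l))" for k x
 proof (rule X_eqI[where N = "R.T k" and f = "\<lambda>x. diff R k (F (Suc k) x)" and g = "\<lambda>x. F k (dX (k + l) x)", OF _ _ _ x])
  fix y z assume y: "y \<in>. X (Suc (k + l))" and z: "z \<in>. X (Suc (k + l))"
  have "diff R k (F (Suc k) (y +[X (Suc (k + l))] z)) = diff R k (F (Suc k) y) +[R.T k] diff R k (F (Suc k) z)"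
   "F k (dX (k + l) (y +[X (Suc (k + l))] z)) = F k (dX (k + l) y) +[R.T k] F k (dX (k + l) z)"
   using y z semihomD(1,2)[OF F[of "Suc k"]] semihomD(2)[OF F[of k]] dX_closed
   by (simp_all add: semihomD(2)[OF R.d_hom] semihomD(2)[OF dX_hom])
  thus "diff R k (F (Suc k) (\<lambda>w. y w +[C] z w)) = diff R k (F (Suc k) y) +[R.T k] diff R k (F (Suc k) z)"
   "F k (dX (k + l) (\<lambda>w. y w +[C] z w)) = F k (dX (k + l) y) +[R.T k] F k (dX (k + l) z)"
   by (simp_all add: free_module_simps)
 next
  fix i j q p assume "i + j = Suc (k + l)" "q \<in>. Q.T i" "p \<in>. P.T j"
  thus "diff R k (F (Suc k) (tn i q p)) = F k (dX (k + l) (tn i q p))" using eq dX_tn by simp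
 qed
 thus ?thesis unfolding chain_map_def using F by simp
qed

lemma X_hom_dp:
 assumes F: "F \<in> semihom \<phi> C (X n) (free_module D \<beta>) s" and D: "connected_graded_algebra K D"
  and ij: "i + j = Suc n" and q: "q \<in>. Q.T i" and p: "p \<in>. P.T j"
 shows "F (dp n i j q p) = (case i of 0 => 0[free_module D \<beta>] | Suc l => F (tn l (diff Q l q) p)) +[free_module D \<beta>]
  (case j of 0 => 0[free_module D \<beta>] | Suc l => if even i then F (tn i q (diff P l p)) else -[free_module D \<beta>] F (tn i q (diff P l p)))"
proof -
 have g: "abelian_group (free_module D \<beta>)" by (rule connected_graded_algebra.fm_group[OF D])
 have L: "(case i of 0 => 0[X n] | Suc l => tn l (diff Q l q) p) \<in>. X n"
  using ij q p tn_closed[OF Q.d_closed] by (cases i) simp_all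
 have R: "(case j of 0 => 0[X n] | Suc l => tn i q (diff P l p)) \<in>. X n"
  using ij q p tn_closed[OF _ P.d_closed] by (cases j) simp_all
 have R': "(case j of 0 => 0[X n] | Suc l => sg n i (tn i q (diff P l p))) \<in>. X n"
  using R by (cases j) (simp_all add: sg_def)
 show ?thesis
  unfolding dp_def semihomD(2)[OF F L R']
  using R semihom_zero[OF C.fm_group g F] semihom_neg[OF C.fm_group g F] by (cases i; cases j) (simp_all add: sg_def)
qed

text \<open>For \<open>q\<close> of positive degree both sides are zero, so that no power of \<open>\<sigma>\<close> appears.\<close>
lemma bisemi_right:
 assumes \<pi>: "\<And>b a. b \<in>. B ==> a \<in>. A ==> \<pi> (b \<diamondop> a) = B.eps b *:[A] a"
 shows "bisemi \<pi> (P.T n) 0 0 n (\<lambda>q p. P.T.sc n (aug Q q) p)"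
 unfolding bisemi_def
proof (intro conjI allI ballI)
 show "biadd (P.T n) 0 n (\<lambda>q p. P.T.sc n (aug Q q) p)"
  unfolding biadd_def
  using P.T.sc_add_l[where n = n] P.T.sc_add_r[where n = n] aug_add(1) by (simp add: free_module_simps)
 fix d e q p assume q: "q \<in> component (Q.T 0) (int d)" and p: "p \<in> component (P.T n) (int e)"
 show "P.T.sc n (aug Q q) p \<in> component (P.T n) (int d + int e + 0)"
  using aug_pos(1)[OF q] fm_compD(1)[OF q] fm_compD(1)[OF p] P.T.sc_comp[OF _ p, of "aug Q q"] P.T.sc_zero_l
  by (cases "d = 0") simp_all
next
 fix d q p b a
 assume q: "q \<in> component (Q.T 0) (int d)" and p: "p \<in>. P.T n" and b: "b \<in>. B" and a: "a \<in>. A"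
 note qc = fm_compD(1)[OF q]
 have "P.T.sc n (B.eps b *[K] aug Q q) ((\<sigma> ^^ d) a *:[P.T n] p) = (B.eps b *:[A] a) *:[P.T n] P.T.sc n (aug Q q) p"
 proof (cases "d = 0")
  case True
  thus ?thesis using qc p a b by (simp add: P.T.sc_comm P.T.sc_smult A.K.m_comm A.KA.smult_assoc1)
 next
  case False
  thus ?thesis using aug_pos(1)[OF q] p a b by (simp add: P.T.sc_zero_l)
 qed
 thus "P.T.sc n (aug Q (\<lambda>u. b *[B] q u)) (\<lambda>v. (\<sigma> ^^ d) a *[A] p v) = \<pi> (b \<diamondop> a) *:[P.T n] P.T.sc n (aug Q q) p"
  using qc p a b by (simp add: augQ_smult \<pi> free_module_simps)
qed

lemma bisemi_left:
 assumes \<pi>: "\<And>b a. b \<in>. B ==> a \<in>. A ==> \<pi> (b \<diamondop> a) = A.eps a *:[B] b"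
 shows "bisemi \<pi> (Q.T n) 0 n 0 (\<lambda>q p. Q.T.sc n (aug P p) q)"
 unfolding bisemi_def
proof (intro conjI allI ballI)
 show "biadd (Q.T n) n 0 (\<lambda>q p. Q.T.sc n (aug P p) q)"
  unfolding biadd_def
  using Q.T.sc_add_l[where n = n] Q.T.sc_add_r[where n = n] aug_add(2) by (simp add: free_module_simps)
 fix d e q p assume q: "q \<in> component (Q.T n) (int d)" and p: "p \<in> component (P.T 0) (int e)"
 show "Q.T.sc n (aug P p) q \<in> component (Q.T n) (int d + int e + 0)"
  using aug_pos(2)[OF p] fm_compD(1)[OF q] fm_compD(1)[OF p] Q.T.sc_comp[OF _ q, of "aug P p"] Q.T.sc_zero_l
  by (cases "e = 0") simp_all
next
 fix d q p b a
 assume q: "q \<in> component (Q.T n) (int d)" and p: "p \<in>. P.T 0" and b: "b \<in>. B" and a: "a \<in>. A"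
 have "Q.T.sc n (A.eps a *[K] aug P p) (b *:[Q.T n] q) = (A.eps a *:[B] b) *:[Q.T n] Q.T.sc n (aug P p) q"
  using fm_compD(1)[OF q] p a b by (simp add: Q.T.sc_comm Q.T.sc_smult A.K.m_comm B.KA.smult_assoc1)
 thus "Q.T.sc n (aug P (\<lambda>v. (\<sigma> ^^ d) a *[A] p v)) (\<lambda>u. b *[B] q u) = \<pi> (b \<diamondop> a) *:[Q.T n] Q.T.sc n (aug P p) q"
  using p a b by (simp add: augP_smult eps_sigma \<pi> free_module_simps)
qed

text \<open>The chain map over the projection \<open>C \<rightarrow> A\<close> that applies the augmentation to \<open>Q 0\<close> and kills the other \<open>Q i\<close>.\<close>
lemma projection_right:
 assumes p: "galg_hom K C A \<pi> \<and> (\<forall>b\<in>carrier B. \<forall>a\<in>carrier A. \<pi> (b \<diamondop> a) = B.eps b *:[A] a)"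
 shows "\<exists>\<theta>. chain_map \<pi> C XC 0 0 A P \<theta> \<and>
  (\<forall>n i j q p. i + j = n --> q \<in>. Q.T i --> p \<in>. P.T j -->
   \<theta> n (tn i q p) = (if i = 0 then P.T.sc n (aug Q q) p else 0[P.T n]))"
proof -
 have \<pi>: "galg_hom K C A \<pi>" "\<And>b a. b \<in>. B ==> a \<in>. A ==> \<pi> (b \<diamondop> a) = B.eps b *:[A] a" using p by simp_all
 define \<psi> where "\<psi> n i j q p = (if i = 0 then P.T.sc n (aug Q q) p else 0[P.T n])" for n and i j :: nat and q p
 have bi: "bisemi \<pi> (P.T n) 0 i j (\<psi> n i j)" if "i + j = n" for n i j
  unfolding \<psi>_def using that bisemi_right[OF \<pi>(2), of n] bisemi_const_zero[OF P.T.graded_mod_axioms \<pi>(1)] by (cases "i = 0") simp_all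
 define \<theta> where "\<theta> n = xmap \<pi> n (P.T n) 0 (\<psi> n)" for n
 have h: "\<theta> n \<in> semihom \<pi> C (X n) (P.T n) 0" for n
  unfolding \<theta>_def by (rule xmap(1)[OF P.T.graded_mod_axioms \<pi>(1) bi])
 have t: "\<theta> n (tn i q p) = \<psi> n i j q p" if "i + j = n" "q \<in>. Q.T i" "p \<in>. P.T j" for n i j q p
  unfolding \<theta>_def by (rule xmap(2)[OF P.T.graded_mod_axioms \<pi>(1) bi that])
 have "chain_map \<pi> C XC 0 0 A P \<theta>"
 proof (rule X_chain_mapI[OF P.resolution_axioms galg_homD(1)[OF \<pi>(1)]])
  show "\<theta> k \<in> semihom \<pi> C (X (k + 0)) (P.T k) 0" for k using h by simp
  fix k i j q p assume ij: "i + j = Suc (k + 0)" and q: "q \<in>. Q.T i" and p: "p \<in>. P.T j"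
  have ij: "i + j = Suc k" using ij by simp
  have "diff P k (\<theta> (Suc k) (tn i q p)) = \<theta> k (dp k i j q p)"
  proof (cases i)
   case 0
   hence "j = Suc k" using ij by simp
   thus ?thesis
    unfolding X_hom_dp[OF h A.connected_graded_algebra_axioms ij q p] t[OF ij q p]
    using 0 q p t[of 0 k k q "diff P k p"] P.d_closed[of p k] by (simp add: \<psi>_def d_sc)
  next
   case (Suc l)
   have dq: "diff Q l q \<in>. Q.T l" using Q.d_closed q Suc by simp
   have 1: "\<theta> k (tn l (diff Q l q) p) = 0[P.T k]"
    using t[of l j k "diff Q l q" p] ij Suc dq p Q.aug_d[of q] q by (cases l) (simp_all add: \<psi>_def P.T.sc_zero_l)
   have 2: "\<theta> k (tn i q (diff P m p)) = 0[P.T k]" if "j = Suc m" for m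
    using t[of i m k q "diff P m p"] ij that q p Suc P.d_closed[of p m] by (simp add: \<psi>_def)
   have z: "-[P.T k] 0[P.T k] = 0[P.T k]" by (rule P.T.N.minus_equality) simp_all
   show ?thesis
    unfolding X_hom_dp[OF h A.connected_graded_algebra_axioms ij q p] t[OF ij q p]
    using Suc 1 2 P.d_zero by (cases j) (simp_all add: \<psi>_def z)
  qed
  thus "diff P k (\<theta> (Suc k) (tn i q p)) = \<theta> k (dp (k + 0) i j q p)" by simp
 qed
 thus ?thesis using t unfolding \<psi>_def by (intro exI[of _ \<theta>]) simp
qed

lemma projection_left:
 assumes p: "galg_hom K C B \<pi> \<and> (\<forall>b\<in>carrier B. \<forall>a\<in>carrier A. \<pi> (b \<diamondop> a) = A.eps a *:[B] b)"
 shows "\<exists>\<theta>. chain_map \<pi> C XC 0 0 B Q \<theta> \<and>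
  (\<forall>n i j q p. i + j = n --> q \<in>. Q.T i --> p \<in>. P.T j -->
   \<theta> n (tn i q p) = (if j = 0 then Q.T.sc n (aug P p) q else 0[Q.T n]))"
proof -
 have \<pi>: "galg_hom K C B \<pi>" "\<And>b a. b \<in>. B ==> a \<in>. A ==> \<pi> (b \<diamondop> a) = A.eps a *:[B] b" using p by simp_all
 define \<psi> where "\<psi> n i j q p = (if j = 0 then Q.T.sc n (aug P p) q else 0[Q.T n])" for n and i j :: nat and q p
 have bi: "bisemi \<pi> (Q.T n) 0 i j (\<psi> n i j)" if "i + j = n" for n i j
  unfolding \<psi>_def using that bisemi_left[OF \<pi>(2), of n] bisemi_const_zero[OF Q.T.graded_mod_axioms \<pi>(1)] by (cases "j = 0") simp_all
 define \<theta> where "\<theta> n = xmap \<pi> n (Q.T n) 0 (\<psi> n)" for n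
 have h: "\<theta> n \<in> semihom \<pi> C (X n) (Q.T n) 0" for n
  unfolding \<theta>_def by (rule xmap(1)[OF Q.T.graded_mod_axioms \<pi>(1) bi])
 have t: "\<theta> n (tn i q p) = \<psi> n i j q p" if "i + j = n" "q \<in>. Q.T i" "p \<in>. P.T j" for n i j q p
  unfolding \<theta>_def by (rule xmap(2)[OF Q.T.graded_mod_axioms \<pi>(1) bi that])
 have "chain_map \<pi> C XC 0 0 B Q \<theta>"
 proof (rule X_chain_mapI[OF Q.resolution_axioms galg_homD(1)[OF \<pi>(1)]])
  show "\<theta> k \<in> semihom \<pi> C (X (k + 0)) (Q.T k) 0" for k using h by simp
  fix k i j q p assume ij: "i + j = Suc (k + 0)" and q: "q \<in>. Q.T i" and p: "p \<in>. P.T j"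
  have ij: "i + j = Suc k" using ij by simp
  have "diff Q k (\<theta> (Suc k) (tn i q p)) = \<theta> k (dp k i j q p)"
  proof (cases j)
   case 0
   hence "i = Suc k" using ij by simp
   thus ?thesis
    unfolding X_hom_dp[OF h B.connected_graded_algebra_axioms ij q p] t[OF ij q p]
    using 0 q p t[of k 0 k "diff Q k q" p] Q.d_closed[of q k] by (simp add: \<psi>_def d_sc)
  next
   case (Suc l)
   have dp: "diff P l p \<in>. P.T l" using P.d_closed p Suc by simp
   have 1: "\<theta> k (tn i q (diff P l p)) = 0[Q.T k]"
    using t[of i l k q "diff P l p"] ij Suc dp q P.aug_d[of p] p by (cases l) (simp_all add: \<psi>_def Q.T.sc_zero_l)
   have 2: "\<theta> k (tn m (diff Q m q) p) = 0[Q.T k]" if "i = Suc m" for m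
    using t[of m j k "diff Q m q" p] ij that q p Suc Q.d_closed[of q m] by (simp add: \<psi>_def)
   have z: "-[Q.T k] 0[Q.T k] = 0[Q.T k]" by (rule Q.T.N.minus_equality) simp_all
   show ?thesis
    unfolding X_hom_dp[OF h B.connected_graded_algebra_axioms ij q p] t[OF ij q p]
    using Suc 1 2 Q.d_zero by (cases i) (simp_all add: \<psi>_def z)
  qed
  thus "diff Q k (\<theta> (Suc k) (tn i q p)) = \<theta> k (dp (k + 0) i j q p)" by simp
 qed
 thus ?thesis using t unfolding \<psi>_def by (intro exI[of _ \<theta>]) simp
qed

text \<open>No sign is needed: the signs in the differential depend on the degree \<open>i\<close> of \<open>q\<close>, which stays the same.\<close>
lemma extend_lift:
 assumes F: "chain_map id A P l s A P F"
 shows "\<exists>G. chain_map id C XC l s C XC G \<and>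
  (\<forall>k i j q p. i + j = k + l --> q \<in>. Q.T i --> p \<in>. P.T j -->
   G k (tn i q p) = (if i \<le> k then tn i q (F (k - i) p) else 0[X k]))"
proof -
 define \<psi> where "\<psi> k i j q p = (if i \<le> k then tn i q (F (k - i) p) else 0[X k])" for k i and j :: nat and q p
 note Fh = chain_mapD(1)[OF F]
 have bi: "bisemi id (X k) s i j (\<psi> k i j)" if ij: "i + j = k + l" for k i j
 proof (cases "i \<le> k")
  case True
  have "k - i + l = j" using True ij by simp
  hence "F (k - i) \<in> semihom id A (P.T j) (P.T (k - i)) s" using Fh[of "k - i"] by simp
  from bisemi_tn[OF semihom_id this, of i k] show ?thesis unfolding \<psi>_def using True by simp
 next
  case False
  thus ?thesis unfolding \<psi>_def using bisemi_const_zero[OF X.graded_mod_axioms galg_hom_id] by simp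
 qed
 define G where "G k = xmap id (k + l) (X k) s (\<psi> k)" for k
 have h: "G k \<in> semihom id C (X (k + l)) (X k) s" for k
  unfolding G_def by (rule xmap(1)[OF X.graded_mod_axioms galg_hom_id bi])
 have t: "G k (tn i q p) = \<psi> k i j q p" if "i + j = k + l" "q \<in>. Q.T i" "p \<in>. P.T j" for k i j q p
  unfolding G_def by (rule xmap(2)[OF X.graded_mod_axioms galg_hom_id bi that])
 have "chain_map id C XC l s C XC G"
 proof (rule X_chain_mapI[OF XC_resolution])
  show "G k \<in> semihom id C (X (k + l)) (C.F (gens XC k)) s" for k using h by simp
  fix k i j q p assume ij: "i + j = Suc (k + l)" and q: "q \<in>. Q.T i" and p: "p \<in>. P.T j"
  have ij': "i + j = Suc k + l" using ij by simp
  have c: "G (Suc k) (tn i q p) \<in>. X (Suc k)"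
   using semihomD(1)[OF h tn_closed[OF q p ij']] .
  have 1: "dX k (G (Suc k) (tn i q p)) = (if i \<le> Suc k then dp k i (Suc k - i) q (F (Suc k - i) p) else 0[X k])"
  proof (cases "i \<le> Suc k")
   case True
   hence "Suc k - i + l = j" using ij by simp
   hence "F (Suc k - i) p \<in>. P.T (Suc k - i)" using semihomD(1)[OF Fh[of "Suc k - i"]] p by simp
   thus ?thesis unfolding t[OF ij' q p] using True dX_tn[of i "Suc k - i" k q] q by (simp add: \<psi>_def)
  next
   case False
   thus ?thesis unfolding t[OF ij' q p] using semihom_zero[OF C.fm_group C.fm_group dX_hom] by (simp add: \<psi>_def)
  qed
  have Lt: "G k (tn m (diff Q m q) p) = (if m \<le> k then tn m (diff Q m q) (F (k - m) p) else 0[X k])" if "i = Suc m" for m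
   using t[of m j k "diff Q m q" p] that ij q p Q.d_closed by (simp add: \<psi>_def)
  have Rt: "G k (tn i q (diff P m p)) = (if i \<le> k then tn i q (F (k - i) (diff P m p)) else 0[X k])" if "j = Suc m" for m
   using t[of i m k q "diff P m p"] that ij q p P.d_closed by (simp add: \<psi>_def)
  have "dX k (G (Suc k) (tn i q p)) = G k (dp (k + l) i j q p)"
  proof (cases "i \<le> k")
   case True
   hence j: "j = Suc (k - i + l)" "Suc k - i = Suc (k - i)" using ij by simp_all
   have "diff P (k - i) (F (Suc (k - i)) p) = F (k - i) (diff P (k - i + l) p)"
    using chain_mapD(2)[OF F] p j by simp
   thus ?thesis
    unfolding 1 X_hom_dp[OF h C.connected_graded_algebra_axioms ij q p]
    using True j Lt Rt[OF j(1)] by (cases i) (simp_all add: dp_def sg_def Suc_diff_le)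
  next
   case False
   then obtain m where m: "i = Suc m" "k \<le> m" by (cases i) auto
   have r: "(case j of 0 => 0[X k] | Suc l' => if even i then G k (tn i q (diff P l' p)) else -[X k] G k (tn i q (diff P l' p))) = 0[X k]"
    using Rt False X_neg_zero by (cases j) simp_all
   have "G k (tn m (diff Q m q) p) \<in>. X k"
    by (rule semihomD(1)[OF h tn_closed[OF Q.d_closed p]]) (use q ij m in simp_all)
   hence "(if m \<le> k then tn m (diff Q m q) (F (k - m) p) else 0[X k]) \<in>. X k" unfolding Lt[OF m(1)] .
   thus ?thesis
    unfolding 1 X_hom_dp[OF h C.connected_graded_algebra_axioms ij q p] r
    using m Lt[OF m(1)] by (auto simp: dp_def)
  qed
  thus "diff XC k (G (Suc k) (tn i q p)) = G k (dp (k + l) i j q p)" using c by simp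
 qed simp
 thus ?thesis using t unfolding \<psi>_def by (intro exI[of _ G]) simp
qed

text \<open>The functional is the coordinate functional of \<open>Q\<close> at \<open>u\<close>, pulled back to \<open>X\<close>, composed with the extension of a lift \<open>F\<close> of the coordinate functional of \<open>P\<close> at \<open>v\<close>. On a generator \<open>e \<boxtimes> f\<close> of bidegree \<open>(i, j)\<close> the extension gives \<open>e \<boxtimes> F f\<close>, from which the projection to \<open>Q\<close> extracts the coordinate of \<open>f\<close> at \<open>v\<close> times \<open>e\<close>; in all other bidegrees the result is zero.\<close>
lemma X_coordinate_gen:
 assumes gA: "\<forall>n m f. is_coc K A P n m f --> gen K A P n m f" and gB: "\<forall>n m f. is_coc K B Q n m f --> gen K B Q n m f"
  and w: "\<zeta> n w = Some m"
 shows "\<exists>E. gen K C XC n m E \<and> (\<forall>w' m'. \<zeta> n w' = Some m' --> E (single C 1[C] w') = (if w' = w then 1[K] else 0[K]))"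
proof -
 define i j u v where defs: "i = \<I> w" "j = n - \<I> w" "u = \<U> w" "v = \<V> w"
 obtain d e where de: "gens Q i u = Some d" "gens P j v = Some e" "m = d + e" and n: "i + j = n"
  using w unfolding zeta_Some defs by auto
 have cu: "gen K B Q i d (\<lambda>q. B.eps (q u))" and cv: "is_coc K A P j e (\<lambda>p. A.eps (p v))"
  unfolding A.eps_def B.eps_def using coordinate_cocycle[OF minP de(2)] gB coordinate_cocycle[OF minQ de(1)] by blast+
 from prr_exists obtain \<pi> where \<pi>: "galg_hom K C A \<pi> \<and> (\<forall>b\<in>carrier B. \<forall>a\<in>carrier A. \<pi> (b \<diamondop> a) = B.eps b *:[A] a)" ..
 from prl_exists obtain \<rho> where \<rho>: "galg_hom K C B \<rho> \<and> (\<forall>b\<in>carrier B. \<forall>a\<in>carrier A. \<rho> (b \<diamondop> a) = A.eps a *:[B] b)" ..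
 obtain \<alpha> where \<alpha>: "chain_map \<pi> C XC 0 0 A P \<alpha>" and \<alpha>tt: "\<forall>n i j q p. i + j = n --> q \<in>. Q.T i --> p \<in>. P.T j -->
   \<alpha> n (tn i q p) = (if i = 0 then P.T.sc n (aug Q q) p else 0[P.T n])"
  using projection_right[OF \<pi>] by (elim exE conjE)
 obtain \<beta> where \<beta>: "chain_map \<rho> C XC 0 0 B Q \<beta>" and \<beta>tt: "\<forall>n i j q p. i + j = n --> q \<in>. Q.T i --> p \<in>. P.T j -->
   \<beta> n (tn i q p) = (if j = 0 then Q.T.sc n (aug P p) q else 0[Q.T n])"
  using projection_left[OF \<rho>] by (elim exE conjE)
 interpret I: res_pair K C XC A P \<pi>
  using XC_resolution P.resolution_axioms \<pi> by (simp add: res_pair_def res_pair_axioms_def)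
 interpret J: res_pair K C XC B Q \<rho>
  using XC_resolution Q.resolution_axioms \<rho> by (simp add: res_pair_def res_pair_axioms_def)
 interpret D: res_pair K A P A P id by (rule res_pair_id[OF P.resolution_axioms])
 have \<alpha>h: "\<alpha> k \<in> semihom \<pi> C (X k) (P.T k) 0" and \<beta>h: "\<beta> k \<in> semihom \<rho> C (X k) (Q.T k) 0" for k
  using chain_mapD(1)[OF \<alpha>, of k] chain_mapD(1)[OF \<beta>, of k] by simp_all
 have sc_aug: "aug P (P.T.sc 0 k p) = k *[K] aug P p" "aug Q (Q.T.sc 0 k q) = k *[K] aug Q q"
  if "k \<in>. K" "p \<in>. P.T 0" "q \<in>. Q.T 0" for k p q
  using semihomD(3)[OF P.aug_hom, of "k *:[A] 1[A]" p] semihomD(3)[OF Q.aug_hom, of "k *:[B] 1[B]" q] that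
  by (simp_all add: P.T.sc_def Q.T.sc_def flip: A.eps_def B.eps_def)
 have a0: "aug P (\<alpha> 0 x) = aug XC x" if x: "x \<in>. X 0" for x
 proof (rule X_eqI[where N = K and f = "\<lambda>x. aug P (\<alpha> 0 x)", OF _ _ _ x])
  fix y z assume y: "y \<in>. X 0" "z \<in>. X 0"
  show "aug P (\<alpha> 0 (\<lambda>w. y w +[C] z w)) = aug P (\<alpha> 0 y) +[K] aug P (\<alpha> 0 z)"
   using semihomD(2)[OF \<alpha>h y] aug_add(2)[OF semihomD(1)[OF \<alpha>h y(1)] semihomD(1)[OF \<alpha>h y(2)]] by (simp add: free_module_simps)
  show "aug XC (\<lambda>w. y w +[C] z w) = aug XC y +[K] aug XC z"
   using y C.fm_add_closed[OF y] semihomD(2)[OF augX_hom y] by (simp add: free_module_simps)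
 next
  fix i j q p assume "i + j = 0" "q \<in>. Q.T i" "p \<in>. P.T j"
  thus "aug P (\<alpha> 0 (tn i q p)) = aug XC (tn i q p)" using \<alpha>tt[rule_format, of 0 0 0 q p] sc_aug(1) tn_closed[of q 0 p 0 0] augX_tn by simp
 qed
 have b0: "aug Q (\<beta> 0 x) = aug XC x" if x: "x \<in>. X 0" for x
 proof (rule X_eqI[where N = K and f = "\<lambda>x. aug Q (\<beta> 0 x)", OF _ _ _ x])
  fix y z assume y: "y \<in>. X 0" "z \<in>. X 0"
  show "aug Q (\<beta> 0 (\<lambda>w. y w +[C] z w)) = aug Q (\<beta> 0 y) +[K] aug Q (\<beta> 0 z)"
   using semihomD(2)[OF \<beta>h y] aug_add(1)[OF semihomD(1)[OF \<beta>h y(1)] semihomD(1)[OF \<beta>h y(2)]] by (simp add: free_module_simps)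
  show "aug XC (\<lambda>w. y w +[C] z w) = aug XC y +[K] aug XC z"
   using y C.fm_add_closed[OF y] semihomD(2)[OF augX_hom y] by (simp add: free_module_simps)
 next
  fix i j q p assume "i + j = 0" "q \<in>. Q.T i" "p \<in>. P.T j"
  thus "aug Q (\<beta> 0 (tn i q p)) = aug XC (tn i q p)" using \<beta>tt[rule_format, of 0 0 0 q p] sc_aug(2) tn_closed[of q 0 p 0 0] augX_tn A.K.m_comm by simp
 qed
 let ?f = "\<lambda>p. A.eps (p v)"
 note fh = is_cocD[OF cv]
 have "\<exists>F. chain_map id A P j (- e) A P F \<and> (\<forall>p\<in>carrier (P.T j). aug P (F 0 p) = ?f p)"
  by (rule D.lift_exists[OF fh(1)]) (rule fh(2))
 then obtain F where F: "chain_map id A P j (- e) A P F" and F0: "\<forall>p\<in>carrier (P.T j). aug P (F 0 p) = ?f p"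
  by (elim exE conjE)
 obtain G where G: "chain_map id C XC j (- e) C XC G" and Gtt: "\<forall>k i j' q p. i + j' = k + j --> q \<in>. Q.T i --> p \<in>. P.T j' -->
   G k (tn i q p) = (if i \<le> k then tn i q (F (k - i) p) else 0[X k])"
  using extend_lift[OF F] by (elim exE conjE)
 note Gt = Gtt[rule_format] and \<alpha>t = \<alpha>tt[rule_format] and \<beta>t = \<beta>tt[rule_format]
 have Gh: "G k \<in> semihom id C (X (k + j)) (X k) (- e)" for k using chain_mapD(1)[OF G, of k] by simp
 have Fc: "F k p \<in>. P.T k" if "p \<in>. P.T (k + j)" for k p using semihomD(1)[OF chain_mapD(1)[OF F] that] .
 have augG: "aug XC (G 0 x) = ?f (\<alpha> j x)" if x: "x \<in>. X j" for x
 proof (rule X_eqI[where N = K and f = "\<lambda>x. aug XC (G 0 x)" and g = "\<lambda>x. ?f (\<alpha> j x)", OF _ _ _ x])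
  have G0: "G 0 \<in> semihom id C (X j) (X 0) (- e)" using Gh[of 0] by simp
  fix y z assume y: "y \<in>. X j" "z \<in>. X j"
  note g = semihomD(1)[OF G0 y(1)] semihomD(1)[OF G0 y(2)]
  show "aug XC (G 0 (\<lambda>w. y w +[C] z w)) = aug XC (G 0 y) +[K] aug XC (G 0 z)"
   using g semihomD(2)[OF G0 y] semihomD(2)[OF augX_hom g] C.fm_add_closed[OF g] by (simp add: free_module_simps)
  show "?f (\<alpha> j (\<lambda>w. y w +[C] z w)) = ?f (\<alpha> j y) +[K] ?f (\<alpha> j z)"
   using semihomD(2)[OF \<alpha>h y] semihomD(2)[OF fh(1) semihomD(1)[OF \<alpha>h y(1)] semihomD(1)[OF \<alpha>h y(2)]] by (simp add: free_module_simps)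
 next
  fix i' j' q p assume ij: "i' + j' = j" and q: "q \<in>. Q.T i'" and p: "p \<in>. P.T j'"
  show "aug XC (G 0 (tn i' q p)) = ?f (\<alpha> j (tn i' q p))"
  proof (cases "i' = 0")
   case True
   hence p': "p \<in>. P.T j" "q \<in>. Q.T 0" using p q ij by simp_all
   have "?f (P.T.sc j (aug Q q) p) = aug Q q *[K] ?f p"
    using p' A.fm_coeff[OF p'(1)] by (simp add: P.T.sc_def free_module_simps A.scalar_mult A.eps_smult)
   thus ?thesis
    using True ij p' Gt[of 0 j 0 q p] \<alpha>t[of 0 j j q p] Fc[of p 0] F0 tn_closed[OF p'(2) Fc[of p 0], of 0] augX_tn[OF p'(2) Fc[of p 0]] by simp
  next
   case False
   have "aug XC 0[X 0] = 0[K]"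
    using semihom_zero[OF C.fm_group _ augX_hom] graded_mod.axioms(2)[OF C.tm_graded_mod] by simp
   thus ?thesis using False ij q p Gt[of i' j' 0 q p] \<alpha>t[OF ij q p] by (simp add: free_module_simps)
  qed
 qed
 have gv: "gen K C XC j e (\<lambda>x. ?f (\<alpha> j x))" by (rule I.gen_pullback[OF \<alpha>]) (use a0 cv gA in simp_all)
 have gu: "gen K C XC i d (\<lambda>x. B.eps (\<beta> i x u))" by (rule J.gen_pullback[OF \<beta> _ cu]) (use b0 in simp)
 define E where "E x = B.eps (\<beta> i (G i x) u)" for x
 have "gen K C XC (i + j) (d + e) E"
  unfolding E_def by (rule gen.prod[OF gu gv G]) (use augG in simp)
 hence gE: "gen K C XC n m E" using n de(3) by simp
 have "E (single C 1[C] w') = (if w' = w then 1[K] else 0[K])" if w': "\<zeta> n w' = Some m'" for w' m'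
 proof -
  define i' j' u' v' where defs': "i' = \<I> w'" "j' = n - \<I> w'" "u' = \<U> w'" "v' = \<V> w'"
  obtain d' e' where de': "gens Q i' u' = Some d'" "gens P j' v' = Some e'" and n': "i' + j' = i + j"
   using w' n unfolding zeta_Some defs' by auto
  let ?q = "single B 1[B] u'" and ?p = "single A 1[A] v'"
  have q: "?q \<in>. Q.T i'" and p: "?p \<in>. P.T j'"
   using B.single_carrier[where \<beta> = "gens Q i'", OF B.A.one_closed de'(1)] A.single_carrier[where \<beta> = "gens P j'", OF A.A.one_closed de'(2)] by auto
  have ww: "w' = w \<longleftrightarrow> i' = i \<and> u' = u \<and> v' = v" unfolding defs defs' by (metis enc_simps(4))
  have "single C 1[C] w' = tn i' ?q ?p"
   using tn_single[of "1[B]" "1[A]" i' u' v'] galg_homD(4)[OF tau_pow_hom] by (simp add: defs' C_one)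
  hence E1: "E (single C 1[C] w') = B.eps (\<beta> i (if i' \<le> i then tn i' ?q (F (i - i') ?p) else 0[X i]) u)"
   using Gt[of i' j' i ?q ?p] n' q p by (simp add: E_def)
  have \<beta>0: "\<beta> i 0[X i] u = 0[B]" using semihom_zero[OF C.fm_group B.fm_group \<beta>h[of i]] by (simp add: free_module_simps)
  consider "i < i'" | "i' < i" | "i' = i" by linarith
  thus ?thesis
  proof cases
   case 1
   thus ?thesis using E1 ww \<beta>0 by simp
  next
   case 2
   have j: "i - i' + j = j'" using 2 n' by simp
   have "F (i - i') ?p \<in>. P.T (i - i')" using Fc[of ?p "i - i'"] p j by simp
   hence "\<beta> i (tn i' ?q (F (i - i') ?p)) = 0[Q.T i]" using \<beta>t[of i' "i - i'" i ?q "F (i - i') ?p"] 2 q by simp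
   thus ?thesis using E1 2 ww by (simp add: free_module_simps)
  next
   case 3
   hence j: "j' = j" using n' by simp
   have p': "F 0 ?p \<in>. P.T 0" using Fc[of ?p 0] p j by simp
   have "aug P (F 0 ?p) = ?f ?p" using F0 p j by simp
   hence "\<beta> i (tn i' ?q (F (i - i') ?p)) = Q.T.sc i (?f ?p) ?q" using \<beta>t[of i 0 i ?q "F 0 ?p"] 3 q p' by simp
   thus ?thesis
    using E1 3 ww by (auto simp: Q.T.sc_def free_module_simps B.single_mult single_def)
  qed
 qed
 thus ?thesis using gE by blast
qed

text \<open>A cochain of internal degree \<open>m\<close> vanishes on all generators of other degrees, and there are finitely many generators of degree \<open>m\<close>; so it is a linear combination of coordinate functionals.\<close>
lemma X_all_gen:
 assumes gA: "\<forall>n m f. is_coc K A P n m f --> gen K A P n m f" and gB: "\<forall>n m f. is_coc K B Q n m f --> gen K B Q n m f"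
  and f: "is_coc K C XC n m f"
 shows "gen K C XC n m f"
proof -
 interpret R: resolution K C XC by (rule XC_resolution)
 have "\<forall>w. \<exists>E. \<zeta> n w = Some m --> gen K C XC n m E \<and>
   (\<forall>w' m'. \<zeta> n w' = Some m' --> E (single C 1[C] w') = (if w' = w then 1[K] else 0[K]))"
  using X_coordinate_gen[OF gA gB] by blast
 from choice[OF this] obtain E where E: "\<forall>w. \<zeta> n w = Some m --> gen K C XC n m (E w) \<and>
   (\<forall>w' m'. \<zeta> n w' = Some m' --> E w (single C 1[C] w') = (if w' = w then 1[K] else 0[K]))" ..
 define c where "c w = f (single C 1[C] w)" for w
 have sc: "single C 1[C] w \<in>. R.T n" if "\<zeta> n w = Some d" for w d
  using C.single_carrier[where \<beta> = "\<zeta> n", OF C.A.one_closed that] by simp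
 have cc: "c w \<in>. K" if "\<zeta> n w = Some d" for w d unfolding c_def by (rule R.coc_val[OF f sc[OF that]])
 have ex: "\<exists>g. gen K C XC n m g \<and> (\<forall>w d. \<zeta> n w = Some d --> g (single C 1[C] w) = (if w \<in> S then c w else 0[K]))"
  if "finite S" "S \<subseteq> {w. \<zeta> n w = Some m}" for S
  using that
 proof (induction S rule: finite_induct)
  case empty
  show ?case using gen.cob[OF R.coc_zero R.cob_zero] by (intro exI[of _ "\<lambda>x. 0[K]"]) simp
 next
  case (insert a S)
  then obtain g where g: "gen K C XC n m g" "\<forall>w d. \<zeta> n w = Some d --> g (single C 1[C] w) = (if w \<in> S then c w else 0[K])"
   by auto
  have a: "\<zeta> n a = Some m" using insert by simp
  have "gen K C XC n m (\<lambda>x. (c a *[K] E a x) +[K] g x)"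
   using gen.add[OF gen.scal[OF cc[OF a]] g(1)] E a by blast
  moreover have "(c a *[K] E a (single C 1[C] w)) +[K] g (single C 1[C] w) = (if w \<in> insert a S then c w else 0[K])"
   if w: "\<zeta> n w = Some d" for w d
  proof -
   have "E a (single C 1[C] w) = (if w = a then 1[K] else 0[K])" using E a w by blast
   thus ?thesis using g(2) w cc[OF a] cc[OF w] insert.hyps(2) by auto
  qed
  ultimately show ?case by (intro exI[of _ "\<lambda>x. (c a *[K] E a x) +[K] g x"]) blast
 qed
 have fin: "finite {w. \<zeta> n w = Some m}" using good_zeta[of n] unfolding good_gens_def by blast
 from ex[OF fin subset_refl] obtain g where g: "gen K C XC n m g"
  and gc: "\<forall>w d. \<zeta> n w = Some d --> g (single C 1[C] w) = (if w \<in> {w. \<zeta> n w = Some m} then c w else 0[K])" by (elim exE conjE)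
 have "g x = f x" if x: "x \<in>. X n" for x
 proof (rule C.fm_hom_unique[OF _ _ graded_mod.axioms(2)[OF C.tm_graded_mod] _ x])
  show "g \<in> semihom id C (X n) (trivial_module K C) (- m)" using is_cocD(1)[OF R.gen_coc[OF g]] by simp
  show fh: "f \<in> semihom id C (X n) (trivial_module K C) (- m)" using is_cocD(1)[OF f] by simp
  fix w d assume w: "\<zeta> n w = Some d"
  have "f (single C 1[C] w) \<in> component (trivial_module K C) (d + - m)"
   using semihomD(4)[OF fh, of "single C 1[C] w" d] C.single_comp[where \<beta> = "\<zeta> n", OF C.one_comp w] by simp
  thus "g (single C 1[C] w) = f (single C 1[C] w)" using gc w by (cases "d = m") (simp_all add: c_def)
 qed
 thus ?thesis using gen.eq[OF g] by simp
qed

end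

theorem theorem3p2:
 fixes K :: "'k ring"
  and A :: "(nat, 'k, 'a) graded_module"
  and B :: "(nat, 'k, 'b) graded_module"
  and \<sigma> :: "'a => 'a"
 assumes "field K"
  and "graded_algebra K A"
  and "graded_algebra K B"
  and "\<sigma> \<in> graded_alg_iso K A A"
 shows "is_K2 K (twisted_tensor K B \<sigma> A) \<longleftrightarrow> is_K2 K A \<and> is_K2 K B"
proof -
 have A: "connected_graded_algebra K A" and B: "connected_graded_algebra K B"
  using assms(2,3) unfolding graded_algebra_def by blast+
 interpret twisted K A B \<sigma> using A B assms(4) by (simp add: twisted_def twisted_axioms_def)
 show ?thesis
 proof
  assume "is_K2 K (twisted_tensor K B \<sigma> A)"
  thus "is_K2 K A \<and> is_K2 K B" using factors_K2 by blast
 next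
  assume K2: "is_K2 K A \<and> is_K2 K B"
  have "\<exists>P. minimal_res K A P \<and> (\<forall>n m f. is_coc K A P n m f --> gen K A P n m f)"
   by (rule K2_retract(2)[OF A A conjunct1[OF K2] galg_hom_id galg_hom_id]) simp
  then obtain P where P: "minimal_res K A P"
   and gP: "\<forall>n m f. is_coc K A P n m f --> gen K A P n m f" by (elim exE conjE)
  have "\<exists>Q. minimal_res K B Q \<and> (\<forall>n m f. is_coc K B Q n m f --> gen K B Q n m f)"
   by (rule K2_retract(2)[OF B B conjunct2[OF K2] galg_hom_id galg_hom_id]) simp
  then obtain Q where Q: "minimal_res K B Q"
   and gQ: "\<forall>n m f. is_coc K B Q n m f --> gen K B Q n m f" by (elim exE conjE)
  interpret product K A B \<sigma> P Q
   using P Q twisted_axioms by (simp add: product_def product_axioms_def minimal_res_def)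
  show "is_K2 K (twisted_tensor K B \<sigma> A)"
   unfolding is_K2_iff[OF C.connected_graded_algebra_axioms] using XC_resolution X_all_gen[OF gP gQ] by blast
 qed
qed

end
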